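(* Let $(X,d_X)$ and $(Y,d_Y)$ be finite metric spaces. The following are equivalent: \begin{enumerate} \item $X\cong_{A^*}Y$; \item $X\cong_{C^*}Y$; \item $X\cong_{qc}Y$. \end{enumerate}
   Context: Metric isometry game $Isom(X,Y)$: for both Alice and Bob the input set and the output set are $X\sqcup Y$. With inputs $v,w$ and outputs $a,b$ for Alice and Bob, respectively, $\lambda(v,w,a,b)=1$ iff: (i) $v$ and $a$ are from different spaces; (ii) $w$ and $b$ are from different spaces; (iii) if $v$ and $w$ are from the same metric space, then $d_\bullet(v,w)=d_\bullet(a,b)$, where $d_\bullet$ is the metric of the space to which the points belong; (iv) if $v$ and $w$ are from different spaces, then $v=b$ if and only if $w=a$. Otherwise $\lambda(v,w,a,b)=0$. The game $*$-algebra $\mathcal{A}(Isom(X,Y))$ is the quotient of the free unital (complex) $*$-algebra generated by $\{e_{v,a}\mid v,a\in X\sqcup Y\}$ by the relations $e_{v,a}=e_{v,a}^*=e_{v,a}^2$; $\sum_a e_{v,a}=1$ for every $v$; and $e_{v,a}e_{w,b}=0$ whenever $\lambda(v,w,a,b)=0$. Let $D_X=[d_X(x,x')]$ and $D_Y=[d_Y(y,y')]$ be the distance matrices. - $X\cong_{A^*}Y$ (algebraically quantum isometric) means $\mathcal{A}(Isom(X,Y))\neq0$. - $X\cong_{C^*}Y$ means there are a non-zero Hilbert space $\mathcal{H}$ and projections $E_{x,y}\in B(\mathcal{H})$ ($x\in X$, $y\in Y$) such that $U=(E_{x,y})$ is unitary as a matrix over $B(\mathcal{H})$ and $(1\otimes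 D_X)U=U(1\otimes D_Y)$; equivalently, there is a unital $*$-homomorphism from $\mathcal{A}(Isom(X,Y))$ to $B(\mathcal{H})$ for some non-zero $\mathcal{H}$. - $X\cong_{qc}Y$ means there are a unital $C^*$-algebra $\mathcal{A}$ with a tracial state and projections $E_{x,y}\in\mathcal{A}$ such that $U=(E_{x,y})$ is unitary as a matrix over $\mathcal{A}$ and $(1\otimes D_X)U=U(1\otimes D_Y)$; this corresponds to $Isom(X,Y)$ having a perfect quantum-commuting ($qc$) strategy. *)

theory Defs
  imports
    "HOL-Analysis.Abstract_Metric_Spaces"
    "HOL-Algebra.QuotRing"
    "HOL-Algebra.Module"
    "HOL-Library.Equipollence"
begin

definition complex_ring :: "complex ring" where
  "complex_ring = \<lparr>carrier = UNIV, mult = (*), one = 1, zero = 0, add = (+)\<rparr>"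


section \<open>Unital \<open>*\<close>-algebras, C*-algebras and tracial states\<close>

record 'a star_algebra = "(complex, 'a) module" +
  star :: "'a \<Rightarrow> 'a"

text \<open>The library's \<^locale>\<open>algebra\<close> is commutative, so it cannot be used here.\<close>

locale star_algebra = Module.module complex_ring A + ring A for A (structure) +
  assumes smult_mult_left: "x \<in> carrier A \<Longrightarrow> y \<in> carrier A \<Longrightarrow> (c \<odot> x) \<otimes> y = c \<odot> (x \<otimes> y)"
    and smult_mult_right: "x \<in> carrier A \<Longrightarrow> y \<in> carrier A \<Longrightarrow> x \<otimes> (c \<odot> y) = c \<odot> (x \<otimes> y)"
    and star_closed: "x \<in> carrier A \<Longrightarrow> star A x \<in> carrier A"
    and star_star: "x \<in> carrier A \<Longrightarrow> star A (star A x) = x"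
    and star_add: "x \<in> carrier A \<Longrightarrow> y \<in> carrier A \<Longrightarrow> star A (x \<oplus> y) = star A x \<oplus> star A y"
    and star_smult: "x \<in> carrier A \<Longrightarrow> star A (c \<odot> x) = cnj c \<odot> star A x"
    and star_mult: "x \<in> carrier A \<Longrightarrow> y \<in> carrier A \<Longrightarrow> star A (x \<otimes> y) = star A y \<otimes> star A x"

record 'a cstar_algebra = "'a star_algebra" +
  anorm :: "'a \<Rightarrow> real"

locale cstar_algebra = star_algebra A for A (structure) +
  assumes anorm_nonneg: "x \<in> carrier A \<Longrightarrow> 0 \<le> anorm A x"
    and anorm_eq_zero: "x \<in> carrier A \<Longrightarrow> anorm A x = 0 \<longleftrightarrow> x = \<zero>"
    and anorm_triangle: "x \<in> carrier A \<Longrightarrow> y \<in> carrier A \<Longrightarrow> anorm A (x \<oplus> y) \<le> anorm A x + anorm A y"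
    and anorm_smult: "x \<in> carrier A \<Longrightarrow> anorm A (c \<odot> x) = cmod c * anorm A x"
    and anorm_mult: "x \<in> carrier A \<Longrightarrow> y \<in> carrier A \<Longrightarrow> anorm A (x \<otimes> y) \<le> anorm A x * anorm A y"
    and anorm_cstar: "x \<in> carrier A \<Longrightarrow> anorm A (star A x \<otimes> x) = (anorm A x)\<^sup>2"
    and complete: "Metric_space.mcomplete (carrier A) (\<lambda>x y. anorm A (x \<ominus> y))"

definition tracial_state :: "('a, 'm) star_algebra_scheme \<Rightarrow> ('a \<Rightarrow> complex) \<Rightarrow> bool" where
  "tracial_state A \<tau> \<longleftrightarrow>
     (\<forall>x\<in>carrier A. \<forall>y\<in>carrier A. \<tau> (x \<oplus>\<^bsub>A\<^esub> y) = \<tau> x + \<tau> y) \<and>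
     (\<forall>c. \<forall>x\<in>carrier A. \<tau> (c \<odot>\<^bsub>A\<^esub> x) = c * \<tau> x) \<and>
     (\<forall>x\<in>carrier A. Im (\<tau> (star A x \<otimes>\<^bsub>A\<^esub> x)) = 0 \<and> 0 \<le> Re (\<tau> (star A x \<otimes>\<^bsub>A\<^esub> x))) \<and>
     \<tau> \<one>\<^bsub>A\<^esub> = 1 \<and>
     (\<forall>x\<in>carrier A. \<forall>y\<in>carrier A. \<tau> (x \<otimes>\<^bsub>A\<^esub> y) = \<tau> (y \<otimes>\<^bsub>A\<^esub> x))"


section \<open>Hilbert spaces and \<open>B(H)\<close>\<close>

text \<open>The fields \<open>mult\<close> and \<open>one\<close>, inherited from \<open>ring\<close> through the library's record for
  modules, carry no meaning in a Hilbert space.\<close>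

record 'h hilbert_space = "(complex, 'h) module" +
  cinner :: "'h \<Rightarrow> 'h \<Rightarrow> complex"

definition hnorm :: "('h, 'm) hilbert_space_scheme \<Rightarrow> 'h \<Rightarrow> real" where
  "hnorm H x = sqrt (Re (cinner H x x))"

locale hilbert_space = Module.module complex_ring H for H (structure) +
  assumes cinner_add: "x \<in> carrier H \<Longrightarrow> y \<in> carrier H \<Longrightarrow> z \<in> carrier H \<Longrightarrow>
      cinner H x (y \<oplus> z) = cinner H x y + cinner H x z"
    and cinner_smult: "x \<in> carrier H \<Longrightarrow> y \<in> carrier H \<Longrightarrow> cinner H x (c \<odot> y) = c * cinner H x y"
    and cinner_cnj: "x \<in> carrier H \<Longrightarrow> y \<in> carrier H \<Longrightarrow> cinner H y x = cnj (cinner H x y)"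
    and cinner_nonneg: "x \<in> carrier H \<Longrightarrow> 0 \<le> Re (cinner H x x)"
    and cinner_eq_zero: "x \<in> carrier H \<Longrightarrow> cinner H x x = 0 \<longleftrightarrow> x = \<zero>"
    and complete: "Metric_space.mcomplete (carrier H) (\<lambda>x y. hnorm H (x \<ominus> y))"

text \<open>Operators are functions restricted to the carrier (in the sense of
  \<^const>\<open>extensional\<close>), so that equality of operators is equality of functions.\<close>

definition bounded_linear_operators :: "('h, 'm) hilbert_space_scheme \<Rightarrow> ('h \<Rightarrow> 'h) set" where
  "bounded_linear_operators H = {T \<in> carrier H \<rightarrow>\<^sub>E carrier H.
     (\<forall>x\<in>carrier H. \<forall>y\<in>carrier H. T (x \<oplus>\<^bsub>H\<^esub> y) = T x \<oplus>\<^bsub>H\<^esub> T y) \<and>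
     (\<forall>c. \<forall>x\<in>carrier H. T (c \<odot>\<^bsub>H\<^esub> x) = c \<odot>\<^bsub>H\<^esub> T x) \<and>
     (\<exists>K. \<forall>x\<in>carrier H. hnorm H (T x) \<le> K * hnorm H x)}"

definition adjoint_operator :: "('h, 'm) hilbert_space_scheme \<Rightarrow> ('h \<Rightarrow> 'h) \<Rightarrow> 'h \<Rightarrow> 'h" where
  "adjoint_operator H T = (THE S. S \<in> bounded_linear_operators H \<and>
     (\<forall>x\<in>carrier H. \<forall>y\<in>carrier H. cinner H (T x) y = cinner H x (S y)))"

definition operator_algebra :: "('h, 'm) hilbert_space_scheme \<Rightarrow> ('h \<Rightarrow> 'h) star_algebra" where
  "operator_algebra H =
     \<lparr>carrier = bounded_linear_operators H,
      mult = compose (carrier H),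
      one = (\<lambda>x\<in>carrier H. x),
      zero = (\<lambda>x\<in>carrier H. \<zero>\<^bsub>H\<^esub>),
      add = (\<lambda>S T. \<lambda>x\<in>carrier H. S x \<oplus>\<^bsub>H\<^esub> T x),
      smult = (\<lambda>c T. \<lambda>x\<in>carrier H. c \<odot>\<^bsub>H\<^esub> T x),
      star = adjoint_operator H\<rparr>"


section \<open>Free \<open>*\<close>-algebras and quotients\<close>

text \<open>The free unital \<open>*\<close>-algebra on \<open>G\<close> is the monoid algebra over words in the letters
  \<open>(g, False)\<close>, standing for \<open>g\<close>, and \<open>(g, True)\<close>, standing for \<open>g*\<close>.\<close>

definition free_star_algebra :: "'g set \<Rightarrow> (('g \<times> bool) list \<Rightarrow> complex) star_algebra" where
  "free_star_algebra G =
     \<lparr>carrier = {f. finite {w. f w \<noteq> 0} \<and> (\<forall>w. f w \<noteq> 0 \<longrightarrow> fst ` set w \<subseteq> G)},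
      mult = (\<lambda>f g w. \<Sum>k\<le>length w. f (take k w) * g (drop k w)),
      one = (\<lambda>w. if w = [] then 1 else 0),
      zero = (\<lambda>w. 0),
      add = (\<lambda>f g w. f w + g w),
      smult = (\<lambda>c f w. c * f w),
      star = (\<lambda>f w. cnj (f (rev (map (apsnd Not) w))))\<rparr>"

definition free_gen :: "'g \<Rightarrow> ('g \<times> bool) list \<Rightarrow> complex" where
  "free_gen g = (\<lambda>w. if w = [(g, False)] then 1 else 0)"

text \<open>A two-sided ideal of a unital algebra is automatically a complex subspace.\<close>

definition star_genideal :: "('a, 'm) star_algebra_scheme \<Rightarrow> 'a set \<Rightarrow> 'a set" where
  "star_genideal A S = \<Inter>{I. ideal I A \<and> star A ` I \<subseteq> I \<and> S \<subseteq> I}"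

definition star_quotient :: "('a, 'm) star_algebra_scheme \<Rightarrow> 'a set \<Rightarrow> 'a set star_algebra" where
  "star_quotient A I =
     \<lparr>carrier = carrier (A Quot I), mult = mult (A Quot I), one = one (A Quot I),
      zero = zero (A Quot I), add = add (A Quot I),
      smult = (\<lambda>c C. I <+>\<^bsub>A\<^esub> (smult A c ` C)),
      star = (\<lambda>C. star A ` C)\<rparr>"


section \<open>The metric isometry game and its \<open>*\<close>-algebra\<close>

text \<open>\<open>V\<close> is the input set and \<open>W\<close> the output set of both players, and \<open>L v w a b\<close> says that
  the answers \<open>a\<close>, \<open>b\<close> to the questions \<open>v\<close>, \<open>w\<close> are winning.\<close>

definition game_relations ::
  "'i set \<Rightarrow> 'o set \<Rightarrow> ('i \<Rightarrow> 'i \<Rightarrow> 'o \<Rightarrow> 'o \<Rightarrow> bool) \<Rightarrow> ((('i \<times> 'o) \<times> bool) list \<Rightarrow> complex) set" where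
  "game_relations V W L = (let F = free_star_algebra (V \<times> W); e = (\<lambda>v a. free_gen (v, a)) in
     {e v a \<ominus>\<^bsub>F\<^esub> star F (e v a) | v a. v \<in> V \<and> a \<in> W} \<union>
     {e v a \<ominus>\<^bsub>F\<^esub> e v a \<otimes>\<^bsub>F\<^esub> e v a | v a. v \<in> V \<and> a \<in> W} \<union>
     {(\<Oplus>\<^bsub>F\<^esub>a\<in>W. e v a) \<ominus>\<^bsub>F\<^esub> \<one>\<^bsub>F\<^esub> | v. v \<in> V} \<union>
     {e v a \<otimes>\<^bsub>F\<^esub> e w b | v a w b. v \<in> V \<and> a \<in> W \<and> w \<in> V \<and> b \<in> W \<and> \<not> L v w a b})"

definition game_algebra ::
  "'i set \<Rightarrow> 'o set \<Rightarrow> ('i \<Rightarrow> 'i \<Rightarrow> 'o \<Rightarrow> 'o \<Rightarrow> bool)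
    \<Rightarrow> ((('i \<times> 'o) \<times> bool) list \<Rightarrow> complex) set star_algebra" where
  "game_algebra V W L =
     (let F = free_star_algebra (V \<times> W) in star_quotient F (star_genideal F (game_relations V W L)))"

text \<open>The distance of points of different spaces is irrelevant: wherever \<open>isom_rule\<close> compares
  distances, \<open>v\<close> and \<open>w\<close> lie in the same space, and then so do \<open>a\<close> and \<open>b\<close> by its first two
  conjuncts.\<close>

fun sum_dist :: "('a \<Rightarrow> 'a \<Rightarrow> real) \<Rightarrow> ('b \<Rightarrow> 'b \<Rightarrow> real) \<Rightarrow> 'a + 'b \<Rightarrow> 'a + 'b \<Rightarrow> real" where
  "sum_dist dX dY (Inl x) (Inl x') = dX x x'"
| "sum_dist dX dY (Inr y) (Inr y') = dY y y'"
| "sum_dist dX dY _ _ = undefined"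

definition isom_rule ::
  "('a \<Rightarrow> 'a \<Rightarrow> real) \<Rightarrow> ('b \<Rightarrow> 'b \<Rightarrow> real)
    \<Rightarrow> 'a + 'b \<Rightarrow> 'a + 'b \<Rightarrow> 'a + 'b \<Rightarrow> 'a + 'b \<Rightarrow> bool" where
  "isom_rule dX dY v w a b \<longleftrightarrow>
     isl v \<noteq> isl a \<and>
     isl w \<noteq> isl b \<and>
     (isl v = isl w \<longrightarrow> sum_dist dX dY v w = sum_dist dX dY a b) \<and>
     (isl v \<noteq> isl w \<longrightarrow> (v = b \<longleftrightarrow> w = a))"

definition isom_algebra ::
  "'a set \<Rightarrow> ('a \<Rightarrow> 'a \<Rightarrow> real) \<Rightarrow> 'b set \<Rightarrow> ('b \<Rightarrow> 'b \<Rightarrow> real)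
    \<Rightarrow> (((('a + 'b) \<times> ('a + 'b)) \<times> bool) list \<Rightarrow> complex) set star_algebra" where
  "isom_algebra X dX Y dY = game_algebra (X <+> Y) (X <+> Y) (isom_rule dX dY)"


section \<open>Matrices over a \<open>*\<close>-algebra\<close>

text \<open>A matrix is a function of two indices; only its values on the index sets matter.\<close>

definition mat_eq :: "'i set \<Rightarrow> 'j set \<Rightarrow> ('i \<Rightarrow> 'j \<Rightarrow> 'c) \<Rightarrow> ('i \<Rightarrow> 'j \<Rightarrow> 'c) \<Rightarrow> bool" where
  "mat_eq I J M N \<longleftrightarrow> (\<forall>i\<in>I. \<forall>j\<in>J. M i j = N i j)"

definition mat_mult ::
  "('c, 'm) star_algebra_scheme \<Rightarrow> 'j set \<Rightarrow> ('i \<Rightarrow> 'j \<Rightarrow> 'c) \<Rightarrow> ('j \<Rightarrow> 'k \<Rightarrow> 'c) \<Rightarrow> 'i \<Rightarrow> 'k \<Rightarrow> 'c" where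
  "mat_mult A J M N = (\<lambda>i k. \<Oplus>\<^bsub>A\<^esub>j\<in>J. M i j \<otimes>\<^bsub>A\<^esub> N j k)"

definition mat_one :: "('c, 'm) star_algebra_scheme \<Rightarrow> 'i \<Rightarrow> 'i \<Rightarrow> 'c" where
  "mat_one A = (\<lambda>i j. if i = j then \<one>\<^bsub>A\<^esub> else \<zero>\<^bsub>A\<^esub>)"

definition mat_star :: "('c, 'm) star_algebra_scheme \<Rightarrow> ('i \<Rightarrow> 'j \<Rightarrow> 'c) \<Rightarrow> 'j \<Rightarrow> 'i \<Rightarrow> 'c" where
  "mat_star A M = (\<lambda>j i. star A (M i j))"

text \<open>The matrix \<open>1 \<otimes> D\<close>.\<close>

definition scalar_mat :: "('c, 'm) star_algebra_scheme \<Rightarrow> ('i \<Rightarrow> 'j \<Rightarrow> real) \<Rightarrow> 'i \<Rightarrow> 'j \<Rightarrow> 'c" where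
  "scalar_mat A D = (\<lambda>i j. complex_of_real (D i j) \<odot>\<^bsub>A\<^esub> \<one>\<^bsub>A\<^esub>)"

definition unitary_mat ::
  "('c, 'm) star_algebra_scheme \<Rightarrow> 'i set \<Rightarrow> 'j set \<Rightarrow> ('i \<Rightarrow> 'j \<Rightarrow> 'c) \<Rightarrow> bool" where
  "unitary_mat A I J U \<longleftrightarrow>
     mat_eq I I (mat_mult A J U (mat_star A U)) (mat_one A) \<and>
     mat_eq J J (mat_mult A I (mat_star A U) U) (mat_one A)"

definition projection :: "('c, 'm) star_algebra_scheme \<Rightarrow> 'c \<Rightarrow> bool" where
  "projection A p \<longleftrightarrow> p \<in> carrier A \<and> star A p = p \<and> p \<otimes>\<^bsub>A\<^esub> p = p"

definition quantum_isometry_matrix ::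
  "('c, 'm) star_algebra_scheme \<Rightarrow> 'a set \<Rightarrow> ('a \<Rightarrow> 'a \<Rightarrow> real) \<Rightarrow> 'b set \<Rightarrow> ('b \<Rightarrow> 'b \<Rightarrow> real)
    \<Rightarrow> ('a \<Rightarrow> 'b \<Rightarrow> 'c) \<Rightarrow> bool" where
  "quantum_isometry_matrix A X dX Y dY U \<longleftrightarrow>
     (\<forall>x\<in>X. \<forall>y\<in>Y. projection A (U x y)) \<and>
     unitary_mat A X Y U \<and>
     mat_eq X Y (mat_mult A X (scalar_mat A dX) U) (mat_mult A Y U (scalar_mat A dY))"


section \<open>Quantum isometry of finite metric spaces\<close>

definition algebraically_isometric ::
  "'a set \<Rightarrow> ('a \<Rightarrow> 'a \<Rightarrow> real) \<Rightarrow> 'b set \<Rightarrow> ('b \<Rightarrow> 'b \<Rightarrow> real) \<Rightarrow> bool" where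
  "algebraically_isometric X dX Y dY \<longleftrightarrow>
     carrier (isom_algebra X dX Y dY) \<noteq> {\<zero>\<^bsub>isom_algebra X dX Y dY\<^esub>}"

text \<open>HOL cannot quantify over types inside a formula.  The type argument of the next two
  predicates is the universe: the Hilbert space, respectively the C*-algebra, ranges over all
  structures whose carrier is an arbitrary subset of that type.  Every universe of at least
  continuum cardinality is allowed in the theorem, so structures of every size are covered: one
  with elements of type \<open>'t\<close> can be transported into the universe \<open>'t + real\<close>.\<close>

definition cstar_isometric ::
  "'h itself \<Rightarrow> 'a set \<Rightarrow> ('a \<Rightarrow> 'a \<Rightarrow> real) \<Rightarrow> 'b set \<Rightarrow> ('b \<Rightarrow> 'b \<Rightarrow> real) \<Rightarrow> bool" where
  "cstar_isometric (_ :: 'h itself) X dX Y dY \<longleftrightarrow>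
     (\<exists>(H :: 'h hilbert_space) E. hilbert_space H \<and> carrier H \<noteq> {\<zero>\<^bsub>H\<^esub>} \<and>
        quantum_isometry_matrix (operator_algebra H) X dX Y dY E)"

definition qc_isometric ::
  "'c itself \<Rightarrow> 'a set \<Rightarrow> ('a \<Rightarrow> 'a \<Rightarrow> real) \<Rightarrow> 'b set \<Rightarrow> ('b \<Rightarrow> 'b \<Rightarrow> real) \<Rightarrow> bool" where
  "qc_isometric (_ :: 'c itself) X dX Y dY \<longleftrightarrow>
     (\<exists>(A :: 'c cstar_algebra) \<tau> E. cstar_algebra A \<and> tracial_state A \<tau> \<and>
        quantum_isometry_matrix A X dX Y dY E)"

end

theory Submission
  imports Defs "HOL-Library.Function_Algebras"
begin

text \<open>
  All three properties are equivalent to the existence of a linear functional on words in the letters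
  \<open>e x y\<close> that takes the value \<open>1\<close> at the empty word and respects the relations of a quantum isometry.
  Given such a functional, the finite-dimensional spaces of invariant tensors over \<open>X\<close> and over \<open>Y\<close>
  (in the sense of Tannaka--Krein duality) are isometric in a way that is compatible with composition,
  adjoints and rotation.  The partial isometries from the tensors over \<open>Y\<close> to the tensors over \<open>X\<close>
  are the moments of a further functional, the analogue of the Haar state of a compact quantum group.
  It is cyclic because invariant tensors can be rotated, and positive because the Gram matrix \<open>S\<close> of
  the words of length \<open>n\<close> is self-adjoint with \<open>S\<^sup>2 = m S\<close> for a positive matrix \<open>m\<close>.  The GNS
  construction, performed in the reproducing kernel Hilbert space of the functional, where the letters
  act by shifting the argument, gives the representation; the commutant of the right shifts is
  a C*-algebra on which the vector state of the empty word is a trace.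
\<close>

section \<open>Functionals on words\<close>

text \<open>Nonvanishing of the game algebra yields, by linear algebra alone, a functional without
  any positivity. It is therefore used merely as a certificate: its value 1 at the empty word shows
  that an invariant pair of tensors is determined by its \<open>X\<close>-half. The invariant
  tensors themselves are defined by a condition on all functionals at once, so they do not depend on
  the given one, are closed under conjugation, and need no algebra in which to compute. Positivity
  comes from the ordinary inner product of the finite-dimensional tensor spaces over
  \<open>X\<close>. The identities required of the new functional are dual to closure properties of
  the invariant tensors (insertion, contraction, distance mask, rotation, composition, star).
  Conversely, a solution by projections only has to provide moments; the obstacle there is that
  orthogonality within rows and columns has to be derived from the sums being 1. The completion in
  the GNS step consists of functions that live on countably many words, so it fits into every
  universe of size at least the continuum.\<close>

definition tuples :: "'c set \<Rightarrow> nat \<Rightarrow> 'c list set" where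
  "tuples S k = {xs. length xs = k \<and> set xs \<subseteq> S}"

lemma finite_tuples [simp]: "finite S \<Longrightarrow> finite (tuples S k)"
  using finite_lists_length_eq[of S k] by (simp add: tuples_def conj_commute)

lemma tuples_0 [simp]: "tuples S 0 = {[]}"
  by (auto simp: tuples_def)

lemma tuples_append: "xs \<in> tuples S k \<Longrightarrow> ys \<in> tuples S l \<Longrightarrow> xs @ ys \<in> tuples S (k + l)"
  by (auto simp: tuples_def)

lemma tuples_Cons: "x \<in> S \<Longrightarrow> xs \<in> tuples S k \<Longrightarrow> x # xs \<in> tuples S (Suc k)"
  by (auto simp: tuples_def)

lemma rev_tuples [simp]: "rev xs \<in> tuples S k \<longleftrightarrow> xs \<in> tuples S k"
  by (auto simp: tuples_def)

lemma length_tuples: "xs \<in> tuples S k \<Longrightarrow> length xs = k"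
  by (auto simp: tuples_def)

lemma tuples_addE:
  assumes "zs \<in> tuples S (k + l)"
  obtains xs ys where "xs \<in> tuples S k" "ys \<in> tuples S l" "zs = xs @ ys"
proof
  show "take k zs \<in> tuples S k" "drop k zs \<in> tuples S l" "zs = take k zs @ drop k zs"
    using assms by (auto simp: tuples_def dest: in_set_takeD in_set_dropD)
qed

lemma tuples_SucE:
  assumes "zs \<in> tuples S (Suc k)"
  obtains x xs where "x \<in> S" "xs \<in> tuples S k" "zs = x # xs"
  using assms by (cases zs) (auto simp: tuples_def)

lemma sum_tuples_add:
  "(\<Sum>zs\<in>tuples S (k + l). f zs) = (\<Sum>xs\<in>tuples S k. \<Sum>ys\<in>tuples S l. f (xs @ ys))"
proof -
  have "bij_betw (\<lambda>(xs, ys). xs @ ys) (tuples S k \<times> tuples S l) (tuples S (k + l))"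
  proof (rule bij_betw_imageI)
    show "inj_on (\<lambda>(xs, ys). xs @ ys) (tuples S k \<times> tuples S l)"
      by (auto simp: inj_on_def tuples_def)
    show "(\<lambda>(xs, ys). xs @ ys) ` (tuples S k \<times> tuples S l) = tuples S (k + l)"
      by (auto simp: tuples_append image_iff elim!: tuples_addE)
  qed
  from sum.reindex_bij_betw[OF this, of f] show ?thesis
    by (simp add: sum.cartesian_product case_prod_unfold)
qed

lemma sum_tuples_Suc:
  "(\<Sum>zs\<in>tuples S (Suc k). f zs) = (\<Sum>x\<in>S. \<Sum>xs\<in>tuples S k. f (x # xs))"
proof -
  have "bij_betw (\<lambda>(x, xs). x # xs) (S \<times> tuples S k) (tuples S (Suc k))"
  proof (rule bij_betw_imageI)
    show "inj_on (\<lambda>(x, xs). x # xs) (S \<times> tuples S k)"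
      by (auto simp: inj_on_def)
    show "(\<lambda>(x, xs). x # xs) ` (S \<times> tuples S k) = tuples S (Suc k)"
      by (auto simp: tuples_Cons image_iff elim!: tuples_SucE)
  qed
  from sum.reindex_bij_betw[OF this, of f] show ?thesis
    by (simp add: sum.cartesian_product case_prod_unfold)
qed

lemma sum_tuples_rev: "(\<Sum>xs\<in>tuples S k. f (rev xs)) = (\<Sum>xs\<in>tuples S k. f xs)"
  by (rule sum.reindex_bij_witness[of _ rev rev]) auto

lemma sum_tuples_insert:
  "(\<Sum>zs\<in>tuples S (k + Suc l). f zs) =
   (\<Sum>xs\<in>tuples S k. \<Sum>ys\<in>tuples S l. \<Sum>a\<in>S. f (xs @ a # ys))"
  by (subst sum_tuples_add, subst sum_tuples_Suc) (simp add: sum.swap[of _ S])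

text \<open>Riesz representation inside a space \<open>T\<close> of functions of which only the
  values on the finite set \<open>S\<close> count. In the induction, the functions of
  \<open>T\<close> that vanish at the new point \<open>x\<close> form a subspace \<open>T0\<close>
  of codimension at most one, so a single vector \<open>u\<close> orthogonal to \<open>T0\<close>
  completes the representer. It serves twice: for evaluation on invariant tensors and for the
  projection onto the range of a Gram matrix.\<close>

lemma finite_riesz:
  fixes T :: "('s \<Rightarrow> complex) set" and l :: "('s \<Rightarrow> complex) \<Rightarrow> complex"
  assumes "finite S"
    and "\<And>t u. t \<in> T \<Longrightarrow> u \<in> T \<Longrightarrow> (\<lambda>s. t s + u s) \<in> T"
    and "\<And>c t. t \<in> T \<Longrightarrow> (\<lambda>s. c * t s) \<in> T"
    and "(\<lambda>s. 0) \<in> T"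
    and "\<And>t u. t \<in> T \<Longrightarrow> u \<in> T \<Longrightarrow> l (\<lambda>s. t s + u s) = l t + l u"
    and "\<And>c t. t \<in> T \<Longrightarrow> l (\<lambda>s. c * t s) = c * l t"
    and "\<And>t. t \<in> T \<Longrightarrow> (\<forall>s\<in>S. t s = 0) \<Longrightarrow> l t = 0"
  shows "\<exists>p\<in>T. \<forall>t\<in>T. l t = (\<Sum>s\<in>S. cnj (p s) * t s)"
  using assms
proof (induction S arbitrary: T l rule: finite_induct)
  case empty
  then show ?case by (intro bexI[of _ "\<lambda>s. 0"]) auto
next
  case (insert x S)
  define T0 where "T0 = {t \<in> T. t x = 0}"
  have T0: "(\<lambda>s. t s + u s) \<in> T0" "(\<lambda>s. c * t s) \<in> T0" "(\<lambda>s. 0) \<in> T0" if "t \<in> T0" "u \<in> T0" for c t u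
    using that insert.prems by (auto simp: T0_def)
  have zero0: "(\<lambda>s. 0) \<in> T0"
    using insert.prems by (auto simp: T0_def)
  have sub: "T0 \<subseteq> T" by (auto simp: T0_def)
  obtain p0 where p0: "p0 \<in> T0" "\<And>t. t \<in> T0 \<Longrightarrow> l t = (\<Sum>s\<in>S. cnj (p0 s) * t s)"
  proof -
    have "\<exists>p\<in>T0. \<forall>t\<in>T0. l t = (\<Sum>s\<in>S. cnj (p s) * t s)"
    proof (rule insert.IH)
      fix t assume "t \<in> T0" "\<forall>s\<in>S. t s = 0"
      then show "l t = 0" using insert.prems(6)[of t] by (auto simp: T0_def)
    qed (use T0 zero0 insert.prems(4,5)[OF subsetD[OF sub]] sub in auto)
    then show ?thesis using that by blast
  qed
  show ?case
  proof (cases "T0 = T")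
    case True
    then have "\<forall>t\<in>T. l t = (\<Sum>s\<in>insert x S. cnj (p0 s) * t s)"
      using p0 insert.hyps by (auto simp: T0_def)
    then show ?thesis using p0 True by auto
  next
    case False
    then obtain t2 where t2: "t2 \<in> T" "t2 x \<noteq> 0" by (auto simp: T0_def)
    define t1 where "t1 = (\<lambda>s. inverse (t2 x) * t2 s)"
    have t1: "t1 \<in> T" "t1 x = 1" using t2 insert.prems(2) by (auto simp: t1_def)
    \<comment> \<open>\<open>r\<close> is the orthogonal projection of \<open>t1\<close> to
      \<open>T0\<close>, supplied by the induction hypothesis for the functional that pairs with
      \<open>t1\<close>. Hence \<open>u\<close> is orthogonal to \<open>T0\<close> and, as
      \<open>r\<close> vanishes at \<open>x\<close>, still has the value 1 there.\<close>
    obtain r where r: "r \<in> T0" "\<And>t. t \<in> T0 \<Longrightarrow> (\<Sum>s\<in>S. cnj (t1 s) * t s) = (\<Sum>s\<in>S. cnj (r s) * t s)"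
    proof -
      have "\<exists>p\<in>T0. \<forall>t\<in>T0. (\<Sum>s\<in>S. cnj (t1 s) * t s) = (\<Sum>s\<in>S. cnj (p s) * t s)"
        by (rule insert.IH)
          (use T0 zero0 in \<open>auto simp: algebra_simps sum.distrib sum_distrib_left\<close>)
      then show ?thesis using that by blast
    qed
    define u where "u = (\<lambda>s. t1 s + (-1) * r s)"
    have u: "u \<in> T" "u x = 1"
      unfolding u_def using t1 r sub insert.prems(1)[OF t1(1) insert.prems(2)[of r "-1"]] by (auto simp: T0_def)
    have uort: "(\<Sum>s\<in>insert x S. cnj (u s) * t s) = 0" if "t \<in> T0" for t
    proof -
      have "t x = 0" using that by (auto simp: T0_def)
      then show ?thesis using insert.hyps r(2)[OF that] by (simp add: u_def algebra_simps sum_subtractf)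
    qed
    define n where "n = (\<Sum>s\<in>insert x S. cnj (u s) * u s)"
    have n: "n \<noteq> 0"
    proof -
      have "n = of_real (\<Sum>s\<in>insert x S. (cmod (u s))\<^sup>2)"
        unfolding n_def of_real_sum by (intro sum.cong refl) (simp only: complex_norm_square mult.commute)
      moreover have "(\<Sum>s\<in>insert x S. (cmod (u s))\<^sup>2) \<ge> 1"
        using insert.hyps u(2) by (simp add: sum_nonneg)
      ultimately show ?thesis by (metis of_real_eq_0_iff not_one_le_zero)
    qed
    \<comment> \<open>\<open>p0\<close> is orthogonal to \<open>u\<close>, so the coefficient is the
      one that makes the pairing of \<open>p\<close> with \<open>u\<close> equal to
      \<open>l u\<close>; on \<open>T0\<close> the second summand contributes nothing.\<close>
    define p where "p = (\<lambda>s. p0 s + (cnj (l u) / cnj n) * u s)"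
    have "p \<in> T" unfolding p_def using p0(1) u(1) sub by (intro insert.prems(1,2)) auto
    moreover have "l t = (\<Sum>s\<in>insert x S. cnj (p s) * t s)" if t: "t \<in> T" for t
    proof -
      define t0 where "t0 = (\<lambda>s. t s + (- t x) * u s)"
      have t0: "t0 \<in> T0" using t u insert.prems(1)[OF t insert.prems(2)[OF u(1), of "- t x"]]
        by (simp add: T0_def t0_def)
      have dec: "t = (\<lambda>s. t0 s + t x * u s)" by (auto simp: t0_def)
      have p0x: "p0 x = 0" using p0 by (auto simp: T0_def)
      have t0x: "t0 x = 0" using t0 by (auto simp: T0_def)
      have p0u: "(\<Sum>s\<in>insert x S. cnj (p0 s) * u s) = 0"
      proof -
        have "(\<Sum>s\<in>insert x S. cnj (p0 s) * u s) = cnj (\<Sum>s\<in>insert x S. cnj (u s) * p0 s)"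
          by (simp add: mult.commute)
        then show ?thesis using uort[OF p0(1)] by simp
      qed
      have "l t = l t0 + t x * l u"
        using insert.prems(4)[of t0 "\<lambda>s. t x * u s"] insert.prems(5)[of u "t x"] t0 u sub insert.prems(2)
        by (subst dec) auto
      also have "l t0 = (\<Sum>s\<in>insert x S. cnj (p0 s) * t0 s)"
        using p0 t0 insert.hyps p0x by auto
      also have "\<dots> + t x * l u = (\<Sum>s\<in>insert x S. cnj (p0 s) * t0 s) + t x * (\<Sum>s\<in>insert x S. cnj (p0 s) * u s)
         + (l u / n) * (\<Sum>s\<in>insert x S. cnj (u s) * t0 s) + t x * ((l u / n) * n)"
        using p0u uort[OF t0] n by simp
      also have "\<dots> = (\<Sum>s\<in>insert x S. cnj (p s) * (t0 s + t x * u s))"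
        unfolding p_def n_def
        by (simp only: sum_distrib_left sum.distrib [symmetric])
           (rule sum.cong, auto simp: algebra_simps add_divide_distrib)
      also have "\<dots> = (\<Sum>s\<in>insert x S. cnj (p s) * t s)"
        by (simp add: t0_def)
      finally show ?thesis .
    qed
    ultimately show ?thesis by blast
  qed
qed

text \<open>The values on words of a linear functional that kills the two-sided ideal generated by
  the relations of a quantum isometry; the contexts \<open>u\<close> and \<open>v\<close> make the
  ideal two-sided. Idempotence and orthogonality of the letters follow
  (\<open>functional_idem\<close>, \<open>functional_orth\<close>), and self-adjointness is built in
  by having one letter per entry.\<close>

definition isometry_functional ::
  "'a set \<Rightarrow> ('a \<Rightarrow> 'a \<Rightarrow> real) \<Rightarrow> 'b set \<Rightarrow> ('b \<Rightarrow> 'b \<Rightarrow> real) \<Rightarrow> (('a \<times> 'b) list \<Rightarrow> complex) \<Rightarrow> bool" where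
  "isometry_functional X dX Y dY \<psi> \<longleftrightarrow>
     (\<forall>w. \<psi> w \<noteq> 0 \<longrightarrow> set w \<subseteq> X \<times> Y) \<and>
     (\<forall>u v. \<forall>x\<in>X. (\<Sum>y\<in>Y. \<psi> (u @ (x, y) # v)) = \<psi> (u @ v)) \<and>
     (\<forall>u v. \<forall>y\<in>Y. (\<Sum>x\<in>X. \<psi> (u @ (x, y) # v)) = \<psi> (u @ v)) \<and>
     (\<forall>u v x x' y y'. dX x x' \<noteq> dY y y' \<longrightarrow> \<psi> (u @ (x, y) # (x', y') # v) = 0)"

lemma isometry_functionalD:
  assumes "isometry_functional X dX Y dY \<psi>"
  shows "\<psi> w \<noteq> 0 \<Longrightarrow> set w \<subseteq> X \<times> Y"
    and "x \<in> X \<Longrightarrow> (\<Sum>y\<in>Y. \<psi> (u @ (x, y) # v)) = \<psi> (u @ v)"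
    and "y \<in> Y \<Longrightarrow> (\<Sum>x\<in>X. \<psi> (u @ (x, y) # v)) = \<psi> (u @ v)"
    and "dX x x' \<noteq> dY y y' \<Longrightarrow> \<psi> (u @ (x, y) # (x', y') # v) = 0"
  using assms unfolding isometry_functional_def by blast+

lemma isometry_functional_swap:
  assumes "isometry_functional X dX Y dY \<psi>"
  shows "isometry_functional Y dY X dX (\<lambda>w. \<psi> (map prod.swap w))"
  using isometry_functionalD[OF assms] unfolding isometry_functional_def
  by (auto simp: image_subset_iff) fastforce+

text \<open>Letters are self-adjoint, so the star reverses words; the distance condition survives
  the reversal because both distances are symmetric.\<close>

lemma isometry_functional_star:
  assumes "isometry_functional X dX Y dY \<psi>"
    and sym: "\<And>x x'. dX x x' = dX x' x" "\<And>y y'. dY y y' = dY y' y"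
  shows "isometry_functional X dX Y dY (\<lambda>w. cnj (\<psi> (rev w)))"
  unfolding isometry_functional_def
proof (intro conjI allI impI ballI)
  fix u v :: "('a \<times> 'b) list" and x x' y y'
  show "(\<Sum>y\<in>Y. cnj (\<psi> (rev (u @ (x, y) # v)))) = cnj (\<psi> (rev (u @ v)))" if "x \<in> X"
    using isometry_functionalD(2)[OF assms(1) that, of "rev v" "rev u"] by (simp flip: cnj_sum)
  show "(\<Sum>x\<in>X. cnj (\<psi> (rev (u @ (x, y) # v)))) = cnj (\<psi> (rev (u @ v)))" if "y \<in> Y"
    using isometry_functionalD(3)[OF assms(1) that, of "rev v" "rev u"] by (simp flip: cnj_sum)
  show "cnj (\<psi> (rev (u @ (x, y) # (x', y') # v))) = 0" if "dX x x' \<noteq> dY y y'"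
    using isometry_functionalD(4)[OF assms(1), of x' x y' y "rev v" "rev u"] that sym by simp
qed (use isometry_functionalD(1)[OF assms(1)] in force)

text \<open>Stability under a fixed context of words is what turns the common kernel of all
  functionals into a two-sided ideal in \<open>functional_imp_algebraic\<close>.\<close>

lemma isometry_functional_shift:
  assumes "isometry_functional X dX Y dY \<psi>"
  shows "isometry_functional X dX Y dY (\<lambda>w. \<psi> (u @ w @ v))"
  unfolding isometry_functional_def
proof (intro conjI allI impI ballI)
  fix u' v' :: "('a \<times> 'b) list" and x x' y y'
  show "(\<Sum>y\<in>Y. \<psi> (u @ (u' @ (x, y) # v') @ v)) = \<psi> (u @ (u' @ v') @ v)" if "x \<in> X"
    using isometry_functionalD(2)[OF assms that, of "u @ u'" "v' @ v"] by simp
  show "(\<Sum>x\<in>X. \<psi> (u @ (u' @ (x, y) # v') @ v)) = \<psi> (u @ (u' @ v') @ v)" if "y \<in> Y"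
    using isometry_functionalD(3)[OF assms that, of "u @ u'" "v' @ v"] by simp
  show "\<psi> (u @ (u' @ (x, y) # (x', y') # v') @ v) = 0" if "dX x x' \<noteq> dY y y'"
    using isometry_functionalD(4)[OF assms that, of "u @ u'" "v' @ v"] by simp
qed (use isometry_functionalD(1)[OF assms] in force)

section \<open>Orthogonality of letters and unitarity of tensor powers under a functional\<close>

locale finite_spaces =
  fixes X :: "'a set" and dX :: "'a \<Rightarrow> 'a \<Rightarrow> real" and Y :: "'b set" and dY :: "'b \<Rightarrow> 'b \<Rightarrow> real"
  assumes finite_X [simp]: "finite X" and finite_Y [simp]: "finite Y"
    and symX: "dX x x' = dX x' x" and symY: "dY y y' = dY y' y"
    and zeroX: "x \<in> X \<Longrightarrow> x' \<in> X \<Longrightarrow> dX x x' = 0 \<longleftrightarrow> x = x'"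
    and zeroY: "y \<in> Y \<Longrightarrow> y' \<in> Y \<Longrightarrow> dY y y' = 0 \<longleftrightarrow> y = y'"
begin

lemma swap: "finite_spaces Y dY X dX"
  by unfold_locales (simp_all add: symX symY zeroX zeroY)

abbreviation "isom_fun \<equiv> isometry_functional X dX Y dY"

text \<open>A distance is 0 exactly on the diagonal, so if just one of the two coordinates agrees,
  the distances differ and the distance condition applies.\<close>

lemma functional_orth:
  assumes "isom_fun \<psi>" "x \<in> X" "x' \<in> X" "y \<in> Y" "y' \<in> Y" "(x = x') \<noteq> (y = y')"
  shows "\<psi> (u @ (x, y) # (x', y') # v) = 0"
proof (rule isometry_functionalD(4)[OF assms(1)])
  show "dX x x' \<noteq> dY y y'" using assms zeroX[of x x'] zeroY[of y y'] by metis
qed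

text \<open>Insert 1 as the sum of row \<open>x\<close> next to the letter; orthogonality removes
  all summands except the one that repeats the letter.\<close>

lemma functional_idem:
  assumes "isom_fun \<psi>" "x \<in> X" "y \<in> Y"
  shows "\<psi> (u @ (x, y) # (x, y) # v) = \<psi> (u @ (x, y) # v)"
proof -
  have "\<psi> (u @ (x, y) # v) = (\<Sum>y'\<in>Y. \<psi> ((u @ [(x, y)]) @ (x, y') # v))"
    using isometry_functionalD(2)[OF assms(1,2), of "u @ [(x, y)]" v] by simp
  also have "\<dots> = (\<Sum>y'\<in>Y. if y' = y then \<psi> (u @ (x, y) # (x, y) # v) else 0)"
    using functional_orth[OF assms(1,2,2,3)] by (intro sum.cong) auto
  finally show ?thesis using assms by simp
qed

text \<open>Unitarity of the \<open>k\<close>-fold tensor power of the matrix of letters. The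
  adjoint of a word is the reversed word, so the inner letters cancel first and the outermost pair
  is left for the last step.\<close>

lemma row_unitary:
  assumes "isom_fun \<psi>" "xs \<in> tuples X k" "xs' \<in> tuples X k"
  shows "(\<Sum>ys\<in>tuples Y k. \<psi> (u @ zip xs ys @ rev (zip xs' ys) @ v)) = (if xs = xs' then \<psi> (u @ v) else 0)"
  using assms(2,3)
proof (induction k arbitrary: xs xs' u v)
  case 0
  then show ?case by simp
next
  case (Suc k)
  obtain a zs where xs: "a \<in> X" "zs \<in> tuples X k" "xs = a # zs" using Suc.prems by (elim tuples_SucE)
  obtain a' zs' where xs': "a' \<in> X" "zs' \<in> tuples X k" "xs' = a' # zs'" using Suc.prems by (elim tuples_SucE)
  have "(\<Sum>ys\<in>tuples Y (Suc k). \<psi> (u @ zip xs ys @ rev (zip xs' ys) @ v)) =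
     (\<Sum>b\<in>Y. \<Sum>ys\<in>tuples Y k. \<psi> ((u @ [(a, b)]) @ zip zs ys @ rev (zip zs' ys) @ (a', b) # v))"
    by (simp add: sum_tuples_Suc xs xs')
  also have "\<dots> = (\<Sum>b\<in>Y. if zs = zs' then \<psi> (u @ (a, b) # (a', b) # v) else 0)"
    by (intro sum.cong refl) (subst Suc.IH[OF xs(2) xs'(2)], simp)
  also have "\<dots> = (if xs = xs' then \<psi> (u @ v) else 0)"
  proof (cases "a = a'")
    case True
    have "(\<Sum>b\<in>Y. \<psi> (u @ (a, b) # (a, b) # v)) = \<psi> (u @ v)"
      using isometry_functionalD(2)[OF assms(1) xs(1), of u v] functional_idem[OF assms(1) xs(1)]
      by simp
    then show ?thesis using True by (simp add: xs xs')
  next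
    case False
    then have "(\<Sum>b\<in>Y. \<psi> (u @ (a, b) # (a', b) # v)) = 0"
      using functional_orth[OF assms(1) xs(1) xs'(1)] by (intro sum.neutral) auto
    then show ?thesis using False by (cases "zs = zs'") (simp_all add: xs xs')
  qed
  finally show ?case .
qed

lemma col_unitary:
  assumes "isom_fun \<psi>" "ys \<in> tuples Y k" "ys' \<in> tuples Y k"
  shows "(\<Sum>xs\<in>tuples X k. \<psi> (u @ zip xs ys @ rev (zip xs ys') @ v)) = (if ys = ys' then \<psi> (u @ v) else 0)"
proof -
  interpret sw: finite_spaces Y dY X dX by (rule swap)
  have [simp]: "map prod.swap (zip as bs) = zip bs as" for as :: "'b list" and bs :: "'a list"
    by (induction as bs rule: list_induct2') auto
  show ?thesis
    using sw.row_unitary[OF isometry_functional_swap[OF assms(1)] assms(2,3), of "map prod.swap u" "map prod.swap v"]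
    by (simp add: rev_map [symmetric])
qed

text \<open>Here the adjoint word stands on the left. Reversing all tuples exchanges the roles of a
  word and its adjoint and reduces the claim to \<open>col_unitary\<close>.\<close>

lemma col_unitary':
  assumes "isom_fun \<psi>" "ys \<in> tuples Y k" "ys' \<in> tuples Y k"
  shows "(\<Sum>xs\<in>tuples X k. \<psi> (u @ rev (zip xs ys) @ zip xs ys' @ v)) = (if ys = ys' then \<psi> (u @ v) else 0)"
proof -
  have "(\<Sum>xs\<in>tuples X k. \<psi> (u @ rev (zip xs ys) @ zip xs ys' @ v)) =
      (\<Sum>xs\<in>tuples X k. \<psi> (u @ zip (rev xs) (rev ys) @ rev (zip (rev xs) (rev ys')) @ v))"
    using assms by (intro sum.cong) (auto simp: zip_rev tuples_def)
  also have "\<dots> = (\<Sum>xs\<in>tuples X k. \<psi> (u @ zip xs (rev ys) @ rev (zip xs (rev ys')) @ v))"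
    by (rule sum_tuples_rev[where f = "\<lambda>xs. \<psi> (u @ zip xs (rev ys) @ rev (zip xs (rev ys')) @ v)"])
  finally show ?thesis using col_unitary[OF assms(1), of "rev ys" k "rev ys'"] assms by simp
qed

end

section \<open>Invariant tensors\<close>

text \<open>The antilinear conjugation on tensors that corresponds to the star on words: complex
  conjugation together with reversal of the tensor legs.\<close>

definition tensor_star :: "('a list + 'b list \<Rightarrow> complex) \<Rightarrow> 'a list + 'b list \<Rightarrow> complex" where
  "tensor_star t = (\<lambda>s. cnj (t (map_sum rev rev s)))"

lemma sum_swap4:
  "(\<Sum>a\<in>A. \<Sum>b\<in>B. \<Sum>c\<in>C. \<Sum>d\<in>D. \<Sum>e\<in>E. f a b c d e) = (\<Sum>e\<in>E. \<Sum>a\<in>A. \<Sum>c\<in>C. \<Sum>d\<in>D. \<Sum>b\<in>B. f a b c d e)"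
proof -
  have "(\<Sum>a\<in>A. \<Sum>b\<in>B. \<Sum>c\<in>C. \<Sum>d\<in>D. \<Sum>e\<in>E. f a b c d e) = (\<Sum>a\<in>A. \<Sum>b\<in>B. \<Sum>c\<in>C. \<Sum>e\<in>E. \<Sum>d\<in>D. f a b c d e)"
    by (intro sum.cong refl sum.swap)
  also have "\<dots> = (\<Sum>a\<in>A. \<Sum>b\<in>B. \<Sum>e\<in>E. \<Sum>c\<in>C. \<Sum>d\<in>D. f a b c d e)"
    by (intro sum.cong refl sum.swap)
  also have "\<dots> = (\<Sum>a\<in>A. \<Sum>e\<in>E. \<Sum>b\<in>B. \<Sum>c\<in>C. \<Sum>d\<in>D. f a b c d e)"
    by (intro sum.cong refl sum.swap)
  also have "\<dots> = (\<Sum>e\<in>E. \<Sum>a\<in>A. \<Sum>b\<in>B. \<Sum>c\<in>C. \<Sum>d\<in>D. f a b c d e)"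
    by (rule sum.swap)
  also have "\<dots> = (\<Sum>e\<in>E. \<Sum>a\<in>A. \<Sum>c\<in>C. \<Sum>b\<in>B. \<Sum>d\<in>D. f a b c d e)"
    by (intro sum.cong refl sum.swap)
  also have "\<dots> = (\<Sum>e\<in>E. \<Sum>a\<in>A. \<Sum>c\<in>C. \<Sum>d\<in>D. \<Sum>b\<in>B. f a b c d e)"
    by (intro sum.cong refl sum.swap)
  finally show ?thesis .
qed

context finite_spaces begin

text \<open>A pair of tensors, indexed by \<open>X\<^sup>k\<close> and by \<open>Y\<^sup>k\<close>, which the \<open>k\<close>-fold tensor power of the
  magic unitary maps to each other: the invariant tensors of Tannaka--Krein duality.\<close>

definition invariants :: "nat \<Rightarrow> ('a list + 'b list \<Rightarrow> complex) set" where
  "invariants k = {t. \<forall>\<psi> u v. isom_fun \<psi> \<longrightarrow> (\<forall>xs\<in>tuples X k.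
     (\<Sum>ys\<in>tuples Y k. t (Inr ys) * \<psi> (u @ zip xs ys @ v)) = t (Inl xs) * \<psi> (u @ v))}"

lemma invariantsI:
  assumes "\<And>\<psi> u v xs. isom_fun \<psi> \<Longrightarrow> xs \<in> tuples X k \<Longrightarrow>
     (\<Sum>ys\<in>tuples Y k. t (Inr ys) * \<psi> (u @ zip xs ys @ v)) = t (Inl xs) * \<psi> (u @ v)"
  shows "t \<in> invariants k"
  using assms by (auto simp: invariants_def)

lemma invariantsD:
  assumes "t \<in> invariants k" "isom_fun \<psi>" "xs \<in> tuples X k"
  shows "(\<Sum>ys\<in>tuples Y k. t (Inr ys) * \<psi> (u @ zip xs ys @ v)) = t (Inl xs) * \<psi> (u @ v)"
  using assms by (auto simp: invariants_def)

text \<open>Inverts the transport from \<open>Y\<close> to \<open>X\<close>: the invariance equation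
  is substituted for \<open>t (Inl xs)\<close>, and the tensor power cancels against its adjoint,
  the reversed word.\<close>

lemma invariantsD':
  assumes "t \<in> invariants k" "isom_fun \<psi>" "ys \<in> tuples Y k"
  shows "(\<Sum>xs\<in>tuples X k. t (Inl xs) * \<psi> (u @ rev (zip xs ys) @ v)) = t (Inr ys) * \<psi> (u @ v)"
proof -
  have "(\<Sum>xs\<in>tuples X k. t (Inl xs) * \<psi> (u @ rev (zip xs ys) @ v)) =
     (\<Sum>xs\<in>tuples X k. \<Sum>ys'\<in>tuples Y k. t (Inr ys') * \<psi> ((u @ rev (zip xs ys)) @ zip xs ys' @ v))"
    by (intro sum.cong refl) (subst invariantsD[OF assms(1,2)], auto)
  also have "\<dots> = (\<Sum>ys'\<in>tuples Y k. t (Inr ys') * (\<Sum>xs\<in>tuples X k. \<psi> (u @ rev (zip xs ys) @ zip xs ys' @ v)))"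
    by (subst sum.swap) (simp add: sum_distrib_left)
  also have "\<dots> = (\<Sum>ys'\<in>tuples Y k. t (Inr ys') * (if ys = ys' then \<psi> (u @ v) else 0))"
    by (intro sum.cong refl arg_cong[where f = "\<lambda>z. _ * z"] col_unitary'[OF assms(2,3)])
  also have "\<dots> = t (Inr ys) * \<psi> (u @ v)"
    using assms(3) by (simp add: if_distrib cong: if_cong)
  finally show ?thesis .
qed

lemma invariants_add: "t \<in> invariants k \<Longrightarrow> t' \<in> invariants k \<Longrightarrow> (\<lambda>s. t s + t' s) \<in> invariants k"
  by (auto simp: invariants_def distrib_right sum.distrib)

lemma invariants_scale: "t \<in> invariants k \<Longrightarrow> (\<lambda>s. c * t s) \<in> invariants k"
  by (auto simp: invariants_def sum_distrib_left [symmetric] mult.assoc)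

lemma invariants_zero: "(\<lambda>s. 0) \<in> invariants k"
  by (auto simp: invariants_def)

lemma invariants_sum: "(\<And>i. i \<in> I \<Longrightarrow> t i \<in> invariants k) \<Longrightarrow> (\<lambda>s. \<Sum>i\<in>I. t i s) \<in> invariants k"
  by (induction I rule: infinite_finite_induct) (auto simp: invariants_zero invariants_add)

lemma invariants_star:
  assumes "t \<in> invariants k"
  shows "tensor_star t \<in> invariants k"
proof (rule invariantsI)
  fix \<psi> :: "('a \<times> 'b) list \<Rightarrow> complex" and u v xs
  assume \<psi>: "isom_fun \<psi>" and xs: "xs \<in> tuples X k"
  have "(\<Sum>ys\<in>tuples Y k. tensor_star t (Inr ys) * \<psi> (u @ zip xs ys @ v)) =
     cnj (\<Sum>ys\<in>tuples Y k. t (Inr (rev ys)) * cnj (\<psi> (rev (rev v @ zip (rev xs) (rev ys) @ rev u))))"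
    using xs by (auto simp: tensor_star_def tuples_def zip_rev intro!: sum.cong)
  also have "\<dots> = cnj (\<Sum>ys\<in>tuples Y k. t (Inr ys) * cnj (\<psi> (rev (rev v @ zip (rev xs) ys @ rev u))))"
    by (rule arg_cong[of _ _ cnj], rule sum_tuples_rev)
  also have "\<dots> = cnj (t (Inl (rev xs)) * cnj (\<psi> (rev (rev v @ rev u))))"
    using invariantsD[OF assms isometry_functional_star[OF \<psi> symX symY], of "rev xs" "rev v" "rev u"] xs
    by simp
  finally show "(\<Sum>ys\<in>tuples Y k. tensor_star t (Inr ys) * \<psi> (u @ zip xs ys @ v)) = tensor_star t (Inl xs) * \<psi> (u @ v)"
    by (simp add: tensor_star_def)
qed

text \<open>Inserting a free leg at position \<open>k\<close> is tensoring with the constant vector,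
  which is invariant since the rows sum to 1.\<close>

lemma invariants_insert:
  assumes "t \<in> invariants (k + l)"
  shows "(\<lambda>s. t (map_sum (\<lambda>xs. take k xs @ drop (Suc k) xs) (\<lambda>ys. take k ys @ drop (Suc k) ys) s)) \<in> invariants (k + Suc l)"
    (is "?t \<in> _")
proof (rule invariantsI)
  fix \<psi> :: "('a \<times> 'b) list \<Rightarrow> complex" and u v zs
  assume \<psi>: "isom_fun \<psi>" and zs: "zs \<in> tuples X (k + Suc l)"
  obtain xs a xs' where xs: "xs \<in> tuples X k" "a \<in> X" "xs' \<in> tuples X l" "zs = xs @ a # xs'"
    using zs by (elim tuples_addE tuples_SucE) auto
  have "(\<Sum>ys\<in>tuples Y (k + Suc l). ?t (Inr ys) * \<psi> (u @ zip zs ys @ v)) =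
    (\<Sum>ys\<in>tuples Y k. \<Sum>ys'\<in>tuples Y l. \<Sum>b\<in>Y. t (Inr (ys @ ys')) * \<psi> ((u @ zip xs ys) @ (a, b) # zip xs' ys' @ v))"
    unfolding sum_tuples_insert by (intro sum.cong refl) (use xs in \<open>auto simp: tuples_def\<close>)
  also have "\<dots> = (\<Sum>ys\<in>tuples Y k. \<Sum>ys'\<in>tuples Y l. t (Inr (ys @ ys')) * \<psi> (u @ zip (xs @ xs') (ys @ ys') @ v))"
    unfolding sum_distrib_left [symmetric] isometry_functionalD(2)[OF \<psi> xs(2)]
    by (intro sum.cong refl) (use xs in \<open>auto simp: tuples_def\<close>)
  also have "\<dots> = t (Inl (xs @ xs')) * \<psi> (u @ v)"
    unfolding sum_tuples_add [symmetric, where f = "\<lambda>zs. t (Inr zs) * \<psi> (u @ zip (xs @ xs') zs @ v)"]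
    by (rule invariantsD[OF assms \<psi> tuples_append[OF xs(1,3)]])
  finally show "(\<Sum>ys\<in>tuples Y (k + Suc l). ?t (Inr ys) * \<psi> (u @ zip zs ys @ v)) = ?t (Inl zs) * \<psi> (u @ v)"
    using xs by (auto simp: tuples_def)
qed

text \<open>Over \<open>Y\<close>, the letter that the shorter word lacks is reintroduced as a
  column sum; after this the invariance of the longer tensor applies.\<close>

lemma invariants_contract:
  assumes "t \<in> invariants (k + Suc l)"
  shows "case_sum (\<lambda>xs. \<Sum>a\<in>X. t (Inl (take k xs @ a # drop k xs))) (\<lambda>ys. \<Sum>b\<in>Y. t (Inr (take k ys @ b # drop k ys)))
    \<in> invariants (k + l)" (is "?t \<in> _")
proof (rule invariantsI)
  fix \<psi> :: "('a \<times> 'b) list \<Rightarrow> complex" and u v zs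
  assume \<psi>: "isom_fun \<psi>" and zs: "zs \<in> tuples X (k + l)"
  obtain xs xs' where xs: "xs \<in> tuples X k" "xs' \<in> tuples X l" "zs = xs @ xs'"
    using zs by (elim tuples_addE) auto
  have "(\<Sum>ys\<in>tuples Y (k + l). ?t (Inr ys) * \<psi> (u @ zip zs ys @ v)) =
    (\<Sum>ys\<in>tuples Y k. \<Sum>ys'\<in>tuples Y l. \<Sum>b\<in>Y. t (Inr (ys @ b # ys')) * \<psi> ((u @ zip xs ys) @ zip xs' ys' @ v))"
    unfolding sum_tuples_add
    by (intro sum.cong refl) (use xs in \<open>auto simp: tuples_def sum_distrib_right\<close>)
  also have "\<dots> = (\<Sum>ys\<in>tuples Y k. \<Sum>ys'\<in>tuples Y l. \<Sum>b\<in>Y. \<Sum>a\<in>X.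
      t (Inr (ys @ b # ys')) * \<psi> ((u @ zip xs ys) @ (a, b) # zip xs' ys' @ v))"
    unfolding sum_distrib_left [symmetric]
    by (intro sum.cong refl arg_cong[where f = "\<lambda>z. _ * z"] isometry_functionalD(3)[OF \<psi>, symmetric])
  also have "\<dots> = (\<Sum>a\<in>X. \<Sum>ys\<in>tuples Y k. \<Sum>ys'\<in>tuples Y l. \<Sum>b\<in>Y.
      t (Inr (ys @ b # ys')) * \<psi> (u @ zip (xs @ a # xs') (ys @ b # ys') @ v))"
    by (simp only: sum.swap[where B = X]) (intro sum.cong refl, use xs in \<open>auto simp: tuples_def\<close>)
  also have "\<dots> = (\<Sum>a\<in>X. t (Inl (xs @ a # xs')) * \<psi> (u @ v))"
    unfolding sum_tuples_insert [symmetric, where f = "\<lambda>zs. t (Inr zs) * \<psi> (u @ zip (xs @ _ # xs') zs @ v)"]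
    by (intro sum.cong refl invariantsD[OF assms \<psi>] tuples_append tuples_Cons xs) auto
  finally show "(\<Sum>ys\<in>tuples Y (k + l). ?t (Inr ys) * \<psi> (u @ zip zs ys @ v)) = ?t (Inl zs) * \<psi> (u @ v)"
    using xs by (auto simp: tuples_def sum_distrib_right)
qed

text \<open>Multiplication by the indicator of distance \<open>r\<close> between two neighbouring
  legs. Words whose letters disagree in distance contribute 0, so the indicator over
  \<open>Y\<close> may be replaced by the one over \<open>X\<close> and pulled out of the
  sum.\<close>

lemma invariants_diagonal:
  assumes "t \<in> invariants (k + Suc (Suc l))"
  shows "(\<lambda>s. t s * of_bool (case_sum (\<lambda>xs. dX (xs ! k) (xs ! Suc k) = r) (\<lambda>ys. dY (ys ! k) (ys ! Suc k) = r) s))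
    \<in> invariants (k + Suc (Suc l))" (is "?t \<in> _")
proof (rule invariantsI)
  fix \<psi> :: "('a \<times> 'b) list \<Rightarrow> complex" and u v zs
  assume \<psi>: "isom_fun \<psi>" and zs: "zs \<in> tuples X (k + Suc (Suc l))"
  obtain xs a a' xs' where xs: "xs \<in> tuples X k" "a \<in> X" "a' \<in> X" "xs' \<in> tuples X l" "zs = xs @ a # a' # xs'"
    using zs by (elim tuples_addE tuples_SucE) auto
  have "(\<Sum>ys\<in>tuples Y (k + Suc (Suc l)). ?t (Inr ys) * \<psi> (u @ zip zs ys @ v)) =
    (\<Sum>ys\<in>tuples Y (k + Suc (Suc l)). of_bool (dX a a' = r) * (t (Inr ys) * \<psi> (u @ zip zs ys @ v)))"
  proof (intro sum.cong refl)
    fix ws assume "ws \<in> tuples Y (k + Suc (Suc l))"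
    then obtain ys b b' ys' where ys: "ys \<in> tuples Y k" "b \<in> Y" "b' \<in> Y" "ys' \<in> tuples Y l" "ws = ys @ b # b' # ys'"
      by (elim tuples_addE tuples_SucE) auto
    have "\<psi> (u @ zip zs ws @ v) = 0" if "dX a a' \<noteq> dY b b'"
      using isometry_functionalD(4)[OF \<psi> that, of "u @ zip xs ys" "zip xs' ys' @ v"] xs ys
      by (simp add: tuples_def)
    moreover have "ws ! k = b" "ws ! Suc k = b'" using ys by (auto simp: tuples_def nth_append)
    ultimately show "?t (Inr ws) * \<psi> (u @ zip zs ws @ v) = of_bool (dX a a' = r) * (t (Inr ws) * \<psi> (u @ zip zs ws @ v))"
      by (cases "dX a a' = dY b b'") auto
  qed
  also have "\<dots> = of_bool (dX a a' = r) * (t (Inl zs) * \<psi> (u @ v))"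
    unfolding sum_distrib_left [symmetric] by (simp only: invariantsD[OF assms \<psi> zs])
  also have "\<dots> = ?t (Inl zs) * \<psi> (u @ v)"
    using xs by (auto simp: tuples_def nth_append)
  finally show "(\<Sum>ys\<in>tuples Y (k + Suc (Suc l)). ?t (Inr ys) * \<psi> (u @ zip zs ys @ v)) = ?t (Inl zs) * \<psi> (u @ v)" .
qed

text \<open>Sandwiching \<open>(a, b) \<cdots>\<close> with the letter \<open>(a', b)\<close> on the right isolates the summand whose last
  \<open>Y\<close>-index is \<open>b\<close>; summing over \<open>a'\<close> removes the letter again.\<close>

lemma invariants_rotate:
  assumes "t \<in> invariants (Suc k)"
  shows "(\<lambda>s. t (map_sum rotate1 rotate1 s)) \<in> invariants (Suc k)" (is "?t \<in> _")
proof (rule invariantsI)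
  fix \<psi> :: "('a \<times> 'b) list \<Rightarrow> complex" and u v zs
  assume \<psi>: "isom_fun \<psi>" and zs: "zs \<in> tuples X (Suc k)"
  obtain a xs where xs: "a \<in> X" "xs \<in> tuples X k" "zs = a # xs"
    using zs by (elim tuples_SucE) auto
  have swp: "(\<Sum>ys\<in>tuples Y k. t (Inr (ys @ [b])) * \<psi> (u @ (a, b) # zip xs ys @ (a', b) # v)) =
       t (Inl (xs @ [a'])) * \<psi> (u @ (a, b) # (a', b) # v)" if "b \<in> Y" "a' \<in> X" for a' b
  proof -
    have "t (Inl (xs @ [a'])) * \<psi> ((u @ [(a, b)]) @ (a', b) # v) =
       (\<Sum>zs\<in>tuples Y (k + Suc 0). t (Inr zs) * \<psi> ((u @ [(a, b)]) @ zip (xs @ [a']) zs @ (a', b) # v))"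
      by (rule invariantsD[OF _ \<psi>, symmetric]) (use assms xs that in \<open>auto simp: tuples_def\<close>)
    also have "\<dots> = (\<Sum>ys\<in>tuples Y k. \<Sum>b'\<in>Y. t (Inr (ys @ [b'])) * \<psi> (((u @ [(a, b)]) @ zip xs ys) @ (a', b') # (a', b) # v))"
      unfolding sum_tuples_insert tuples_0
      by (intro sum.cong refl) (use xs in \<open>auto simp: tuples_def intro!: sum.cong\<close>)
    also have "\<dots> = (\<Sum>ys\<in>tuples Y k. \<Sum>b'\<in>Y. if b' = b then t (Inr (ys @ [b])) * \<psi> (((u @ [(a, b)]) @ zip xs ys) @ (a', b) # v) else 0)"
    proof (intro sum.cong refl)
      fix ys b' assume "b' \<in> Y"
      then show "t (Inr (ys @ [b'])) * \<psi> (((u @ [(a, b)]) @ zip xs ys) @ (a', b') # (a', b) # v) =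
          (if b' = b then t (Inr (ys @ [b])) * \<psi> (((u @ [(a, b)]) @ zip xs ys) @ (a', b) # v) else 0)"
        using that functional_idem[OF \<psi>, of a' b "(u @ [(a, b)]) @ zip xs ys" v]
          functional_orth[OF \<psi>, of a' a' b' b "(u @ [(a, b)]) @ zip xs ys" v] by auto
    qed
    finally show ?thesis using that by simp
  qed
  have "(\<Sum>zs'\<in>tuples Y (Suc k). ?t (Inr zs') * \<psi> (u @ zip zs zs' @ v)) =
    (\<Sum>b\<in>Y. \<Sum>ys\<in>tuples Y k. t (Inr (ys @ [b])) * \<psi> ((u @ (a, b) # zip xs ys) @ v))"
    by (simp add: sum_tuples_Suc xs)
  also have "\<dots> = (\<Sum>b\<in>Y. \<Sum>ys\<in>tuples Y k. \<Sum>a'\<in>X. t (Inr (ys @ [b])) * \<psi> ((u @ (a, b) # zip xs ys) @ (a', b) # v))"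
    unfolding sum_distrib_left [symmetric]
    by (intro sum.cong refl) (simp only: isometry_functionalD(3)[OF \<psi>])
  also have "\<dots> = (\<Sum>b\<in>Y. \<Sum>a'\<in>X. t (Inl (xs @ [a'])) * \<psi> (u @ (a, b) # (a', b) # v))"
    by (simp add: sum.swap[where B = X] swp)
  also have "\<dots> = (\<Sum>a'\<in>X. t (Inl (xs @ [a'])) * (\<Sum>b\<in>Y. \<psi> (u @ (a, b) # (a', b) # v)))"
    by (simp add: sum.swap[where B = X] sum_distrib_left)
  also have "\<dots> = (\<Sum>a'\<in>X. t (Inl (xs @ [a'])) * (if a = a' then \<psi> (u @ v) else 0))"
  proof (intro sum.cong refl arg_cong[where f = "\<lambda>z. _ * z"])
    fix a' assume a': "a' \<in> X"
    have "tuples Y (Suc 0) = (\<lambda>b. [b]) ` Y" by (auto simp: tuples_def length_Suc_conv)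
    then have "(\<Sum>b\<in>Y. \<psi> (u @ (a, b) # (a', b) # v)) = (\<Sum>ys\<in>tuples Y (Suc 0). \<psi> (u @ zip [a] ys @ rev (zip [a'] ys) @ v))"
      by (simp add: sum.reindex inj_on_def)
    also have "\<dots> = (if a = a' then \<psi> (u @ v) else 0)"
      using row_unitary[OF \<psi>, of "[a]" "Suc 0" "[a']" u v] xs a' by (simp add: tuples_def)
    finally show "(\<Sum>b\<in>Y. \<psi> (u @ (a, b) # (a', b) # v)) = (if a = a' then \<psi> (u @ v) else 0)" .
  qed
  also have "\<dots> = t (Inl (xs @ [a])) * \<psi> (u @ v)"
    using xs by (simp add: if_distrib cong: if_cong)
  finally show "(\<Sum>ys\<in>tuples Y (Suc k). ?t (Inr ys) * \<psi> (u @ zip zs ys @ v)) = ?t (Inl zs) * \<psi> (u @ v)"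
    using xs by simp
qed

text \<open>The last \<open>n\<close> legs of \<open>t\<close> are contracted with the first
  \<open>n\<close> legs of \<open>t'\<close> in nested order, the last leg of \<open>t\<close> with
  the first one of \<open>t'\<close>; hence the reversal.\<close>

definition tensor_comp ::
  "nat \<Rightarrow> ('a list + 'b list \<Rightarrow> complex) \<Rightarrow> ('a list + 'b list \<Rightarrow> complex) \<Rightarrow> 'a list + 'b list \<Rightarrow> complex" where
  "tensor_comp n t t' = case_sum
     (\<lambda>zs. \<Sum>xs\<in>tuples X n. t (Inl (take n zs @ xs)) * t' (Inl (rev xs @ drop n zs)))
     (\<lambda>zs. \<Sum>ys\<in>tuples Y n. t (Inr (take n zs @ ys)) * t' (Inr (rev ys @ drop n zs)))"

text \<open>A tensor \<open>t \<in> invariants (2 n)\<close> is read as the operator with the entry \<open>t (rev xs @ xs')\<close>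
  at \<open>(xs, xs')\<close>.\<close>

lemma invariants_comp:
  assumes t: "t \<in> invariants (n + n)" and t': "t' \<in> invariants (n + n)"
  shows "tensor_comp n t t' \<in> invariants (n + n)" (is "?t \<in> _")
proof (rule invariantsI)
  fix \<psi> :: "('a \<times> 'b) list \<Rightarrow> complex" and u v zs
  assume \<psi>: "isom_fun \<psi>" and zs: "zs \<in> tuples X (n + n)"
  obtain xs xs' where xs: "xs \<in> tuples X n" "xs' \<in> tuples X n" "zs = xs @ xs'"
    using zs by (elim tuples_addE) auto
  let ?Y = "tuples Y n" and ?X = "tuples X n"
  have "(\<Sum>ys\<in>tuples Y (n + n). ?t (Inr ys) * \<psi> (u @ zip zs ys @ v)) =
    (\<Sum>ys\<in>?Y. \<Sum>ys'\<in>?Y. \<Sum>c\<in>?Y. t (Inr (ys @ c)) * t' (Inr (rev c @ ys')) * \<psi> ((u @ zip xs ys) @ zip xs' ys' @ v))"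
    unfolding sum_tuples_add
    by (intro sum.cong refl) (use xs in \<open>auto simp: tuples_def sum_distrib_right tensor_comp_def\<close>)
  \<comment> \<open>The contracted index is split into \<open>c\<close> and \<open>d\<close> with a
    Kronecker delta, which \<open>col_unitary\<close> rewrites as a sum of words over a new tuple
    \<open>e\<close>. These words provide the letters that \<open>t\<close> and \<open>t'\<close>
    need at their contracted legs.\<close>
  also have "\<dots> = (\<Sum>ys\<in>?Y. \<Sum>ys'\<in>?Y. \<Sum>c\<in>?Y. \<Sum>d\<in>?Y. t (Inr (ys @ c)) * t' (Inr (rev d @ ys')) *
       (if c = d then \<psi> ((u @ zip xs ys) @ zip xs' ys' @ v) else 0))"
    by (intro sum.cong refl) (simp add: if_distrib cong: if_cong)
  also have "\<dots> = (\<Sum>ys\<in>?Y. \<Sum>ys'\<in>?Y. \<Sum>c\<in>?Y. \<Sum>d\<in>?Y. \<Sum>e\<in>?X. t (Inr (ys @ c)) * t' (Inr (rev d @ ys')) *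
       \<psi> ((u @ zip xs ys) @ zip e c @ rev (zip e d) @ zip xs' ys' @ v))"
    unfolding sum_distrib_left [symmetric]
    by (intro sum.cong refl arg_cong[where f = "\<lambda>z. _ * z"] col_unitary[OF \<psi>, symmetric])
  also have "\<dots> = (\<Sum>e\<in>?X. \<Sum>ys\<in>?Y. \<Sum>c\<in>?Y. \<Sum>d\<in>?Y. \<Sum>ys'\<in>?Y. t (Inr (ys @ c)) * t' (Inr (rev d @ ys')) *
       \<psi> ((u @ zip xs ys) @ zip e c @ rev (zip e d) @ zip xs' ys' @ v))"
    by (rule sum_swap4)
  also have "\<dots> = (\<Sum>e\<in>?X. \<Sum>ys\<in>?Y. \<Sum>c\<in>?Y. t (Inr (ys @ c)) * (\<Sum>d\<in>?Y. \<Sum>ys'\<in>?Y. t' (Inr (rev d @ ys')) *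
       \<psi> ((u @ zip (xs @ e) (ys @ c)) @ zip (rev e @ xs') (rev d @ ys') @ v)))"
    unfolding sum_distrib_left
    by (intro sum.cong refl) (use xs in \<open>auto simp: tuples_def zip_rev\<close>)
  also have "\<dots> = (\<Sum>e\<in>?X. \<Sum>ys\<in>?Y. \<Sum>c\<in>?Y. t (Inr (ys @ c)) * (t' (Inl (rev e @ xs')) * \<psi> (u @ zip (xs @ e) (ys @ c) @ v)))"
  proof (intro sum.cong refl arg_cong[where f = "\<lambda>z. _ * z"])
    fix e ys c assume e: "e \<in> ?X"
    have "(\<Sum>d\<in>?Y. \<Sum>ys'\<in>?Y. t' (Inr (rev d @ ys')) * \<psi> ((u @ zip (xs @ e) (ys @ c)) @ zip (rev e @ xs') (rev d @ ys') @ v))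
      = (\<Sum>zs\<in>tuples Y (n + n). t' (Inr zs) * \<psi> ((u @ zip (xs @ e) (ys @ c)) @ zip (rev e @ xs') zs @ v))"
      unfolding sum_tuples_add by (rule sum_tuples_rev)
    then show "(\<Sum>d\<in>?Y. \<Sum>ys'\<in>?Y. t' (Inr (rev d @ ys')) * \<psi> ((u @ zip (xs @ e) (ys @ c)) @ zip (rev e @ xs') (rev d @ ys') @ v))
       = t' (Inl (rev e @ xs')) * \<psi> (u @ zip (xs @ e) (ys @ c) @ v)"
      using invariantsD[OF t' \<psi>, of "rev e @ xs'" "u @ zip (xs @ e) (ys @ c)" v] tuples_append[of "rev e" X n xs' n] e xs
      by simp
  qed
  also have "\<dots> = (\<Sum>e\<in>?X. t' (Inl (rev e @ xs')) * (\<Sum>ys\<in>?Y. \<Sum>c\<in>?Y. t (Inr (ys @ c)) * \<psi> (u @ zip (xs @ e) (ys @ c) @ v)))"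
    unfolding sum_distrib_left by (intro sum.cong refl) (simp add: algebra_simps)
  also have "\<dots> = (\<Sum>e\<in>?X. t' (Inl (rev e @ xs')) * (t (Inl (xs @ e)) * \<psi> (u @ v)))"
  proof (intro sum.cong refl arg_cong[where f = "\<lambda>z. _ * z"])
    fix e assume e: "e \<in> ?X"
    show "(\<Sum>ys\<in>?Y. \<Sum>c\<in>?Y. t (Inr (ys @ c)) * \<psi> (u @ zip (xs @ e) (ys @ c) @ v)) = t (Inl (xs @ e)) * \<psi> (u @ v)"
      unfolding sum_tuples_add [symmetric, where f = "\<lambda>zs. t (Inr zs) * \<psi> (u @ zip (xs @ e) zs @ v)"]
      by (rule invariantsD[OF t \<psi> tuples_append[OF xs(1) e]])
  qed
  finally show "(\<Sum>ys\<in>tuples Y (n + n). ?t (Inr ys) * \<psi> (u @ zip zs ys @ v)) = ?t (Inl zs) * \<psi> (u @ v)"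
    using xs(1) by (simp add: xs(3) length_tuples sum_distrib_left sum_distrib_right tensor_comp_def algebra_simps)
qed

end

section \<open>The Haar functional\<close>

locale isometry_game = finite_spaces X dX Y dY
  for X :: "'a set" and dX :: "'a \<Rightarrow> 'a \<Rightarrow> real" and Y :: "'b set" and dY :: "'b \<Rightarrow> 'b \<Rightarrow> real" +
  fixes \<psi>0 :: "('a \<times> 'b) list \<Rightarrow> complex"
  assumes functional0: "isom_fun \<psi>0" and functional0_Nil: "\<psi>0 [] = 1"
begin

text \<open>Only the \<open>X\<close>-halves are paired: on invariant tensors they determine the
  \<open>Y\<close>-halves by \<open>invariants_Inr_zero\<close>.\<close>

definition ip :: "nat \<Rightarrow> ('a list + 'b list \<Rightarrow> complex) \<Rightarrow> ('a list + 'b list \<Rightarrow> complex) \<Rightarrow> complex" where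
  "ip k t t' = (\<Sum>xs\<in>tuples X k. cnj (t (Inl xs)) * t' (Inl xs))"

text \<open>The one place that consults the given functional. The equation for the
  \<open>Y\<close>-half is tested in the empty context, where \<psi>0 takes the value 1.\<close>

lemma invariants_Inr_zero:
  assumes "t \<in> invariants k" "\<forall>xs\<in>tuples X k. t (Inl xs) = 0" "ys \<in> tuples Y k"
  shows "t (Inr ys) = 0"
  using invariantsD'[OF assms(1) functional0 assms(3), of "[]" "[]"] assms(2) by (simp add: functional0_Nil)

lemma ip_self_zero:
  assumes "ip k t t = 0" "xs \<in> tuples X k"
  shows "t (Inl xs) = 0"
proof -
  have "ip k t t = of_real (\<Sum>xs\<in>tuples X k. (cmod (t (Inl xs)))\<^sup>2)"
    unfolding ip_def of_real_sum by (intro sum.cong refl) (simp only: complex_norm_square mult.commute)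
  then have "(\<Sum>xs\<in>tuples X k. (cmod (t (Inl xs)))\<^sup>2) = 0"
    using assms(1) by (metis of_real_eq_0_iff)
  then show ?thesis using assms(2) by (simp add: sum_nonneg_eq_0_iff)
qed

lemma ip_cnj: "cnj (ip k t t') = ip k t' t"
  by (simp add: ip_def mult.commute)

lemma ip_sum_left: "ip k (\<lambda>s. \<Sum>i\<in>I. c i * t i s) t' = (\<Sum>i\<in>I. cnj (c i) * ip k (t i) t')"
  unfolding ip_def sum_distrib_left
  by (subst sum.swap) (simp add: sum_distrib_right sum_distrib_left algebra_simps)

lemma ex_representer:
  assumes "ys \<in> tuples Y k"
  shows "\<exists>p\<in>invariants k. \<forall>t\<in>invariants k. t (Inr ys) = ip k p t"
proof -
  have "\<exists>p\<in>invariants k. \<forall>t\<in>invariants k. t (Inr ys) = (\<Sum>s\<in>Inl ` tuples X k. cnj (p s) * t s)"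
  proof (rule finite_riesz)
    show "t (Inr ys) = 0" if "t \<in> invariants k" "\<forall>s\<in>Inl ` tuples X k. t s = 0" for t
      using invariants_Inr_zero[OF that(1) _ assms] that(2) by blast
  qed (simp_all add: invariants_add invariants_scale invariants_zero)
  then show ?thesis by (simp add: ip_def sum.reindex)
qed

text \<open>The column at \<open>ys\<close> of the operator from tensors over \<open>Y\<close> to
  tensors over \<open>X\<close>. By \<open>representer_unique\<close> its values on
  \<open>X\<close>-tuples do not depend on the choice, and these are the values that
  \<open>haar\<close> reads.\<close>

definition rep :: "nat \<Rightarrow> 'b list \<Rightarrow> 'a list + 'b list \<Rightarrow> complex" where
  "rep k ys = (SOME p. p \<in> invariants k \<and> (\<forall>t\<in>invariants k. t (Inr ys) = ip k p t))"

lemma rep_invariants: "ys \<in> tuples Y k \<Longrightarrow> rep k ys \<in> invariants k"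
  and ip_rep: "ys \<in> tuples Y k \<Longrightarrow> t \<in> invariants k \<Longrightarrow> ip k (rep k ys) t = t (Inr ys)"
proof -
  assume ys: "ys \<in> tuples Y k"
  then have *: "rep k ys \<in> invariants k \<and> (\<forall>t\<in>invariants k. t (Inr ys) = ip k (rep k ys) t)"
    unfolding rep_def by (rule someI_ex[OF ex_representer[unfolded Bex_def]])
  then show "rep k ys \<in> invariants k" by blast
  show "ip k (rep k ys) t = t (Inr ys)" if "t \<in> invariants k" using * that by simp
qed

text \<open>The proof principle for the identities of \<open>haar\<close>: invariant tensors are
  compared by their pairings with invariant tensors, which suffices because their difference is
  itself one of the test tensors.\<close>

lemma representer_unique:
  assumes p: "p \<in> invariants k" and q: "q \<in> invariants k" and "\<And>t. t \<in> invariants k \<Longrightarrow> ip k p t = ip k q t"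
    and xs: "xs \<in> tuples X k"
  shows "p (Inl xs) = q (Inl xs)"
proof -
  define r where "r = (\<lambda>s. p s + (-1) * q s)"
  have r: "r \<in> invariants k" unfolding r_def by (intro invariants_add invariants_scale p q)
  have "ip k r t = ip k p t - ip k q t" for t
    by (simp add: ip_def r_def algebra_simps sum_subtractf)
  then have "ip k r r = 0" using assms(3)[OF r] by simp
  from ip_self_zero[OF this xs] show ?thesis by (simp add: r_def)
qed

definition haar :: "('a \<times> 'b) list \<Rightarrow> complex" where
  "haar w = (if set w \<subseteq> X \<times> Y then rep (length w) (map snd w) (Inl (map fst w)) else 0)"

lemma haar_zip:
  assumes "xs \<in> tuples X k" "ys \<in> tuples Y k"
  shows "haar (zip xs ys) = rep k ys (Inl xs)"
proof -
  have "set (zip xs ys) \<subseteq> X \<times> Y"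
    using assms by (auto simp: tuples_def dest: set_zip_leftD set_zip_rightD)
  then show ?thesis using assms by (simp add: haar_def tuples_def)
qed

lemma wordE:
  assumes "set w \<subseteq> X \<times> Y"
  obtains xs ys where "xs \<in> tuples X (length w)" "ys \<in> tuples Y (length w)" "w = zip xs ys"
proof
  show "map fst w \<in> tuples X (length w)" "map snd w \<in> tuples Y (length w)" "w = zip (map fst w) (map snd w)"
    using assms by (auto simp: tuples_def zip_map_fst_snd)
qed

text \<open>Insertion and contraction of a leg are adjoint to each other for \<open>ip\<close>, and
  both preserve invariance. Summing evaluations over the leg \<open>b\<close> is evaluation after
  contraction, so the row relation comes from inserting a leg into the representer; dually,
  contracting the representer gives the column relation.\<close>

lemma rep_contract:
  assumes xs: "xs \<in> tuples X k" "xs' \<in> tuples X l" and ys: "ys \<in> tuples Y k" "ys' \<in> tuples Y l"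
  shows "a \<in> X \<Longrightarrow> (\<Sum>b\<in>Y. rep (k + Suc l) (ys @ b # ys') (Inl (xs @ a # xs'))) = rep (k + l) (ys @ ys') (Inl (xs @ xs'))"
    and "b \<in> Y \<Longrightarrow> (\<Sum>a\<in>X. rep (k + Suc l) (ys @ b # ys') (Inl (xs @ a # xs'))) = rep (k + l) (ys @ ys') (Inl (xs @ xs'))"
proof -
  define ins where "ins = (\<lambda>t :: 'a list + 'b list \<Rightarrow> complex. \<lambda>s.
    t (map_sum (\<lambda>xs. take k xs @ drop (Suc k) xs) (\<lambda>ys. take k ys @ drop (Suc k) ys) s))"
  define con where "con = (\<lambda>t :: 'a list + 'b list \<Rightarrow> complex.
    case_sum (\<lambda>xs. \<Sum>a\<in>X. t (Inl (take k xs @ a # drop k xs))) (\<lambda>ys. \<Sum>b\<in>Y. t (Inr (take k ys @ b # drop k ys))))"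
  have ins: "ins t \<in> invariants (k + Suc l)" if "t \<in> invariants (k + l)" for t
    unfolding ins_def by (rule invariants_insert[OF that])
  have con: "con t \<in> invariants (k + l)" if "t \<in> invariants (k + Suc l)" for t
    unfolding con_def by (rule invariants_contract[OF that])
  have adj: "ip (k + Suc l) (ins t) t' = ip (k + l) t (con t')" for t t'
    unfolding ip_def sum_tuples_insert sum_tuples_add[where k = k and l = l] ins_def con_def
    by (intro sum.cong refl) (auto simp: length_tuples sum_distrib_left)
  have adj': "ip (k + Suc l) t' (ins t) = ip (k + l) (con t') t" for t t'
    using arg_cong[OF adj, of cnj] by (simp only: ip_cnj)
  have yy: "ys @ ys' \<in> tuples Y (k + l)" and yby: "\<And>b. b \<in> Y \<Longrightarrow> ys @ b # ys' \<in> tuples Y (k + Suc l)"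
    and xx: "xs @ xs' \<in> tuples X (k + l)" and xax: "\<And>a. a \<in> X \<Longrightarrow> xs @ a # xs' \<in> tuples X (k + Suc l)"
    using xs ys by (auto simp: tuples_def)
  show "(\<Sum>b\<in>Y. rep (k + Suc l) (ys @ b # ys') (Inl (xs @ a # xs'))) = rep (k + l) (ys @ ys') (Inl (xs @ xs'))" if a: "a \<in> X"
  proof -
    have "(\<Sum>b\<in>Y. 1 * rep (k + Suc l) (ys @ b # ys') (Inl (xs @ a # xs'))) = ins (rep (k + l) (ys @ ys')) (Inl (xs @ a # xs'))"
    proof (rule representer_unique[OF _ ins[OF rep_invariants[OF yy]] _ xax[OF a]])
      show "(\<lambda>s. \<Sum>b\<in>Y. 1 * rep (k + Suc l) (ys @ b # ys') s) \<in> invariants (k + Suc l)"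
        by (intro invariants_sum invariants_scale rep_invariants yby)
      fix t assume t: "t \<in> invariants (k + Suc l)"
      have "ip (k + Suc l) (\<lambda>s. \<Sum>b\<in>Y. 1 * rep (k + Suc l) (ys @ b # ys') s) t = (\<Sum>b\<in>Y. t (Inr (ys @ b # ys')))"
        unfolding ip_sum_left by (intro sum.cong refl) (simp only: ip_rep[OF yby t] complex_cnj_one mult_1)
      also have "\<dots> = con t (Inr (ys @ ys'))" using ys by (simp add: con_def length_tuples)
      also have "\<dots> = ip (k + Suc l) (ins (rep (k + l) (ys @ ys'))) t"
        by (simp only: adj ip_rep[OF yy con[OF t]])
      finally show "ip (k + Suc l) (\<lambda>s. \<Sum>b\<in>Y. 1 * rep (k + Suc l) (ys @ b # ys') s) t = ip (k + Suc l) (ins (rep (k + l) (ys @ ys'))) t" .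
    qed
    then show ?thesis using xs by (simp add: ins_def length_tuples)
  qed
  show "(\<Sum>a\<in>X. rep (k + Suc l) (ys @ b # ys') (Inl (xs @ a # xs'))) = rep (k + l) (ys @ ys') (Inl (xs @ xs'))" if b: "b \<in> Y"
  proof -
    have "con (rep (k + Suc l) (ys @ b # ys')) (Inl (xs @ xs')) = rep (k + l) (ys @ ys') (Inl (xs @ xs'))"
    proof (rule representer_unique[OF con[OF rep_invariants[OF yby[OF b]]] rep_invariants[OF yy] _ xx])
      fix t assume t: "t \<in> invariants (k + l)"
      have "ip (k + l) (con (rep (k + Suc l) (ys @ b # ys'))) t = ins t (Inr (ys @ b # ys'))"
        by (simp only: adj' [symmetric] ip_rep[OF yby[OF b] ins[OF t]])
      also have "\<dots> = ip (k + l) (rep (k + l) (ys @ ys')) t"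
        using ys by (simp add: ip_rep[OF yy t] ins_def length_tuples)
      finally show "ip (k + l) (con (rep (k + Suc l) (ys @ b # ys'))) t = ip (k + l) (rep (k + l) (ys @ ys')) t" .
    qed
    then show ?thesis using xs by (simp add: con_def length_tuples)
  qed
qed

text \<open>The distance mask is self-adjoint for \<open>ip\<close> and does not change the
  evaluation at the given \<open>Y\<close>-tuple, whose neighbouring points have exactly the masked
  distance. So it fixes the representer, and the masked value at the given \<open>X\<close>-tuple is
  0.\<close>

lemma rep_distance:
  assumes xs: "xs \<in> tuples X k" "xs' \<in> tuples X l" and ys: "ys \<in> tuples Y k" "ys' \<in> tuples Y l"
    and ab: "a \<in> X" "a' \<in> X" "b \<in> Y" "b' \<in> Y" and ne: "dX a a' \<noteq> dY b b'"
  shows "rep (k + Suc (Suc l)) (ys @ b # b' # ys') (Inl (xs @ a # a' # xs')) = 0"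
proof -
  let ?k = "k + Suc (Suc l)" and ?ys = "ys @ b # b' # ys'" and ?xs = "xs @ a # a' # xs'"
  define dia where "dia = (\<lambda>t :: 'a list + 'b list \<Rightarrow> complex. \<lambda>s.
     t s * of_bool (case_sum (\<lambda>xs. dX (xs ! k) (xs ! Suc k) = dY b b') (\<lambda>ys. dY (ys ! k) (ys ! Suc k) = dY b b') s))"
  have dia: "dia t \<in> invariants ?k" if "t \<in> invariants ?k" for t
    unfolding dia_def by (rule invariants_diagonal[OF that])
  have y: "?ys \<in> tuples Y ?k" and x: "?xs \<in> tuples X ?k" using xs ys ab by (auto simp: tuples_def)
  have "dia (rep ?k ?ys) (Inl ?xs) = rep ?k ?ys (Inl ?xs)"
  proof (rule representer_unique[OF dia[OF rep_invariants[OF y]] rep_invariants[OF y] _ x])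
    fix t assume t: "t \<in> invariants ?k"
    have "ip ?k (dia (rep ?k ?ys)) t = ip ?k (rep ?k ?ys) (dia t)"
      unfolding ip_def dia_def by (intro sum.cong refl) (auto simp: of_bool_def)
    also have "\<dots> = dia t (Inr ?ys)" by (rule ip_rep[OF y dia[OF t]])
    also have "\<dots> = t (Inr ?ys)" using ys by (simp add: dia_def tuples_def nth_append)
    also have "\<dots> = ip ?k (rep ?k ?ys) t" by (rule ip_rep[OF y t, symmetric])
    finally show "ip ?k (dia (rep ?k ?ys)) t = ip ?k (rep ?k ?ys) t" .
  qed
  moreover have "dia (rep ?k ?ys) (Inl ?xs) = 0"
    using xs ne by (simp add: dia_def tuples_def nth_append)
  ultimately show ?thesis by simp
qed

lemma map_word_tuples:
  assumes "set w \<subseteq> X \<times> Y"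
  shows "map fst w \<in> tuples X (length w)" "map snd w \<in> tuples Y (length w)"
  using assms by (auto simp: tuples_def)

lemma isom_fun_haar: "isom_fun haar"
  unfolding isometry_functional_def
proof (intro conjI allI impI ballI)
  fix w assume "haar w \<noteq> 0" then show "set w \<subseteq> X \<times> Y" by (auto simp: haar_def split: if_splits)
next
  fix u v :: "('a \<times> 'b) list" and x assume x: "x \<in> X"
  show "(\<Sum>y\<in>Y. haar (u @ (x, y) # v)) = haar (u @ v)"
  proof (cases "set u \<subseteq> X \<times> Y \<and> set v \<subseteq> X \<times> Y")
    case True
    then have u: "set u \<subseteq> X \<times> Y" and v: "set v \<subseteq> X \<times> Y" by auto
    show ?thesis
      using rep_contract(1)[OF map_word_tuples(1)[OF u] map_word_tuples(1)[OF v] map_word_tuples(2)[OF u] map_word_tuples(2)[OF v] x]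
      using True x by (simp add: haar_def)
  next
    case False
    then have "haar (u @ v) = 0" "haar (u @ (x, y) # v) = 0" for y
      unfolding haar_def by auto
    then show ?thesis by simp
  qed
next
  fix u v :: "('a \<times> 'b) list" and y assume y: "y \<in> Y"
  show "(\<Sum>x\<in>X. haar (u @ (x, y) # v)) = haar (u @ v)"
  proof (cases "set u \<subseteq> X \<times> Y \<and> set v \<subseteq> X \<times> Y")
    case True
    then have u: "set u \<subseteq> X \<times> Y" and v: "set v \<subseteq> X \<times> Y" by auto
    show ?thesis
      using rep_contract(2)[OF map_word_tuples(1)[OF u] map_word_tuples(1)[OF v] map_word_tuples(2)[OF u] map_word_tuples(2)[OF v] y]
      using True y by (simp add: haar_def)
  next
    case False
    then have "haar (u @ v) = 0" "haar (u @ (x, y) # v) = 0" for x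
      unfolding haar_def by auto
    then show ?thesis by simp
  qed
next
  fix u v :: "('a \<times> 'b) list" and x x' y y' assume ne: "dX x x' \<noteq> dY y y'"
  show "haar (u @ (x, y) # (x', y') # v) = 0"
  proof (cases "set (u @ (x, y) # (x', y') # v) \<subseteq> X \<times> Y")
    case True
    then have u: "set u \<subseteq> X \<times> Y" and v: "set v \<subseteq> X \<times> Y" by auto
    show ?thesis
      using rep_distance[OF map_word_tuples(1)[OF u] map_word_tuples(1)[OF v] map_word_tuples(2)[OF u] map_word_tuples(2)[OF v] _ _ _ _ ne]
      using True by (simp add: haar_def)
  next
    case False
    then show ?thesis unfolding haar_def by (rule if_not_P)
  qed
qed

lemma haar_Nil: "haar [] = 1"
proof -
  have one: "(\<lambda>s. 1) \<in> invariants 0" by (rule invariantsI) simp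
  have "cnj (rep 0 [] (Inl [])) = 1"
    using ip_rep[OF _ one, of "[]"] by (simp add: ip_def)
  from arg_cong[OF this, of cnj] show ?thesis by (simp add: haar_def)
qed

lemma haar_rotate: "haar (p # w) = haar (w @ [p])"
proof (cases "set (p # w) \<subseteq> X \<times> Y")
  case True
  define k where "k = length w"
  obtain a b where p: "p = (a, b)" "a \<in> X" "b \<in> Y" using True by (cases p) auto
  obtain xs ys where w: "xs \<in> tuples X k" "ys \<in> tuples Y k" "w = zip xs ys"
    using wordE[OF order_trans[OF set_subset_Cons True]] unfolding k_def by blast
  define rot where "rot = (\<lambda>t :: 'a list + 'b list \<Rightarrow> complex. \<lambda>s. t (map_sum rotate1 rotate1 s))"
  have rot: "rot t \<in> invariants (Suc k)" if "t \<in> invariants (Suc k)" for t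
    unfolding rot_def by (rule invariants_rotate[OF that])
  have y: "ys @ [b] \<in> tuples Y (Suc k)" "b # ys \<in> tuples Y (Suc k)" and x: "a # xs \<in> tuples X (Suc k)" "xs @ [a] \<in> tuples X (Suc k)"
    using w p by (auto simp: tuples_def)
  have "rot (rep (Suc k) (ys @ [b])) (Inl (a # xs)) = rep (Suc k) (b # ys) (Inl (a # xs))"
  proof (rule representer_unique[OF rot[OF rep_invariants[OF y(1)]] rep_invariants[OF y(2)] _ x(1)])
    fix t assume t: "t \<in> invariants (Suc k)"
    \<comment> \<open>Conjugating the rotation with the reversal in \<open>tensor_star\<close> gives
      the inverse rotation. So the adjoint of \<open>rot\<close> for \<open>ip\<close> preserves
      invariant tensors too.\<close>
    define r where "r = tensor_star (rot (tensor_star t))"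
    have r: "r \<in> invariants (Suc k)" unfolding r_def by (intro invariants_star rot t)
    have r_snoc: "r (Inl (zs @ [c])) = t (Inl (c # zs))" "r (Inr (ws @ [d])) = t (Inr (d # ws))" for zs c ws d
      by (simp_all add: r_def tensor_star_def rot_def)
    have "ip (Suc k) (rot (rep (Suc k) (ys @ [b]))) t =
       (\<Sum>c\<in>X. \<Sum>zs\<in>tuples X k. cnj (rep (Suc k) (ys @ [b]) (Inl (zs @ [c]))) * t (Inl (c # zs)))"
      by (simp add: ip_def sum_tuples_Suc rot_def)
    also have "\<dots> = ip (k + Suc 0) (rep (Suc k) (ys @ [b])) r"
      unfolding ip_def sum_tuples_insert by (simp add: r_snoc sum.swap[of _ X])
    also have "\<dots> = t (Inr (b # ys))" using ip_rep[OF y(1) r] by (simp add: r_snoc)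
    also have "\<dots> = ip (Suc k) (rep (Suc k) (b # ys)) t" by (rule ip_rep[OF y(2) t, symmetric])
    finally show "ip (Suc k) (rot (rep (Suc k) (ys @ [b]))) t = ip (Suc k) (rep (Suc k) (b # ys)) t" .
  qed
  then show ?thesis
    using haar_zip[OF x(1) y(2)] haar_zip[OF x(2) y(1)] w p by (simp add: rot_def tuples_def)
next
  case False
  then show ?thesis by (auto simp: haar_def)
qed

lemma haar_cyclic: "haar (u @ v) = haar (v @ u)"
proof (induction u arbitrary: v)
  case (Cons p u)
  have "haar ((p # u) @ v) = haar (u @ (v @ [p]))" using haar_rotate[of p "u @ v"] by simp
  also have "\<dots> = haar (v @ (p # u))" using Cons[of "v @ [p]"] by simp
  finally show ?case .
qed simp

text \<open>\<open>tensor_star\<close> is antiunitary for \<open>ip\<close> and exchanges evaluation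
  at \<open>ys\<close> with conjugated evaluation at \<open>rev ys\<close>; hence it maps the
  representer of the one to that of the other.\<close>

lemma haar_star: "haar (rev w) = cnj (haar w)"
proof (cases "set w \<subseteq> X \<times> Y")
  case True
  define k where "k = length w"
  obtain xs ys where w: "xs \<in> tuples X k" "ys \<in> tuples Y k" "w = zip xs ys"
    using wordE[OF True] unfolding k_def by blast
  have ry: "rev ys \<in> tuples Y k" using w by simp
  have "tensor_star (rep k (rev ys)) (Inl xs) = rep k ys (Inl xs)"
  proof (rule representer_unique[OF invariants_star[OF rep_invariants[OF ry]] rep_invariants[OF w(2)] _ w(1)])
    fix t assume t: "t \<in> invariants k"
    have "ip k (tensor_star (rep k (rev ys))) t =
       (\<Sum>xs\<in>tuples X k. cnj (cnj (rep k (rev ys) (Inl (rev xs))) * tensor_star t (Inl (rev xs))))"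
      by (simp add: ip_def tensor_star_def)
    also have "\<dots> = (\<Sum>xs\<in>tuples X k. cnj (cnj (rep k (rev ys) (Inl xs)) * tensor_star t (Inl xs)))"
      by (rule sum_tuples_rev)
    also have "\<dots> = cnj (ip k (rep k (rev ys)) (tensor_star t))" by (simp add: ip_def)
    also have "\<dots> = t (Inr ys)"
      by (simp only: ip_rep[OF ry invariants_star[OF t]]) (simp add: tensor_star_def)
    also have "\<dots> = ip k (rep k ys) t" by (rule ip_rep[OF w(2) t, symmetric])
    finally show "ip k (tensor_star (rep k (rev ys))) t = ip k (rep k ys) t" .
  qed
  moreover have "rev w = zip (rev xs) (rev ys)" using w by (simp add: zip_rev length_tuples)
  ultimately have "cnj (haar (rev w)) = haar w"
    using haar_zip[OF w(1,2)] haar_zip[of "rev xs" k "rev ys"] w by (simp add: tensor_star_def)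
  from arg_cong[OF this, of cnj] show ?thesis by simp
next
  case False
  then show ?thesis by (auto simp: haar_def)
qed

end

section \<open>Positivity of the Haar functional\<close>

context isometry_game begin

abbreviation gram :: "nat \<Rightarrow> 'a list \<times> 'b list \<Rightarrow> 'a list \<times> 'b list \<Rightarrow> complex" where
  "gram n i j \<equiv> haar (rev (zip (fst i) (snd i)) @ zip (fst j) (snd j))"

lemma gram_cnj: "cnj (gram n i j) = gram n j i"
  by (simp add: haar_star [symmetric])

lemma gram_rep:
  assumes "xs \<in> tuples X n" "ys \<in> tuples Y n" "xs' \<in> tuples X n" "ys' \<in> tuples Y n"
  shows "gram n (xs, ys) (xs', ys') = rep (n + n) (rev ys @ ys') (Inl (rev xs @ xs'))"
proof -
  have "rev (zip xs ys) @ zip xs' ys' = zip (rev xs @ xs') (rev ys @ ys')"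
    using assms by (simp add: zip_rev length_tuples)
  then show ?thesis using assms by (simp add: haar_zip tuples_append)
qed

text \<open>A Gram matrix in \<open>z\<close> and \<open>y\<close>: its vectors are the families of
  representers indexed by \<open>y'\<close>, which makes it positive. It is the factor that appears
  when the Gram matrix of the words of length \<open>n\<close> is squared.\<close>

definition middle :: "nat \<Rightarrow> 'b list \<Rightarrow> 'b list \<Rightarrow> complex" where
  "middle n z y = (\<Sum>y'\<in>tuples Y n. ip (n + n) (rep (n + n) (rev y' @ z)) (rep (n + n) (rev y' @ y)))"

lemma middle_cnj: "cnj (middle n z y) = middle n y z"
  by (simp add: middle_def ip_cnj)

text \<open>Composition on the right with \<open>t'\<close> has composition on the right with the
  conjugate of \<open>t'\<close> as its adjoint, the usual rule for the Hilbert-Schmidt inner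
  product of operators.\<close>

lemma ip_comp_adjoint:
  "ip (n + n) (tensor_comp n t t') t'' = ip (n + n) t (tensor_comp n t'' (tensor_star t'))"
proof -
  have "ip (n + n) (tensor_comp n t t') t'' =
    (\<Sum>a\<in>tuples X n. \<Sum>b\<in>tuples X n. \<Sum>e\<in>tuples X n. cnj (t (Inl (a @ e))) * cnj (t' (Inl (rev e @ b))) * t'' (Inl (a @ b)))"
    unfolding ip_def sum_tuples_add
    by (intro sum.cong refl) (simp add: tensor_comp_def length_tuples sum_distrib_right)
  also have "\<dots> = (\<Sum>a\<in>tuples X n. \<Sum>e\<in>tuples X n. \<Sum>b\<in>tuples X n. cnj (t (Inl (a @ e))) * cnj (t' (Inl (rev e @ b))) * t'' (Inl (a @ b)))"
    by (intro sum.cong refl sum.swap)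
  also have "\<dots> = ip (n + n) t (tensor_comp n t'' (tensor_star t'))"
    unfolding ip_def sum_tuples_add
    by (intro sum.cong refl) (simp add: tensor_comp_def tensor_star_def length_tuples sum_distrib_left algebra_simps)
  finally show ?thesis .
qed

text \<open>Summing over the \<open>X\<close>-part of \<open>j\<close> composes two representers,
  and the result is an invariant tensor. Tested against an invariant \<open>t\<close>, one factor
  moves across \<open>ip\<close> and the other one evaluates, so that the computation takes place
  over \<open>Y\<close>.\<close>

lemma gram_square_right:
  assumes "x \<in> tuples X n" "y \<in> tuples Y n" "x' \<in> tuples X n" "y' \<in> tuples Y n"
  shows "(\<Sum>j\<in>tuples X n \<times> tuples Y n. gram n (x, y) j * gram n j (x', y')) =
    (\<Sum>z\<in>tuples Y n. gram n (x, y) (x', z) * middle n z y')"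
proof -
  let ?Y = "tuples Y n" and ?r = "rep (n + n)"
  have r: "?r (rev a @ b) \<in> invariants (n + n)" if "a \<in> ?Y" "b \<in> ?Y" for a b
    using that by (intro rep_invariants tuples_append) auto
  have ipr: "ip (n + n) (?r (rev a @ b)) t = t (Inr (rev a @ b))" if "a \<in> ?Y" "b \<in> ?Y" "t \<in> invariants (n + n)" for a b t
    using that by (intro ip_rep tuples_append) auto
  have "(\<Sum>w\<in>?Y. 1 * tensor_comp n (?r (rev y @ w)) (?r (rev w @ y')) (Inl (rev x @ x'))) =
     (\<Sum>z\<in>?Y. middle n z y' * ?r (rev y @ z) (Inl (rev x @ x')))"
  proof (rule representer_unique)
    show "(\<lambda>s. \<Sum>w\<in>?Y. 1 * tensor_comp n (?r (rev y @ w)) (?r (rev w @ y')) s) \<in> invariants (n + n)"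
      by (intro invariants_sum invariants_scale invariants_comp r assms)
    show "(\<lambda>s. \<Sum>z\<in>?Y. middle n z y' * ?r (rev y @ z) s) \<in> invariants (n + n)"
      by (intro invariants_sum invariants_scale r assms)
    show "rev x @ x' \<in> tuples X (n + n)" using assms by (intro tuples_append) auto
    fix t assume t: "t \<in> invariants (n + n)"
    have "ip (n + n) (\<lambda>s. \<Sum>w\<in>?Y. 1 * tensor_comp n (?r (rev y @ w)) (?r (rev w @ y')) s) t =
      (\<Sum>w\<in>?Y. ip (n + n) (?r (rev y @ w)) (tensor_comp n t (tensor_star (?r (rev w @ y')))))"
      unfolding ip_sum_left by (simp add: ip_comp_adjoint)
    also have "\<dots> = (\<Sum>w\<in>?Y. tensor_comp n t (tensor_star (?r (rev w @ y'))) (Inr (rev y @ w)))"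
      by (intro sum.cong refl ipr invariants_comp invariants_star r t assms)
    also have "\<dots> = (\<Sum>w\<in>?Y. \<Sum>z\<in>?Y. t (Inr (rev y @ z)) * cnj (?r (rev w @ y') (Inr (rev w @ z))))"
      using assms by (intro sum.cong refl) (simp add: tensor_comp_def tensor_star_def length_tuples)
    \<comment> \<open>The value of a representer at a \<open>Y\<close>-tuple is again an inner
      product of two representers; summed over \<open>w\<close> these give \<open>middle\<close>, up
      to conjugation.\<close>
    also have "\<dots> = (\<Sum>w\<in>?Y. \<Sum>z\<in>?Y. t (Inr (rev y @ z)) * cnj (ip (n + n) (?r (rev w @ z)) (?r (rev w @ y'))))"
      by (intro sum.cong refl) (simp add: ipr r assms)
    also have "\<dots> = (\<Sum>z\<in>?Y. cnj (middle n z y') * t (Inr (rev y @ z)))"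
      by (subst sum.swap) (simp add: middle_def sum_distrib_left algebra_simps)
    also have "\<dots> = ip (n + n) (\<lambda>s. \<Sum>z\<in>?Y. middle n z y' * ?r (rev y @ z) s) t"
      unfolding ip_sum_left by (intro sum.cong refl) (simp add: ipr t assms)
    finally show "ip (n + n) (\<lambda>s. \<Sum>w\<in>?Y. 1 * tensor_comp n (?r (rev y @ w)) (?r (rev w @ y')) s) t =
      ip (n + n) (\<lambda>s. \<Sum>z\<in>?Y. middle n z y' * ?r (rev y @ z) s) t" .
  qed
  moreover have "(\<Sum>j\<in>tuples X n \<times> tuples Y n. gram n (x, y) j * gram n j (x', y')) =
     (\<Sum>w\<in>?Y. 1 * tensor_comp n (?r (rev y @ w)) (?r (rev w @ y')) (Inl (rev x @ x')))"
  proof -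
    have "(\<Sum>j\<in>tuples X n \<times> tuples Y n. gram n (x, y) j * gram n j (x', y')) =
      (\<Sum>e\<in>tuples X n. \<Sum>w\<in>?Y. ?r (rev y @ w) (Inl (rev x @ e)) * ?r (rev w @ y') (Inl (rev e @ x')))"
      unfolding sum.cartesian_product by (intro sum.cong refl) (auto simp: gram_rep assms simp del: fst_conv snd_conv)
    also have "\<dots> = (\<Sum>w\<in>?Y. \<Sum>e\<in>tuples X n. ?r (rev y @ w) (Inl (rev x @ e)) * ?r (rev w @ y') (Inl (rev e @ x')))"
      by (rule sum.swap)
    finally show ?thesis using assms by (simp add: tensor_comp_def length_tuples)
  qed
  moreover have "(\<Sum>z\<in>?Y. gram n (x, y) (x', z) * middle n z y') = (\<Sum>z\<in>?Y. middle n z y' * ?r (rev y @ z) (Inl (rev x @ x')))"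
    using assms by (intro sum.cong refl) (auto simp: gram_rep simp del: fst_conv snd_conv)
  ultimately show ?thesis by simp
qed

lemma gram_square_left:
  assumes "x \<in> tuples X n" "y \<in> tuples Y n" "i \<in> tuples X n \<times> tuples Y n"
  shows "(\<Sum>j\<in>tuples X n \<times> tuples Y n. gram n (x, y) j * gram n j i) =
    (\<Sum>z\<in>tuples Y n. middle n y z * gram n (x, z) i)"
proof -
  have "cnj (\<Sum>j\<in>tuples X n \<times> tuples Y n. gram n i j * gram n j (x, y)) =
     cnj (\<Sum>z\<in>tuples Y n. gram n i (x, z) * middle n z y)"
    using gram_square_right[of "fst i" n "snd i" x y] assms by (auto simp: mem_Times_iff)
  then show ?thesis
    by (simp only: cnj_sum complex_cnj_mult gram_cnj middle_cnj mult.commute)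
qed

lemma middle_positive:
  "0 \<le> Re (\<Sum>y\<in>tuples Y n. \<Sum>z\<in>tuples Y n. cnj (g y) * middle n y z * g z)"
proof -
  let ?Y = "tuples Y n" and ?r = "rep (n + n)"
  define h where "h = (\<lambda>w. \<lambda>s. \<Sum>z\<in>?Y. g z * ?r (rev w @ z) s)"
  have "(\<Sum>y\<in>?Y. \<Sum>z\<in>?Y. cnj (g y) * middle n y z * g z) =
     (\<Sum>y\<in>?Y. \<Sum>z\<in>?Y. \<Sum>w\<in>?Y. cnj (g y) * ip (n + n) (?r (rev w @ y)) (?r (rev w @ z)) * g z)"
    by (simp add: middle_def sum_distrib_left sum_distrib_right)
  also have "\<dots> = (\<Sum>y\<in>?Y. \<Sum>w\<in>?Y. \<Sum>z\<in>?Y. cnj (g y) * ip (n + n) (?r (rev w @ y)) (?r (rev w @ z)) * g z)"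
    by (intro sum.cong refl sum.swap)
  also have "\<dots> = (\<Sum>w\<in>?Y. \<Sum>y\<in>?Y. \<Sum>z\<in>?Y. cnj (g y) * ip (n + n) (?r (rev w @ y)) (?r (rev w @ z)) * g z)"
    by (rule sum.swap)
  also have "\<dots> = (\<Sum>w\<in>?Y. ip (n + n) (h w) (h w))"
  proof (intro sum.cong refl)
    fix w
    have "ip (n + n) (?r (rev w @ y)) (h w) = (\<Sum>z\<in>?Y. ip (n + n) (?r (rev w @ y)) (?r (rev w @ z)) * g z)" for y
      using arg_cong[OF ip_sum_left[of "n + n" g "\<lambda>z. ?r (rev w @ z)" ?Y "?r (rev w @ y)"], of cnj]
      by (simp add: h_def ip_cnj mult.commute)
    moreover have hw: "ip (n + n) (h w) t = (\<Sum>z\<in>?Y. cnj (g z) * ip (n + n) (?r (rev w @ z)) t)" for t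
      unfolding h_def by (rule ip_sum_left)
    ultimately show "(\<Sum>y\<in>?Y. \<Sum>z\<in>?Y. cnj (g y) * ip (n + n) (?r (rev w @ y)) (?r (rev w @ z)) * g z) = ip (n + n) (h w) (h w)"
      by (simp add: hw sum_distrib_left mult.assoc)
  qed
  also have "Re \<dots> \<ge> 0"
    unfolding Re_sum ip_def
    by (intro sum_nonneg) simp
  finally show ?thesis .
qed

text \<open>The Gram matrix \<open>S\<close> is self-adjoint with \<open>S\<^sup>2 = m S\<close> for a positive \<open>m\<close>, so that
  \<open>\<langle>d, S\<^sup>3 d\<rangle> = \<langle>S d, m S d\<rangle> \<ge> 0\<close>; and \<open>\<langle>c, S c\<rangle>\<close> depends only on the projection of \<open>c\<close> to the
  range of \<open>S\<close>.\<close>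

lemma gram_positive:
  fixes c :: "'a list \<times> 'b list \<Rightarrow> complex"
  shows "0 \<le> Re (\<Sum>i\<in>tuples X n \<times> tuples Y n. \<Sum>j\<in>tuples X n \<times> tuples Y n. cnj (c i) * gram n i j * c j)"
proof -
  let ?I = "tuples X n \<times> tuples Y n"
  define S where "S = (\<lambda>d i. \<Sum>j\<in>?I. gram n i j * d j)"
  define B where "B = (\<lambda>d d' :: 'a list \<times> 'b list \<Rightarrow> complex. \<Sum>i\<in>?I. cnj (d i) * d' i)"
  have adj: "B (S d) d' = B d (S d')" for d d'
  proof -
    have "B (S d) d' = (\<Sum>i\<in>?I. \<Sum>j\<in>?I. gram n j i * cnj (d j) * d' i)"
      by (simp only: B_def S_def cnj_sum complex_cnj_mult gram_cnj sum_distrib_right)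
    also have "\<dots> = (\<Sum>j\<in>?I. \<Sum>i\<in>?I. gram n j i * cnj (d j) * d' i)" by (rule sum.swap)
    finally show ?thesis by (simp add: B_def S_def sum_distrib_left algebra_simps)
  qed
  have Bcnj: "cnj (B d d') = B d' d" for d d' by (simp add: B_def mult.commute)
  \<comment> \<open>The projection of \<open>c\<close> to the range of the Gram matrix exists by
    Riesz; written as \<open>S d\<close> it supplies the vector \<open>d\<close> of the positivity
    argument.\<close>
  have "\<exists>p\<in>range S. \<forall>t\<in>range S. B c t = (\<Sum>s\<in>?I. cnj (p s) * t s)"
  proof (rule finite_riesz)
    fix t u assume "t \<in> range S" "u \<in> range S"
    then obtain d e where "t = S d" "u = S e" by auto
    then have "(\<lambda>s. t s + u s) = S (\<lambda>s. d s + e s)" by (simp add: S_def algebra_simps sum.distrib)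
    then show "(\<lambda>s. t s + u s) \<in> range S" by simp
  next
    fix t a assume "t \<in> range S"
    then obtain d where "t = S d" by auto
    then have "(\<lambda>s. a * t s) = S (\<lambda>s. a * d s)" by (simp add: S_def sum_distrib_left algebra_simps)
    then show "(\<lambda>s. a * t s) \<in> range S" by simp
  next
    have "(\<lambda>s. 0) = S (\<lambda>s. 0)" by (simp add: S_def)
    then show "(\<lambda>s. 0) \<in> range S" by (metis rangeI)
  next
    show "B c t = 0" if "\<forall>s\<in>?I. t s = 0" for t
      unfolding B_def using that by (intro sum.neutral) simp
  qed (auto simp: B_def sum.distrib sum_distrib_left algebra_simps)
  then obtain d where d: "\<And>e. B c (S e) = B (S d) (S e)" unfolding B_def by auto
  have "B c (S c) = B (S d) (S c)" by (rule d)
  also have "\<dots> = cnj (B c (S (S d)))" by (simp only: adj [symmetric] Bcnj)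
  also have "\<dots> = B (S (S d)) (S d)" by (simp only: d Bcnj)
  also have "\<dots> = B (S d) (S (S d))" by (rule adj)
  also have "\<dots> = (\<Sum>i\<in>?I. cnj (S d i) * (\<Sum>z\<in>tuples Y n. middle n (snd i) z * S d (fst i, z)))"
  proof -
    have "S (S d) (x, y) = (\<Sum>z\<in>tuples Y n. middle n y z * S d (x, z))" if xy: "x \<in> tuples X n" "y \<in> tuples Y n" for x y
    proof -
      have "S (S d) (x, y) = (\<Sum>j\<in>?I. \<Sum>i\<in>?I. gram n (x, y) j * gram n j i * d i)"
        by (simp add: S_def sum_distrib_left mult.assoc)
      also have "\<dots> = (\<Sum>i\<in>?I. (\<Sum>j\<in>?I. gram n (x, y) j * gram n j i) * d i)"
        by (subst sum.swap) (simp add: sum_distrib_right)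
      also have "\<dots> = (\<Sum>i\<in>?I. (\<Sum>z\<in>tuples Y n. middle n y z * gram n (x, z) i) * d i)"
        by (intro sum.cong refl arg_cong[where f = "\<lambda>z. z * _"] gram_square_left xy)
      also have "\<dots> = (\<Sum>z\<in>tuples Y n. middle n y z * S d (x, z))"
        unfolding sum_distrib_right S_def sum_distrib_left by (subst sum.swap) (simp add: mult.assoc)
      finally show ?thesis .
    qed
    then show ?thesis unfolding B_def by (intro sum.cong refl) auto
  qed
  \<comment> \<open>\<open>middle\<close> acts on the \<open>Y\<close>-coordinate only, so for each
    fixed \<open>x\<close> the inner double sum is an instance of
    \<open>middle_positive\<close>.\<close>
  also have "\<dots> = (\<Sum>x\<in>tuples X n. \<Sum>y\<in>tuples Y n. \<Sum>z\<in>tuples Y n. cnj (S d (x, y)) * middle n y z * S d (x, z))"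
    by (simp add: sum.cartesian_product' sum_distrib_left mult.assoc)
  also have "Re \<dots> \<ge> 0"
    unfolding Re_sum[of _ "tuples X n"] by (intro sum_nonneg middle_positive)
  finally show ?thesis
    by (simp add: B_def S_def sum_distrib_left mult.assoc)
qed

lemma functional_pad:
  assumes "isom_fun \<psi>" "m > 0 \<Longrightarrow> x \<in> X"
  shows "(\<Sum>ys\<in>tuples Y m. \<psi> (u @ zip (replicate m x) ys @ v)) = \<psi> (u @ v)"
  using assms(2)
proof (induction m arbitrary: u)
  case (Suc m)
  then have x: "x \<in> X" by simp
  have "(\<Sum>ys\<in>tuples Y (Suc m). \<psi> (u @ zip (replicate (Suc m) x) ys @ v)) =
     (\<Sum>b\<in>Y. \<Sum>ys\<in>tuples Y m. \<psi> ((u @ [(x, b)]) @ zip (replicate m x) ys @ v))"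
    by (simp add: sum_tuples_Suc)
  also have "\<dots> = (\<Sum>b\<in>Y. \<psi> (u @ (x, b) # v))"
    by (intro sum.cong refl) (subst Suc.IH, simp_all add: x)
  finally show ?case by (simp add: isometry_functionalD(2)[OF assms(1) x])
qed simp

text \<open>Words of different lengths are padded to a common length \<open>n\<close> by \<open>1 = \<Sum>y. e x y\<close>.\<close>

lemma haar_positive:
  fixes a :: "'i \<Rightarrow> complex" and w :: "'i \<Rightarrow> ('a \<times> 'b) list"
  assumes "finite J"
  shows "0 \<le> Re (\<Sum>k\<in>J. \<Sum>l\<in>J. cnj (a k) * a l * haar (rev (w k) @ w l))"
proof -
  \<comment> \<open>If \<open>X\<close> is empty there is no letter to pad with, but then the empty
    word is the only word over \<open>X \<times> Y\<close> and length 0 suffices. The 0 in the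
    maximum covers an empty \<open>J\<close>.\<close>
  define n where "n = (if X = {} then 0 else Max (insert 0 ((length \<circ> w) ` J)))"
  define x where "x = (SOME x. x \<in> X)"
  have x: "X \<noteq> {} \<Longrightarrow> x \<in> X" unfolding x_def by (rule someI_ex) blast
  define ok where "ok = (\<lambda>k. set (w k) \<subseteq> X \<times> Y)"
  have n: "length (w k) \<le> n" if "k \<in> J" "ok k" for k
    using that assms by (auto simp: n_def ok_def)
  have x': "x \<in> X" if "n - m > 0" for m
    using that x by (auto simp: n_def split: if_splits)
  let ?I = "tuples X n \<times> tuples Y n"
  define pad where "pad = (\<lambda>k. n - length (w k))"
  \<comment> \<open>The coefficient vector of the padded word: its \<open>X\<close>-part is fixed,
    its \<open>Y\<close>-part runs over all extensions. It is 0 for words with letters outside of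
    \<open>X \<times> Y\<close>, where \<open>haar\<close> vanishes as well.\<close>
  define e where "e = (\<lambda>k i. of_bool (ok k \<and> fst i = map fst (w k) @ replicate (pad k) x \<and> take (length (w k)) (snd i) = map snd (w k)) :: complex)"
  have e: "(\<Sum>i\<in>?I. e k i * F i) = of_bool (ok k) *
      (\<Sum>ys\<in>tuples Y (pad k). F (map fst (w k) @ replicate (pad k) x, map snd (w k) @ ys))" if k: "k \<in> J" for F k
  proof (cases "ok k")
    case True
    then have len: "length (w k) + pad k = n" using n[OF k] by (simp add: pad_def)
    let ?xs = "map fst (w k) @ replicate (pad k) x"
    have xs: "?xs \<in> tuples X n"
      using True x'[of "length (w k)"] len unfolding tuples_def ok_def pad_def by auto
    have "(\<Sum>i\<in>?I. e k i * F i) = (\<Sum>x'\<in>tuples X n. \<Sum>y\<in>tuples Y n. e k (x', y) * F (x', y))"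
      by (simp add: sum.cartesian_product)
    also have "\<dots> = (\<Sum>x'\<in>tuples X n. if x' = ?xs then \<Sum>y\<in>tuples Y n. of_bool (take (length (w k)) y = map snd (w k)) * F (?xs, y) else 0)"
      by (intro sum.cong refl) (auto simp: e_def True)
    also have "\<dots> = (\<Sum>y\<in>tuples Y (length (w k) + pad k). of_bool (take (length (w k)) y = map snd (w k)) * F (?xs, y))"
      using xs by (simp add: len)
    also have "\<dots> = (\<Sum>y\<in>tuples Y (length (w k)). if y = map snd (w k) then \<Sum>ys\<in>tuples Y (pad k). F (?xs, map snd (w k) @ ys) else 0)"
      unfolding sum_tuples_add by (intro sum.cong refl) (auto simp: length_tuples)
    also have "\<dots> = (\<Sum>ys\<in>tuples Y (pad k). F (?xs, map snd (w k) @ ys))"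
      using True map_word_tuples(2)[of "w k"] by (simp add: ok_def)
    finally show ?thesis using True by simp
  qed (simp add: e_def)
  have ee: "(\<Sum>i\<in>?I. \<Sum>j\<in>?I. e k i * e l j * gram n i j) = haar (rev (w k) @ w l)" if k: "k \<in> J" and l: "l \<in> J" for k l
  proof -
    have "(\<Sum>i\<in>?I. \<Sum>j\<in>?I. e k i * e l j * gram n i j) = (\<Sum>i\<in>?I. e k i * (\<Sum>j\<in>?I. e l j * gram n i j))"
      by (simp add: sum_distrib_left mult.assoc)
    also have "\<dots> = (\<Sum>i\<in>?I. e k i * (of_bool (ok l) * haar (rev (zip (fst i) (snd i)) @ w l)))"
    proof (intro sum.cong refl arg_cong[where f = "\<lambda>z. _ * z"])
      fix i
      show "(\<Sum>j\<in>?I. e l j * gram n i j) = of_bool (ok l) * haar (rev (zip (fst i) (snd i)) @ w l)"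
        using functional_pad[OF isom_fun_haar, of "pad l" x "rev (zip (fst i) (snd i)) @ w l" "[]"] x'[of "length (w l)"]
        by (subst e[OF l]) (simp add: zip_map_fst_snd pad_def)
    qed
    also have "\<dots> = of_bool (ok k) * (of_bool (ok l) * haar (rev (w k) @ w l))"
    proof -
      have rv: "rev (zip (replicate (pad k) x) ys) = zip (replicate (pad k) x) (rev ys)" if "ys \<in> tuples Y (pad k)" for ys
        using that by (simp add: zip_rev [symmetric] length_tuples)
      have "(\<Sum>ys\<in>tuples Y (pad k). haar (rev (zip (replicate (pad k) x) ys) @ rev (w k) @ w l)) =
         (\<Sum>ys\<in>tuples Y (pad k). haar (zip (replicate (pad k) x) (rev ys) @ rev (w k) @ w l))"
        by (intro sum.cong refl) (simp add: rv)
      also have "\<dots> = (\<Sum>ys\<in>tuples Y (pad k). haar (zip (replicate (pad k) x) ys @ rev (w k) @ w l))"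
        by (rule sum_tuples_rev)
      also have "\<dots> = haar (rev (w k) @ w l)"
        using functional_pad[OF isom_fun_haar, of "pad k" x "[]" "rev (w k) @ w l"] x'[of "length (w k)"]
        by (simp add: pad_def)
      finally show ?thesis
        by (subst e[OF k]) (simp add: zip_map_fst_snd sum_distrib_left [symmetric])
    qed
    also have "\<dots> = haar (rev (w k) @ w l)" by (auto simp: ok_def haar_def)
    finally show ?thesis .
  qed
  define c where "c = (\<lambda>i. \<Sum>k\<in>J. a k * e k i)"
  have ce: "cnj (e k i) = e k i" for k i by (simp add: e_def)
  have "(\<Sum>i\<in>?I. \<Sum>j\<in>?I. cnj (c i) * gram n i j * c j) =
     (\<Sum>i\<in>?I. \<Sum>j\<in>?I. \<Sum>k\<in>J. \<Sum>l\<in>J. cnj (a k) * a l * (e k i * e l j * gram n i j))"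
    by (intro sum.cong refl)
       (simp add: c_def ce sum_distrib_left sum_distrib_right algebra_simps)
  also have "\<dots> = (\<Sum>k\<in>J. \<Sum>l\<in>J. \<Sum>i\<in>?I. \<Sum>j\<in>?I. cnj (a k) * a l * (e k i * e l j * gram n i j))"
  proof -
    have sw: "(\<Sum>i\<in>A. \<Sum>j\<in>A. \<Sum>k\<in>J. \<Sum>l\<in>J. f i j k l) = (\<Sum>k\<in>J. \<Sum>l\<in>J. \<Sum>i\<in>A. \<Sum>j\<in>A. f i j k l)"
      for A :: "('a list \<times> 'b list) set" and f :: "_ \<Rightarrow> _ \<Rightarrow> _ \<Rightarrow> _ \<Rightarrow> complex"
    proof -
      have "(\<Sum>i\<in>A. \<Sum>j\<in>A. \<Sum>k\<in>J. \<Sum>l\<in>J. f i j k l) = (\<Sum>i\<in>A. \<Sum>k\<in>J. \<Sum>j\<in>A. \<Sum>l\<in>J. f i j k l)"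
        by (intro sum.cong refl sum.swap)
      also have "\<dots> = (\<Sum>k\<in>J. \<Sum>i\<in>A. \<Sum>j\<in>A. \<Sum>l\<in>J. f i j k l)"
        by (rule sum.swap)
      also have "\<dots> = (\<Sum>k\<in>J. \<Sum>i\<in>A. \<Sum>l\<in>J. \<Sum>j\<in>A. f i j k l)"
        by (intro sum.cong refl sum.swap)
      also have "\<dots> = (\<Sum>k\<in>J. \<Sum>l\<in>J. \<Sum>i\<in>A. \<Sum>j\<in>A. f i j k l)"
        by (intro sum.cong refl sum.swap)
      finally show ?thesis .
    qed
    show ?thesis by (rule sw)
  qed
  also have "\<dots> = (\<Sum>k\<in>J. \<Sum>l\<in>J. cnj (a k) * a l * haar (rev (w k) @ w l))"
    by (intro sum.cong refl) (simp only: sum_distrib_left [symmetric] ee)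
  finally show ?thesis using gram_positive[where n = n and c = c] by simp
qed

end

section \<open>The game algebra and functionals on words\<close>

text \<open>The linear extension to the free algebra of a function \<open>g\<close> on words.
  Arbitrary \<open>g\<close> separate the elements (\<open>ev_eqI\<close>), and
  \<open>ev_conv\<close> turns a product into an iterated evaluation, so identities such as
  associativity reduce to identities of concatenated words.\<close>

definition ev :: "('w \<Rightarrow> complex) \<Rightarrow> ('w \<Rightarrow> complex) \<Rightarrow> complex" where
  "ev f g = (\<Sum>w | f w \<noteq> 0. f w * g w)"

lemma ev_superset: "finite S \<Longrightarrow> {w. f w \<noteq> 0} \<subseteq> S \<Longrightarrow> ev f g = (\<Sum>w\<in>S. f w * g w)"
  unfolding ev_def by (rule sum.mono_neutral_left) auto

lemma ev_add:
  assumes "finite {w. f w \<noteq> 0}" "finite {w. h w \<noteq> 0}"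
  shows "ev (\<lambda>w. f w + h w) g = ev f g + ev h g"
proof -
  let ?S = "{w. f w \<noteq> 0} \<union> {w. h w \<noteq> 0}"
  have "ev (\<lambda>w. f w + h w) g = (\<Sum>w\<in>?S. (f w + h w) * g w)" "ev f g = (\<Sum>w\<in>?S. f w * g w)" "ev h g = (\<Sum>w\<in>?S. h w * g w)"
    by (intro ev_superset; use assms in auto)+
  then show ?thesis by (simp add: distrib_right sum.distrib)
qed

lemma ev_scale: "ev (\<lambda>w. c * f w) g = c * ev f g"
  by (cases "c = 0") (simp_all add: ev_def sum_distrib_left mult.assoc)

lemma ev_diff:
  assumes "finite {w. f w \<noteq> 0}" "finite {w. h w \<noteq> 0}"
  shows "ev (\<lambda>w. f w - h w) g = ev f g - ev h g"
  using ev_add[of f "\<lambda>w. (-1) * h w" g] assms ev_scale[of "-1" h g] by simp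

lemma ev_delta: "ev (\<lambda>w. if w = v then 1 else 0) g = g v"
proof -
  have "{w. (if w = v then 1 else 0 :: complex) \<noteq> 0} = {v}" by auto
  then show ?thesis by (simp add: ev_def)
qed

lemma ev_point: "ev f (\<lambda>w. if w = v then 1 else 0) = f v" if "finite {w. f w \<noteq> 0}"
proof -
  have "ev f (\<lambda>w. if w = v then 1 else 0) = (\<Sum>w | f w \<noteq> 0. if w = v then f v else 0)"
    unfolding ev_def by (intro sum.cong) auto
  then show ?thesis using that by simp
qed

lemma ev_eqI:
  assumes "finite {w. f w \<noteq> 0}" "finite {w. h w \<noteq> 0}" "\<And>g. ev f g = ev h g"
  shows "f = h"
  using assms(3)[of "\<lambda>w. if w = _ then 1 else 0"] by (intro ext) (metis ev_point assms(1,2))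

definition conv :: "('l list \<Rightarrow> complex) \<Rightarrow> ('l list \<Rightarrow> complex) \<Rightarrow> 'l list \<Rightarrow> complex" where
  "conv f g w = (\<Sum>k\<le>length w. f (take k w) * g (drop k w))"

lemma conv_support: "{w. conv f g w \<noteq> 0} \<subseteq> (\<lambda>(u, v). u @ v) ` ({w. f w \<noteq> 0} \<times> {w. g w \<noteq> 0})"
proof
  fix w assume "w \<in> {w. conv f g w \<noteq> 0}"
  then obtain k where "f (take k w) * g (drop k w) \<noteq> 0"
    unfolding conv_def by (auto elim: sum.not_neutral_contains_not_neutral)
  then show "w \<in> (\<lambda>(u, v). u @ v) ` ({w. f w \<noteq> 0} \<times> {w. g w \<noteq> 0})"
    by (intro image_eqI[of _ _ "(take k w, drop k w)"]) auto
qed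

text \<open>A word with a cut point is the same as a pair of words; so the convolution sum over cut
  points becomes the double sum over the two factors.\<close>

lemma ev_conv:
  assumes f: "finite {w. f w \<noteq> 0}" and g: "finite {w. g w \<noteq> 0}"
  shows "ev (conv f g) h = ev f (\<lambda>u. ev g (\<lambda>v. h (u @ v)))"
proof -
  define S where "S = (\<lambda>(u, v). u @ v) ` ({w. f w \<noteq> 0} \<times> {w. g w \<noteq> 0})"
  have S: "finite S" using f g by (simp add: S_def)
  have "ev (conv f g) h = (\<Sum>w\<in>S. \<Sum>k\<le>length w. f (take k w) * g (drop k w) * h (take k w @ drop k w))"
    using ev_superset[OF S, of "conv f g"] conv_support[of f g]
    by (simp add: S_def conv_def sum_distrib_right)
  also have "\<dots> = (\<Sum>(w, k)\<in>(SIGMA w:S. {..length w}). f (take k w) * g (drop k w) * h (take k w @ drop k w))"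
    using S by (simp add: sum.Sigma)
  also have "\<dots> = (\<Sum>(u, v)\<in>{(u, v). u @ v \<in> S}. f u * g v * h (u @ v))"
    by (rule sum.reindex_bij_witness[of _ "\<lambda>(u, v). (u @ v, length u)" "\<lambda>(w, k). (take k w, drop k w)"]) auto
  also have "\<dots> = (\<Sum>(u, v)\<in>{w. f w \<noteq> 0} \<times> {w. g w \<noteq> 0}. f u * g v * h (u @ v))"
  proof (rule sum.mono_neutral_right)
    have "{(u, v). u @ v \<in> S} \<subseteq> (\<lambda>(w, k). (take k w, drop k w)) ` (SIGMA w:S. {..length w})"
    proof
      fix p assume "p \<in> {(u, v). u @ v \<in> S}"
      then obtain u v where "p = (u, v)" "u @ v \<in> S" by blast
      then show "p \<in> (\<lambda>(w, k). (take k w, drop k w)) ` (SIGMA w:S. {..length w})"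
        by (intro image_eqI[of _ _ "(u @ v, length u)"]) auto
    qed
    then show "finite {(u, v). u @ v \<in> S}" by (rule finite_subset) (use S in auto)
  qed (auto simp: S_def)
  also have "\<dots> = ev f (\<lambda>u. ev g (\<lambda>v. h (u @ v)))"
    by (simp add: ev_def sum.cartesian_product sum_distrib_left mult.assoc)
  finally show ?thesis .
qed

lemma conv_finite: "finite {w. f w \<noteq> 0} \<Longrightarrow> finite {w. g w \<noteq> 0} \<Longrightarrow> finite {w. conv f g w \<noteq> 0}"
  using finite_subset[OF conv_support] by blast

section \<open>The free star-algebra as a ring, its star and its ideals\<close>

context
  fixes G :: "'g set"
begin

abbreviation "free \<equiv> free_star_algebra G"

lemma free_carrier: "f \<in> carrier free \<longleftrightarrow> finite {w. f w \<noteq> 0} \<and> (\<forall>w. f w \<noteq> 0 \<longrightarrow> fst ` set w \<subseteq> G)"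
  by (simp add: free_star_algebra_def)

lemma free_simps:
  "mult free = conv" "one free = (\<lambda>w. if w = [] then 1 else 0)" "zero free = (\<lambda>w. 0)" "add free = (\<lambda>f g w. f w + g w)"
  "smult free = (\<lambda>c f w. c * f w)" "star free = (\<lambda>f w. cnj (f (rev (map (apsnd Not) w))))"
  by (auto simp: free_star_algebra_def conv_def fun_eq_iff)

lemma free_finite: "f \<in> carrier free \<Longrightarrow> finite {w. f w \<noteq> 0}"
  by (simp add: free_carrier)

lemma free_eqI: "f \<in> carrier free \<Longrightarrow> h \<in> carrier free \<Longrightarrow> (\<And>g. ev f g = ev h g) \<Longrightarrow> f = h"
  by (rule ev_eqI) (simp_all add: free_finite)

lemma free_add_closed: "f \<in> carrier free \<Longrightarrow> g \<in> carrier free \<Longrightarrow> (\<lambda>w. f w + g w) \<in> carrier free"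
proof -
  assume f: "f \<in> carrier free" and g: "g \<in> carrier free"
  have "{w. f w + g w \<noteq> 0} \<subseteq> {w. f w \<noteq> 0} \<union> {w. g w \<noteq> 0}" by auto
  then have "finite {w. f w + g w \<noteq> 0}" by (rule finite_subset) (use f g free_finite in auto)
  moreover have "fst ` set w \<subseteq> G" if "f w + g w \<noteq> 0" for w
  proof (cases "f w = 0")
    case True
    then have "g w \<noteq> 0" using that by simp
    then show ?thesis using g unfolding free_carrier by blast
  next
    case False
    then show ?thesis using f unfolding free_carrier by blast
  qed
  ultimately show ?thesis by (simp add: free_carrier)
qed

lemma free_smult_closed: "f \<in> carrier free \<Longrightarrow> (\<lambda>w. c * f w) \<in> carrier free"
  unfolding free_carrier by (auto intro: finite_subset[of _ "{w. f w \<noteq> 0}"])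

lemma free_conv_closed: "f \<in> carrier free \<Longrightarrow> g \<in> carrier free \<Longrightarrow> conv f g \<in> carrier free"
proof -
  assume f: "f \<in> carrier free" and g: "g \<in> carrier free"
  have "fst ` set w \<subseteq> G" if w: "conv f g w \<noteq> 0" for w
  proof -
    obtain u v where "w = u @ v" "f u \<noteq> 0" "g v \<noteq> 0" using conv_support[of f g] w by auto
    moreover from this have "fst ` set u \<subseteq> G" "fst ` set v \<subseteq> G" using f g unfolding free_carrier by blast+
    ultimately show ?thesis by (simp add: image_Un)
  qed
  then show ?thesis using conv_finite[OF free_finite[OF f] free_finite[OF g]] by (simp add: free_carrier)
qed

lemma free_delta_closed: "fst ` set v \<subseteq> G \<Longrightarrow> (\<lambda>w. if w = v then 1 else 0) \<in> carrier free"
  unfolding free_carrier by (auto intro: finite_subset[of _ "{v}"])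

lemma free_zero_closed: "(\<lambda>w. 0) \<in> carrier free"
  by (simp add: free_carrier)

lemma free_ring: "Ring.ring free"
proof (rule ringI)
  note cl = free_add_closed free_conv_closed free_delta_closed free_zero_closed
  show "abelian_group free"
  proof (rule abelian_groupI)
    show "\<exists>g\<in>carrier free. g \<oplus>\<^bsub>free\<^esub> f = \<zero>\<^bsub>free\<^esub>" if "f \<in> carrier free" for f
      using free_smult_closed[OF that, of "-1"] by (intro bexI[of _ "\<lambda>w. - 1 * f w"]) (simp_all add: free_simps)
  qed (auto simp: free_simps cl algebra_simps)
  show "Group.monoid free"
  proof (rule monoidI)
    show "f \<otimes>\<^bsub>free\<^esub> g \<otimes>\<^bsub>free\<^esub> h = f \<otimes>\<^bsub>free\<^esub> (g \<otimes>\<^bsub>free\<^esub> h)" if "f \<in> carrier free" "g \<in> carrier free" "h \<in> carrier free" for f g h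
      using that by (intro free_eqI) (simp_all add: free_simps cl ev_conv free_finite)
    have one: "(\<lambda>w :: ('g \<times> bool) list. if w = [] then 1 else 0 :: complex) \<in> carrier free" by (intro cl) simp
    show "\<one>\<^bsub>free\<^esub> \<otimes>\<^bsub>free\<^esub> f = f" "f \<otimes>\<^bsub>free\<^esub> \<one>\<^bsub>free\<^esub> = f" if "f \<in> carrier free" for f
      using that one by (auto intro!: free_eqI simp: free_simps cl ev_conv free_finite ev_delta)
  qed (auto simp: free_simps cl)
  show "(f \<oplus>\<^bsub>free\<^esub> g) \<otimes>\<^bsub>free\<^esub> h = f \<otimes>\<^bsub>free\<^esub> h \<oplus>\<^bsub>free\<^esub> g \<otimes>\<^bsub>free\<^esub> h" for f g h
    by (simp add: free_simps conv_def fun_eq_iff distrib_right sum.distrib)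
  show "h \<otimes>\<^bsub>free\<^esub> (f \<oplus>\<^bsub>free\<^esub> g) = h \<otimes>\<^bsub>free\<^esub> f \<oplus>\<^bsub>free\<^esub> h \<otimes>\<^bsub>free\<^esub> g" for f g h
    by (simp add: free_simps conv_def fun_eq_iff distrib_left sum.distrib)
qed

lemma free_uminus: "g \<in> carrier free \<Longrightarrow> \<ominus>\<^bsub>free\<^esub> g = (\<lambda>w. - g w)"
proof -
  interpret Ring.ring free by (rule free_ring)
  assume g: "g \<in> carrier free"
  have n: "(\<lambda>w. - 1 * g w) \<in> carrier free" by (rule free_smult_closed[OF g])
  have "\<ominus>\<^bsub>free\<^esub> g = (\<lambda>w. - 1 * g w)"
    by (rule minus_equality) (use g n in \<open>simp_all add: free_simps\<close>)
  then show ?thesis by simp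
qed

lemma free_minus: "f \<in> carrier free \<Longrightarrow> g \<in> carrier free \<Longrightarrow> f \<ominus>\<^bsub>free\<^esub> g = (\<lambda>w. f w - g w)"
  by (simp add: a_minus_def free_uminus free_simps)

lemma free_finsum:
  assumes "finite I" "\<And>i. i \<in> I \<Longrightarrow> f i \<in> carrier free"
  shows "(\<Oplus>\<^bsub>free\<^esub>i\<in>I. f i) = (\<lambda>w. \<Sum>i\<in>I. f i w)"
proof -
  interpret Ring.ring free by (rule free_ring)
  show ?thesis using assms
    by (induction rule: finite_induct) (auto simp: free_simps Pi_def)
qed

lemma free_star_closed: "f \<in> carrier free \<Longrightarrow> star free f \<in> carrier free"
proof -
  let ?r = "\<lambda>w :: ('g \<times> bool) list. rev (map (apsnd Not) w)"
  have rr: "?r (?r w) = w" for w by (simp add: rev_map [symmetric] comp_def) (simp add: apsnd_def map_prod_def case_prod_unfold)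
  have fs: "fst ` set (?r w) = fst ` set w" for w by (force simp: image_iff)
  assume f: "f \<in> carrier free"
  have "{w. star free f w \<noteq> 0} \<subseteq> ?r ` {w. f w \<noteq> 0}"
  proof
    fix w assume "w \<in> {w. star free f w \<noteq> 0}"
    then show "w \<in> ?r ` {w. f w \<noteq> 0}"
      by (intro image_eqI[of _ _ "?r w"]) (simp_all only: rr free_simps mem_Collect_eq complex_cnj_zero_iff not_False_eq_True)
  qed
  then have "finite {w. star free f w \<noteq> 0}" using free_finite[OF f] by (meson finite_imageI finite_subset)
  moreover have "fst ` set w \<subseteq> G" if "star free f w \<noteq> 0" for w
  proof -
    have "f (?r w) \<noteq> 0" using that by (simp add: free_simps)
    with f have "fst ` set (?r w) \<subseteq> G" unfolding free_carrier by blast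
    then show ?thesis by (simp only: fs)
  qed
  ultimately show ?thesis by (simp add: free_carrier)
qed

lemma ev_star: "ev (star free f) g = cnj (ev f (\<lambda>w. cnj (g (rev (map (apsnd Not) w)))))"
proof -
  let ?r = "\<lambda>w :: ('g \<times> bool) list. rev (map (apsnd Not) w)"
  have rr: "?r (?r w) = w" for w by (simp add: rev_map [symmetric] comp_def) (simp add: apsnd_def map_prod_def case_prod_unfold)
  have "ev (star free f) g = (\<Sum>w | f (?r w) \<noteq> 0. cnj (f (?r w)) * g w)"
    by (simp add: ev_def free_simps)
  also have "\<dots> = (\<Sum>w | f w \<noteq> 0. cnj (f w) * g (?r w))"
    by (rule sum.reindex_bij_witness[of _ ?r ?r]) (simp_all only: rr mem_Collect_eq not_False_eq_True)
  finally show ?thesis by (simp add: ev_def)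
qed

lemma ideal_star_genideal:
  assumes "S \<subseteq> carrier free"
  shows "ideal (star_genideal free S) free" "star free ` star_genideal free S \<subseteq> star_genideal free S" "S \<subseteq> star_genideal free S"
proof -
  interpret Ring.ring free by (rule free_ring)
  let ?X = "{I. ideal I free \<and> star free ` I \<subseteq> I \<and> S \<subseteq> I}"
  have "carrier free \<in> ?X" using oneideal free_star_closed assms by auto
  then have "?X \<noteq> {}" by blast
  then show "ideal (star_genideal free S) free" unfolding star_genideal_def by (rule i_Intersect[rotated]) auto
qed (auto simp: star_genideal_def)

lemma star_quotient_nonzero_iff:
  assumes "ideal I free"
  shows "carrier (star_quotient free I) \<noteq> {\<zero>\<^bsub>star_quotient free I\<^esub>} \<longleftrightarrow> \<one>\<^bsub>free\<^esub> \<notin> I"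
proof -
  interpret ideal I free by (rule assms)
  have c: "carrier (star_quotient free I) = a_rcosets\<^bsub>free\<^esub> I" "\<zero>\<^bsub>star_quotient free I\<^esub> = I"
    by (simp_all add: star_quotient_def FactRing_def)
  show ?thesis
  proof
    assume *: "carrier (star_quotient free I) \<noteq> {\<zero>\<^bsub>star_quotient free I\<^esub>}"
    show "\<one>\<^bsub>free\<^esub> \<notin> I"
    proof
      assume "\<one>\<^bsub>free\<^esub> \<in> I"
      then have "I = carrier free" by (rule one_imp_carrier)
      then have "a_rcosets\<^bsub>free\<^esub> I = {I}"
        using a_coset_join2[OF _ a_subgroup] zero_closed by (auto simp: A_RCOSETS_def')
      then show False using * c by simp
    qed
  next
    assume *: "\<one>\<^bsub>free\<^esub> \<notin> I"
    have "I +>\<^bsub>free\<^esub> \<one>\<^bsub>free\<^esub> \<in> a_rcosets\<^bsub>free\<^esub> I" by (rule a_rcosetsI) (use a_subset in auto)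
    moreover have "\<one>\<^bsub>free\<^esub> \<in> I +>\<^bsub>free\<^esub> \<one>\<^bsub>free\<^esub>" by (rule a_rcos_self) auto
    ultimately show "carrier (star_quotient free I) \<noteq> {\<zero>\<^bsub>star_quotient free I\<^esub>}" using * unfolding c by blast
  qed
qed

end

lemma ev_swap: "ev f (\<lambda>u. ev g (\<lambda>v. h u v)) = ev g (\<lambda>v. ev f (\<lambda>u. h u v))"
  unfolding ev_def sum_distrib_left by (subst sum.swap) (simp add: algebra_simps)

lemma ev_zero [simp]: "ev f (\<lambda>w. 0) = 0"
  by (simp add: ev_def)

lemma ev_sum:
  assumes "finite I" "\<And>i. i \<in> I \<Longrightarrow> finite {w. f i w \<noteq> 0}"
  shows "ev (\<lambda>w. \<Sum>i\<in>I. f i w) g = (\<Sum>i\<in>I. ev (f i) g)"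
proof -
  let ?S = "\<Union>i\<in>I. {w. f i w \<noteq> 0}"
  have S: "finite ?S" using assms by auto
  have "{w. (\<Sum>i\<in>I. f i w) \<noteq> 0} \<subseteq> ?S"
    by (auto elim: sum.not_neutral_contains_not_neutral)
  then have "ev (\<lambda>w. \<Sum>i\<in>I. f i w) g = (\<Sum>w\<in>?S. (\<Sum>i\<in>I. f i w) * g w)"
    by (rule ev_superset[OF S])
  also have "\<dots> = (\<Sum>i\<in>I. \<Sum>w\<in>?S. f i w * g w)"
    unfolding sum_distrib_right by (rule sum.swap)
  also have "\<dots> = (\<Sum>i\<in>I. ev (f i) g)"
    by (intro sum.cong refl ev_superset[symmetric] S) auto
  finally show ?thesis .
qed

section \<open>Transfer of functionals on words to the game algebra\<close>

definition delta :: "'w \<Rightarrow> 'w \<Rightarrow> complex" where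
  "delta v = (\<lambda>w. if w = v then 1 else 0)"

lemma delta_finite [simp]: "finite {w. delta v w \<noteq> 0}"
  by (rule finite_subset[of _ "{v}"]) (auto simp: delta_def)

lemma ev_delta' [simp]: "ev (delta v) g = g v"
  unfolding delta_def by (rule ev_delta)

lemma conv_delta: "conv (delta u) (delta v) = delta (u @ v)"
  by (rule ev_eqI) (simp_all add: conv_finite ev_conv)

lemma free_gen_delta: "free_gen p = delta [(p, False)]"
  by (simp add: free_gen_def delta_def)

lemma free_delta: "fst ` set v \<subseteq> G \<Longrightarrow> delta v \<in> carrier (free_star_algebra G)"
  unfolding delta_def by (rule free_delta_closed)

lemma star_free_gen: "star (free_star_algebra G) (free_gen p) = delta [(p, True)]"
proof (rule ext)
  fix w :: "('a \<times> bool) list"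
  have "rev (map (apsnd Not) w) = [(p, False)] \<longleftrightarrow> w = [(p, True)]"
    by (cases w rule: rev_cases) (auto simp: apsnd_def map_prod_def split: prod.splits)
  then show "star (free_star_algebra G) (free_gen p) w = delta [(p, True)] w"
    by (simp add: free_simps free_gen_def delta_def)
qed

text \<open>The generators from \<open>x\<close> to \<open>y\<close> and from \<open>y\<close> to
  \<open>x\<close>, starred or not, all stand for the entry \<open>(x, y)\<close>: generators are
  self-adjoint, and the last rule of the game forces the two directions to coincide.\<close>

fun letter :: "(('a + 'b) \<times> ('a + 'b)) \<times> bool \<Rightarrow> 'a \<times> 'b" where
  "letter ((Inl x, Inr y), b) = (x, y)"
| "letter ((Inr y, Inl x), b) = (x, y)"
| "letter _ = undefined"

definition mixed :: "(('a + 'b) \<times> ('a + 'b)) \<times> bool \<Rightarrow> bool" where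
  "mixed l \<longleftrightarrow> isl (fst (fst l)) \<noteq> isl (snd (fst l))"

text \<open>A generator whose question and answer lie in the same space loses against every partner
  and has to be sent to 0. The test \<open>mixed\<close> also keeps \<open>letter\<close> away from
  its undefined case.\<close>

definition lift_functional :: "(('a \<times> 'b) list \<Rightarrow> complex) \<Rightarrow> ((('a + 'b) \<times> ('a + 'b)) \<times> bool) list \<Rightarrow> complex" where
  "lift_functional \<psi> w = (if \<forall>l\<in>set w. mixed l then \<psi> (map letter w) else 0)"

lemma lift_append_left:
  "(\<lambda>v. lift_functional \<psi> (u @ v)) = (if \<forall>l\<in>set u. mixed l then lift_functional (\<lambda>w. \<psi> (map letter u @ w @ [])) else (\<lambda>w. 0))"
  by (auto simp: lift_functional_def fun_eq_iff)

lemma lift_append_right: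
  "(\<lambda>u. lift_functional \<psi> (u @ v)) = (if \<forall>l\<in>set v. mixed l then lift_functional (\<lambda>w. \<psi> ([] @ w @ map letter v)) else (\<lambda>w. 0))"
  by (auto simp: lift_functional_def fun_eq_iff)

lemma letter_Not [simp]: "letter (apsnd Not l) = letter l" "mixed (apsnd Not l) = mixed l"
  by (cases l rule: letter.cases; simp add: mixed_def)+

lemma lift_star: "cnj (lift_functional \<psi> (rev (map (apsnd Not) w))) = lift_functional (\<lambda>w. cnj (\<psi> (rev w))) w"
  by (simp add: lift_functional_def rev_map comp_def)

context finite_spaces begin

abbreviation "free_isom \<equiv> free_star_algebra ((X <+> Y) \<times> (X <+> Y))"
abbreviation "isom_relations \<equiv> game_relations (X <+> Y) (X <+> Y) (isom_rule dX dY)"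

lemma isom_relations_cases:
  assumes "r \<in> isom_relations"
  obtains v a where "v \<in> X <+> Y" "a \<in> X <+> Y" "r = (\<lambda>w. delta [((v, a), False)] w - delta [((v, a), True)] w)"
  | v a where "v \<in> X <+> Y" "a \<in> X <+> Y" "r = (\<lambda>w. delta [((v, a), False)] w - delta [((v, a), False), ((v, a), False)] w)"
  | v where "v \<in> X <+> Y" "r = (\<lambda>w. (\<Sum>a\<in>X <+> Y. delta [((v, a), False)] w) - delta [] w)"
  | v a v' b where "v \<in> X <+> Y" "a \<in> X <+> Y" "v' \<in> X <+> Y" "b \<in> X <+> Y" "\<not> isom_rule dX dY v v' a b"
      "r = delta [((v, a), False), ((v', b), False)]"
proof -
  interpret Ring.ring free_isom by (rule free_ring)
  have d: "delta [((v, a), c)] \<in> carrier free_isom" "delta [((v, a), c), ((v, a), c)] \<in> carrier free_isom"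
    if "v \<in> X <+> Y" "a \<in> X <+> Y" for v a c
    using that by (auto intro!: free_delta)
  have one: "\<one>\<^bsub>free_isom\<^esub> = delta []" by (simp add: free_simps delta_def)
  have sum: "(\<Oplus>\<^bsub>free_isom\<^esub>a\<in>X <+> Y. delta [((v, a), False)]) = (\<lambda>w. \<Sum>a\<in>X <+> Y. delta [((v, a), False)] w)"
    if "v \<in> X <+> Y" for v
    using that d by (intro free_finsum) auto
  have sumc: "(\<lambda>w. \<Sum>a\<in>X <+> Y. delta [((v, a), False)] w) \<in> carrier free_isom" if "v \<in> X <+> Y" for v
    unfolding sum[OF that, symmetric] by (intro finsum_closed) (use d that in auto)
  consider v a where "v \<in> X <+> Y" "a \<in> X <+> Y" "r = free_gen (v, a) \<ominus>\<^bsub>free_isom\<^esub> star free_isom (free_gen (v, a))"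
    | v a where "v \<in> X <+> Y" "a \<in> X <+> Y" "r = free_gen (v, a) \<ominus>\<^bsub>free_isom\<^esub> free_gen (v, a) \<otimes>\<^bsub>free_isom\<^esub> free_gen (v, a)"
    | v where "v \<in> X <+> Y" "r = (\<Oplus>\<^bsub>free_isom\<^esub>a\<in>X <+> Y. free_gen (v, a)) \<ominus>\<^bsub>free_isom\<^esub> \<one>\<^bsub>free_isom\<^esub>"
    | v a v' b where "v \<in> X <+> Y" "a \<in> X <+> Y" "v' \<in> X <+> Y" "b \<in> X <+> Y" "\<not> isom_rule dX dY v v' a b"
      "r = free_gen (v, a) \<otimes>\<^bsub>free_isom\<^esub> free_gen (v', b)"
    using assms unfolding game_relations_def Let_def by blast
  then show thesis
  proof cases
    case 1
    then show ?thesis using that(1) d unfolding free_gen_delta star_free_gen[unfolded free_gen_delta] by (simp add: free_minus)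
  next
    case 2
    then show ?thesis using that(2) d unfolding free_gen_delta free_simps(1) by (simp add: free_minus conv_delta)
  next
    case 3
    have "delta [] \<in> carrier free_isom" by (rule free_delta) simp
    then show ?thesis using 3 that(3) unfolding free_gen_delta one sum[OF 3(1)] by (simp add: free_minus[OF sumc])
  next
    case 4
    then show ?thesis using that(4) unfolding free_gen_delta free_simps(1) by (simp add: conv_delta)
  qed
qed

lemma isom_relations_carrier: "isom_relations \<subseteq> carrier free_isom"
proof
  interpret Ring.ring free_isom by (rule free_ring)
  have gen: "free_gen (v, a) \<in> carrier free_isom" if "v \<in> X <+> Y" "a \<in> X <+> Y" for v a
    unfolding free_gen_delta by (rule free_delta) (use that in simp)
  fix r assume "r \<in> isom_relations"
  then show "r \<in> carrier free_isom"
    unfolding game_relations_def Let_def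
    by (elim UnE CollectE exE conjE; simp only:)
      (intro minus_closed m_closed finsum_closed Pi_I free_star_closed gen one_closed; assumption)+
qed

text \<open>The sum relation at a question in \<open>X\<close> is a row relation and at a question
  in \<open>Y\<close> a column relation. Among the losing answers, one from the wrong space gives an
  unmixed generator, questions from the same space give a violated distance, and questions from
  different spaces violate orthogonality.\<close>

lemma lift_relations:
  assumes \<psi>: "isom_fun \<psi>" and r: "r \<in> isom_relations"
  shows "ev r (lift_functional \<psi>) = 0"
  using r
proof (cases rule: isom_relations_cases)
  case (1 v a)
  then show ?thesis by (simp add: ev_diff lift_functional_def mixed_def)
     (cases v; cases a; simp)
next
  case (2 v a)
  then show ?thesis using functional_idem[OF \<psi>, of _ _ "[]" "[]"]
    by (cases v; cases a) (auto simp: ev_diff lift_functional_def mixed_def)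
next
  case (3 v)
  have "ev r (lift_functional \<psi>) = (\<Sum>a\<in>X <+> Y. lift_functional \<psi> [((v, a), False)]) - \<psi> []"
  proof -
    have "{w. (\<Sum>a\<in>X <+> Y. delta [((v, a), False)] w) \<noteq> 0} \<subseteq> (\<Union>a\<in>X <+> Y. {w. delta [((v, a), False)] w \<noteq> 0})"
      by (auto elim: sum.not_neutral_contains_not_neutral)
    then have "finite {w. (\<Sum>a\<in>X <+> Y. delta [((v, a), False)] w) \<noteq> 0}" by (rule finite_subset) auto
    then show ?thesis unfolding 3(2) by (simp add: ev_diff ev_sum lift_functional_def)
  qed
  also have "\<dots> = 0"
    using 3(1) isometry_functionalD(2)[OF \<psi>, of _ "[]" "[]"] isometry_functionalD(3)[OF \<psi>, of _ "[]" "[]"]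
    by (auto simp: sum.Plus lift_functional_def mixed_def)
  finally show ?thesis .
next
  case (4 v a v' b)
  then show ?thesis
    using isometry_functionalD(4)[OF \<psi>, of _ _ _ _ "[]" "[]"] functional_orth[OF \<psi>, of _ _ _ _ "[]" "[]"] symX symY
    by (cases v; cases a; cases v'; cases b) (auto simp: lift_functional_def mixed_def isom_rule_def)
qed

text \<open>The ideal is enlarged to the common kernel \<open>J\<close> of the lifts of all
  functionals, since the kernel of a single one need not be an ideal. Closure under products comes
  from stability of functionals under contexts, closure under the star from stability under
  reversal, and \<psi>0 keeps 1 out of \<open>J\<close>.\<close>

lemma functional_imp_algebraic:
  assumes \<psi>0: "isom_fun \<psi>0" "\<psi>0 [] = 1"
  shows "algebraically_isometric X dX Y dY"
proof -
  interpret F: Ring.ring free_isom by (rule free_ring)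
  define J where "J = {f \<in> carrier free_isom. \<forall>\<psi>. isom_fun \<psi> \<longrightarrow> ev f (lift_functional \<psi>) = 0}"
  have "ideal J free_isom"
  proof (rule idealI)
    show "Ring.ring free_isom" by (rule free_ring)
    show "subgroup J (add_monoid free_isom)"
    proof (rule subgroup.intro)
      show "x \<otimes>\<^bsub>add_monoid free_isom\<^esub> y \<in> J" if "x \<in> J" "y \<in> J" for x y
      proof -
        have xy: "x \<in> carrier free_isom" "y \<in> carrier free_isom" using that by (auto simp: J_def)
        then show ?thesis
          using that ev_add[OF free_finite[OF xy(1)] free_finite[OF xy(2)]]
          by (simp add: J_def free_simps free_add_closed)
      qed
      show "inv\<^bsub>add_monoid free_isom\<^esub> x \<in> J" if x: "x \<in> J" for x
      proof -
        have xc: "x \<in> carrier free_isom" using x by (simp add: J_def)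
        have "ev (\<lambda>w. - x w) h = - ev x h" for h using ev_scale[of "-1" x h] by simp
        then show ?thesis
          using x free_smult_closed[OF xc, of "-1"]
          by (simp add: a_inv_def[symmetric] free_uminus[OF xc] J_def)
      qed
      show "\<one>\<^bsub>add_monoid free_isom\<^esub> \<in> J"
        by (simp add: J_def free_simps free_zero_closed ev_def)
    qed (auto simp: J_def)
  next
    fix f a assume f: "f \<in> J" and a: "a \<in> carrier free_isom"
    have fc: "f \<in> carrier free_isom" using f by (simp add: J_def)
    have f0: "ev f (lift_functional \<psi>) = 0" if "isom_fun \<psi>" for \<psi> using f that by (simp add: J_def)
    show "a \<otimes>\<^bsub>free_isom\<^esub> f \<in> J"
    proof -
      have "ev (conv a f) (lift_functional \<psi>) = 0" if \<psi>: "isom_fun \<psi>" for \<psi>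
      proof -
        have "ev f (\<lambda>v. lift_functional \<psi> (u @ v)) = 0" for u
          unfolding lift_append_left using f0[OF isometry_functional_shift[OF \<psi>, of "map letter u" "[]"]] by simp
        then show ?thesis by (simp add: ev_conv free_finite[OF a] free_finite[OF fc])
      qed
      then show ?thesis using F.m_closed[OF a fc] by (simp add: J_def free_simps)
    qed
    show "f \<otimes>\<^bsub>free_isom\<^esub> a \<in> J"
    proof -
      have "ev (conv f a) (lift_functional \<psi>) = 0" if \<psi>: "isom_fun \<psi>" for \<psi>
      proof -
        have "ev f (\<lambda>u. lift_functional \<psi> (u @ v)) = 0" for v
          unfolding lift_append_right using f0[OF isometry_functional_shift[OF \<psi>, of "[]" "map letter v"]] by simp
        then show ?thesis unfolding ev_conv[OF free_finite[OF fc] free_finite[OF a]] by (subst ev_swap) simp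
      qed
      then show ?thesis using F.m_closed[OF fc a] by (simp add: J_def free_simps)
    qed
  qed
  moreover have "star free_isom ` J \<subseteq> J"
  proof
    fix g assume "g \<in> star free_isom ` J"
    then obtain f where f: "f \<in> J" "g = star free_isom f" by auto
    have "ev g (lift_functional \<psi>) = 0" if "isom_fun \<psi>" for \<psi>
      using f(1) isometry_functional_star[OF that symX symY] unfolding f(2) ev_star lift_star by (simp add: J_def)
    then show "g \<in> J" using f free_star_closed[of f] by (auto simp: J_def)
  qed
  moreover have "isom_relations \<subseteq> J"
    using isom_relations_carrier lift_relations by (auto simp: J_def)
  ultimately have "star_genideal free_isom isom_relations \<subseteq> J"
    unfolding star_genideal_def by blast
  moreover have "\<one>\<^bsub>free_isom\<^esub> \<notin> J"
  proof
    assume "\<one>\<^bsub>free_isom\<^esub> \<in> J"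
    then have "ev (delta []) (lift_functional \<psi>0) = 0" using \<psi>0 by (auto simp: J_def free_simps delta_def)
    then show False using \<psi>0 by (simp add: lift_functional_def)
  qed
  ultimately have "\<one>\<^bsub>free_isom\<^esub> \<notin> star_genideal free_isom isom_relations" by blast
  then show ?thesis
    unfolding algebraically_isometric_def isom_algebra_def game_algebra_def Let_def
    using star_quotient_nonzero_iff[OF ideal_star_genideal(1)[OF isom_relations_carrier]] by simp
qed

end

section \<open>A linear functional that separates the unit from the ideal\<close>

lemma vector_space_scale_fun: "vector_space (\<lambda>c (f :: 'w \<Rightarrow> complex) w. c * f w)"
  by (rule vector_space.intro) (simp_all add: fun_eq_iff distrib_left distrib_right)

lemma vector_space_complex_mult: "vector_space ((*) :: complex \<Rightarrow> complex \<Rightarrow> complex)"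
  by (rule vector_space.intro) (simp_all add: distrib_left distrib_right)

context finite_spaces begin

text \<open>The ideal is a subspace without 1, so extension of a basis yields a linear functional
  that kills it and is 1 at the unit. Its values on words in the generators from \<open>X\<close> to
  \<open>Y\<close> are the required functional; the column relations for these come from the
  generators in the opposite direction, which are shown to have the same values.\<close>

lemma algebraic_imp_functional:
  assumes "algebraically_isometric X dX Y dY"
  shows "\<exists>\<psi>. isom_fun \<psi> \<and> \<psi> [] = 1"
proof -
  interpret Ring.ring free_isom by (rule free_ring)
  define I where "I = star_genideal free_isom isom_relations"
  have idI: "ideal I free_isom" and rel: "isom_relations \<subseteq> I"
    unfolding I_def using ideal_star_genideal[OF isom_relations_carrier] by blast+
  interpret I: ideal I free_isom by (rule idI)
  have one: "\<one>\<^bsub>free_isom\<^esub> = delta []" by (simp add: free_simps delta_def)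
  have n1: "delta [] \<notin> I"
    using assms star_quotient_nonzero_iff[OF idI]
    unfolding algebraically_isometric_def isom_algebra_def game_algebra_def Let_def I_def one by simp
  have Ic: "f \<in> carrier free_isom" if "f \<in> I" for f using that I.a_subset by blast
  let ?s = "\<lambda>c (f :: ((('a + 'b) \<times> ('a + 'b)) \<times> bool) list \<Rightarrow> complex) w. c * f w"
  interpret vs: vector_space ?s
    by (rule vector_space_scale_fun)
  interpret vp: vector_space_pair ?s "(*) :: complex \<Rightarrow> complex \<Rightarrow> complex"
    by (intro vector_space_pair.intro vector_space_scale_fun) (rule vector_space_complex_mult)
  have sub: "vs.subspace I"
  proof (rule vs.subspaceI)
    show "0 \<in> I" using I.zero_closed by (simp add: free_simps zero_fun_def)
    show "f + g \<in> I" if "f \<in> I" "g \<in> I" for f g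
      using I.a_closed[OF that] by (simp add: free_simps plus_fun_def)
    show "?s c f \<in> I" if f: "f \<in> I" for c f
    proof -
      have d: "delta [] \<in> carrier free_isom" by (rule free_delta) simp
      have cd: "?s c (delta []) \<in> carrier free_isom" by (rule free_smult_closed[OF d])
      have "conv (?s c (delta [])) f = ?s c (conv (delta []) f)"
        by (simp add: conv_def fun_eq_iff sum_distrib_left mult.assoc)
      moreover have "conv (delta []) f = f"
        using l_one[OF Ic[OF f]] by (simp only: one) (simp add: free_simps)
      ultimately have "?s c f = ?s c (delta []) \<otimes>\<^bsub>free_isom\<^esub> f" by (simp add: free_simps)
      then show ?thesis using I.I_l_closed[OF f cd] by simp
    qed
  qed
  obtain B where B: "B \<subseteq> I" "vs.independent B" "I \<subseteq> vs.span B"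
    using vs.maximal_independent_subset by blast
  have spB: "vs.span B = I" using B sub vs.span_minimal[OF B(1) sub] by blast
  \<comment> \<open>The unit lies outside of the span of \<open>B\<close>, so it can be adjoined to
    this basis of the ideal and the values of \<open>g\<close> can be prescribed.\<close>
  have ind: "vs.independent (insert (delta []) B)"
    using B(2) n1 spB by (simp add: vs.independent_insert)
  obtain g where g: "Vector_Spaces.linear ?s (*) g" "\<forall>x\<in>insert (delta []) B. g x = (if x = delta [] then 1 else 0)"
    using vp.linear_independent_extend[OF ind, of "\<lambda>x. if x = delta [] then 1 else 0"] by blast
  interpret g: Vector_Spaces.linear ?s "(*) :: complex \<Rightarrow> complex \<Rightarrow> complex" g by (rule g(1))
  have g1: "g (delta []) = 1" using g(2) by simp
  have gI: "g f = 0" if "f \<in> I" for f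
  proof (rule vp.linear_eq_0_on_span[OF g(1), of B])
    show "g b = 0" if "b \<in> B" for b using that g(2) B(1) n1 by auto
    show "f \<in> vs.span B" using that spB by simp
  qed
  have g_diff: "g (\<lambda>w. f w - h w) = g f - g h" for f h
    using g.diff[of f h] by (simp add: fun_diff_def)
  have g_sum: "g (\<lambda>w. \<Sum>i\<in>S. f i w) = (\<Sum>i\<in>S. g (f i))" for S :: "('a + 'b) set" and f
  proof -
    have "sum f S w = (\<Sum>i\<in>S. f i w)" for w
      by (induction S rule: infinite_finite_induct) (simp_all add: zero_fun_def plus_fun_def)
    then have "sum f S = (\<lambda>w. \<Sum>i\<in>S. f i w)" by (rule ext)
    then show ?thesis using g.sum[of f S] by simp
  qed
  define \<Psi> where "\<Psi> = (\<lambda>w. g (delta w))"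
  define V where "V = X <+> Y"
  define W where "W = {w :: ((('a + 'b) \<times> ('a + 'b)) \<times> bool) list. fst ` set w \<subseteq> V \<times> V}"
  have sand: "g (conv (delta u) (conv r (delta v))) = 0" if "r \<in> isom_relations" "u \<in> W" "v \<in> W" for r u v
  proof -
    have "r \<in> I" using that rel by blast
    moreover have "delta u \<in> carrier free_isom" "delta v \<in> carrier free_isom"
      using that(2,3) by (auto simp: W_def V_def intro!: free_delta)
    ultimately have "delta u \<otimes>\<^bsub>free_isom\<^esub> (r \<otimes>\<^bsub>free_isom\<^esub> delta v) \<in> I" by (intro I.I_l_closed I.I_r_closed)
    then show ?thesis using gI by (simp add: free_simps)
  qed
  have conv_diff: "conv (delta u) (conv (\<lambda>w. f w - h w) (delta v)) = (\<lambda>w. conv (delta u) (conv f (delta v)) w - conv (delta u) (conv h (delta v)) w)"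
    for u v and f h :: "((('a + 'b) \<times> ('a + 'b)) \<times> bool) list \<Rightarrow> complex"
    by (simp add: conv_def fun_eq_iff algebra_simps sum_subtractf)
  have conv_sum: "conv (delta u) (conv (\<lambda>w. \<Sum>i\<in>S. f i w) (delta v)) = (\<lambda>w. \<Sum>i\<in>S. conv (delta u) (conv (f i) (delta v)) w)"
    for u v and f :: "_ \<Rightarrow> ((('a + 'b) \<times> ('a + 'b)) \<times> bool) list \<Rightarrow> complex" and S :: "('a + 'b) set"
  proof (rule ext)
    fix w
    have "conv (\<lambda>w. \<Sum>i\<in>S. f i w) (delta v) = (\<lambda>w. \<Sum>i\<in>S. conv (f i) (delta v) w)"
      by (rule ext, unfold conv_def sum_distrib_right, rule sum.swap)
    then show "conv (delta u) (conv (\<lambda>w. \<Sum>i\<in>S. f i w) (delta v)) w = (\<Sum>i\<in>S. conv (delta u) (conv (f i) (delta v)) w)"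
      by (simp add: conv_def[of "delta u"] sum_distrib_left) (rule sum.swap)
  qed
  have mem: "free_gen (v, a) \<otimes>\<^bsub>free_isom\<^esub> free_gen (v', b) \<in> isom_relations"
    if "v \<in> V" "a \<in> V" "v' \<in> V" "b \<in> V" "\<not> isom_rule dX dY v v' a b" for v a v' b
    unfolding game_relations_def Let_def using that unfolding V_def by blast
  have mem1: "(\<Oplus>\<^bsub>free_isom\<^esub>a\<in>X <+> Y. free_gen (v, a)) \<ominus>\<^bsub>free_isom\<^esub> \<one>\<^bsub>free_isom\<^esub> \<in> isom_relations" if "v \<in> V" for v
    unfolding game_relations_def Let_def using that unfolding V_def by blast
  have orth: "\<Psi> (u @ ((v, a), False) # ((v', b), False) # w) = 0"
    if "v \<in> V" "a \<in> V" "v' \<in> V" "b \<in> V" "\<not> isom_rule dX dY v v' a b" "u \<in> W" "w \<in> W" for v a v' b u w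
    using sand[OF mem[OF that(1-5)] that(6,7)] by (simp add: free_simps free_gen_delta conv_delta \<Psi>_def)
  have sum1: "(\<Sum>a\<in>V. \<Psi> (u @ ((v, a), False) # w)) = \<Psi> (u @ w)" if "v \<in> V" "u \<in> W" "w \<in> W" for v u w
  proof -
    have gen: "delta [((v, a), False)] \<in> carrier free_isom" if "a \<in> X <+> Y" for a
      by (rule free_delta) (use that \<open>v \<in> V\<close> in \<open>simp add: V_def\<close>)
    have fs: "(\<Oplus>\<^bsub>free_isom\<^esub>a\<in>X <+> Y. delta [((v, a), False)]) = (\<lambda>w. \<Sum>a\<in>X <+> Y. delta [((v, a), False)] w)"
      by (rule free_finsum) (use gen in auto)
    have sc: "(\<lambda>w. \<Sum>a\<in>X <+> Y. delta [((v, a), False)] w) \<in> carrier free_isom"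
      unfolding fs[symmetric] by (rule finsum_closed) (use gen in blast)
    have d: "delta [] \<in> carrier free_isom" by (rule free_delta) simp
    show ?thesis
      using sand[OF mem1[OF that(1)] that(2,3)]
      unfolding free_gen_delta fs one free_minus[OF sc d] conv_diff conv_sum g_diff g_sum conv_delta
      by (simp add: \<Psi>_def V_def)
  qed
  have W_app: "u @ l # w \<in> W \<longleftrightarrow> u \<in> W \<and> fst l \<in> V \<times> V \<and> w \<in> W" "u @ w \<in> W \<longleftrightarrow> u \<in> W \<and> w \<in> W" "[] \<in> W"
    "l # w \<in> W \<longleftrightarrow> fst l \<in> V \<times> V \<and> w \<in> W" for u l w
    by (auto simp: W_def)
  have finV: "finite V" by (simp add: V_def)
  \<comment> \<open>Multiplying by 1 as the sum over all answers \<open>b\<close> to the same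
    question leaves only losing products.\<close>
  have same: "\<Psi> (u @ ((v, a), False) # w) = 0" if "v \<in> V" "a \<in> V" "isl v = isl a" "u \<in> W" "w \<in> W" for v a u w
  proof -
    have "\<Psi> (u @ ((v, a), False) # w) = (\<Sum>b\<in>V. \<Psi> (u @ ((v, a), False) # ((v, b), False) # w))"
      using sum1[of v "u @ [((v, a), False)]" w] that by (simp add: W_app)
    also have "\<dots> = 0" by (intro sum.neutral ballI orth) (use that in \<open>auto simp: isom_rule_def\<close>)
    finally show ?thesis .
  qed
  \<comment> \<open>The last rule gives \<open>e x y = e x y * e y x = e y x\<close>: on either side
    1 is inserted as a sum over answers, only one of which is compatible with the other
    factor.\<close>
  have flip: "\<Psi> (u @ ((Inl x, Inr y), False) # w) = \<Psi> (u @ ((Inr y, Inl x), False) # w)"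
    if "x \<in> X" "y \<in> Y" "u \<in> W" "w \<in> W" for x y u w
  proof -
    have xy: "Inl x \<in> V" "Inr y \<in> V" using that by (auto simp: V_def)
    let ?m = "\<Psi> (u @ ((Inl x, Inr y), False) # ((Inr y, Inl x), False) # w)"
    have "\<Psi> (u @ ((Inl x, Inr y), False) # w) = (\<Sum>a\<in>V. \<Psi> (u @ ((Inl x, Inr y), False) # ((Inr y, a), False) # w))"
      using sum1[of "Inr y" "u @ [((Inl x, Inr y), False)]" w] that xy by (simp add: W_app)
    also have "\<dots> = (\<Sum>a\<in>V. if a = Inl x then ?m else 0)"
      by (intro sum.cong refl) (use xy that in \<open>auto intro!: orth simp: isom_rule_def\<close>)
    also have "\<dots> = ?m" using xy finV by simp
    also have "\<dots> = (\<Sum>a\<in>V. if a = Inr y then ?m else 0)" using xy finV by simp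
    also have "\<dots> = (\<Sum>a\<in>V. \<Psi> (u @ ((Inl x, a), False) # ((Inr y, Inl x), False) # w))"
      by (intro sum.cong refl) (use xy that in \<open>auto intro!: orth simp: isom_rule_def\<close>)
    also have "\<dots> = \<Psi> (u @ ((Inr y, Inl x), False) # w)"
      using sum1[of "Inl x" u "((Inr y, Inl x), False) # w"] that xy by (simp add: W_app)
    finally show ?thesis .
  qed
  define enc where "enc = map (\<lambda>(x, y). ((Inl x :: 'a + 'b, Inr y :: 'a + 'b), False))"
  have encW: "enc w \<in> W" if "set w \<subseteq> X \<times> Y" for w
    using that by (auto simp: enc_def W_def V_def)
  have enc_app: "enc (u @ v) = enc u @ enc v" "enc ((x, y) # v) = ((Inl x, Inr y), False) # enc v" "enc [] = []" for u v x y
    by (simp_all add: enc_def)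
  define \<psi> where "\<psi> = (\<lambda>w. if set w \<subseteq> X \<times> Y then \<Psi> (enc w) else 0)"
  have "isom_fun \<psi>"
    unfolding isometry_functional_def
  proof (intro conjI allI impI ballI)
    fix w assume "\<psi> w \<noteq> 0" then show "set w \<subseteq> X \<times> Y" by (auto simp: \<psi>_def split: if_splits)
  next
    fix u v :: "('a \<times> 'b) list" and x assume x: "x \<in> X"
    show "(\<Sum>y\<in>Y. \<psi> (u @ (x, y) # v)) = \<psi> (u @ v)"
    proof (cases "set u \<subseteq> X \<times> Y \<and> set v \<subseteq> X \<times> Y")
      case True
      then have uv: "enc u \<in> W" "enc v \<in> W" using encW by auto
      have "\<Psi> (enc u @ enc v) = (\<Sum>a\<in>V. \<Psi> (enc u @ ((Inl x, a), False) # enc v))"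
        using sum1[of "Inl x", OF _ uv] x by (simp add: V_def InlI)
      also have "\<dots> = (\<Sum>x'\<in>X. \<Psi> (enc u @ ((Inl x, Inl x'), False) # enc v)) + (\<Sum>y\<in>Y. \<Psi> (enc u @ ((Inl x, Inr y), False) # enc v))"
        by (simp add: V_def sum.Plus)
      also have "(\<Sum>x'\<in>X. \<Psi> (enc u @ ((Inl x, Inl x'), False) # enc v)) = 0"
        by (intro sum.neutral ballI same uv) (use x in \<open>auto simp: V_def\<close>)
      finally show ?thesis using True x by (simp add: \<psi>_def enc_app)
    next
      case False
      then have "\<psi> (u @ v) = 0" "\<psi> (u @ (x, y) # v) = 0" for y by (auto simp: \<psi>_def)
      then show ?thesis by (simp only: sum.neutral_const)
    qed
  next
    fix u v :: "('a \<times> 'b) list" and y assume y: "y \<in> Y"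
    show "(\<Sum>x\<in>X. \<psi> (u @ (x, y) # v)) = \<psi> (u @ v)"
    proof (cases "set u \<subseteq> X \<times> Y \<and> set v \<subseteq> X \<times> Y")
      case True
      then have uv: "enc u \<in> W" "enc v \<in> W" using encW by auto
      have "\<Psi> (enc u @ enc v) = (\<Sum>a\<in>V. \<Psi> (enc u @ ((Inr y, a), False) # enc v))"
        using sum1[of "Inr y", OF _ uv] y by (simp add: V_def InrI)
      also have "\<dots> = (\<Sum>x\<in>X. \<Psi> (enc u @ ((Inr y, Inl x), False) # enc v)) + (\<Sum>y'\<in>Y. \<Psi> (enc u @ ((Inr y, Inr y'), False) # enc v))"
        by (simp add: V_def sum.Plus)
      also have "(\<Sum>y'\<in>Y. \<Psi> (enc u @ ((Inr y, Inr y'), False) # enc v)) = 0"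
        by (intro sum.neutral ballI same uv) (use y in \<open>auto simp: V_def\<close>)
      also have "(\<Sum>x\<in>X. \<Psi> (enc u @ ((Inr y, Inl x), False) # enc v)) = (\<Sum>x\<in>X. \<Psi> (enc u @ ((Inl x, Inr y), False) # enc v))"
        by (intro sum.cong refl flip[symmetric] y uv)
      finally show ?thesis using True y by (simp add: \<psi>_def enc_app)
    next
      case False
      then have "\<psi> (u @ v) = 0" "\<psi> (u @ (x, y) # v) = 0" for x by (auto simp: \<psi>_def)
      then show ?thesis by (simp only: sum.neutral_const)
    qed
  next
    fix u v :: "('a \<times> 'b) list" and x x' y y' assume ne: "dX x x' \<noteq> dY y y'"
    show "\<psi> (u @ (x, y) # (x', y') # v) = 0"
    proof (cases "set (u @ (x, y) # (x', y') # v) \<subseteq> X \<times> Y")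
      case True
      then show ?thesis
        using orth[of "Inl x" "Inr y" "Inl x'" "Inr y'" "enc u" "enc v"] ne encW[of u] encW[of v]
        by (simp add: \<psi>_def enc_app V_def isom_rule_def InlI InrI)
    next
      case False
      then show ?thesis unfolding \<psi>_def by (rule if_not_P)
    qed
  qed
  moreover have "\<psi> [] = 1" using g1 by (simp add: \<psi>_def \<Psi>_def enc_app)
  ultimately show ?thesis by blast
qed

end

section \<open>Hilbert spaces and faithful representations\<close>

lemma cring_complex_ring: "cring complex_ring"
proof (rule cringI)
  show "abelian_group complex_ring"
    by (rule abelian_groupI) (auto simp: complex_ring_def intro: exI[of _ "- _"])
  show "Group.comm_monoid complex_ring"
    by (rule comm_monoidI) (auto simp: complex_ring_def)
qed (auto simp: complex_ring_def algebra_simps)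

lemma complex_ring_simps [simp]:
  "carrier complex_ring = UNIV" "mult complex_ring = (*)" "one complex_ring = 1"
  "zero complex_ring = 0" "add complex_ring = (+)"
  by (simp_all add: complex_ring_def)

text \<open>The discriminant argument with a complex parameter. It is tested at
  \<open>t = - r * cnj z\<close> for real \<open>r\<close>: the minimum is at
  \<open>r = 1 / q\<close> if \<open>q > 0\<close>, and for \<open>q = 0\<close> a large
  \<open>r\<close> makes the form negative unless \<open>z\<close> is 0.\<close>

lemma quadratic_nonneg_imp:
  fixes z :: complex and p q :: real
  assumes "q \<ge> 0" "\<And>t :: complex. 0 \<le> p + 2 * Re (t * z) + (cmod t)\<^sup>2 * q"
  shows "(cmod z)\<^sup>2 \<le> p * q"
proof -
  have key: "0 \<le> p - 2 * r * (cmod z)\<^sup>2 + r\<^sup>2 * (cmod z)\<^sup>2 * q" for r :: real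
  proof -
    have "of_real (- r) * cnj z * z = of_real (- r * (cmod z)\<^sup>2)"
      by (simp only: of_real_mult complex_norm_square mult_ac)
    then have "Re (of_real (- r) * cnj z * z) = - r * (cmod z)\<^sup>2" by (metis Re_complex_of_real)
    moreover have "(cmod (of_real (- r) * cnj z))\<^sup>2 = r\<^sup>2 * (cmod z)\<^sup>2" by (simp add: norm_mult power_mult_distrib)
    ultimately show ?thesis using assms(2)[of "of_real (- r) * cnj z"] by simp
  qed
  show ?thesis
  proof (cases "q = 0")
    case True
    have "z = 0"
    proof (rule ccontr)
      assume "z \<noteq> 0"
      then show False using key[of "(p + 1) / (cmod z)\<^sup>2"] key[of 0] True by simp
    qed
    then show ?thesis using True by simp
  next
    case False
    then have "(cmod z)\<^sup>2 / q \<le> p" using key[of "1 / q"] by (simp add: power2_eq_square)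
    then show ?thesis using False assms(1) by (simp add: field_simps)
  qed
qed

section \<open>Inner product geometry and bounded operators\<close>

context hilbert_space begin

lemma smult_closed' [simp, intro]: "x \<in> carrier H \<Longrightarrow> c \<odot> x \<in> carrier H"
  using smult_closed[of c x] by simp

lemma cinner_add_left:
  "x \<in> carrier H \<Longrightarrow> y \<in> carrier H \<Longrightarrow> z \<in> carrier H \<Longrightarrow> cinner H (x \<oplus> y) z = cinner H x z + cinner H y z"
  using cinner_cnj[of z "x \<oplus> y"] cinner_cnj[of z x] cinner_cnj[of z y] by (simp add: cinner_add)

lemma cinner_smult_left:
  "x \<in> carrier H \<Longrightarrow> y \<in> carrier H \<Longrightarrow> cinner H (c \<odot> x) y = cnj c * cinner H x y"
  using cinner_cnj[of y "c \<odot> x"] cinner_cnj[of y x] by (simp add: cinner_smult)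

lemma cinner_zero [simp]: "x \<in> carrier H \<Longrightarrow> cinner H x \<zero> = 0"
  using cinner_add[of x \<zero> \<zero>] by simp

lemma cinner_diff:
  assumes "x \<in> carrier H" "y \<in> carrier H" "z \<in> carrier H"
  shows "cinner H x (y \<ominus> z) = cinner H x y - cinner H x z"
proof -
  have "(y \<ominus> z) \<oplus> z = y" using assms by (simp add: a_minus_def a_assoc M.l_neg)
  then show ?thesis using cinner_add[of x "y \<ominus> z" z] assms by (metis add_diff_cancel_right' minus_closed)
qed

lemma cinner_diff_left:
  "x \<in> carrier H \<Longrightarrow> y \<in> carrier H \<Longrightarrow> z \<in> carrier H \<Longrightarrow> cinner H (y \<ominus> z) x = cinner H y x - cinner H z x"
  using cinner_cnj[of x "y \<ominus> z"] cinner_cnj[of x y] cinner_cnj[of x z] by (simp add: cinner_diff)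

lemma cinner_self: "x \<in> carrier H \<Longrightarrow> cinner H x x = of_real ((hnorm H x)\<^sup>2)"
  using cinner_cnj[of x x] cinner_nonneg[of x] by (auto simp: hnorm_def complex_eq_iff)

lemma hnorm_nonneg [simp]: "x \<in> carrier H \<Longrightarrow> 0 \<le> hnorm H x"
  by (simp add: hnorm_def cinner_nonneg)

lemma hnorm_eq_zero [simp]: "x \<in> carrier H \<Longrightarrow> hnorm H x = 0 \<longleftrightarrow> x = \<zero>"
  using cinner_self[of x] cinner_eq_zero[of x] by auto

lemma hnorm_zero [simp]: "hnorm H \<zero> = 0"
  by simp

lemma eqI_cinner:
  assumes "x \<in> carrier H" "y \<in> carrier H" "\<And>z. z \<in> carrier H \<Longrightarrow> cinner H z x = cinner H z y"
  shows "x = y"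
proof -
  have "cinner H (x \<ominus> y) (x \<ominus> y) = 0"
    using assms by (simp add: cinner_diff)
  then have "x \<ominus> y = \<zero>" using cinner_eq_zero[of "x \<ominus> y"] assms by simp
  then show ?thesis using assms by (metis M.minus_equality M.minus_minus a_minus_def M.add.inv_closed M.minus_unique M.r_neg a_comm)
qed

lemma smult_one [simp]: "x \<in> carrier H \<Longrightarrow> 1 \<odot> x = x"
  using smult_one[of x] by simp

lemma cinner_finsum:
  assumes "finite I" "f \<in> I \<rightarrow> carrier H" "x \<in> carrier H"
  shows "cinner H x (\<Oplus>i\<in>I. f i) = (\<Sum>i\<in>I. cinner H x (f i))"
  using assms by (induction rule: finite_induct) (auto simp: cinner_add Pi_def)

lemma hnorm_add_sq:
  assumes "x \<in> carrier H" "y \<in> carrier H"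
  shows "(hnorm H (x \<oplus> y))\<^sup>2 = (hnorm H x)\<^sup>2 + 2 * Re (cinner H x y) + (hnorm H y)\<^sup>2"
proof -
  have "(hnorm H v)\<^sup>2 = Re (cinner H v v)" if "v \<in> carrier H" for v
    using that by (simp add: hnorm_def cinner_nonneg)
  moreover have "Re (cinner H y x) = Re (cinner H x y)" using cinner_cnj[of x y] assms by simp
  ultimately show ?thesis using assms by (simp add: cinner_add cinner_add_left)
qed

lemma hnorm_smult: "x \<in> carrier H \<Longrightarrow> hnorm H (c \<odot> x) = cmod c * hnorm H x"
proof -
  assume x: "x \<in> carrier H"
  have "cinner H (c \<odot> x) (c \<odot> x) = (c * cnj c) * cinner H x x"
    using x by (simp add: cinner_smult cinner_smult_left)
  also have "\<dots> = of_real ((cmod c * hnorm H x)\<^sup>2)"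
    unfolding complex_norm_square [symmetric] cinner_self[OF x] by (simp add: power_mult_distrib)
  finally show ?thesis using x unfolding hnorm_def[of H "c \<odot> x"] by (simp del: of_real_power)
qed

lemma cauchy_schwarz:
  assumes "x \<in> carrier H" "y \<in> carrier H"
  shows "cmod (cinner H x y) \<le> hnorm H x * hnorm H y"
proof -
  have "(cmod (cinner H x y))\<^sup>2 \<le> (hnorm H x)\<^sup>2 * (hnorm H y)\<^sup>2"
  proof (rule quadratic_nonneg_imp)
    fix t :: complex
    have "0 \<le> (hnorm H (x \<oplus> t \<odot> y))\<^sup>2" by simp
    then show "0 \<le> (hnorm H x)\<^sup>2 + 2 * Re (t * cinner H x y) + (cmod t)\<^sup>2 * (hnorm H y)\<^sup>2"
      using assms by (subst (asm) hnorm_add_sq) (auto simp: cinner_smult hnorm_smult power_mult_distrib)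
  qed simp
  then have "(cmod (cinner H x y))\<^sup>2 \<le> (hnorm H x * hnorm H y)\<^sup>2" by (simp only: power_mult_distrib)
  then show ?thesis by (rule power2_le_imp_le) (simp add: assms)
qed

lemma hnorm_triangle:
  assumes "x \<in> carrier H" "y \<in> carrier H"
  shows "hnorm H (x \<oplus> y) \<le> hnorm H x + hnorm H y"
proof (rule power2_le_imp_le)
  show "(hnorm H (x \<oplus> y))\<^sup>2 \<le> (hnorm H x + hnorm H y)\<^sup>2"
    using cauchy_schwarz[OF assms] complex_Re_le_cmod[of "cinner H x y"] assms
    by (simp add: hnorm_add_sq power2_sum)
qed (use assms in simp)

lemma hnorm_triangle3:
  assumes "x \<in> carrier H" "y \<in> carrier H" "z \<in> carrier H"
  shows "hnorm H (x \<ominus> z) \<le> hnorm H (x \<ominus> y) + hnorm H (y \<ominus> z)"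
proof -
  have "x \<ominus> z = (x \<ominus> y) \<oplus> (y \<ominus> z)"
    by (rule eqI_cinner) (use assms in \<open>auto simp: cinner_add cinner_diff\<close>)
  then show ?thesis using hnorm_triangle[of "x \<ominus> y" "y \<ominus> z"] assms by simp
qed

abbreviation "ops \<equiv> bounded_linear_operators H"

lemma op_extensional: "T \<in> ops \<Longrightarrow> T \<in> extensional (carrier H)"
  by (simp add: bounded_linear_operators_def PiE_def)

lemma op_closed [simp]: "T \<in> ops \<Longrightarrow> x \<in> carrier H \<Longrightarrow> T x \<in> carrier H"
  by (auto simp: bounded_linear_operators_def)

lemma op_add: "T \<in> ops \<Longrightarrow> x \<in> carrier H \<Longrightarrow> y \<in> carrier H \<Longrightarrow> T (x \<oplus> y) = T x \<oplus> T y"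
  by (auto simp: bounded_linear_operators_def)

lemma op_smult: "T \<in> ops \<Longrightarrow> x \<in> carrier H \<Longrightarrow> T (c \<odot> x) = c \<odot> T x"
  by (auto simp: bounded_linear_operators_def)

lemma op_bound:
  assumes "T \<in> ops"
  obtains K where "0 \<le> K" "\<And>x. x \<in> carrier H \<Longrightarrow> hnorm H (T x) \<le> K * hnorm H x"
proof -
  have "\<exists>K. \<forall>x\<in>carrier H. hnorm H (T x) \<le> K * hnorm H x"
    using assms by (simp add: bounded_linear_operators_def)
  then obtain K where K: "\<And>x. x \<in> carrier H \<Longrightarrow> hnorm H (T x) \<le> K * hnorm H x" by blast
  show thesis
  proof (rule that)
    show "0 \<le> max K 0" by simp
    fix x assume x: "x \<in> carrier H"
    have "K * hnorm H x \<le> max K 0 * hnorm H x" by (rule mult_right_mono) (use x in simp_all)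
    with K[OF x] show "hnorm H (T x) \<le> max K 0 * hnorm H x" by (rule order_trans)
  qed
qed

lemma opsI:
  assumes "T \<in> extensional (carrier H)" "\<And>x. x \<in> carrier H \<Longrightarrow> T x \<in> carrier H"
    and "\<And>x y. x \<in> carrier H \<Longrightarrow> y \<in> carrier H \<Longrightarrow> T (x \<oplus> y) = T x \<oplus> T y"
    and "\<And>c x. x \<in> carrier H \<Longrightarrow> T (c \<odot> x) = c \<odot> T x"
    and "\<And>x. x \<in> carrier H \<Longrightarrow> hnorm H (T x) \<le> K * hnorm H x"
  shows "T \<in> ops"
proof -
  have "T \<in> carrier H \<rightarrow>\<^sub>E carrier H" using assms(1,2) unfolding PiE_def by (intro IntI Pi_I)
  moreover have "\<exists>K. \<forall>x\<in>carrier H. hnorm H (T x) \<le> K * hnorm H x" using assms(5) by (intro exI ballI)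
  ultimately show ?thesis using assms(3,4) by (simp add: bounded_linear_operators_def)
qed

lemma op_eqI: "S \<in> ops \<Longrightarrow> T \<in> ops \<Longrightarrow> (\<And>x. x \<in> carrier H \<Longrightarrow> S x = T x) \<Longrightarrow> S = T"
  by (rule extensionalityI[OF op_extensional op_extensional])

lemma op_finsum:
  assumes "T \<in> ops" "finite I" "f \<in> I \<rightarrow> carrier H"
  shows "T (\<Oplus>i\<in>I. f i) = (\<Oplus>i\<in>I. T (f i))"
  using assms(2,3)
proof (induction rule: finite_induct)
  case empty
  have "T \<zero> = T (0 \<odot> \<zero>)" by (simp add: smult_l_null [simplified])
  also have "\<dots> = \<zero>" using assms(1) by (simp only: op_smult zero_closed) (simp add: smult_l_null [simplified])
  finally show ?case by simp
next
  case (insert i I)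
  then show ?case using assms(1) by (simp add: Pi_def op_add)
qed

lemma ops_one: "(\<lambda>x\<in>carrier H. x) \<in> ops"
  by (rule opsI[of _ 1]) auto

lemma ops_zero: "(\<lambda>x\<in>carrier H. \<zero>) \<in> ops"
proof (rule opsI[of _ 0])
  show "(\<lambda>x\<in>carrier H. \<zero>) (c \<odot> x) = c \<odot> (\<lambda>x\<in>carrier H. \<zero>) x" if "x \<in> carrier H" for c x
    using that by (auto intro!: eqI_cinner simp: cinner_smult)
qed auto

lemma ops_add:
  assumes "S \<in> ops" "T \<in> ops"
  shows "(\<lambda>x\<in>carrier H. S x \<oplus> T x) \<in> ops"
proof -
  obtain K L where K: "\<And>x. x \<in> carrier H \<Longrightarrow> hnorm H (S x) \<le> K * hnorm H x"
    and L: "\<And>x. x \<in> carrier H \<Longrightarrow> hnorm H (T x) \<le> L * hnorm H x"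
    using op_bound assms by metis
  show ?thesis
  proof (rule opsI[of _ "K + L"])
    fix x assume x: "x \<in> carrier H"
    show "hnorm H ((\<lambda>x\<in>carrier H. S x \<oplus> T x) x) \<le> (K + L) * hnorm H x"
      using hnorm_triangle[of "S x" "T x"] K[OF x] L[OF x] x assms by (simp add: algebra_simps)
    show "(\<lambda>x\<in>carrier H. S x \<oplus> T x) (c \<odot> x) = c \<odot> (\<lambda>x\<in>carrier H. S x \<oplus> T x) x" for c
      using x assms by (auto simp: op_smult smult_r_distr)
  qed (use assms in \<open>auto simp: op_add M.a_ac\<close>)
qed

lemma ops_smult:
  assumes "T \<in> ops"
  shows "(\<lambda>x\<in>carrier H. c \<odot> T x) \<in> ops"
proof -
  obtain L where L: "\<And>x. x \<in> carrier H \<Longrightarrow> hnorm H (T x) \<le> L * hnorm H x"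
    using op_bound assms by metis
  show ?thesis
  proof (rule opsI[of _ "cmod c * L"])
    fix x assume x: "x \<in> carrier H"
    show "hnorm H ((\<lambda>x\<in>carrier H. c \<odot> T x) x) \<le> (cmod c * L) * hnorm H x"
      using L[OF x] x assms by (simp add: hnorm_smult mult.assoc mult_left_mono)
    show "(\<lambda>x\<in>carrier H. c \<odot> T x) (d \<odot> x) = d \<odot> (\<lambda>x\<in>carrier H. c \<odot> T x) x" for d
      using x assms by (auto intro!: eqI_cinner simp: op_smult cinner_smult)
    show "(\<lambda>x\<in>carrier H. c \<odot> T x) (x \<oplus> y) = (\<lambda>x\<in>carrier H. c \<odot> T x) x \<oplus> (\<lambda>x\<in>carrier H. c \<odot> T x) y"
      if "y \<in> carrier H" for y
      using x that assms by (auto simp: op_add smult_r_distr)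
  qed (use assms in auto)
qed

lemma ops_compose:
  assumes "S \<in> ops" "T \<in> ops"
  shows "compose (carrier H) S T \<in> ops"
proof -
  obtain K L where K: "0 \<le> K" "\<And>x. x \<in> carrier H \<Longrightarrow> hnorm H (S x) \<le> K * hnorm H x"
    and L: "\<And>x. x \<in> carrier H \<Longrightarrow> hnorm H (T x) \<le> L * hnorm H x"
    using op_bound assms by metis
  show ?thesis
  proof (rule opsI[of _ "K * L"])
    fix x assume x: "x \<in> carrier H"
    have "hnorm H (S (T x)) \<le> K * hnorm H (T x)" using K x assms by simp
    also have "\<dots> \<le> K * (L * hnorm H x)" using L[OF x] K by (intro mult_left_mono) auto
    finally show "hnorm H (compose (carrier H) S T x) \<le> (K * L) * hnorm H x"
      using x by (simp add: compose_def mult.assoc)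
  qed (use assms in \<open>auto simp: compose_def op_add op_smult\<close>)
qed

text \<open>\<open>adjoint_operator\<close> is a definite description and carries information only
  after some adjoint has been exhibited; adjoints are computed through this lemma.\<close>

lemma adjoint_unique:
  assumes "S \<in> ops" "\<And>x y. x \<in> carrier H \<Longrightarrow> y \<in> carrier H \<Longrightarrow> cinner H (T x) y = cinner H x (S y)"
  shows "adjoint_operator H T = S"
  unfolding adjoint_operator_def
proof (rule the_equality)
  fix S' assume S': "S' \<in> ops \<and> (\<forall>x\<in>carrier H. \<forall>y\<in>carrier H. cinner H (T x) y = cinner H x (S' y))"
  show "S' = S"
  proof (rule op_eqI)
    fix x assume x: "x \<in> carrier H"
    show "S' x = S x"
    proof (rule eqI_cinner)
      fix z assume z: "z \<in> carrier H"
      have "cinner H (T z) x = cinner H z (S' x)" using S' z x by blast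
      with assms(2)[OF z x] show "cinner H z (S' x) = cinner H z (S x)" by simp
    qed (use x S' assms(1) in \<open>simp_all only: op_closed\<close>)
  qed (use S' assms(1) in blast)+
next
  show "S \<in> ops \<and> (\<forall>x\<in>carrier H. \<forall>y\<in>carrier H. cinner H (T x) y = cinner H x (S y))"
    using assms by blast
qed

end

text \<open>A faithful representation by bounded operators carries the algebra axioms back from
  \<open>B(H)\<close>; it serves both for \<open>B(H)\<close> itself and for copies of operator algebras in other types.\<close>

locale operator_rep = hilbert_space H for H :: "('h, 'n) hilbert_space_scheme" (structure) +
  fixes A :: "('c, 'm) star_algebra_scheme" and \<pi> :: "'c \<Rightarrow> 'h \<Rightarrow> 'h"
  assumes rep_ops: "a \<in> carrier A \<Longrightarrow> \<pi> a \<in> bounded_linear_operators H"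
    and faithful: "a \<in> carrier A \<Longrightarrow> b \<in> carrier A \<Longrightarrow> (\<And>x. x \<in> carrier H \<Longrightarrow> \<pi> a x = \<pi> b x) \<Longrightarrow> a = b"
    and mult_carrier: "a \<in> carrier A \<Longrightarrow> b \<in> carrier A \<Longrightarrow> a \<otimes>\<^bsub>A\<^esub> b \<in> carrier A"
    and add_carrier: "a \<in> carrier A \<Longrightarrow> b \<in> carrier A \<Longrightarrow> a \<oplus>\<^bsub>A\<^esub> b \<in> carrier A"
    and smult_carrier: "a \<in> carrier A \<Longrightarrow> c \<odot>\<^bsub>A\<^esub> a \<in> carrier A"
    and one_carrier: "\<one>\<^bsub>A\<^esub> \<in> carrier A"
    and zero_carrier: "\<zero>\<^bsub>A\<^esub> \<in> carrier A"
    and rep_mult: "a \<in> carrier A \<Longrightarrow> b \<in> carrier A \<Longrightarrow> x \<in> carrier H \<Longrightarrow> \<pi> (a \<otimes>\<^bsub>A\<^esub> b) x = \<pi> a (\<pi> b x)"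
    and rep_add: "a \<in> carrier A \<Longrightarrow> b \<in> carrier A \<Longrightarrow> x \<in> carrier H \<Longrightarrow> \<pi> (a \<oplus>\<^bsub>A\<^esub> b) x = \<pi> a x \<oplus> \<pi> b x"
    and rep_smult: "a \<in> carrier A \<Longrightarrow> x \<in> carrier H \<Longrightarrow> \<pi> (c \<odot>\<^bsub>A\<^esub> a) x = c \<odot> \<pi> a x"
    and rep_one: "x \<in> carrier H \<Longrightarrow> \<pi> \<one>\<^bsub>A\<^esub> x = x"
    and rep_zero: "x \<in> carrier H \<Longrightarrow> \<pi> \<zero>\<^bsub>A\<^esub> x = \<zero>"
begin

lemmas rep_closed = mult_carrier add_carrier smult_carrier one_carrier zero_carrier
lemmas rep_simps = rep_mult rep_add rep_smult rep_one rep_zero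

lemma rep_in [simp]: "a \<in> carrier A \<Longrightarrow> x \<in> carrier H \<Longrightarrow> \<pi> a x \<in> carrier H"
  using rep_ops by simp

lemma ring: "Ring.ring A"
proof (rule ringI)
  show "abelian_group A"
  proof (rule abelian_groupI)
    fix a assume a: "a \<in> carrier A"
    have "(-1) \<odot>\<^bsub>A\<^esub> a \<oplus>\<^bsub>A\<^esub> a = \<zero>\<^bsub>A\<^esub>"
    proof (rule faithful)
      fix x assume x: "x \<in> carrier H"
      have "(-1) \<odot> \<pi> a x \<oplus> \<pi> a x = \<zero>"
        by (rule eqI_cinner) (use a x in \<open>auto simp: cinner_add cinner_smult\<close>)
      then show "\<pi> ((-1) \<odot>\<^bsub>A\<^esub> a \<oplus>\<^bsub>A\<^esub> a) x = \<pi> \<zero>\<^bsub>A\<^esub> x"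
        using a x by (simp add: rep_simps rep_closed)
    qed (use a in \<open>simp_all add: rep_closed\<close>)
    then show "\<exists>b\<in>carrier A. b \<oplus>\<^bsub>A\<^esub> a = \<zero>\<^bsub>A\<^esub>" using a smult_carrier by blast
  qed (auto intro!: faithful simp: rep_closed rep_simps M.a_ac)
  show "Group.monoid A"
    by (rule monoidI) (auto intro!: faithful simp: rep_closed rep_simps)
qed (auto intro!: faithful simp: rep_closed rep_simps op_add[OF rep_ops])

lemma module: "Module.module complex_ring A"
proof (rule moduleI)
  show "cring complex_ring" by (rule cring_complex_ring)
  interpret A: Ring.ring A by (rule ring)
  show "abelian_group A" by (rule A.abelian_group_axioms)
  fix c d :: complex and a assume a: "a \<in> carrier A"
  show "(c \<oplus>\<^bsub>complex_ring\<^esub> d) \<odot>\<^bsub>A\<^esub> a = c \<odot>\<^bsub>A\<^esub> a \<oplus>\<^bsub>A\<^esub> d \<odot>\<^bsub>A\<^esub> a"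
    using a by (auto intro!: faithful eqI_cinner simp: rep_closed rep_simps cinner_smult cinner_add distrib_right)
  show "(c \<otimes>\<^bsub>complex_ring\<^esub> d) \<odot>\<^bsub>A\<^esub> a = c \<odot>\<^bsub>A\<^esub> (d \<odot>\<^bsub>A\<^esub> a)"
    using a by (auto intro!: faithful eqI_cinner simp: rep_closed rep_simps cinner_smult)
qed (auto intro!: faithful simp: rep_closed rep_simps smult_r_distr)

lemma smult_mult_left: "a \<in> carrier A \<Longrightarrow> b \<in> carrier A \<Longrightarrow> (c \<odot>\<^bsub>A\<^esub> a) \<otimes>\<^bsub>A\<^esub> b = c \<odot>\<^bsub>A\<^esub> (a \<otimes>\<^bsub>A\<^esub> b)"
  by (auto intro!: faithful simp: rep_closed rep_simps)

lemma smult_mult_right: "a \<in> carrier A \<Longrightarrow> b \<in> carrier A \<Longrightarrow> a \<otimes>\<^bsub>A\<^esub> (c \<odot>\<^bsub>A\<^esub> b) = c \<odot>\<^bsub>A\<^esub> (a \<otimes>\<^bsub>A\<^esub> b)"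
  by (auto intro!: faithful simp: rep_closed rep_simps op_smult[OF rep_ops])

lemma rep_finsum:
  assumes "finite I" "f \<in> I \<rightarrow> carrier A" "x \<in> carrier H"
  shows "\<pi> (\<Oplus>\<^bsub>A\<^esub>i\<in>I. f i) x = (\<Oplus>i\<in>I. \<pi> (f i) x)"
proof -
  interpret A: Ring.ring A by (rule ring)
  show ?thesis using assms
    by (induction rule: finite_induct) (auto simp: rep_simps Pi_def A.finsum_closed)
qed

end

lemma operator_algebra_simps [simp]:
  "carrier (operator_algebra H) = bounded_linear_operators H"
  "mult (operator_algebra H) = compose (carrier H)"
  "one (operator_algebra H) = (\<lambda>x\<in>carrier H. x)"
  "zero (operator_algebra H) = (\<lambda>x\<in>carrier H. \<zero>\<^bsub>H\<^esub>)"
  "add (operator_algebra H) = (\<lambda>S T. \<lambda>x\<in>carrier H. S x \<oplus>\<^bsub>H\<^esub> T x)"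
  "smult (operator_algebra H) = (\<lambda>c T. \<lambda>x\<in>carrier H. c \<odot>\<^bsub>H\<^esub> T x)"
  "star (operator_algebra H) = adjoint_operator H"
  by (simp_all add: operator_algebra_def)

lemma (in hilbert_space) operator_rep_self: "operator_rep H (operator_algebra H) (\<lambda>T. T)"
proof (intro operator_rep.intro operator_rep_axioms.intro)
  show "hilbert_space H" by (rule hilbert_space_axioms)
  show "a = b" if "a \<in> carrier (operator_algebra H)" "b \<in> carrier (operator_algebra H)"
    "\<And>x. x \<in> carrier H \<Longrightarrow> a x = b x" for a b
    using that by (intro op_eqI) simp_all
qed (simp_all add: ops_one ops_zero ops_add ops_smult ops_compose, simp_all add: compose_def)

section \<open>Quantum isometry matrices and functionals on words\<close>

text \<open>The star-free part of a star-algebra, which the bounded operators satisfy without any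
  claim on the existence of adjoints. Moments of quantum isometry matrices are computed at this
  level for both kinds of algebras.\<close>

locale complex_algebra = Module.module complex_ring A + ring A for A :: "('a, 'm) star_algebra_scheme" (structure) +
  assumes smult_mult_left: "x \<in> carrier A \<Longrightarrow> y \<in> carrier A \<Longrightarrow> (c \<odot> x) \<otimes> y = c \<odot> (x \<otimes> y)"
    and smult_mult_right: "x \<in> carrier A \<Longrightarrow> y \<in> carrier A \<Longrightarrow> x \<otimes> (c \<odot> y) = c \<odot> (x \<otimes> y)"
begin

lemma smult_in [simp]: "x \<in> carrier A \<Longrightarrow> c \<odot> x \<in> carrier A"
  using smult_closed[of c x] by simp

lemma smult_add [simp]: "x \<in> carrier A \<Longrightarrow> y \<in> carrier A \<Longrightarrow> c \<odot> (x \<oplus> y) = c \<odot> x \<oplus> c \<odot> y"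
  using smult_r_distr[of c x y] by simp

lemma smult_smult [simp]: "x \<in> carrier A \<Longrightarrow> c \<odot> (d \<odot> x) = (c * d) \<odot> x"
  using smult_assoc1[of c d x] by simp

definition linear_functional :: "('a \<Rightarrow> complex) \<Rightarrow> bool" where
  "linear_functional L \<longleftrightarrow> (\<forall>x\<in>carrier A. \<forall>y\<in>carrier A. L (x \<oplus> y) = L x + L y) \<and>
     (\<forall>c. \<forall>x\<in>carrier A. L (c \<odot> x) = c * L x)"

lemma linear_functional_zero: "linear_functional L \<Longrightarrow> L \<zero> = 0"
proof -
  assume "linear_functional L"
  then have "L (\<zero> \<oplus> \<zero>) = L \<zero> + L \<zero>" unfolding linear_functional_def by blast
  then show ?thesis by simp
qed

lemma linear_functional_finsum:
  assumes "linear_functional L" "finite I" "f \<in> I \<rightarrow> carrier A"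
  shows "L (\<Oplus>i\<in>I. f i) = (\<Sum>i\<in>I. L (f i))"
  using assms(2,3)
proof (induction rule: finite_induct)
  case empty then show ?case using linear_functional_zero[OF assms(1)] by simp
next
  case (insert i I)
  then have "f i \<in> carrier A" "f \<in> I \<rightarrow> carrier A" by auto
  then show ?case using insert assms(1) by (simp add: linear_functional_def finsum_closed)
qed

lemma linear_functional_mult:
  assumes "linear_functional L" "p \<in> carrier A" "q \<in> carrier A"
  shows "linear_functional (\<lambda>x. L (p \<otimes> (x \<otimes> q)))"
  using assms unfolding linear_functional_def
  by (auto simp: l_distr r_distr smult_mult_left smult_mult_right)

definition word_prod :: "('x \<Rightarrow> 'y \<Rightarrow> 'a) \<Rightarrow> ('x \<times> 'y) list \<Rightarrow> 'a" where
  "word_prod E w = foldr (\<lambda>p a. E (fst p) (snd p) \<otimes> a) w \<one>"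

lemma word_prod_simps [simp]:
  "word_prod E [] = \<one>" "word_prod E (p # w) = E (fst p) (snd p) \<otimes> word_prod E w"
  by (simp_all add: word_prod_def)

lemma word_prod_closed:
  "(\<And>x y. x \<in> X \<Longrightarrow> y \<in> Y \<Longrightarrow> E x y \<in> carrier A) \<Longrightarrow> set w \<subseteq> X \<times> Y \<Longrightarrow> word_prod E w \<in> carrier A"
  by (induction w) auto

lemma word_prod_append:
  assumes "\<And>x y. x \<in> X \<Longrightarrow> y \<in> Y \<Longrightarrow> E x y \<in> carrier A" "set u \<subseteq> X \<times> Y" "set v \<subseteq> X \<times> Y"
  shows "word_prod E (u @ v) = word_prod E u \<otimes> word_prod E v"
  using assms(2)
proof (induction u)
  case Nil
  then show ?case using word_prod_closed[OF assms(1,3)] by simp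
next
  case (Cons p u)
  then have "word_prod E u \<in> carrier A" "E (fst p) (snd p) \<in> carrier A"
    using word_prod_closed[OF assms(1), where w = u] assms(1) by auto
  then show ?case using Cons word_prod_closed[OF assms(1,3)] by (simp add: m_assoc)
qed

text \<open>The distance condition on words is extracted from the matrix equation by placing its
  entry at \<open>(x, y')\<close> between the letters \<open>(x, y)\<close> and
  \<open>(x', y')\<close>. Orthogonality is assumed under \<open>L\<close> only: for the trace it is
  proved in this weak form, for operators on a Hilbert space it holds before applying
  \<open>L\<close>.\<close>

lemma isometry_functional_word_prod:
  fixes X :: "'x set" and Y :: "'y set"
  assumes fin: "finite X" "finite Y"
    and E: "\<And>x y. x \<in> X \<Longrightarrow> y \<in> Y \<Longrightarrow> E x y \<in> carrier A"
    and idem: "\<And>x y. x \<in> X \<Longrightarrow> y \<in> Y \<Longrightarrow> E x y \<otimes> E x y = E x y"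
    and row: "\<And>x. x \<in> X \<Longrightarrow> (\<Oplus>y\<in>Y. E x y) = \<one>"
    and col: "\<And>y. y \<in> Y \<Longrightarrow> (\<Oplus>x\<in>X. E x y) = \<one>"
    and dist: "\<And>x y. x \<in> X \<Longrightarrow> y \<in> Y \<Longrightarrow>
      (\<Oplus>x'\<in>X. complex_of_real (dX x x') \<odot> E x' y) = (\<Oplus>y'\<in>Y. complex_of_real (dY y' y) \<odot> E x y')"
    and L: "linear_functional L"
    and row_orth: "\<And>u v x y y'. set u \<subseteq> X \<times> Y \<Longrightarrow> set v \<subseteq> X \<times> Y \<Longrightarrow> x \<in> X \<Longrightarrow> y \<in> Y \<Longrightarrow> y' \<in> Y \<Longrightarrow> y \<noteq> y' \<Longrightarrow>
      L (word_prod E (u @ (x, y) # (x, y') # v)) = 0"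
    and col_orth: "\<And>u v x x' y. set u \<subseteq> X \<times> Y \<Longrightarrow> set v \<subseteq> X \<times> Y \<Longrightarrow> x \<in> X \<Longrightarrow> x' \<in> X \<Longrightarrow> y \<in> Y \<Longrightarrow> x \<noteq> x' \<Longrightarrow>
      L (word_prod E (u @ (x, y) # (x', y) # v)) = 0"
  shows "isometry_functional X dX Y dY (\<lambda>w. if set w \<subseteq> X \<times> Y then L (word_prod E w) else 0)"
    (is "isometry_functional X dX Y dY ?\<psi>")
proof -
  have wp: "word_prod E w \<in> carrier A" if "set w \<subseteq> X \<times> Y" for w
    using word_prod_closed[OF E that] .
  have mid: "L (word_prod E (u @ (x, y) # v)) = L (word_prod E u \<otimes> (E x y \<otimes> word_prod E v))"
    if "set u \<subseteq> X \<times> Y" "set v \<subseteq> X \<times> Y" "x \<in> X" "y \<in> Y" for u v x y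
    using that by (subst word_prod_append[OF E]) auto
  show ?thesis
    unfolding isometry_functional_def
  proof (intro conjI allI impI ballI)
    fix w assume "?\<psi> w \<noteq> 0" then show "set w \<subseteq> X \<times> Y" by (auto split: if_splits)
  next
    fix u v :: "('x \<times> 'y) list" and x assume x: "x \<in> X"
    show "(\<Sum>y\<in>Y. ?\<psi> (u @ (x, y) # v)) = ?\<psi> (u @ v)"
    proof (cases "set u \<subseteq> X \<times> Y \<and> set v \<subseteq> X \<times> Y")
      case True
      then have u: "set u \<subseteq> X \<times> Y" and v: "set v \<subseteq> X \<times> Y" by auto
      have "(\<Sum>y\<in>Y. ?\<psi> (u @ (x, y) # v)) = (\<Sum>y\<in>Y. L (word_prod E u \<otimes> (E x y \<otimes> word_prod E v)))"
        using u v x by (intro sum.cong refl) (simp add: mid)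
      also have "\<dots> = L (word_prod E u \<otimes> ((\<Oplus>y\<in>Y. E x y) \<otimes> word_prod E v))"
        using linear_functional_finsum[OF linear_functional_mult[OF L wp[OF u] wp[OF v]] fin(2), of "E x"] E x by simp
      also have "\<dots> = L (word_prod E (u @ v))"
        using row[OF x] wp[OF u] wp[OF v] by (simp add: word_prod_append[OF E u v])
      finally show ?thesis using u v by simp
    next
      case False
      then have "?\<psi> (u @ v) = 0" "?\<psi> (u @ (x, y) # v) = 0" for y by auto
      then show ?thesis by (simp only: sum.neutral_const)
    qed
  next
    fix u v :: "('x \<times> 'y) list" and y assume y: "y \<in> Y"
    show "(\<Sum>x\<in>X. ?\<psi> (u @ (x, y) # v)) = ?\<psi> (u @ v)"
    proof (cases "set u \<subseteq> X \<times> Y \<and> set v \<subseteq> X \<times> Y")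
      case True
      then have u: "set u \<subseteq> X \<times> Y" and v: "set v \<subseteq> X \<times> Y" by auto
      have "(\<Sum>x\<in>X. ?\<psi> (u @ (x, y) # v)) = (\<Sum>x\<in>X. L (word_prod E u \<otimes> (E x y \<otimes> word_prod E v)))"
        using u v y by (intro sum.cong refl) (simp add: mid)
      also have "\<dots> = L (word_prod E u \<otimes> ((\<Oplus>x\<in>X. E x y) \<otimes> word_prod E v))"
        using linear_functional_finsum[OF linear_functional_mult[OF L wp[OF u] wp[OF v]] fin(1), of "\<lambda>x. E x y"] E y by simp
      also have "\<dots> = L (word_prod E (u @ v))"
        using col[OF y] wp[OF u] wp[OF v] by (simp add: word_prod_append[OF E u v])
      finally show ?thesis using u v by simp
    next
      case False
      then have "?\<psi> (u @ v) = 0" "?\<psi> (u @ (x, y) # v) = 0" for x by auto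
      then show ?thesis by (simp only: sum.neutral_const)
    qed
  next
    fix u v :: "('x \<times> 'y) list" and x x' y y' assume ne: "dX x x' \<noteq> dY y y'"
    show "?\<psi> (u @ (x, y) # (x', y') # v) = 0"
    proof (cases "set (u @ (x, y) # (x', y') # v) \<subseteq> X \<times> Y")
      case True
      then have u: "set u \<subseteq> X \<times> Y" and v: "set v \<subseteq> X \<times> Y" and xy: "x \<in> X" "y \<in> Y" "x' \<in> X" "y' \<in> Y" by auto
      \<comment> \<open>\<open>M\<close> places an element between the two letters. Of column
        \<open>y'\<close> only the entry at \<open>x'\<close> survives and of row \<open>x\<close>
        only the entry at \<open>y\<close>, both with the value \<open>z\<close>; so the equation
        becomes \<open>dX x x' * z = dY y y' * z\<close>.\<close>
      define M where "M = (\<lambda>a. L (word_prod E (u @ [(x, y)]) \<otimes> (a \<otimes> word_prod E ((x', y') # v))))"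
      define z where "z = L (word_prod E (u @ (x, y) # (x', y') # v))"
      have u': "set (u @ [(x, y)]) \<subseteq> X \<times> Y" and v': "set ((x', y') # v) \<subseteq> X \<times> Y" using u v xy by auto
      have M: "linear_functional M" unfolding M_def by (rule linear_functional_mult[OF L wp[OF u'] wp[OF v']])
      have ME: "M (E a b) = L (word_prod E ((u @ [(x, y)]) @ (a, b) # (x', y') # v))" if "a \<in> X" "b \<in> Y" for a b
        using mid[OF u' v' that] by (simp add: M_def)
      have Mx: "M (E a y') = (if a = x' then z else 0)" if "a \<in> X" for a
      proof (cases "a = x'")
        case True
        have "word_prod E ((x', y') # (x', y') # v) = word_prod E ((x', y') # v)"
          using idem[OF xy(3,4)] E xy wp[OF v] by (simp add: m_assoc [symmetric])
        moreover have "word_prod E ((u @ [(x, y)]) @ w) = word_prod E (u @ [(x, y)]) \<otimes> word_prod E w" if "set w \<subseteq> X \<times> Y" for w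
          by (rule word_prod_append[OF E u' that])
        moreover have "z = L (word_prod E ((u @ [(x, y)]) @ (x', y') # v))" by (simp add: z_def)
        moreover have "set ((x', y') # (x', y') # v) \<subseteq> X \<times> Y" using v' by simp
        ultimately show ?thesis using True v' unfolding ME[OF that xy(4)] by metis
      next
        case False
        then show ?thesis using ME[OF that xy(4)] col_orth[OF u' v that xy(3,4)] by simp
      qed
      have My: "M (E x b) = (if b = y then z else 0)" if "b \<in> Y" for b
      proof (cases "b = y")
        case True
        have "word_prod E ((x, y) # (x, y) # (x', y') # v) = word_prod E ((x, y) # (x', y') # v)"
          using idem[OF xy(1,2)] E xy wp[OF v] by (simp add: m_assoc [symmetric])
        moreover have "word_prod E (u @ w) = word_prod E u \<otimes> word_prod E w" if "set w \<subseteq> X \<times> Y" for w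
          by (rule word_prod_append[OF E u that])
        ultimately show ?thesis using True xy v unfolding ME[OF xy(1) that] z_def by simp
      next
        case False
        then show ?thesis using ME[OF xy(1) that] row_orth[OF u v' xy(1,2) that] by simp
      qed
      have sc: "M (of_real r \<odot> a) = of_real r * M a" if "a \<in> carrier A" for r a
        using M that unfolding linear_functional_def by blast
      have "(\<Sum>a\<in>X. of_real (dX x a) * M (E a y')) = M (\<Oplus>a\<in>X. complex_of_real (dX x a) \<odot> E a y')"
        using E xy by (subst linear_functional_finsum[OF M fin(1)]) (auto simp: sc)
      also have "\<dots> = M (\<Oplus>b\<in>Y. complex_of_real (dY b y') \<odot> E x b)" using dist[OF xy(1,4)] by simp
      also have "\<dots> = (\<Sum>b\<in>Y. of_real (dY b y') * M (E x b))"
        using E xy by (subst linear_functional_finsum[OF M fin(2)]) (auto simp: sc)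
      finally have "of_real (dX x x') * z = of_real (dY y y') * z"
        using fin xy by (simp add: Mx My if_distrib cong: sum.cong if_cong)
      then have "z = 0" using ne by simp
      then show ?thesis by (simp add: z_def)
    next
      case False
      then show ?thesis by (rule if_not_P)
    qed
  qed
qed

text \<open>A self-adjoint idempotent equals its product with its star, so the diagonal entries of
  \<open>U U* = 1\<close> are row sums and those of \<open>U* U = 1\<close> are column sums.\<close>

lemma quantum_isometry_matrix_relations:
  assumes "quantum_isometry_matrix A X dX Y dY E" and fin: "finite X" "finite Y"
  shows "\<And>x y. x \<in> X \<Longrightarrow> y \<in> Y \<Longrightarrow> E x y \<in> carrier A"
    and "\<And>x y. x \<in> X \<Longrightarrow> y \<in> Y \<Longrightarrow> E x y \<otimes> E x y = E x y"
    and "\<And>x y. x \<in> X \<Longrightarrow> y \<in> Y \<Longrightarrow> star A (E x y) = E x y"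
    and "\<And>x. x \<in> X \<Longrightarrow> (\<Oplus>y\<in>Y. E x y) = \<one>"
    and "\<And>y. y \<in> Y \<Longrightarrow> (\<Oplus>x\<in>X. E x y) = \<one>"
    and "\<And>x y. x \<in> X \<Longrightarrow> y \<in> Y \<Longrightarrow>
      (\<Oplus>x'\<in>X. complex_of_real (dX x x') \<odot> E x' y) = (\<Oplus>y'\<in>Y. complex_of_real (dY y' y) \<odot> E x y')"
proof -
  show E: "E x y \<in> carrier A" "E x y \<otimes> E x y = E x y" "star A (E x y) = E x y" if "x \<in> X" "y \<in> Y" for x y
    using assms(1) that by (auto simp: quantum_isometry_matrix_def projection_def)
  show "(\<Oplus>y\<in>Y. E x y) = \<one>" if x: "x \<in> X" for x
  proof -
    have "(\<Oplus>y\<in>Y. E x y) = (\<Oplus>y\<in>Y. E x y \<otimes> star A (E x y))"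
      by (rule finsum_cong') (use E x in auto)
    then show ?thesis
      using assms(1) x by (simp add: quantum_isometry_matrix_def unitary_mat_def mat_eq_def mat_mult_def mat_star_def mat_one_def)
  qed
  show "(\<Oplus>x\<in>X. E x y) = \<one>" if y: "y \<in> Y" for y
  proof -
    have "(\<Oplus>x\<in>X. E x y) = (\<Oplus>x\<in>X. star A (E x y) \<otimes> E x y)"
      by (rule finsum_cong') (use E y in auto)
    then show ?thesis
      using assms(1) y by (simp add: quantum_isometry_matrix_def unitary_mat_def mat_eq_def mat_mult_def mat_star_def mat_one_def)
  qed
  show "(\<Oplus>x'\<in>X. complex_of_real (dX x x') \<odot> E x' y) = (\<Oplus>y'\<in>Y. complex_of_real (dY y' y) \<odot> E x y')"
    if xy: "x \<in> X" "y \<in> Y" for x y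
  proof -
    have "(\<Oplus>x'\<in>X. complex_of_real (dX x x') \<odot> E x' y) = (\<Oplus>x'\<in>X. (complex_of_real (dX x x') \<odot> \<one>) \<otimes> E x' y)"
      by (rule finsum_cong') (use E xy in \<open>auto simp: smult_mult_left\<close>)
    also have "\<dots> = (\<Oplus>y'\<in>Y. E x y' \<otimes> (complex_of_real (dY y' y) \<odot> \<one>))"
      using assms(1) xy by (simp add: quantum_isometry_matrix_def mat_eq_def mat_mult_def scalar_mat_def)
    also have "\<dots> = (\<Oplus>y'\<in>Y. complex_of_real (dY y' y) \<odot> E x y')"
      by (rule finsum_cong') (use E xy in \<open>auto simp: smult_mult_right\<close>)
    finally show ?thesis .
  qed
qed

end

sublocale star_algebra \<subseteq> complex_algebra
  by unfold_locales (auto simp: smult_mult_left smult_mult_right)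

lemma (in operator_rep) complex_algebra: "complex_algebra A"
  by (intro complex_algebra.intro module ring complex_algebra_axioms.intro smult_mult_left smult_mult_right)

section \<open>Positive functionals on a star-algebra\<close>

context star_algebra begin

definition positive_functional :: "('a \<Rightarrow> complex) \<Rightarrow> bool" where
  "positive_functional \<tau> \<longleftrightarrow> linear_functional \<tau> \<and>
     (\<forall>x\<in>carrier A. Im (\<tau> (star A x \<otimes> x)) = 0 \<and> 0 \<le> Re (\<tau> (star A x \<otimes> x)))"

text \<open>The Cauchy-Schwarz argument with the test elements
  \<open>star A b \<oplus> t \<odot> z\<close>, whose quadratic term in \<open>t\<close> is 0 by
  assumption.\<close>

lemma positive_functional_null:
  assumes \<tau>: "positive_functional \<tau>" and z: "z \<in> carrier A" and null: "\<tau> (star A z \<otimes> z) = 0" and b: "b \<in> carrier A"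
  shows "\<tau> (b \<otimes> z) = 0"
proof -
  have lin: "\<tau> (x \<oplus> y) = \<tau> x + \<tau> y" "\<tau> (c \<odot> x) = c * \<tau> x" if "x \<in> carrier A" "y \<in> carrier A" for x y c
    using \<tau> that by (auto simp: positive_functional_def linear_functional_def)
  define u where "u = \<tau> (b \<otimes> z)"
  define v where "v = \<tau> (star A z \<otimes> star A b)"
  define p where "p = \<tau> (b \<otimes> star A b)"
  have G: "Im (p + t * u + cnj t * v) = 0 \<and> 0 \<le> Re (p + t * u + cnj t * v)" for t
  proof -
    let ?w = "star A b \<oplus> t \<odot> z"
    have sw: "star A ?w = b \<oplus> cnj t \<odot> star A z"
      using b z by (simp add: star_add star_smult star_star star_closed)
    have "star A ?w \<otimes> ?w = (b \<otimes> star A b \<oplus> t \<odot> (b \<otimes> z)) \<oplus> (cnj t \<odot> (star A z \<otimes> star A b) \<oplus> (t * cnj t) \<odot> (star A z \<otimes> z))"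
      unfolding sw using b z by (simp add: l_distr r_distr star_closed smult_mult_left smult_mult_right a_ac mult.commute)
    then have "\<tau> (star A ?w \<otimes> ?w) = p + t * u + cnj t * v"
      using b z null by (simp add: lin star_closed p_def u_def v_def)
    moreover have "?w \<in> carrier A" using b z by (simp add: star_closed)
    ultimately show ?thesis using \<tau> unfolding positive_functional_def by metis
  qed
  have p: "Im p = 0" using G[of 0] by simp
  \<comment> \<open>Positivity includes that the values are real. The parameters 1 and
    \<open>\<i>\<close> therefore show that the two mixed terms are conjugate to each other;
    Hermitian symmetry of \<tau> is thus derived where it is used.\<close>
  have "Im (u + v) = 0" using G[of 1] p by simp
  moreover have "Re (u - v) = 0" using G[of \<i>] p by simp
  ultimately have v: "v = cnj u" by (auto simp: complex_eq_iff)
  have "(cmod u)\<^sup>2 \<le> Re p * 0"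
  proof (rule quadratic_nonneg_imp)
    show "0 \<le> Re p + 2 * Re (t * u) + (cmod t)\<^sup>2 * 0" for t using G[of t] by (simp add: v)
  qed simp
  then show ?thesis by (simp add: u_def)
qed

text \<open>Without a C*-norm, projections summing up to \<open>1\<close> need not be orthogonal, but their
  products are null for every positive functional.\<close>

lemma positive_functional_orthogonal:
  assumes \<tau>: "positive_functional \<tau>" and I: "finite I" "i \<in> I" "j \<in> I" "i \<noteq> j"
    and P: "\<And>k. k \<in> I \<Longrightarrow> P k \<in> carrier A" "\<And>k. k \<in> I \<Longrightarrow> P k \<otimes> P k = P k" "\<And>k. k \<in> I \<Longrightarrow> star A (P k) = P k"
    and sum: "(\<Oplus>k\<in>I. P k) = \<one>" and b: "b \<in> carrier A" and c: "c \<in> carrier A"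
  shows "\<tau> (b \<otimes> (P i \<otimes> (P j \<otimes> c))) = 0"
proof -
  define q where "q = star A c \<otimes> P j"
  have [simp]: "star A c \<in> carrier A" using c star_closed by simp
  have q: "q \<in> carrier A" "P j \<otimes> c \<in> carrier A" using c P I by (auto simp: q_def)
  \<comment> \<open>Each \<open>N (P k)\<close> is nonnegative, being the value of \<tau> at
    \<open>z* z\<close> for \<open>z = P k P j c\<close>. As \<open>N\<close> takes the same value
    at the unit and at \<open>P j\<close>, the sum over the other indices is 0.\<close>
  define N where "N = (\<lambda>a. \<tau> (q \<otimes> (a \<otimes> (P j \<otimes> c))))"
  have N: "linear_functional N"
    unfolding N_def using \<tau> q by (intro linear_functional_mult) (auto simp: positive_functional_def)
  have Nk: "N (P k) = \<tau> (star A (P k \<otimes> (P j \<otimes> c)) \<otimes> (P k \<otimes> (P j \<otimes> c)))" if k: "k \<in> I" for k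
  proof -
    have "star A (P k \<otimes> (P j \<otimes> c)) = q \<otimes> P k"
      using P I k c by (simp add: star_mult q_def)
    moreover have "(q \<otimes> P k) \<otimes> (P k \<otimes> (P j \<otimes> c)) = q \<otimes> ((P k \<otimes> P k) \<otimes> (P j \<otimes> c))"
      using q P(1)[OF k] by (simp add: m_assoc)
    ultimately show ?thesis using P(2)[OF k] by (simp add: N_def)
  qed
  have pos: "Im (N (P k)) = 0 \<and> 0 \<le> Re (N (P k))" if k: "k \<in> I" for k
    unfolding Nk[OF k] using \<tau> P(1)[OF k] q by (simp add: positive_functional_def)
  have "N (\<Oplus>k\<in>I. P k) = (\<Sum>k\<in>I. N (P k))"
    by (rule linear_functional_finsum[OF N I(1)]) (use P in auto)
  moreover have "N \<one> = N (P j)"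
  proof -
    have "P j \<otimes> (P j \<otimes> c) = P j \<otimes> c" using P I c by (simp add: m_assoc [symmetric])
    then show ?thesis using q by (simp add: N_def)
  qed
  ultimately have "N (P j) = N (P j) + (\<Sum>k\<in>I - {j}. N (P k))"
    using sum sum.remove[OF I(1) I(3), of "\<lambda>k. N (P k)"] by simp
  then have "(\<Sum>k\<in>I - {j}. Re (N (P k))) = 0" by (simp flip: Re_sum)
  then have "Re (N (P i)) = 0" using pos I by (subst (asm) sum_nonneg_eq_0_iff) auto
  then have "N (P i) = 0" using pos[OF I(2)] by (simp add: complex_eq_iff)
  then show ?thesis
    using positive_functional_null[OF \<tau> _ _ b, of "P i \<otimes> (P j \<otimes> c)"] Nk[OF I(2)] P(1)[OF I(2)] q by simp
qed

end

theorem qc_isometric_imp_functional: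
  assumes "qc_isometric TYPE('c) X dX Y dY" and fin: "finite X" "finite Y"
  shows "\<exists>\<psi>. isometry_functional X dX Y dY \<psi> \<and> \<psi> [] = 1"
proof -
  obtain A :: "'c cstar_algebra" and \<tau> E where A: "cstar_algebra A" and \<tau>: "tracial_state A \<tau>"
    and E: "quantum_isometry_matrix A X dX Y dY E"
    using assms(1) unfolding qc_isometric_def by blast
  interpret cstar_algebra A by (rule A)
  note R = quantum_isometry_matrix_relations[OF E fin]
  have L: "linear_functional \<tau>"
    using \<tau> by (auto simp: tracial_state_def linear_functional_def)
  have pos: "positive_functional \<tau>"
    using \<tau> L by (auto simp: tracial_state_def positive_functional_def)
  have wp: "word_prod E (u @ p # q # v) = word_prod E u \<otimes>\<^bsub>A\<^esub> (E (fst p) (snd p) \<otimes>\<^bsub>A\<^esub> (E (fst q) (snd q) \<otimes>\<^bsub>A\<^esub> word_prod E v))"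
    if "set u \<subseteq> X \<times> Y" "set (p # q # v) \<subseteq> X \<times> Y" for u p q v
    using word_prod_append[OF R(1) that] by simp
  have wc: "word_prod E u \<in> carrier A" if "set u \<subseteq> X \<times> Y" for u
    by (rule word_prod_closed[OF R(1) that])
  have "isometry_functional X dX Y dY (\<lambda>w. if set w \<subseteq> X \<times> Y then \<tau> (word_prod E w) else 0)" (is "isometry_functional _ _ _ _ ?\<psi>")
  proof (rule isometry_functional_word_prod[OF fin R(1) R(2) R(4) R(5) R(6) L])
    fix u v :: "('a \<times> 'b) list" and x y y'
    assume "set u \<subseteq> X \<times> Y" "set v \<subseteq> X \<times> Y" "x \<in> X" "y \<in> Y" "y' \<in> Y" "y \<noteq> y'"
    then show "\<tau> (word_prod E (u @ (x, y) # (x, y') # v)) = 0"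
      using positive_functional_orthogonal[OF pos fin(2), of y y' "E x" "word_prod E u" "word_prod E v"] R
      by (simp add: wp wc)
  next
    fix u v :: "('a \<times> 'b) list" and x x' y
    assume "set u \<subseteq> X \<times> Y" "set v \<subseteq> X \<times> Y" "x \<in> X" "x' \<in> X" "y \<in> Y" "x \<noteq> x'"
    then show "\<tau> (word_prod E (u @ (x, y) # (x', y) # v)) = 0"
      using positive_functional_orthogonal[OF pos fin(1), of x x' "\<lambda>x. E x y" "word_prod E u" "word_prod E v"] R
      by (simp add: wp wc)
  qed
  moreover have "\<tau> \<one>\<^bsub>A\<^esub> = 1" using \<tau> by (simp add: tracial_state_def)
  ultimately show ?thesis by (intro exI[of _ ?\<psi>] conjI) simp_all
qed

text \<open>The operators \<open>P i\<close> are only known to equal the value of a definite description, which is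
  the same junk operator for all operators without adjoint; but then the sum of the \<open>P i\<close> could
  not be the identity.  So no completeness is needed for the existence of the adjoints.\<close>

lemma (in hilbert_space) self_adjoint_of_sum:
  assumes I: "finite I" and P: "\<And>i. i \<in> I \<Longrightarrow> P i \<in> ops" "\<And>i. i \<in> I \<Longrightarrow> adjoint_operator H (P i) = P i"
    and sum: "\<And>x. x \<in> carrier H \<Longrightarrow> (\<Oplus>i\<in>I. P i x) = x"
    and i: "i \<in> I" and xy: "x \<in> carrier H" "y \<in> carrier H"
  shows "cinner H (P i x) y = cinner H x (P i y)"
proof -
  define adj where "adj = (\<lambda>T. \<exists>S\<in>ops. \<forall>x\<in>carrier H. \<forall>y\<in>carrier H. cinner H (T x) y = cinner H x (S y))"
  have sym: "cinner H (P i x) y = cinner H x (P i y)" if "i \<in> I" "adj (P i)" "x \<in> carrier H" "y \<in> carrier H" for i x y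
  proof -
    have "adj (P i)" by fact
    then obtain S where S: "S \<in> ops" "\<And>x y. x \<in> carrier H \<Longrightarrow> y \<in> carrier H \<Longrightarrow> cinner H (P i x) y = cinner H x (S y)"
      unfolding adj_def by blast
    have "S = P i" using adjoint_unique[OF S] P(2)[OF that(1)] by simp
    then show ?thesis using S(2)[OF that(3,4)] by simp
  qed
  define J where "J = {i \<in> I. \<not> adj (P i)}"
  define T0 :: "'a \<Rightarrow> 'a" where "T0 = (THE S. False)"
  have J: "P i = T0" if "i \<in> J" for i
  proof -
    have no: "\<not> (S \<in> ops \<and> (\<forall>x\<in>carrier H. \<forall>y\<in>carrier H. cinner H (P i x) y = cinner H x (S y)))" for S
      using that by (auto simp: J_def adj_def)
    have "adjoint_operator H (P i) = T0"
      unfolding adjoint_operator_def T0_def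
      by (rule arg_cong[where f = The], rule ext) (use no in blast)
    then show ?thesis using P(2) that by (simp add: J_def)
  qed
  have "J = {}"
  proof (rule ccontr)
    assume "J \<noteq> {}"
    then obtain k where k: "k \<in> J" by blast
    have fJ: "finite J" "J \<subseteq> I" using I by (auto simp: J_def)
    \<comment> \<open>The identity is symmetric and so are the summands outside of \<open>J\<close>;
      what remains is \<open>card J\<close> times the common operator \<open>T0\<close>. So
      \<open>T0\<close> is its own adjoint, against the definition of \<open>J\<close>.\<close>
    have "cinner H (T0 x) y = cinner H x (T0 y)" if x: "x \<in> carrier H" and y: "y \<in> carrier H" for x y
    proof -
      have "(\<Sum>i\<in>I. cinner H x (P i y)) = cinner H x y"
        using cinner_finsum[OF I, of "\<lambda>i. P i y" x] P(1) x y sum[OF y] by simp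
      moreover have "(\<Sum>i\<in>I. cinner H (P i x) y) = cinner H x y"
      proof -
        have "(\<Sum>i\<in>I. cinner H (P i x) y) = cnj (\<Sum>i\<in>I. cinner H y (P i x))"
          using P(1) x y by (simp add: cinner_cnj[symmetric])
        also have "(\<Sum>i\<in>I. cinner H y (P i x)) = cinner H y x"
          using cinner_finsum[OF I, of "\<lambda>i. P i x" y] P(1) x y sum[OF x] by simp
        finally show ?thesis using cinner_cnj[OF y x] by simp
      qed
      moreover have "(\<Sum>i\<in>I - J. cinner H x (P i y)) = (\<Sum>i\<in>I - J. cinner H (P i x) y)"
        using sym x y by (intro sum.cong) (auto simp: J_def)
      ultimately have "(\<Sum>i\<in>J. cinner H x (P i y)) = (\<Sum>i\<in>J. cinner H (P i x) y)"
        using sum.subset_diff[OF fJ(2) I, of "\<lambda>i. cinner H x (P i y)"] sum.subset_diff[OF fJ(2) I, of "\<lambda>i. cinner H (P i x) y"]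
        by (metis add_left_cancel)
      then have "of_nat (card J) * cinner H x (T0 y) = of_nat (card J) * cinner H (T0 x) y" by (simp add: J)
      moreover have "card J \<noteq> 0" using k fJ by auto
      ultimately show ?thesis by simp
    qed
    moreover have "T0 \<in> ops" using P(1)[of k] k by (simp add: J [symmetric]) (simp add: J_def)
    ultimately have "adj (P k)" unfolding adj_def J[OF k] by (intro bexI[of _ T0] ballI)
    then show False using k by (simp add: J_def)
  qed
  then show ?thesis using sym[OF i _ xy] i by (auto simp: J_def)
qed

text \<open>For \<open>y = P j x\<close> the squared norms of the \<open>P k y\<close> add up to
  that of \<open>y\<close>, and the summand \<open>k = j\<close> already accounts for all of
  it.\<close>

lemma (in hilbert_space) orthogonal_of_sum:
  assumes I: "finite I" and P: "\<And>i. i \<in> I \<Longrightarrow> P i \<in> ops" "\<And>i. i \<in> I \<Longrightarrow> adjoint_operator H (P i) = P i"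
    and idem: "\<And>i x. i \<in> I \<Longrightarrow> x \<in> carrier H \<Longrightarrow> P i (P i x) = P i x"
    and sum: "\<And>x. x \<in> carrier H \<Longrightarrow> (\<Oplus>i\<in>I. P i x) = x"
    and ij: "i \<in> I" "j \<in> I" "i \<noteq> j" and x: "x \<in> carrier H"
  shows "P i (P j x) = \<zero>"
proof -
  have sa: "cinner H (P k v) w = cinner H v (P k w)" if "k \<in> I" "v \<in> carrier H" "w \<in> carrier H" for k v w
    by (rule self_adjoint_of_sum[of I P]) (use I P sum that in auto)
  let ?y = "P j x"
  have y: "?y \<in> carrier H" using P ij x by simp
  have sq: "cinner H ?y (P k ?y) = cinner H (P k ?y) (P k ?y)" if k: "k \<in> I" for k
    using sa[OF k y, of "P k ?y"] idem[OF k y] P(1)[OF k] y by simp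
  have "(\<Sum>k\<in>I. cinner H (P k ?y) (P k ?y)) = cinner H ?y ?y"
    using cinner_finsum[OF I, of "\<lambda>k. P k ?y" ?y] P(1) y sum[OF y] by (simp add: sq)
  then have "(\<Sum>k\<in>I - {j}. cinner H (P k ?y) (P k ?y)) = 0"
    using sum.remove[OF I ij(2), of "\<lambda>k. cinner H (P k ?y) (P k ?y)"] idem[OF ij(2) x] by simp
  then have "(\<Sum>k\<in>I - {j}. Re (cinner H (P k ?y) (P k ?y))) = 0" by (simp flip: Re_sum)
  then have "Re (cinner H (P i ?y) (P i ?y)) = 0"
    using P(1) y I ij by (subst (asm) sum_nonneg_eq_0_iff) (auto simp: cinner_nonneg)
  then have "cinner H (P i ?y) (P i ?y) = 0"
    using cinner_self[of "P i ?y"] P(1)[OF ij(1)] y by (simp add: complex_eq_iff del: of_real_power)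
  then show ?thesis using cinner_eq_zero[of "P i ?y"] P(1)[OF ij(1)] y by simp
qed

theorem cstar_isometric_imp_functional:
  assumes "cstar_isometric TYPE('h) X dX Y dY" and fin: "finite X" "finite Y"
  shows "\<exists>\<psi>. isometry_functional X dX Y dY \<psi> \<and> \<psi> [] = 1"
proof -
  obtain H :: "'h hilbert_space" and E where H: "hilbert_space H" "carrier H \<noteq> {\<zero>\<^bsub>H\<^esub>}"
    and E: "quantum_isometry_matrix (operator_algebra H) X dX Y dY E"
    using assms(1) unfolding cstar_isometric_def by blast
  interpret hilbert_space H by (rule H)
  interpret rep: operator_rep H "operator_algebra H" "\<lambda>T. T" by (rule operator_rep_self)
  interpret B: complex_algebra "operator_algebra H" by (rule rep.complex_algebra)
  note R = B.quantum_isometry_matrix_relations[OF E fin]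
  have Eops: "E x y \<in> ops" if "x \<in> X" "y \<in> Y" for x y using R(1)[OF that] by simp
  obtain \<xi> where \<xi>: "\<xi> \<in> carrier H" "\<xi> \<noteq> \<zero>\<^bsub>H\<^esub>" using H(2) zero_closed by blast
  have n\<xi>: "cinner H \<xi> \<xi> \<noteq> 0" using \<xi> cinner_eq_zero by simp
  \<comment> \<open>Any nonzero vector serves; dividing by its squared norm makes the value at the
    empty word 1.\<close>
  define \<omega> where "\<omega> = (\<lambda>T. cinner H \<xi> (T \<xi>) / cinner H \<xi> \<xi>)"
  have L: "B.linear_functional \<omega>"
    using \<xi> by (auto simp: B.linear_functional_def \<omega>_def cinner_add cinner_smult add_divide_distrib)
  have idem: "E x y (E x y h) = E x y h" if "x \<in> X" "y \<in> Y" "h \<in> carrier H" for x y h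
    using fun_cong[OF R(2)[OF that(1,2)], of h] that(3) by (simp add: compose_def)
  have row: "(\<Oplus>\<^bsub>H\<^esub>y\<in>Y. E x y h) = h" if "x \<in> X" "h \<in> carrier H" for x h
    using rep.rep_finsum[OF fin(2), of "E x" h] R(4)[OF that(1)] that Eops by simp
  have col: "(\<Oplus>\<^bsub>H\<^esub>x\<in>X. E x y h) = h" if "y \<in> Y" "h \<in> carrier H" for y h
    using rep.rep_finsum[OF fin(1), of "\<lambda>x. E x y" h] R(5)[OF that(1)] that Eops by simp
  have adj: "adjoint_operator H (E x y) = E x y" if "x \<in> X" "y \<in> Y" for x y
    using R(3)[OF that] by simp
  have zero: "\<omega> (B.word_prod E (u @ p # q # v)) = 0"
    if u: "set u \<subseteq> X \<times> Y" and pqv: "set (p # q # v) \<subseteq> X \<times> Y"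
      and orth: "\<And>h. h \<in> carrier H \<Longrightarrow> E (fst p) (snd p) (E (fst q) (snd q) h) = \<zero>\<^bsub>H\<^esub>" for u v p q
  proof -
    have Wu: "B.word_prod E u \<in> carrier (operator_algebra H)" by (rule B.word_prod_closed[OF R(1) u])
    have Wv: "B.word_prod E v \<in> carrier (operator_algebra H)"
      by (rule B.word_prod_closed[OF R(1)]) (use pqv in auto)
    have "B.word_prod E (p # q # v) = \<zero>\<^bsub>operator_algebra H\<^esub>"
    proof (rule rep.faithful)
      show "B.word_prod E (p # q # v) \<in> carrier (operator_algebra H)"
        by (rule B.word_prod_closed[OF R(1) pqv])
      show "B.word_prod E (p # q # v) h = \<zero>\<^bsub>operator_algebra H\<^esub> h" if "h \<in> carrier H" for h
        using that orth Wv by (simp add: compose_def)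
    qed (rule B.zero_closed)
    then have "B.word_prod E (u @ p # q # v) = \<zero>\<^bsub>operator_algebra H\<^esub>"
      using B.word_prod_append[OF R(1) u pqv] B.r_null[OF Wu] by simp
    then show ?thesis using B.linear_functional_zero[OF L] by simp
  qed
  have "isometry_functional X dX Y dY (\<lambda>w. if set w \<subseteq> X \<times> Y then \<omega> (B.word_prod E w) else 0)" (is "isometry_functional _ _ _ _ ?\<psi>")
  proof (rule B.isometry_functional_word_prod[OF fin R(1) R(2) R(4) R(5) R(6) L])
    fix u v :: "('a \<times> 'b) list" and x y y'
    assume *: "set u \<subseteq> X \<times> Y" "set v \<subseteq> X \<times> Y" "x \<in> X" "y \<in> Y" "y' \<in> Y" "y \<noteq> y'"
    show "\<omega> (B.word_prod E (u @ (x, y) # (x, y') # v)) = 0"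
      by (rule zero) (use * orthogonal_of_sum[OF fin(2), of "E x"] Eops adj idem row in auto)
  next
    fix u v :: "('a \<times> 'b) list" and x x' y
    assume *: "set u \<subseteq> X \<times> Y" "set v \<subseteq> X \<times> Y" "x \<in> X" "x' \<in> X" "y \<in> Y" "x \<noteq> x'"
    show "\<omega> (B.word_prod E (u @ (x, y) # (x', y) # v)) = 0"
      by (rule zero) (use * orthogonal_of_sum[OF fin(1), of "\<lambda>x. E x y"] Eops adj idem col in auto)
  qed
  moreover have "\<omega> (B.word_prod E []) = 1" using n\<xi> \<xi> by (simp add: \<omega>_def)
  ultimately show ?thesis by (intro exI[of _ ?\<psi>] conjI) simp_all
qed

section \<open>Reproducing kernel Hilbert spaces\<close>

text \<open>A list is a formal finite combination of points, paired antilinearly with a function.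
  Repeated points are harmless, so addition is concatenation and no quotient has to be
  formed.\<close>

definition pairing :: "(complex \<times> 'i) list \<Rightarrow> ('i \<Rightarrow> complex) \<Rightarrow> complex" where
  "pairing c f = (\<Sum>(a, w)\<leftarrow>c. cnj a * f w)"

definition scale :: "complex \<Rightarrow> (complex \<times> 'i) list \<Rightarrow> (complex \<times> 'i) list" where
  "scale s c = map (map_prod ((*) s) id) c"

lemma pairing_simps [simp]:
  "pairing [] f = 0"
  "pairing ((a, w) # c) f = cnj a * f w + pairing c f"
  "pairing (c @ d) f = pairing c f + pairing d f"
  by (simp_all add: pairing_def)

lemma pairing_add: "pairing c (\<lambda>w. f w + g w) = pairing c f + pairing c g"
  by (induction c) (auto simp: algebra_simps)

lemma pairing_smult: "pairing c (\<lambda>w. s * f w) = s * pairing c f"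
  by (induction c) (auto simp: algebra_simps)

lemma pairing_diff: "pairing c (\<lambda>w. f w - g w) = pairing c f - pairing c g"
  by (induction c) (auto simp: algebra_simps)

lemma pairing_uminus: "pairing c (\<lambda>w. - f w) = - pairing c f"
  by (induction c) auto

lemma pairing_zero [simp]: "pairing c (\<lambda>w. 0) = 0"
  by (induction c) auto

lemma pairing_scale [simp]: "pairing (scale s c) f = cnj s * pairing c f"
  by (induction c) (auto simp: algebra_simps scale_def)

lemma pairing_map: "pairing (map (map_prod id \<sigma>) c) f = pairing c (\<lambda>w. f (\<sigma> w))"
  by (induction c) auto

lemma pairing_cnj: "pairing (map (map_prod cnj \<sigma>) c) f = cnj (pairing c (\<lambda>w. cnj (f (\<sigma> w))))"
  by (induction c) auto

lemma tendsto_pairing: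
  assumes "\<And>w. (\<lambda>n. f n w) \<longlonglongrightarrow> g w"
  shows "(\<lambda>n. pairing c (f n)) \<longlonglongrightarrow> pairing c g"
  by (induction c) (auto intro!: tendsto_intros assms)

locale positive_kernel =
  fixes K :: "'i \<Rightarrow> 'i \<Rightarrow> complex"
  assumes hermitian: "cnj (K v w) = K w v"
    and positive: "0 \<le> Re (pairing c (\<lambda>v. cnj (pairing c (\<lambda>w. K w v))))"
begin

text \<open>The combination \<open>c\<close> of kernel functions: by Hermitian symmetry of
  \<open>K\<close> a pair \<open>(a, w)\<close> contributes \<open>a * K v w\<close> at
  \<open>v\<close>.\<close>

definition synth :: "(complex \<times> 'i) list \<Rightarrow> 'i \<Rightarrow> complex" where
  "synth c = (\<lambda>v. cnj (pairing c (\<lambda>w. K w v)))"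

definition qform :: "(complex \<times> 'i) list \<Rightarrow> real" where
  "qform c = Re (pairing c (synth c))"

lemma synth_Nil: "synth [] = (\<lambda>v. 0)"
  by (simp add: synth_def)

lemma synth_single: "synth [(1, w)] = (\<lambda>v. K v w)"
  by (simp add: synth_def hermitian)

lemma synth_append: "synth (c @ d) = (\<lambda>v. synth c v + synth d v)"
  by (auto simp: synth_def)

lemma synth_scale: "synth (scale s c) = (\<lambda>v. s * synth c v)"
  by (auto simp: synth_def)

lemma synth_swap: "cnj (pairing c (synth d)) = pairing d (synth c)"
proof (induction c)
  case Nil then show ?case by (simp add: synth_Nil)
next
  case (Cons p c)
  obtain a w where p: "p = (a, w)" by (cases p)
  have "synth (p # c) = (\<lambda>v. a * K v w + synth c v)" by (auto simp: p synth_def hermitian)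
  moreover have "pairing d (\<lambda>v. K v w) = cnj (synth d w)" by (simp add: synth_def)
  ultimately show ?case using Cons by (simp add: p pairing_add pairing_smult)
qed

lemma pairing_synth_self: "pairing c (synth c) = of_real (qform c)"
  using synth_swap[of c c] by (auto simp: qform_def complex_eq_iff)

lemma qform_nonneg: "0 \<le> qform c"
  using positive[of c] by (simp add: qform_def synth_def)

lemma qform_append: "qform (c @ d) = qform c + qform d + 2 * Re (pairing c (synth d))"
proof -
  have "Re (pairing d (synth c)) = Re (pairing c (synth d))"
    using synth_swap[of c d] by (metis complex_cnj(1) complex.sel(1) complex_surj)
  then show ?thesis by (simp add: qform_def synth_append pairing_add)
qed

lemma qform_scale: "qform (scale s c) = (cmod s)\<^sup>2 * qform c"
proof -
  have "cnj s * s = of_real ((cmod s)\<^sup>2)" unfolding complex_norm_square by (rule mult.commute)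
  have "qform (scale s c) = Re ((cnj s * s) * of_real (qform c))"
    unfolding qform_def[of "scale s c"] by (simp add: synth_scale pairing_smult pairing_synth_self algebra_simps)
  also have "\<dots> = (cmod s)\<^sup>2 * qform c"
    unfolding \<open>cnj s * s = _\<close> of_real_mult [symmetric] by (rule Re_complex_of_real)
  finally show ?thesis .
qed

text \<open>Membership in the reproducing kernel space, equivalent to boundedness of pairing with
  \<open>f\<close> in the seminorm \<open>sqrt (qform c)\<close>. In this form the completion
  consists of functions, and limits of equivalence classes do not occur.\<close>

definition rkhs_bounded :: "('i \<Rightarrow> complex) \<Rightarrow> bool" where
  "rkhs_bounded f \<longleftrightarrow> (\<exists>C. \<forall>c. 2 * Re (pairing c f) - qform c \<le> C)"

text \<open>The squared norm of \<open>f\<close>, since \<open>2 Re \<langle>c, f\<rangle> - \<parallel>c\<parallel>\<^sup>2 = \<parallel>f\<parallel>\<^sup>2 - \<parallel>f - c\<parallel>\<^sup>2\<close>.\<close>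

definition sqnorm :: "('i \<Rightarrow> complex) \<Rightarrow> real" where
  "sqnorm f = (SUP c. 2 * Re (pairing c f) - qform c)"

definition nrm :: "('i \<Rightarrow> complex) \<Rightarrow> real" where
  "nrm f = sqrt (sqnorm f)"

lemma sqnorm_upper:
  assumes "rkhs_bounded f"
  shows "2 * Re (pairing c f) - qform c \<le> sqnorm f"
proof -
  have "bdd_above (range (\<lambda>c. 2 * Re (pairing c f) - qform c))"
    using assms by (auto simp: rkhs_bounded_def bdd_above_def)
  then show ?thesis unfolding sqnorm_def by (rule cSUP_upper[rotated]) simp
qed

lemma sqnorm_least:
  assumes "\<And>c. 2 * Re (pairing c f) - qform c \<le> C"
  shows "rkhs_bounded f" "sqnorm f \<le> C"
proof -
  show "rkhs_bounded f" using assms by (auto simp: rkhs_bounded_def)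
  show "sqnorm f \<le> C" unfolding sqnorm_def by (rule cSUP_least) (use assms in auto)
qed

lemma sqnorm_nonneg: "rkhs_bounded f \<Longrightarrow> 0 \<le> sqnorm f"
  using sqnorm_upper[of f "[]"] by (simp add: qform_def)

lemma nrm_nonneg: "rkhs_bounded f \<Longrightarrow> 0 \<le> nrm f"
  by (simp add: nrm_def sqnorm_nonneg)

lemma cauchy_schwarz:
  assumes f: "rkhs_bounded f"
  shows "cmod (pairing c f) \<le> nrm f * sqrt (qform c)"
proof -
  define z where "z = pairing c f"
  define q where "q = qform c"
  have q0: "q \<ge> 0" by (simp add: q_def qform_nonneg)
  \<comment> \<open>The supremum is tested on the multiples \<open>t * z\<close> of
    \<open>c\<close>. The best choice is \<open>t = 1 / q\<close>; for \<open>q = 0\<close> a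
    sufficiently large \<open>t\<close> would exceed the supremum unless \<open>z\<close> is
    0.\<close>
  have key: "2 * t * (cmod z)\<^sup>2 - t\<^sup>2 * (cmod z)\<^sup>2 * q \<le> sqnorm f" for t :: real
  proof -
    have "cnj (of_real t * z) * z = of_real (t * (cmod z)\<^sup>2)"
      by (simp only: complex_cnj_mult complex_cnj_complex_of_real of_real_mult complex_norm_square mult_ac)
    then have "Re (pairing (scale (of_real t * z) c) f) = t * (cmod z)\<^sup>2"
      by (metis pairing_scale z_def Re_complex_of_real)
    moreover have "qform (scale (of_real t * z) c) = t\<^sup>2 * (cmod z)\<^sup>2 * q"
      by (simp add: qform_scale norm_mult power_mult_distrib q_def)
    ultimately show ?thesis using sqnorm_upper[OF f, of "scale (of_real t * z) c"] by simp
  qed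
  have "(cmod z)\<^sup>2 \<le> sqnorm f * q"
  proof (cases "z = 0")
    case True then show ?thesis using q0 sqnorm_nonneg[OF f] by simp
  next
    case nz: False
    show ?thesis
    proof (cases "q = 0")
      case True
      have "2 * ((sqnorm f + 1) / (cmod z)\<^sup>2) * (cmod z)\<^sup>2 \<le> sqnorm f"
        using key[of "(sqnorm f + 1) / (cmod z)\<^sup>2"] True by simp
      then show ?thesis using nz sqnorm_nonneg[OF f] by simp
    next
      case False
      then have "(cmod z)\<^sup>2 / q \<le> sqnorm f"
        using key[of "1 / q"] by (simp add: power2_eq_square)
      then show ?thesis using False q0 by (simp add: field_simps)
    qed
  qed
  then have "sqrt ((cmod z)\<^sup>2) \<le> sqrt (sqnorm f * q)" by (rule real_sqrt_le_mono)
  then show ?thesis by (simp add: nrm_def real_sqrt_mult z_def q_def)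
qed

lemma nrm_least:
  assumes "0 \<le> C" "\<And>c. cmod (pairing c f) \<le> C * sqrt (qform c)"
  shows "rkhs_bounded f" "nrm f \<le> C"
proof -
  have *: "2 * Re (pairing c f) - qform c \<le> C\<^sup>2" for c
  proof -
    have "2 * Re (pairing c f) \<le> 2 * C * sqrt (qform c)"
      using complex_Re_le_cmod[of "pairing c f"] assms(2)[of c] by linarith
    moreover have "0 \<le> (C - sqrt (qform c))\<^sup>2" by simp
    ultimately show ?thesis using qform_nonneg[of c] by (simp add: power2_diff)
  qed
  show "rkhs_bounded f" by (rule sqnorm_least[OF *])
  show "nrm f \<le> C" unfolding nrm_def
    using sqnorm_least(2)[OF *] assms(1) by (simp add: real_le_lsqrt)
qed

lemma bounded_zero: "rkhs_bounded (\<lambda>w. 0)" and nrm_zero: "nrm (\<lambda>w. 0) = 0"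
proof -
  have *: "cmod (pairing c (\<lambda>w. 0)) \<le> 0 * sqrt (qform c)" for c by simp
  show "rkhs_bounded (\<lambda>w. 0)" by (rule nrm_least[OF _ *]) simp
  then show "nrm (\<lambda>w. 0) = 0" using nrm_least(2)[OF _ *] nrm_nonneg by (meson dual_order.antisym order_refl)
qed

lemma bounded_add: "rkhs_bounded f \<Longrightarrow> rkhs_bounded g \<Longrightarrow> rkhs_bounded (\<lambda>w. f w + g w)"
  and nrm_triangle: "rkhs_bounded f \<Longrightarrow> rkhs_bounded g \<Longrightarrow> nrm (\<lambda>w. f w + g w) \<le> nrm f + nrm g"
proof -
  assume f: "rkhs_bounded f" and g: "rkhs_bounded g"
  have *: "cmod (pairing c (\<lambda>w. f w + g w)) \<le> (nrm f + nrm g) * sqrt (qform c)" for c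
    using cauchy_schwarz[OF f, of c] cauchy_schwarz[OF g, of c] norm_triangle_ineq[of "pairing c f" "pairing c g"]
    by (simp add: pairing_add distrib_right)
  have "0 \<le> nrm f + nrm g" using nrm_nonneg f g by simp
  from nrm_least[OF this *] show "rkhs_bounded (\<lambda>w. f w + g w)" "nrm (\<lambda>w. f w + g w) \<le> nrm f + nrm g" by auto
qed

lemma bounded_smult: "rkhs_bounded f \<Longrightarrow> rkhs_bounded (\<lambda>w. s * f w)"
  and nrm_smult_le: "rkhs_bounded f \<Longrightarrow> nrm (\<lambda>w. s * f w) \<le> cmod s * nrm f"
proof -
  assume f: "rkhs_bounded f"
  have *: "cmod (pairing c (\<lambda>w. s * f w)) \<le> (cmod s * nrm f) * sqrt (qform c)" for c
    using cauchy_schwarz[OF f, of c] by (simp add: pairing_smult norm_mult mult.assoc mult_left_mono)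
  have "0 \<le> cmod s * nrm f" using nrm_nonneg f by simp
  from nrm_least[OF this *] show "rkhs_bounded (\<lambda>w. s * f w)" "nrm (\<lambda>w. s * f w) \<le> cmod s * nrm f" by auto
qed

lemma bounded_diff: "rkhs_bounded f \<Longrightarrow> rkhs_bounded g \<Longrightarrow> rkhs_bounded (\<lambda>w. f w - g w)"
  using bounded_add[OF _ bounded_smult[of g "-1"], of f] by simp

lemma nrm_commute: "rkhs_bounded f \<Longrightarrow> rkhs_bounded g \<Longrightarrow> nrm (\<lambda>w. f w - g w) = nrm (\<lambda>w. g w - f w)"
  using nrm_smult_le[of "\<lambda>w. f w - g w" "-1"] nrm_smult_le[of "\<lambda>w. g w - f w" "-1"]
  by (simp add: bounded_diff)

lemma nrm_triangle3:
  assumes "rkhs_bounded f" "rkhs_bounded g" "rkhs_bounded h"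
  shows "nrm (\<lambda>w. f w - h w) \<le> nrm (\<lambda>w. f w - g w) + nrm (\<lambda>w. g w - h w)"
  using nrm_triangle[OF bounded_diff[OF assms(1,2)] bounded_diff[OF assms(2,3)]] by simp

lemma pairing_single: "pairing [(1, w)] f = f w"
  by simp

lemma value_le: "rkhs_bounded f \<Longrightarrow> cmod (f w) \<le> nrm f * sqrt (Re (K w w))"
  using cauchy_schwarz[of f "[(1, w)]"] by (simp add: qform_def synth_single)

lemma nrm_eq_zero: "rkhs_bounded f \<Longrightarrow> nrm f = 0 \<Longrightarrow> f = (\<lambda>w. 0)"
proof (rule ext)
  fix w assume "rkhs_bounded f" "nrm f = 0"
  then have "cmod (f w) \<le> 0" using value_le[of f w] by simp
  then show "f w = 0" by simp
qed

lemma bounded_synth: "rkhs_bounded (synth c)" and nrm_synth: "nrm (synth c) = sqrt (qform c)"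
proof -
  have *: "2 * Re (pairing d (synth c)) - qform d \<le> qform c" for d
  proof -
    have "qform (d @ scale (-1) c) = qform d + qform c - 2 * Re (pairing d (synth c))"
      by (simp add: qform_append qform_scale synth_scale pairing_uminus)
    then show ?thesis using qform_nonneg[of "d @ scale (-1) c"] by simp
  qed
  show b: "rkhs_bounded (synth c)" by (rule sqnorm_least[OF *])
  have "sqnorm (synth c) = qform c"
    using sqnorm_least(2)[OF *] sqnorm_upper[OF b, of c] by (simp add: pairing_synth_self)
  then show "nrm (synth c) = sqrt (qform c)" by (simp add: nrm_def)
qed

text \<open>A near-maximiser \<open>c\<close> of the supremum in \<open>sqnorm\<close> is a good
  approximation: testing on \<open>d @ c\<close> shows that the squared distance is at most the
  defect. Half of the square of \<open>e\<close> leaves room for the strict inequality.\<close>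

lemma ex_approximation:
  assumes f: "rkhs_bounded f" and "e > 0"
  shows "\<exists>c. nrm (\<lambda>w. f w - synth c w) < e"
proof -
  have "\<exists>c. sqnorm f - e\<^sup>2 / 2 < 2 * Re (pairing c f) - qform c"
  proof (rule ccontr)
    assume "\<not> ?thesis"
    then have "sqnorm f \<le> sqnorm f - e\<^sup>2 / 2" by (intro sqnorm_least(2)) (auto simp: not_less)
    then show False using assms by simp
  qed
  then obtain c where c: "sqnorm f - e\<^sup>2 / 2 < 2 * Re (pairing c f) - qform c" by blast
  have "2 * Re (pairing d (\<lambda>w. f w - synth c w)) - qform d \<le> e\<^sup>2 / 2" for d
    using sqnorm_upper[OF f, of "d @ c"] c by (simp add: pairing_diff qform_append)
  from sqnorm_least(2)[OF this] have "sqnorm (\<lambda>w. f w - synth c w) < e\<^sup>2"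
    using \<open>e > 0\<close> by (smt (verit) field_sum_of_halves zero_less_power)
  then show ?thesis
    using \<open>e > 0\<close> by (auto simp: nrm_def real_less_lsqrt intro!: exI[of _ c])
qed

definition approx :: "('i \<Rightarrow> complex) \<Rightarrow> nat \<Rightarrow> (complex \<times> 'i) list" where
  "approx f n = (SOME c. nrm (\<lambda>w. f w - synth c w) < inverse (real (Suc n)))"

lemma approx: "rkhs_bounded f \<Longrightarrow> nrm (\<lambda>w. f w - synth (approx f n) w) < inverse (real (Suc n))"
  unfolding approx_def by (rule someI_ex, rule ex_approximation) auto

lemma approx_tendsto:
  assumes "rkhs_bounded f"
  shows "(\<lambda>n. nrm (\<lambda>w. f w - synth (approx f n) w)) \<longlonglongrightarrow> 0"
proof (rule tendsto_sandwich[OF _ _ tendsto_const LIMSEQ_inverse_real_of_nat])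
  show "\<forall>\<^sub>F n in sequentially. 0 \<le> nrm (\<lambda>w. f w - synth (approx f n) w)"
    using assms by (simp add: nrm_nonneg bounded_diff bounded_synth)
  show "\<forall>\<^sub>F n in sequentially. nrm (\<lambda>w. f w - synth (approx f n) w) \<le> inverse (real (Suc n))"
    using approx[OF assms] by (simp add: less_imp_le)
qed

text \<open>On finite combinations the inner product with \<open>g\<close> is plain
  \<open>pairing\<close>. The left argument is replaced by its approximations, whose pairings form a
  Cauchy sequence by \<open>pairing_diff_le\<close>.\<close>

definition inner :: "('i \<Rightarrow> complex) \<Rightarrow> ('i \<Rightarrow> complex) \<Rightarrow> complex" where
  "inner f g = lim (\<lambda>n. pairing (approx f n) g)"

lemma pairing_diff_le:
  assumes g: "rkhs_bounded g"
  shows "cmod (pairing c g - pairing d g) \<le> nrm g * nrm (\<lambda>w. synth c w - synth d w)"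
proof -
  have "synth (c @ scale (-1) d) = (\<lambda>w. synth c w - synth d w)"
    by (auto simp: synth_append synth_scale)
  then show ?thesis
    using cauchy_schwarz[OF g, of "c @ scale (-1) d"] nrm_synth[of "c @ scale (-1) d"] by simp
qed

lemma inner_tendsto:
  assumes f: "rkhs_bounded f" and g: "rkhs_bounded g"
  shows "(\<lambda>n. pairing (approx f n) g) \<longlonglongrightarrow> inner f g"
proof -
  have "Cauchy (\<lambda>n. pairing (approx f n) g)"
  proof (rule metric_CauchyI)
    fix e :: real assume e: "e > 0"
    define d where "d = e / (2 * (nrm g + 1))"
    have d: "d > 0" using e nrm_nonneg[OF g] by (simp add: d_def)
    obtain M where M: "\<And>n. n \<ge> M \<Longrightarrow> nrm (\<lambda>w. f w - synth (approx f n) w) < d"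
      using order_tendstoD(2)[OF approx_tendsto[OF f] d] by (auto simp: eventually_sequentially)
    have "dist (pairing (approx f m) g) (pairing (approx f n) g) < e" if "m \<ge> M" "n \<ge> M" for m n
    proof -
      have "nrm (\<lambda>w. synth (approx f m) w - synth (approx f n) w) \<le> d + d"
        using nrm_triangle3[OF bounded_synth f bounded_synth, of "approx f m" "approx f n"]
          nrm_commute[OF f bounded_synth, of "approx f m"] M[OF that(1)] M[OF that(2)] by simp
      then have "nrm g * nrm (\<lambda>w. synth (approx f m) w - synth (approx f n) w) \<le> nrm g * (d + d)"
        using nrm_nonneg[OF g] by (rule mult_left_mono)
      also have "d + d = e / (nrm g + 1)" unfolding d_def by (metis mult_2 mult_2_right divide_divide_eq_left field_sum_of_halves mult.commute)
      also have "nrm g * (e / (nrm g + 1)) < e"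
        using e nrm_nonneg[OF g] by (simp add: pos_divide_less_eq algebra_simps)
      finally show ?thesis
        using pairing_diff_le[OF g, of "approx f m" "approx f n"] by (simp add: dist_norm)
    qed
    then show "\<exists>M. \<forall>m\<ge>M. \<forall>n\<ge>M. dist (pairing (approx f m) g) (pairing (approx f n) g) < e" by blast
  qed
  then show ?thesis
    unfolding inner_def by (simp add: Cauchy_convergent_iff convergent_LIMSEQ_iff)
qed

lemma inner_add:
  assumes "rkhs_bounded f" "rkhs_bounded g" "rkhs_bounded h"
  shows "inner f (\<lambda>w. g w + h w) = inner f g + inner f h"
  using LIMSEQ_unique[OF inner_tendsto[OF assms(1) bounded_add[OF assms(2,3)], unfolded pairing_add]
    tendsto_add[OF inner_tendsto[OF assms(1,2)] inner_tendsto[OF assms(1,3)]]] .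

lemma inner_smult:
  assumes "rkhs_bounded f" "rkhs_bounded g"
  shows "inner f (\<lambda>w. s * g w) = s * inner f g"
  using LIMSEQ_unique[OF inner_tendsto[OF assms(1) bounded_smult[OF assms(2)], unfolded pairing_smult]
    tendsto_mult[OF tendsto_const inner_tendsto[OF assms]]] .

lemma qform_approx_tendsto:
  assumes f: "rkhs_bounded f"
  shows "(\<lambda>n. sqrt (qform (approx f n))) \<longlonglongrightarrow> nrm f"
proof -
  have "\<bar>sqrt (qform (approx f n)) - nrm f\<bar> \<le> nrm (\<lambda>w. f w - synth (approx f n) w)" for n
    using nrm_triangle[OF bounded_diff[OF f bounded_synth] bounded_synth, of "approx f n" "approx f n"]
      nrm_triangle[OF bounded_diff[OF bounded_synth f] f, of "approx f n"]
      nrm_commute[OF f bounded_synth, of "approx f n"]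
    by (simp add: nrm_synth [symmetric])
  then have "(\<lambda>n. sqrt (qform (approx f n)) - nrm f) \<longlonglongrightarrow> 0"
    by (intro Lim_null_comparison[OF _ approx_tendsto[OF f]]) simp
  then show ?thesis by (rule LIM_zero_cancel)
qed

text \<open>Approximating both arguments makes the expression symmetric, so that Hermitian symmetry
  and the value at equal arguments pass to the limit from finite combinations.\<close>

lemma inner_tendsto':
  assumes f: "rkhs_bounded f" and g: "rkhs_bounded g"
  shows "(\<lambda>n. pairing (approx f n) (synth (approx g n))) \<longlonglongrightarrow> inner f g"
proof -
  have le: "cmod (pairing (approx f n) (synth (approx g n)) - pairing (approx f n) g)
      \<le> nrm (\<lambda>w. g w - synth (approx g n) w) * sqrt (qform (approx f n))" for n
    using cauchy_schwarz[OF bounded_diff[OF g bounded_synth], of "approx f n" "approx g n"]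
    by (simp add: pairing_diff norm_minus_commute)
  have "(\<lambda>n. nrm (\<lambda>w. g w - synth (approx g n) w) * sqrt (qform (approx f n))) \<longlonglongrightarrow> 0 * nrm f"
    by (intro tendsto_mult approx_tendsto qform_approx_tendsto f g)
  then have "(\<lambda>n. nrm (\<lambda>w. g w - synth (approx g n) w) * sqrt (qform (approx f n))) \<longlonglongrightarrow> 0"
    by (simp only: mult_zero_left)
  then have "(\<lambda>n. pairing (approx f n) (synth (approx g n)) - pairing (approx f n) g) \<longlonglongrightarrow> 0"
    by (rule Lim_null_comparison[OF always_eventually[OF allI[OF le]]])
  from tendsto_add[OF this inner_tendsto[OF f g]] show ?thesis by simp
qed

lemma inner_cnj:
  assumes "rkhs_bounded f" "rkhs_bounded g"
  shows "inner g f = cnj (inner f g)"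
  using LIMSEQ_unique[OF inner_tendsto'[OF assms(2,1)] tendsto_cnj[OF inner_tendsto'[OF assms], unfolded synth_swap]] .

lemma inner_self:
  assumes f: "rkhs_bounded f"
  shows "inner f f = of_real ((nrm f)\<^sup>2)"
proof -
  have "(\<lambda>n. complex_of_real ((sqrt (qform (approx f n)))\<^sup>2)) \<longlonglongrightarrow> of_real ((nrm f)\<^sup>2)"
    by (intro tendsto_of_real tendsto_power qform_approx_tendsto f)
  then have "(\<lambda>n. pairing (approx f n) (synth (approx f n))) \<longlonglongrightarrow> of_real ((nrm f)\<^sup>2)"
    by (simp add: pairing_synth_self qform_nonneg)
  with inner_tendsto'[OF f f] show ?thesis by (rule LIMSEQ_unique)
qed

lemma inner_synth:
  assumes f: "rkhs_bounded f"
  shows "inner (synth c) f = pairing c f"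
proof -
  let ?c = "approx (synth c)"
  have le: "cmod (pairing (?c n) f - pairing c f) \<le> nrm f * nrm (\<lambda>w. synth c w - synth (?c n) w)" for n
    using pairing_diff_le[OF f, of "?c n" c] nrm_commute[OF bounded_synth bounded_synth, of "?c n" c] by simp
  have "(\<lambda>n. nrm f * nrm (\<lambda>w. synth c w - synth (?c n) w)) \<longlonglongrightarrow> nrm f * 0"
    by (intro tendsto_mult tendsto_const approx_tendsto bounded_synth)
  then have "(\<lambda>n. nrm f * nrm (\<lambda>w. synth c w - synth (?c n) w)) \<longlonglongrightarrow> 0"
    by (simp only: mult_zero_right)
  then have "(\<lambda>n. pairing (?c n) f - pairing c f) \<longlonglongrightarrow> 0"
    by (rule Lim_null_comparison[OF always_eventually[OF allI[OF le]]])
  then have "(\<lambda>n. pairing (?c n) f) \<longlonglongrightarrow> pairing c f" by (rule LIM_zero_cancel)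
  from LIMSEQ_unique[OF inner_tendsto[OF bounded_synth f] this] show ?thesis .
qed

text \<open>Evaluation at a point is continuous, so a Cauchy sequence converges pointwise; the norm
  bounds survive in the limit because a pairing involves only finitely many points.\<close>

lemma rkhs_complete:
  assumes F: "\<And>n. rkhs_bounded (F n)"
    and C: "\<And>e. e > 0 \<Longrightarrow> \<exists>M. \<forall>m\<ge>M. \<forall>n\<ge>M. nrm (\<lambda>w. F m w - F n w) < e"
  shows "\<exists>f. rkhs_bounded f \<and> (\<lambda>n. nrm (\<lambda>w. F n w - f w)) \<longlonglongrightarrow> 0"
proof -
  have "Cauchy (\<lambda>n. F n w)" for w
  proof (rule metric_CauchyI)
    fix e :: real assume e: "e > 0"
    define r where "r = sqrt (Re (K w w)) + 1"
    have "sqrt (Re (K w w)) \<ge> 0" using qform_nonneg[of "[(1, w)]"] by (simp add: qform_def synth_single)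
    then have r: "r > 0" unfolding r_def by linarith
    obtain M where M: "\<And>m n. m \<ge> M \<Longrightarrow> n \<ge> M \<Longrightarrow> nrm (\<lambda>w. F m w - F n w) < e / r"
      using C[of "e / r"] e r by auto
    have "dist (F m w) (F n w) < e" if "m \<ge> M" "n \<ge> M" for m n
    proof -
      have "dist (F m w) (F n w) \<le> nrm (\<lambda>w. F m w - F n w) * sqrt (Re (K w w))"
        using value_le[OF bounded_diff[OF F[of m] F[of n]], of w] by (simp add: dist_norm)
      also have "\<dots> \<le> nrm (\<lambda>w. F m w - F n w) * r"
        using nrm_nonneg[OF bounded_diff[OF F F]] by (intro mult_left_mono) (simp_all add: r_def)
      also have "\<dots> < e" using M[OF that] r by (simp add: field_simps)
      finally show ?thesis .
    qed
    then show "\<exists>M. \<forall>m\<ge>M. \<forall>n\<ge>M. dist (F m w) (F n w) < e" by blast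
  qed
  then have "\<exists>f. \<forall>w. (\<lambda>n. F n w) \<longlonglongrightarrow> f w"
    by (auto simp: Cauchy_convergent_iff convergent_def intro: choice)
  then obtain f where f: "\<And>w. (\<lambda>n. F n w) \<longlonglongrightarrow> f w" by blast
  have lim: "rkhs_bounded (\<lambda>w. F n w - f w) \<and> nrm (\<lambda>w. F n w - f w) \<le> e"
    if e: "e > 0" and M: "\<And>m. m \<ge> M \<Longrightarrow> nrm (\<lambda>w. F n w - F m w) \<le> e" for e n M
  proof -
    have "cmod (pairing c (\<lambda>w. F n w - f w)) \<le> e * sqrt (qform c)" for c
    proof (rule LIMSEQ_le_const2)
      show "(\<lambda>m. cmod (pairing c (\<lambda>w. F n w - F m w))) \<longlonglongrightarrow> cmod (pairing c (\<lambda>w. F n w - f w))"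
        by (intro tendsto_norm tendsto_pairing tendsto_diff tendsto_const f)
      have "cmod (pairing c (\<lambda>w. F n w - F m w)) \<le> e * sqrt (qform c)" if "m \<ge> M" for m
        using cauchy_schwarz[OF bounded_diff[OF F F], of c n m] M[OF that] qform_nonneg[of c]
        by (meson mult_right_mono order_trans real_sqrt_ge_zero)
      then show "\<exists>N. \<forall>m\<ge>N. cmod (pairing c (\<lambda>w. F n w - F m w)) \<le> e * sqrt (qform c)" by blast
    qed
    from nrm_least[OF _ this] e show ?thesis by simp
  qed
  obtain M1 where M1: "\<And>m n. m \<ge> M1 \<Longrightarrow> n \<ge> M1 \<Longrightarrow> nrm (\<lambda>w. F m w - F n w) < 1"
    using C[of 1] by auto
  have "rkhs_bounded (\<lambda>w. F M1 w - f w)" using lim[of 1 M1 M1] M1 by (auto simp: less_imp_le)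
  from bounded_diff[OF F[of M1] this] have fb: "rkhs_bounded f" by simp
  moreover have "(\<lambda>n. nrm (\<lambda>w. F n w - f w)) \<longlonglongrightarrow> 0"
  proof (rule LIMSEQ_I)
    fix e :: real assume e: "e > 0"
    obtain M where M: "\<And>m n. m \<ge> M \<Longrightarrow> n \<ge> M \<Longrightarrow> nrm (\<lambda>w. F m w - F n w) < e / 2"
      using C[of "e / 2"] e by auto
    have "norm (nrm (\<lambda>w. F n w - f w) - 0) < e" if "n \<ge> M" for n
      using lim[of "e / 2" M n] M[OF that] e nrm_nonneg[OF bounded_diff[OF F fb], of n]
      by (auto simp: less_imp_le)
    then show "\<exists>M. \<forall>n\<ge>M. norm (nrm (\<lambda>w. F n w - f w) - 0) < e" by blast
  qed
  ultimately show ?thesis by blast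
qed

end

section \<open>Shifts and reflections of a reproducing kernel space\<close>

context positive_kernel begin

lemma inner_bound:
  assumes f: "rkhs_bounded f" and g: "rkhs_bounded g"
  shows "cmod (inner f g) \<le> nrm f * nrm g"
proof (rule LIMSEQ_le)
  show "(\<lambda>n. cmod (pairing (approx f n) g)) \<longlonglongrightarrow> cmod (inner f g)"
    by (intro tendsto_norm inner_tendsto f g)
  show "(\<lambda>n. sqrt (qform (approx f n)) * nrm g) \<longlonglongrightarrow> nrm f * nrm g"
    by (intro tendsto_mult tendsto_const qform_approx_tendsto f)
  show "\<exists>N. \<forall>n\<ge>N. cmod (pairing (approx f n) g) \<le> sqrt (qform (approx f n)) * nrm g"
    using cauchy_schwarz[OF g] by (simp add: mult.commute)
qed

lemma inner_diff_left:
  assumes f: "rkhs_bounded f" and g: "rkhs_bounded g" and h: "rkhs_bounded h"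
  shows "inner (\<lambda>w. f w - g w) h = inner f h - inner g h"
proof -
  have "inner h (\<lambda>w. f w - g w) = inner h f - inner h g"
    using inner_add[OF h f bounded_smult[OF g, of "-1"]] inner_smult[OF h g, of "-1"] by simp
  then show ?thesis
    using inner_cnj[OF h bounded_diff[OF f g]] inner_cnj[OF h f] inner_cnj[OF h g] by simp
qed

text \<open>Reduces identities for a contractive map \<open>T\<close> to finite combinations.
  Contractivity is stated for differences, which covers linear and antilinear maps alike.\<close>

lemma inner_transform_tendsto:
  assumes f: "rkhs_bounded f" and g: "rkhs_bounded g"
    and T: "\<And>f. rkhs_bounded f \<Longrightarrow> rkhs_bounded (T f)"
    and le: "\<And>f g. rkhs_bounded f \<Longrightarrow> rkhs_bounded g \<Longrightarrow> nrm (\<lambda>w. T f w - T g w) \<le> nrm (\<lambda>w. f w - g w)"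
  shows "(\<lambda>n. inner (T (synth (approx f n))) g) \<longlonglongrightarrow> inner (T f) g"
proof -
  let ?s = "\<lambda>n. synth (approx f n)"
  have bound: "cmod (inner (T (?s n)) g - inner (T f) g) \<le> nrm (\<lambda>w. f w - ?s n w) * nrm g" for n
  proof -
    have "cmod (inner (T (?s n)) g - inner (T f) g) \<le> nrm (\<lambda>w. T (?s n) w - T f w) * nrm g"
      using inner_bound[OF bounded_diff[OF T[OF bounded_synth] T[OF f]] g]
      by (simp add: inner_diff_left[OF T[OF bounded_synth] T[OF f] g])
    also have "\<dots> \<le> nrm (\<lambda>w. f w - ?s n w) * nrm g"
      using le[OF bounded_synth f, of "approx f n"] nrm_commute[OF f bounded_synth, of "approx f n"] nrm_nonneg[OF g]
      by (intro mult_right_mono) simp_all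
    finally show ?thesis .
  qed
  have "(\<lambda>n. nrm (\<lambda>w. f w - ?s n w) * nrm g) \<longlonglongrightarrow> 0 * nrm g"
    by (intro tendsto_mult tendsto_const approx_tendsto f)
  then have "(\<lambda>n. nrm (\<lambda>w. f w - ?s n w) * nrm g) \<longlonglongrightarrow> 0" by (simp only: mult_zero_left)
  then have "(\<lambda>n. inner (T (?s n)) g - inner (T f) g) \<longlonglongrightarrow> 0"
    by (rule Lim_null_comparison[OF always_eventually[OF allI[OF bound]]])
  then show ?thesis by (rule LIM_zero_cancel)
qed

lemma inner_synth_right:
  assumes f: "rkhs_bounded f"
  shows "inner f (synth c) = cnj (pairing c f)"
  using inner_cnj[OF bounded_synth f, of c] inner_synth[OF f] by simp

lemma inner_approx_right:
  assumes "rkhs_bounded f" "rkhs_bounded g"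
  shows "(\<lambda>n. inner g (synth (approx f n))) \<longlonglongrightarrow> inner g f"
  unfolding inner_synth_right[OF assms(2)] inner_cnj[OF assms]
  by (intro tendsto_cnj inner_tendsto assms)

context
  fixes \<sigma> :: "'i \<Rightarrow> 'i"
  assumes sym: "K (\<sigma> v) w = K v (\<sigma> w)" and idem: "K (\<sigma> v) (\<sigma> w) = K v (\<sigma> w)"
begin

lemma synth_shift: "synth (map (map_prod id \<sigma>) c) = (\<lambda>v. synth c (\<sigma> v))"
proof
  have "K (\<sigma> w) v = K w (\<sigma> v)" for v w by (rule sym)
  then show "synth (map (map_prod id \<sigma>) c) v = synth c (\<sigma> v)" for v
    by (simp add: synth_def pairing_map)
qed

text \<open>The two conditions on \<sigma> say that the shift is a self-adjoint idempotent
  \<open>P\<close> on finite combinations. So the squared norm of \<open>P c\<close> is the inner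
  product of \<open>c\<close> with \<open>P c\<close>, and Cauchy-Schwarz bounds the norm of
  \<open>P c\<close> by that of \<open>c\<close>.\<close>

lemma qform_shift: "qform (map (map_prod id \<sigma>) c) \<le> qform c"
proof -
  let ?d = "map (map_prod id \<sigma>) c"
  have eq: "pairing ?d (synth ?d) = pairing c (synth ?d)"
  proof -
    have "synth c (\<sigma> (\<sigma> v)) = synth c (\<sigma> v)" for v
      using sym idem by (simp add: synth_def)
    then show ?thesis by (simp add: pairing_map synth_shift)
  qed
  have "qform ?d \<le> cmod (pairing c (synth ?d))"
    unfolding eq[symmetric] qform_def by (rule complex_Re_le_cmod)
  also have "\<dots> \<le> sqrt (qform ?d) * sqrt (qform c)"
    using cauchy_schwarz[OF bounded_synth, of c ?d] by (simp add: nrm_synth)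
  finally have le: "sqrt (qform ?d) * sqrt (qform ?d) \<le> sqrt (qform ?d) * sqrt (qform c)"
    by (simp add: qform_nonneg)
  show ?thesis
  proof (cases "qform ?d = 0")
    case True then show ?thesis by (simp add: qform_nonneg)
  next
    case False
    then have "sqrt (qform ?d) > 0" using qform_nonneg[of ?d] by simp
    then have "sqrt (qform ?d) \<le> sqrt (qform c)" using le by (simp only: mult_le_cancel_left_pos)
    then show ?thesis by simp
  qed
qed

lemma bounded_shift: "rkhs_bounded f \<Longrightarrow> rkhs_bounded (\<lambda>w. f (\<sigma> w))"
  and nrm_shift: "rkhs_bounded f \<Longrightarrow> nrm (\<lambda>w. f (\<sigma> w)) \<le> nrm f"
proof -
  assume f: "rkhs_bounded f"
  have *: "cmod (pairing c (\<lambda>w. f (\<sigma> w))) \<le> nrm f * sqrt (qform c)" for c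
  proof -
    have "cmod (pairing c (\<lambda>w. f (\<sigma> w))) \<le> nrm f * sqrt (qform (map (map_prod id \<sigma>) c))"
      using cauchy_schwarz[OF f, of "map (map_prod id \<sigma>) c"] by (simp add: pairing_map)
    also have "\<dots> \<le> nrm f * sqrt (qform c)"
      using qform_shift[of c] nrm_nonneg[OF f] by (intro mult_left_mono) simp_all
    finally show ?thesis .
  qed
  from nrm_least[OF nrm_nonneg[OF f] *]
  show "rkhs_bounded (\<lambda>w. f (\<sigma> w))" "nrm (\<lambda>w. f (\<sigma> w)) \<le> nrm f" by auto
qed

lemma inner_shift:
  assumes f: "rkhs_bounded f" and g: "rkhs_bounded g"
  shows "inner (\<lambda>w. f (\<sigma> w)) g = inner f (\<lambda>w. g (\<sigma> w))"
proof (rule LIMSEQ_unique)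
  show "(\<lambda>n. inner (\<lambda>w. synth (approx f n) (\<sigma> w)) g) \<longlonglongrightarrow> inner (\<lambda>w. f (\<sigma> w)) g"
    by (rule inner_transform_tendsto[OF f g, where T = "\<lambda>f w. f (\<sigma> w)"])
      (use bounded_shift nrm_shift[OF bounded_diff] in auto)
  have "inner (\<lambda>w. synth c (\<sigma> w)) g = pairing c (\<lambda>w. g (\<sigma> w))" for c
    unfolding synth_shift[symmetric] inner_synth[OF g] by (rule pairing_map)
  then show "(\<lambda>n. inner (\<lambda>w. synth (approx f n) (\<sigma> w)) g) \<longlonglongrightarrow> inner f (\<lambda>w. g (\<sigma> w))"
    using inner_tendsto[OF f bounded_shift[OF g]] by simp
qed

end

context
  fixes \<rho> :: "'i \<Rightarrow> 'i"
  assumes antisym: "K (\<rho> v) w = K (\<rho> w) v" and invol: "\<rho> (\<rho> v) = v"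
begin

lemma synth_reflect: "synth (map (map_prod cnj \<rho>) c) = (\<lambda>v. cnj (synth c (\<rho> v)))"
proof
  fix v
  have "cnj (K (\<rho> w) v) = K w (\<rho> v)" for w
    by (simp only: antisym[of w v] hermitian)
  then show "synth (map (map_prod cnj \<rho>) c) v = cnj (synth c (\<rho> v))"
    by (simp add: synth_def pairing_cnj)
qed

lemma qform_reflect: "qform (map (map_prod cnj \<rho>) c) = qform c"
  unfolding qform_def synth_reflect by (simp add: pairing_cnj invol)

lemma bounded_reflect: "rkhs_bounded f \<Longrightarrow> rkhs_bounded (\<lambda>w. cnj (f (\<rho> w)))"
  and nrm_reflect: "rkhs_bounded f \<Longrightarrow> nrm (\<lambda>w. cnj (f (\<rho> w))) \<le> nrm f"
proof -
  assume f: "rkhs_bounded f"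
  have *: "cmod (pairing c (\<lambda>w. cnj (f (\<rho> w)))) \<le> nrm f * sqrt (qform c)" for c
    using cauchy_schwarz[OF f, of "map (map_prod cnj \<rho>) c"] by (simp add: pairing_cnj qform_reflect)
  from nrm_least[OF nrm_nonneg[OF f] *]
  show "rkhs_bounded (\<lambda>w. cnj (f (\<rho> w)))" "nrm (\<lambda>w. cnj (f (\<rho> w))) \<le> nrm f" by auto
qed

text \<open>The reflection is an antiunitary involution \<open>J\<close>, and
  \<open>\<langle>J f, g\<rangle> = \<langle>J g, f\<rangle>\<close> holds for every such map. It is
  the source of the trace property in \<open>commutant_trace\<close>.\<close>

lemma inner_reflect:
  assumes f: "rkhs_bounded f" and g: "rkhs_bounded g"
  shows "inner (\<lambda>w. cnj (f (\<rho> w))) g = inner (\<lambda>w. cnj (g (\<rho> w))) f"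
proof (rule LIMSEQ_unique)
  show "(\<lambda>n. inner (\<lambda>w. cnj (synth (approx f n) (\<rho> w))) g) \<longlonglongrightarrow> inner (\<lambda>w. cnj (f (\<rho> w))) g"
    by (rule inner_transform_tendsto[OF f g, where T = "\<lambda>f w. cnj (f (\<rho> w))"])
      (use bounded_reflect nrm_reflect[OF bounded_diff] in auto)
  have "inner (\<lambda>w. cnj (synth c (\<rho> w))) g = inner (\<lambda>w. cnj (g (\<rho> w))) (synth c)" for c
    unfolding synth_reflect[symmetric] inner_synth[OF g] inner_synth_right[OF bounded_reflect[OF g]]
    by (rule pairing_cnj)
  then show "(\<lambda>n. inner (\<lambda>w. cnj (synth (approx f n) (\<rho> w))) g) \<longlonglongrightarrow> inner (\<lambda>w. cnj (g (\<rho> w))) f"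
    using inner_approx_right[OF f bounded_reflect[OF g]] by simp
qed

end

end

text \<open>\<^locale>\<open>Metric_space\<close> constrains the distance outside of the carrier as well, hence the
  normalisation \<open>\<nu>\<close>, through which the operation \<open>\<oplus>\<close> sees points outside of the carrier.\<close>

lemma (in abelian_group) Metric_space_of_norm:
  fixes N :: "'a \<Rightarrow> real"
  assumes nonneg: "\<And>x. x \<in> carrier G \<Longrightarrow> 0 \<le> N x"
    and zero: "\<And>x. x \<in> carrier G \<Longrightarrow> N x = 0 \<longleftrightarrow> x = \<zero>"
    and triangle: "\<And>x y. x \<in> carrier G \<Longrightarrow> y \<in> carrier G \<Longrightarrow> N (x \<oplus> y) \<le> N x + N y"
    and minus: "\<And>x. x \<in> carrier G \<Longrightarrow> N (\<ominus> x) = N x"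
    and \<nu>: "\<And>x. \<nu> x \<in> carrier G" "\<And>x. x \<in> carrier G \<Longrightarrow> \<nu> x = x" "\<And>x y. x \<oplus> y = \<nu> x \<oplus> \<nu> y"
  shows "Metric_space (carrier G) (\<lambda>x y. N (x \<ominus> y))"
proof -
  have inv: "\<ominus> y = \<ominus> \<nu> y" for y
  proof -
    have "\<nu> y \<oplus> z = \<nu> y \<oplus> \<nu> z" "z \<oplus> \<nu> y = \<nu> z \<oplus> \<nu> y" for z
      using \<nu>(3)[of "\<nu> y" z] \<nu>(3)[of z "\<nu> y"] \<nu>(2)[OF \<nu>(1)] by simp_all
    then have "y \<oplus> z = \<nu> y \<oplus> z" "z \<oplus> y = z \<oplus> \<nu> y" for z
      using \<nu>(3)[of y z] \<nu>(3)[of z y] by simp_all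
    then show ?thesis by (simp add: a_inv_def m_inv_def)
  qed
  have minus_\<nu>: "x \<ominus> y = \<nu> x \<ominus> \<nu> y" for x y
    unfolding a_minus_def inv[of y]
    using \<nu>(3)[of x "\<ominus> \<nu> y"] \<nu>(2)[OF a_inv_closed[OF \<nu>(1)]] by simp
  have flip: "\<ominus> (x \<ominus> y) = y \<ominus> x" if "x \<in> carrier G" "y \<in> carrier G" for x y
    using that by (simp add: a_minus_def minus_add a_comm)
  show ?thesis
  proof
    show "0 \<le> N (x \<ominus> y)" for x y unfolding minus_\<nu>[of x y] by (intro nonneg minus_closed \<nu>)
    show "N (x \<ominus> y) = N (y \<ominus> x)" for x y
      unfolding minus_\<nu>[of x y] minus_\<nu>[of y x]
      using minus[OF minus_closed[OF \<nu>(1) \<nu>(1)], of x y] flip[OF \<nu>(1) \<nu>(1), of x y] by simp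
    show "N (x \<ominus> y) = 0 \<longleftrightarrow> x = y" if "x \<in> carrier G" "y \<in> carrier G" for x y
      using zero[OF minus_closed[OF that]] that r_neg by (metis a_minus_def a_inv_closed minus_equality minus_minus)
    show "N (x \<ominus> z) \<le> N (x \<ominus> y) + N (y \<ominus> z)" if "x \<in> carrier G" "y \<in> carrier G" "z \<in> carrier G" for x y z
    proof -
      have "(x \<ominus> y) \<oplus> (y \<ominus> z) = x \<ominus> z"
        using that by (simp add: a_minus_def a_assoc) (simp add: a_assoc[symmetric] l_neg)
      then show ?thesis using triangle[OF minus_closed minus_closed, of x y y z] that by simp
    qed
  qed
qed

lemma mcomplete_of_sequences:
  assumes "Metric_space M d"
    and "\<And>s. range s \<subseteq> M \<Longrightarrow> (\<And>e. e > 0 \<Longrightarrow> \<exists>N. \<forall>m\<ge>N. \<forall>n\<ge>N. d (s m) (s n) < e) \<Longrightarrow>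
      \<exists>x\<in>M. (\<lambda>n. d (s n) x) \<longlonglongrightarrow> 0"
  shows "Metric_space.mcomplete M d"
proof -
  interpret Metric_space M d by (rule assms(1))
  show ?thesis unfolding mcomplete_def
  proof (intro allI impI)
    fix s assume s: "MCauchy s"
    have cau: "\<exists>N. \<forall>m\<ge>N. \<forall>n\<ge>N. d (s m) (s n) < e" if "e > 0" for e
      using s that unfolding MCauchy_def by meson
    have rs: "range s \<subseteq> M" using s by (simp add: MCauchy_def)
    obtain x where x: "x \<in> M" "(\<lambda>n. d (s n) x) \<longlonglongrightarrow> 0" using assms(2)[OF rs cau] by blast
    have "\<exists>N. \<forall>n\<ge>N. s n \<in> M \<and> d (s n) x < e" if "e > 0" for e
      using order_tendstoD(2)[OF x(2) that] rs by (auto simp: eventually_sequentially)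
    then have "limitin mtopology s x sequentially" using x(1) by (simp add: limit_metric_sequentially)
    then show "\<exists>x. limitin mtopology s x sequentially" by blast
  qed
qed

section \<open>The Hilbert space of the Haar functional\<close>

context operator_rep begin

lemma weak_eqI:
  assumes "a \<in> carrier A" "b \<in> carrier A"
    and "\<And>h k. h \<in> carrier H \<Longrightarrow> k \<in> carrier H \<Longrightarrow> cinner H k (\<pi> a h) = cinner H k (\<pi> b h)"
  shows "a = b"
  by (rule faithful[OF assms(1,2)], rule eqI_cinner) (use assms in auto)

lemma cinner_rep_finsum:
  assumes "finite I" "f \<in> I \<rightarrow> carrier A" "h \<in> carrier H" "k \<in> carrier H"
  shows "cinner H k (\<pi> (\<Oplus>\<^bsub>A\<^esub>i\<in>I. f i) h) = (\<Sum>i\<in>I. cinner H k (\<pi> (f i) h))"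
proof -
  have "(\<lambda>i. \<pi> (f i) h) \<in> I \<rightarrow> carrier H" by (intro Pi_I rep_in) (use assms in auto)
  then show ?thesis using cinner_finsum[OF assms(1) _ assms(4)] rep_finsum[OF assms(1-3)] by simp
qed

text \<open>For the distance equation both sides are expanded into the double sum of the products of
  \<open>E x y'\<close> and \<open>E x' y\<close>, by inserting a row sum on one side and a column
  sum on the other; a product survives only if \<open>dX x x' = dY y' y\<close>. Inner products turn
  the sums of operators into sums of numbers.\<close>

lemma quantum_isometry_matrixI:
  assumes fs: "finite_spaces X dX Y dY"
    and E: "\<And>x y. x \<in> X \<Longrightarrow> y \<in> Y \<Longrightarrow> E x y \<in> carrier A"
    and star: "\<And>x y. x \<in> X \<Longrightarrow> y \<in> Y \<Longrightarrow> star A (E x y) = E x y"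
    and idem: "\<And>x y h. x \<in> X \<Longrightarrow> y \<in> Y \<Longrightarrow> h \<in> carrier H \<Longrightarrow> \<pi> (E x y) (\<pi> (E x y) h) = \<pi> (E x y) h"
    and row: "\<And>x h k. x \<in> X \<Longrightarrow> h \<in> carrier H \<Longrightarrow> k \<in> carrier H \<Longrightarrow> (\<Sum>y\<in>Y. cinner H k (\<pi> (E x y) h)) = cinner H k h"
    and col: "\<And>y h k. y \<in> Y \<Longrightarrow> h \<in> carrier H \<Longrightarrow> k \<in> carrier H \<Longrightarrow> (\<Sum>x\<in>X. cinner H k (\<pi> (E x y) h)) = cinner H k h"
    and orth: "\<And>x y x' y' h. x \<in> X \<Longrightarrow> y \<in> Y \<Longrightarrow> x' \<in> X \<Longrightarrow> y' \<in> Y \<Longrightarrow> h \<in> carrier H \<Longrightarrow> dX x x' \<noteq> dY y y' \<Longrightarrow>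
      \<pi> (E x y) (\<pi> (E x' y') h) = \<zero>"
  shows "quantum_isometry_matrix A X dX Y dY E"
proof -
  interpret fs: finite_spaces X dX Y dY by (rule fs)
  interpret A: complex_algebra A by (rule complex_algebra)
  note [simp] = E star
  have proj: "projection A (E x y)" if "x \<in> X" "y \<in> Y" for x y
  proof -
    have "E x y \<otimes>\<^bsub>A\<^esub> E x y = E x y" by (rule faithful) (use that idem in \<open>auto simp: rep_mult\<close>)
    then show ?thesis using that by (simp add: projection_def)
  qed
  have u1: "(\<Oplus>\<^bsub>A\<^esub>y\<in>Y. E x y \<otimes>\<^bsub>A\<^esub> star A (E x' y)) = (if x = x' then \<one>\<^bsub>A\<^esub> else \<zero>\<^bsub>A\<^esub>)"
    if x: "x \<in> X" "x' \<in> X" for x x'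
  proof (rule weak_eqI)
    fix h k assume hk: "h \<in> carrier H" "k \<in> carrier H"
    have z: "\<pi> (E x y) (\<pi> (E x' y) h) = \<zero>" if "y \<in> Y" "x \<noteq> x'" for y
      using that x hk fs.zeroX[of x x'] fs.zeroY[of y y] by (intro orth) auto
    have "cinner H k (\<pi> (\<Oplus>\<^bsub>A\<^esub>y\<in>Y. E x y \<otimes>\<^bsub>A\<^esub> star A (E x' y)) h) = (\<Sum>y\<in>Y. cinner H k (\<pi> (E x y) (\<pi> (E x' y) h)))"
      using x hk by (subst cinner_rep_finsum) (auto simp: rep_mult)
    also have "\<dots> = cinner H k (\<pi> (if x = x' then \<one>\<^bsub>A\<^esub> else \<zero>\<^bsub>A\<^esub>) h)"
      using x hk z row[of x h k] by (auto simp: idem rep_one rep_zero)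
    finally show "cinner H k (\<pi> (\<Oplus>\<^bsub>A\<^esub>y\<in>Y. E x y \<otimes>\<^bsub>A\<^esub> star A (E x' y)) h) = cinner H k (\<pi> (if x = x' then \<one>\<^bsub>A\<^esub> else \<zero>\<^bsub>A\<^esub>) h)" .
  qed (use x in auto)
  have u2: "(\<Oplus>\<^bsub>A\<^esub>x\<in>X. star A (E x y) \<otimes>\<^bsub>A\<^esub> E x y') = (if y = y' then \<one>\<^bsub>A\<^esub> else \<zero>\<^bsub>A\<^esub>)"
    if y: "y \<in> Y" "y' \<in> Y" for y y'
  proof (rule weak_eqI)
    fix h k assume hk: "h \<in> carrier H" "k \<in> carrier H"
    have z: "\<pi> (E x y) (\<pi> (E x y') h) = \<zero>" if "x \<in> X" "y \<noteq> y'" for x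
      using that y hk fs.zeroX[of x x] fs.zeroY[of y y'] by (intro orth) auto
    have "cinner H k (\<pi> (\<Oplus>\<^bsub>A\<^esub>x\<in>X. star A (E x y) \<otimes>\<^bsub>A\<^esub> E x y') h) = (\<Sum>x\<in>X. cinner H k (\<pi> (E x y) (\<pi> (E x y') h)))"
      using y hk by (subst cinner_rep_finsum) (auto simp: rep_mult)
    also have "\<dots> = cinner H k (\<pi> (if y = y' then \<one>\<^bsub>A\<^esub> else \<zero>\<^bsub>A\<^esub>) h)"
      using y hk z col[of y h k] by (auto simp: idem rep_one rep_zero)
    finally show "cinner H k (\<pi> (\<Oplus>\<^bsub>A\<^esub>x\<in>X. star A (E x y) \<otimes>\<^bsub>A\<^esub> E x y') h) = cinner H k (\<pi> (if y = y' then \<one>\<^bsub>A\<^esub> else \<zero>\<^bsub>A\<^esub>) h)" .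
  qed (use y in auto)
  have d: "(\<Oplus>\<^bsub>A\<^esub>x'\<in>X. (complex_of_real (dX x x') \<odot>\<^bsub>A\<^esub> \<one>\<^bsub>A\<^esub>) \<otimes>\<^bsub>A\<^esub> E x' y) =
      (\<Oplus>\<^bsub>A\<^esub>y'\<in>Y. E x y' \<otimes>\<^bsub>A\<^esub> (complex_of_real (dY y' y) \<odot>\<^bsub>A\<^esub> \<one>\<^bsub>A\<^esub>))"
    if xy: "x \<in> X" "y \<in> Y" for x y
  proof (rule weak_eqI)
    fix h k assume hk: "h \<in> carrier H" "k \<in> carrier H"
    define m where "m = (\<lambda>x' y'. cinner H k (\<pi> (E x y') (\<pi> (E x' y) h)))"
    have "cinner H k (\<pi> (\<Oplus>\<^bsub>A\<^esub>x'\<in>X. (complex_of_real (dX x x') \<odot>\<^bsub>A\<^esub> \<one>\<^bsub>A\<^esub>) \<otimes>\<^bsub>A\<^esub> E x' y) h) =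
      (\<Sum>x'\<in>X. of_real (dX x x') * cinner H k (\<pi> (E x' y) h))"
      using xy hk by (subst cinner_rep_finsum) (auto simp: rep_mult rep_smult rep_one cinner_smult)
    also have "\<dots> = (\<Sum>x'\<in>X. \<Sum>y'\<in>Y. of_real (dX x x') * m x' y')"
      using xy hk row[of x _ k] by (simp add: m_def sum_distrib_left[symmetric])
    also have "\<dots> = (\<Sum>x'\<in>X. \<Sum>y'\<in>Y. of_real (dY y' y) * m x' y')"
    proof (intro sum.cong refl)
      fix x' y' assume "x' \<in> X" "y' \<in> Y"
      then have "m x' y' = 0" if "dX x x' \<noteq> dY y' y"
        using orth[OF xy(1) _ _ xy(2) hk(1) that] hk by (simp add: m_def)
      then show "of_real (dX x x') * m x' y' = of_real (dY y' y) * m x' y'" by (cases "dX x x' = dY y' y") auto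
    qed
    also have "\<dots> = (\<Sum>y'\<in>Y. of_real (dY y' y) * (\<Sum>x'\<in>X. m x' y'))"
      by (subst sum.swap) (simp add: sum_distrib_left)
    also have "\<dots> = (\<Sum>y'\<in>Y. of_real (dY y' y) * cinner H k (\<pi> (E x y') h))"
    proof (intro sum.cong refl arg_cong[where f = "\<lambda>z. _ * z"])
      fix y' assume y': "y' \<in> Y"
      define fx where "fx = (\<lambda>x'. \<pi> (E x' y) h)"
      have fx: "fx \<in> X \<rightarrow> carrier H" using xy hk by (auto simp: fx_def)
      have "(\<Oplus>x'\<in>X. fx x') = h"
        by (rule eqI_cinner) (use fx hk xy col in \<open>auto simp: cinner_finsum fx_def\<close>)
      then have "\<pi> (E x y') h = (\<Oplus>x'\<in>X. \<pi> (E x y') (fx x'))"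
        using op_finsum[OF rep_ops[OF E[OF xy(1) y']] fs.finite_X fx] by simp
      then show "(\<Sum>x'\<in>X. m x' y') = cinner H k (\<pi> (E x y') h)"
        using fx hk xy y' by (simp add: cinner_finsum m_def fx_def Pi_def)
    qed
    also have "\<dots> = cinner H k (\<pi> (\<Oplus>\<^bsub>A\<^esub>y'\<in>Y. E x y' \<otimes>\<^bsub>A\<^esub> (complex_of_real (dY y' y) \<odot>\<^bsub>A\<^esub> \<one>\<^bsub>A\<^esub>)) h)"
      using xy hk by (subst cinner_rep_finsum) (auto simp: rep_mult rep_smult rep_one cinner_smult op_smult[OF rep_ops])
    finally show "cinner H k (\<pi> (\<Oplus>\<^bsub>A\<^esub>x'\<in>X. (complex_of_real (dX x x') \<odot>\<^bsub>A\<^esub> \<one>\<^bsub>A\<^esub>) \<otimes>\<^bsub>A\<^esub> E x' y) h) =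
      cinner H k (\<pi> (\<Oplus>\<^bsub>A\<^esub>y'\<in>Y. E x y' \<otimes>\<^bsub>A\<^esub> (complex_of_real (dY y' y) \<odot>\<^bsub>A\<^esub> \<one>\<^bsub>A\<^esub>)) h)" .
  qed (use xy in auto)
  show ?thesis
    unfolding quantum_isometry_matrix_def unitary_mat_def mat_eq_def mat_mult_def mat_star_def mat_one_def scalar_mat_def
    using proj u1 u2 d by blast
qed

end

section \<open>Transport of the reproducing kernel space into a given type\<close>

locale rkhs_model = positive_kernel K for K :: "'i \<Rightarrow> 'i \<Rightarrow> complex" +
  fixes \<iota> :: "('i \<Rightarrow> complex) \<Rightarrow> 'h"
  assumes inj_\<iota>: "inj_on \<iota> {f. rkhs_bounded f}"
begin

text \<open>The zero function as default makes the operations of \<open>rkhs\<close> map all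
  arguments, inside the carrier or not, into the carrier; \<open>Metric_space_of_norm\<close> relies
  on this.\<close>

definition dec :: "'h \<Rightarrow> 'i \<Rightarrow> complex" where
  "dec h = (if h \<in> \<iota> ` {f. rkhs_bounded f} then inv_into {f. rkhs_bounded f} \<iota> h else (\<lambda>w. 0))"

lemma dec_\<iota> [simp]: "rkhs_bounded f \<Longrightarrow> dec (\<iota> f) = f"
  using inj_\<iota> by (simp add: dec_def)

lemma bounded_dec [simp]: "rkhs_bounded (dec h)"
  unfolding dec_def using inv_into_into[of h \<iota> "{f. rkhs_bounded f}"] by (simp add: bounded_zero)

definition rkhs :: "'h hilbert_space" where
  "rkhs = \<lparr>carrier = \<iota> ` {f. rkhs_bounded f}, mult = \<lambda>x y. x, one = \<iota> (\<lambda>w. 0), zero = \<iota> (\<lambda>w. 0),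
    add = \<lambda>x y. \<iota> (\<lambda>w. dec x w + dec y w), smult = \<lambda>c x. \<iota> (\<lambda>w. c * dec x w),
    cinner = \<lambda>x y. inner (dec x) (dec y)\<rparr>"

lemma rkhs_simps:
  "zero rkhs = \<iota> (\<lambda>w. 0)" "add rkhs x y = \<iota> (\<lambda>w. dec x w + dec y w)" "smult rkhs c x = \<iota> (\<lambda>w. c * dec x w)"
  "cinner rkhs x y = inner (dec x) (dec y)"
  by (simp_all add: rkhs_def)

lemma \<iota>_carrier [simp]: "rkhs_bounded f \<Longrightarrow> \<iota> f \<in> carrier rkhs"
  by (simp add: rkhs_def)

lemma \<iota>_dec [simp]: "x \<in> carrier rkhs \<Longrightarrow> \<iota> (dec x) = x"
  by (auto simp: rkhs_def)

lemma rkhs_eqI: "x \<in> carrier rkhs \<Longrightarrow> y \<in> carrier rkhs \<Longrightarrow> (\<And>w. dec x w = dec y w) \<Longrightarrow> x = y"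
  by (metis \<iota>_dec ext)

lemma dec_simps [simp]:
  "dec (\<zero>\<^bsub>rkhs\<^esub>) = (\<lambda>w. 0)" "dec (x \<oplus>\<^bsub>rkhs\<^esub> y) = (\<lambda>w. dec x w + dec y w)" "dec (c \<odot>\<^bsub>rkhs\<^esub> x) = (\<lambda>w. c * dec x w)"
  by (simp_all add: rkhs_simps bounded_zero bounded_add bounded_smult)

lemma rkhs_closed [simp]: "\<zero>\<^bsub>rkhs\<^esub> \<in> carrier rkhs" "x \<oplus>\<^bsub>rkhs\<^esub> y \<in> carrier rkhs" "c \<odot>\<^bsub>rkhs\<^esub> x \<in> carrier rkhs"
  by (simp_all add: rkhs_simps bounded_zero bounded_add bounded_smult)

lemma abelian_group_rkhs: "abelian_group rkhs"
proof (rule abelian_groupI)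
  show "\<exists>y\<in>carrier rkhs. y \<oplus>\<^bsub>rkhs\<^esub> x = \<zero>\<^bsub>rkhs\<^esub>" if "x \<in> carrier rkhs" for x
    by (rule bexI[of _ "(-1) \<odot>\<^bsub>rkhs\<^esub> x"]) (auto intro!: rkhs_eqI)
qed (auto intro!: rkhs_eqI simp: algebra_simps)

lemma hnorm_rkhs: "hnorm rkhs x = nrm (dec x)"
  by (simp add: hnorm_def rkhs_simps inner_self nrm_nonneg del: of_real_power)

lemma uminus_rkhs: "x \<in> carrier rkhs \<Longrightarrow> \<ominus>\<^bsub>rkhs\<^esub> x = (-1) \<odot>\<^bsub>rkhs\<^esub> x"
proof -
  interpret abelian_group rkhs by (rule abelian_group_rkhs)
  assume x: "x \<in> carrier rkhs"
  show ?thesis by (rule minus_equality[OF _ x]) (auto intro!: rkhs_eqI)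
qed

lemma dec_minus: "x \<in> carrier rkhs \<Longrightarrow> y \<in> carrier rkhs \<Longrightarrow> dec (x \<ominus>\<^bsub>rkhs\<^esub> y) = (\<lambda>w. dec x w - dec y w)"
  by (simp add: a_minus_def uminus_rkhs)

lemma Metric_space_rkhs: "Metric_space (carrier rkhs) (\<lambda>x y. hnorm rkhs (x \<ominus>\<^bsub>rkhs\<^esub> y))"
proof -
  interpret abelian_group rkhs by (rule abelian_group_rkhs)
  show ?thesis
  proof (rule Metric_space_of_norm[where \<nu> = "\<lambda>x. \<iota> (dec x)"])
    show "hnorm rkhs x = 0 \<longleftrightarrow> x = \<zero>\<^bsub>rkhs\<^esub>" if "x \<in> carrier rkhs" for x
      unfolding hnorm_rkhs using nrm_eq_zero[of "dec x"] that by (auto simp: nrm_zero intro!: rkhs_eqI)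
    show "hnorm rkhs (\<ominus>\<^bsub>rkhs\<^esub> x) = hnorm rkhs x" if "x \<in> carrier rkhs" for x
      using nrm_commute[OF bounded_zero bounded_dec, of x] that by (simp add: hnorm_rkhs uminus_rkhs)
    show "x \<oplus>\<^bsub>rkhs\<^esub> y = \<iota> (dec x) \<oplus>\<^bsub>rkhs\<^esub> \<iota> (dec y)" for x y by (simp add: rkhs_simps)
  qed (simp_all add: hnorm_rkhs nrm_nonneg nrm_triangle)
qed

lemma hilbert_space_rkhs: "hilbert_space rkhs"
proof (rule hilbert_space.intro)
  show "Module.module complex_ring rkhs"
    by (rule moduleI[OF cring_complex_ring abelian_group_rkhs]) (auto intro!: rkhs_eqI simp: algebra_simps)
  show "hilbert_space_axioms rkhs"
  proof
    show "Metric_space.mcomplete (carrier rkhs) (\<lambda>x y. hnorm rkhs (x \<ominus>\<^bsub>rkhs\<^esub> y))"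
    proof (rule mcomplete_of_sequences[OF Metric_space_rkhs])
      fix s :: "nat \<Rightarrow> 'h"
      assume s: "range s \<subseteq> carrier rkhs" and C: "\<And>e. e > 0 \<Longrightarrow> \<exists>N. \<forall>m\<ge>N. \<forall>n\<ge>N. hnorm rkhs (s m \<ominus>\<^bsub>rkhs\<^esub> s n) < e"
      have d: "hnorm rkhs (s m \<ominus>\<^bsub>rkhs\<^esub> x) = nrm (\<lambda>w. dec (s m) w - dec x w)" if "x \<in> carrier rkhs" for m x
      proof -
        have "s m \<in> carrier rkhs" using s by auto
        then show ?thesis using that by (simp add: hnorm_rkhs dec_minus)
      qed
      have d': "hnorm rkhs (s m \<ominus>\<^bsub>rkhs\<^esub> s n) = nrm (\<lambda>w. dec (s m) w - dec (s n) w)" for m n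
        by (rule d) (use s in auto)
      obtain f where f: "rkhs_bounded f" "(\<lambda>n. nrm (\<lambda>w. dec (s n) w - f w)) \<longlonglongrightarrow> 0"
        using rkhs_complete[of "\<lambda>n. dec (s n)"] C unfolding d' by auto
      then show "\<exists>x\<in>carrier rkhs. (\<lambda>n. hnorm rkhs (s n \<ominus>\<^bsub>rkhs\<^esub> x)) \<longlonglongrightarrow> 0"
        by (intro bexI[of _ "\<iota> f"]) (simp_all add: d)
    qed
    show "cinner rkhs x x = 0 \<longleftrightarrow> x = \<zero>\<^bsub>rkhs\<^esub>" if "x \<in> carrier rkhs" for x
      using nrm_eq_zero[of "dec x"] that inner_self[OF bounded_zero]
      by (auto simp: rkhs_simps(4) inner_self nrm_zero intro!: rkhs_eqI)
    show "0 \<le> Re (cinner rkhs x x)" if "x \<in> carrier rkhs" for x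
      by (simp add: rkhs_simps(4) inner_self del: of_real_power)
    show "cinner rkhs y x = cnj (cinner rkhs x y)" for x y
      unfolding rkhs_simps(4) by (rule inner_cnj) simp_all
  qed (simp_all add: rkhs_simps(4) inner_add inner_smult)
qed

sublocale H: hilbert_space rkhs by (rule hilbert_space_rkhs)

definition shift_op :: "('i \<Rightarrow> 'i) \<Rightarrow> 'h \<Rightarrow> 'h" where
  "shift_op \<sigma> = (\<lambda>h\<in>carrier rkhs. \<iota> (\<lambda>w. dec h (\<sigma> w)))"

lemma
  assumes "\<And>v w. K (\<sigma> v) w = K v (\<sigma> w)" and "\<And>v w. K (\<sigma> v) (\<sigma> w) = K v (\<sigma> w)"
  shows dec_shift_op: "h \<in> carrier rkhs \<Longrightarrow> dec (shift_op \<sigma> h) w = dec h (\<sigma> w)"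
    and shift_op_ops: "shift_op \<sigma> \<in> bounded_linear_operators rkhs"
    and cinner_shift_op: "h \<in> carrier rkhs \<Longrightarrow> k \<in> carrier rkhs \<Longrightarrow> cinner rkhs (shift_op \<sigma> h) k = cinner rkhs h (shift_op \<sigma> k)"
    and adjoint_shift_op: "adjoint_operator rkhs (shift_op \<sigma>) = shift_op \<sigma>"
proof -
  have b: "rkhs_bounded (\<lambda>w. dec h (\<sigma> w))" for h
    by (rule bounded_shift[OF assms bounded_dec])
  show dec: "dec (shift_op \<sigma> h) w = dec h (\<sigma> w)" if "h \<in> carrier rkhs" for h w
    using that b by (simp add: shift_op_def)
  have c: "shift_op \<sigma> h \<in> carrier rkhs" if "h \<in> carrier rkhs" for h
    using that b by (simp add: shift_op_def)
  show ops: "shift_op \<sigma> \<in> bounded_linear_operators rkhs"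
  proof (rule H.opsI[of _ 1])
    show "shift_op \<sigma> \<in> extensional (carrier rkhs)" by (simp add: shift_op_def)
    show "hnorm rkhs (shift_op \<sigma> h) \<le> 1 * hnorm rkhs h" if "h \<in> carrier rkhs" for h
      using nrm_shift[OF assms bounded_dec, of h] that b by (simp add: hnorm_rkhs shift_op_def)
  qed (auto intro!: rkhs_eqI simp: c dec)
  show ci: "cinner rkhs (shift_op \<sigma> h) k = cinner rkhs h (shift_op \<sigma> k)" if "h \<in> carrier rkhs" "k \<in> carrier rkhs" for h k
    using that inner_shift[OF assms bounded_dec bounded_dec, of h k] b by (simp add: rkhs_simps shift_op_def)
  show "adjoint_operator rkhs (shift_op \<sigma>) = shift_op \<sigma>"
    by (rule H.adjoint_unique[OF ops ci])
qed

end

section \<open>Operator norm and weak limits of operators\<close>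

context hilbert_space begin

lemma hnorm_le_of_cinner:
  assumes "y \<in> carrier H" "0 \<le> C" "\<And>k. k \<in> carrier H \<Longrightarrow> cmod (cinner H k y) \<le> C * hnorm H k"
  shows "hnorm H y \<le> C"
proof (cases "hnorm H y = 0")
  case False
  have "hnorm H y * hnorm H y \<le> C * hnorm H y"
    using assms(3)[OF assms(1)] by (simp add: cinner_self[OF assms(1)] norm_mult power2_eq_square assms(1))
  then show ?thesis using False hnorm_nonneg[OF assms(1)] by (simp add: mult_le_cancel_right)
qed (use assms in simp)

definition opnorm :: "('a \<Rightarrow> 'a) \<Rightarrow> real" where
  "opnorm T = Inf {K. 0 \<le> K \<and> (\<forall>x\<in>carrier H. hnorm H (T x) \<le> K * hnorm H x)}"

lemma opnorm_least: "0 \<le> K \<Longrightarrow> (\<And>x. x \<in> carrier H \<Longrightarrow> hnorm H (T x) \<le> K * hnorm H x) \<Longrightarrow> opnorm T \<le> K"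
  unfolding opnorm_def by (rule cInf_lower) (auto intro!: bdd_belowI[of _ 0])

lemma opnorm_set_nonempty:
  assumes "T \<in> ops"
  shows "{K. 0 \<le> K \<and> (\<forall>x\<in>carrier H. hnorm H (T x) \<le> K * hnorm H x)} \<noteq> {}"
proof -
  from op_bound[OF assms] obtain K where "0 \<le> K" "\<And>x. x \<in> carrier H \<Longrightarrow> hnorm H (T x) \<le> K * hnorm H x"
    by metis
  then have "K \<in> {K. 0 \<le> K \<and> (\<forall>x\<in>carrier H. hnorm H (T x) \<le> K * hnorm H x)}" by simp
  then show ?thesis by (metis empty_iff)
qed

lemma opnorm_nonneg: "T \<in> ops \<Longrightarrow> 0 \<le> opnorm T"
  unfolding opnorm_def by (rule cInf_greatest[OF opnorm_set_nonempty]) auto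

lemma opnorm_bound:
  assumes T: "T \<in> ops" and x: "x \<in> carrier H"
  shows "hnorm H (T x) \<le> opnorm T * hnorm H x"
proof (cases "hnorm H x = 0")
  case True
  obtain K where "hnorm H (T x) \<le> K * hnorm H x" using op_bound[OF T] x by metis
  then show ?thesis using True by simp
next
  case False
  then have pos: "hnorm H x > 0" using hnorm_nonneg[OF x] by linarith
  have "hnorm H (T x) / hnorm H x \<le> opnorm T"
    unfolding opnorm_def
    by (rule cInf_greatest[OF opnorm_set_nonempty[OF T]]) (use x pos in \<open>auto simp: divide_le_eq\<close>)
  then show ?thesis using pos by (simp add: divide_le_eq)
qed

lemma adjoint_bound:
  assumes T: "T \<in> ops" and S: "S \<in> ops" and adj: "\<And>x y. x \<in> carrier H \<Longrightarrow> y \<in> carrier H \<Longrightarrow> cinner H (T x) y = cinner H x (S y)"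
    and y: "y \<in> carrier H"
  shows "hnorm H (S y) \<le> opnorm T * hnorm H y"
proof (rule hnorm_le_of_cinner)
  fix k assume k: "k \<in> carrier H"
  have "cmod (cinner H k (S y)) \<le> hnorm H (T k) * hnorm H y"
    using cauchy_schwarz[of "T k" y] adj[OF k y] T k y by simp
  also have "\<dots> \<le> opnorm T * hnorm H k * hnorm H y"
    by (intro mult_right_mono opnorm_bound T k) (use y in simp)
  finally show "cmod (cinner H k (S y)) \<le> opnorm T * hnorm H y * hnorm H k" by (simp add: mult_ac)
qed (use S y opnorm_nonneg[OF T] in simp_all)

lemma cinner_tendsto:
  assumes "\<And>n. s n \<in> carrier H" "y \<in> carrier H" "k \<in> carrier H" and lim: "(\<lambda>n. hnorm H (s n \<ominus> y)) \<longlonglongrightarrow> 0"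
  shows "(\<lambda>n. cinner H k (s n)) \<longlonglongrightarrow> cinner H k y"
proof -
  have bound: "cmod (cinner H k (s n) - cinner H k y) \<le> hnorm H k * hnorm H (s n \<ominus> y)" for n
    using cauchy_schwarz[OF assms(3), of "s n \<ominus> y"] assms by (simp add: cinner_diff)
  have "(\<lambda>n. hnorm H k * hnorm H (s n \<ominus> y)) \<longlonglongrightarrow> hnorm H k * 0"
    by (intro tendsto_mult tendsto_const lim)
  then have "(\<lambda>n. hnorm H k * hnorm H (s n \<ominus> y)) \<longlonglongrightarrow> 0" by (simp only: mult_zero_right)
  then have "(\<lambda>n. cinner H k (s n) - cinner H k y) \<longlonglongrightarrow> 0"
    by (rule Lim_null_comparison[OF always_eventually[OF allI[OF bound]]])
  then show ?thesis by (rule LIM_zero_cancel)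
qed

lemma Cauchy_converges:
  assumes "Metric_space (carrier H) (\<lambda>x y. hnorm H (x \<ominus> y))"
    and s: "\<And>n. s n \<in> carrier H" and C: "\<And>e. e > 0 \<Longrightarrow> \<exists>N. \<forall>m\<ge>N. \<forall>n\<ge>N. hnorm H (s m \<ominus> s n) < e"
  shows "\<exists>y\<in>carrier H. (\<lambda>n. hnorm H (s n \<ominus> y)) \<longlonglongrightarrow> 0"
proof -
  interpret M: Metric_space "carrier H" "\<lambda>x y. hnorm H (x \<ominus> y)" by (rule assms(1))
  have "M.MCauchy s" unfolding M.MCauchy_def using s C by (auto simp: image_subset_iff)
  then obtain y where y: "limitin M.mtopology s y sequentially"
    using complete unfolding M.mcomplete_def by blast
  have yH: "y \<in> carrier H" using y by (simp add: M.limit_metric_sequentially)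
  have "(\<lambda>n. hnorm H (s n \<ominus> y)) \<longlonglongrightarrow> 0"
  proof (rule LIMSEQ_I)
    fix e :: real assume "e > 0"
    then obtain N where "\<forall>n\<ge>N. hnorm H (s n \<ominus> y) < e"
      using y unfolding M.limit_metric_sequentially by meson
    then show "\<exists>N. \<forall>n\<ge>N. norm (hnorm H (s n \<ominus> y) - 0) < e" using s yH by auto
  qed
  then show ?thesis using yH by blast
qed

text \<open>Additivity, homogeneity and the norm bound can all be expressed by inner products and
  therefore pass to the weak limit.\<close>

lemma weak_limit_operator:
  assumes T: "\<And>n. T n \<in> ops" and bound: "\<And>n x. n \<ge> N \<Longrightarrow> x \<in> carrier H \<Longrightarrow> hnorm H (T n x) \<le> C * hnorm H x"
    and lim: "\<And>x. x \<in> carrier H \<Longrightarrow> \<exists>y\<in>carrier H. \<forall>k\<in>carrier H. (\<lambda>n. cinner H k (T n x)) \<longlonglongrightarrow> cinner H k y"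
  shows "\<exists>S\<in>ops. \<forall>x\<in>carrier H. \<forall>k\<in>carrier H. (\<lambda>n. cinner H k (T n x)) \<longlonglongrightarrow> cinner H k (S x)"
proof -
  obtain L where L: "\<And>x. x \<in> carrier H \<Longrightarrow> L x \<in> carrier H"
    "\<And>x k. x \<in> carrier H \<Longrightarrow> k \<in> carrier H \<Longrightarrow> (\<lambda>n. cinner H k (T n x)) \<longlonglongrightarrow> cinner H k (L x)"
    using lim by metis
  define S where "S = restrict L (carrier H)"
  have SL: "S x = L x" if "x \<in> carrier H" for x using that by (simp add: S_def)
  have "S \<in> ops"
  \<comment> \<open>\<open>hnorm_le_of_cinner\<close> asks for a nonnegative bound, and
    \<open>C\<close> carries no sign.\<close>
  proof (rule opsI[of _ "max C 0"])
    show "S \<in> extensional (carrier H)" by (simp add: S_def)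
    fix x assume x: "x \<in> carrier H"
    show "S x \<in> carrier H" using L(1)[OF x] SL[OF x] by simp
    show "S (x \<oplus> y) = S x \<oplus> S y" if y: "y \<in> carrier H" for y
    proof (rule eqI_cinner)
      fix k assume k: "k \<in> carrier H"
      have "(\<lambda>n. cinner H k (T n x) + cinner H k (T n y)) \<longlonglongrightarrow> cinner H k (L x) + cinner H k (L y)"
        by (intro tendsto_add L x y k)
      moreover have "(\<lambda>n. cinner H k (T n x) + cinner H k (T n y)) \<longlonglongrightarrow> cinner H k (L (x \<oplus> y))"
        using L(2)[of "x \<oplus> y" k] x y k T by (simp add: op_add cinner_add)
      ultimately show "cinner H k (S (x \<oplus> y)) = cinner H k (S x \<oplus> S y)"
        using LIMSEQ_unique x y k L(1) by (simp add: SL cinner_add) blast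
    qed (use x y L(1) SL in simp_all)
    show "S (c \<odot> x) = c \<odot> S x" for c
    proof (rule eqI_cinner)
      fix k assume k: "k \<in> carrier H"
      have "(\<lambda>n. c * cinner H k (T n x)) \<longlonglongrightarrow> c * cinner H k (L x)"
        by (intro tendsto_mult tendsto_const L x k)
      moreover have "(\<lambda>n. c * cinner H k (T n x)) \<longlonglongrightarrow> cinner H k (L (c \<odot> x))"
        using L(2)[of "c \<odot> x" k] x k T by (simp add: op_smult cinner_smult)
      ultimately show "cinner H k (S (c \<odot> x)) = cinner H k (c \<odot> S x)"
        using LIMSEQ_unique x k L(1) by (simp add: SL cinner_smult) blast
    qed (use x L(1) SL in simp_all)
    show "hnorm H (S x) \<le> max C 0 * hnorm H x"
    proof (rule hnorm_le_of_cinner)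
      fix k assume k: "k \<in> carrier H"
      show "cmod (cinner H k (S x)) \<le> max C 0 * hnorm H x * hnorm H k"
      proof (rule LIMSEQ_le_const2)
        show "(\<lambda>n. cmod (cinner H k (T n x))) \<longlonglongrightarrow> cmod (cinner H k (S x))"
          unfolding SL[OF x] by (intro tendsto_norm L x k)
        have "cmod (cinner H k (T n x)) \<le> max C 0 * hnorm H x * hnorm H k" if n: "n \<ge> N" for n
        proof -
          have "cmod (cinner H k (T n x)) \<le> hnorm H k * hnorm H (T n x)"
            by (rule cauchy_schwarz) (use T k x in simp_all)
          also have "\<dots> \<le> hnorm H k * (max C 0 * hnorm H x)"
          proof (rule mult_left_mono)
            have "C * hnorm H x \<le> max C 0 * hnorm H x" by (rule mult_right_mono) (use x in simp_all)
            with bound[OF n x] show "hnorm H (T n x) \<le> max C 0 * hnorm H x" by (rule order_trans)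
          qed (use k in simp)
          finally show ?thesis by (simp add: mult_ac)
        qed
        then show "\<exists>N. \<forall>n\<ge>N. cmod (cinner H k (T n x)) \<le> max C 0 * hnorm H x * hnorm H k" by blast
      qed
    qed (use x L(1) SL in simp_all)
  qed
  then show ?thesis using L(2) SL by (intro bexI[of _ S]) auto
qed

end

section \<open>Linear relations among kernel functions and the size of the space\<close>

context positive_kernel begin

lemma inner_sum_right:
  assumes "rkhs_bounded h" "\<And>i. i \<in> I \<Longrightarrow> rkhs_bounded (f i)"
  shows "rkhs_bounded (\<lambda>w. \<Sum>i\<in>I. f i w)" "inner h (\<lambda>w. \<Sum>i\<in>I. f i w) = (\<Sum>i\<in>I. inner h (f i))"
proof -
  have "rkhs_bounded (\<lambda>w. \<Sum>i\<in>I. f i w) \<and> inner h (\<lambda>w. \<Sum>i\<in>I. f i w) = (\<Sum>i\<in>I. inner h (f i))"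
    using assms(2)
  proof (induction I rule: infinite_finite_induct)
    case (insert i I)
    then show ?case using inner_add[OF assms(1), of "f i" "\<lambda>w. \<Sum>i\<in>I. f i w"] bounded_add by simp
  qed (use inner_smult[OF assms(1) bounded_zero, of 0] bounded_zero in simp_all)
  then show "rkhs_bounded (\<lambda>w. \<Sum>i\<in>I. f i w)" "inner h (\<lambda>w. \<Sum>i\<in>I. f i w) = (\<Sum>i\<in>I. inner h (f i))"
    by auto
qed

lemma value_tendsto:
  assumes f: "rkhs_bounded f"
  shows "(\<lambda>n. synth (approx f n) w) \<longlonglongrightarrow> f w"
proof -
  have bound: "cmod (synth (approx f n) w - f w) \<le> nrm (\<lambda>w. f w - synth (approx f n) w) * sqrt (Re (K w w))" for n
    using value_le[OF bounded_diff[OF f bounded_synth[of "approx f n"]], of w] by (simp add: norm_minus_commute)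
  have "(\<lambda>n. nrm (\<lambda>w. f w - synth (approx f n) w) * sqrt (Re (K w w))) \<longlonglongrightarrow> 0 * sqrt (Re (K w w))"
    by (intro tendsto_mult tendsto_const approx_tendsto f)
  then have "(\<lambda>n. nrm (\<lambda>w. f w - synth (approx f n) w) * sqrt (Re (K w w))) \<longlonglongrightarrow> 0"
    by (simp only: mult_zero_left)
  then have "(\<lambda>n. synth (approx f n) w - f w) \<longlonglongrightarrow> 0"
    by (rule Lim_null_comparison[OF always_eventually[OF allI[OF bound]]])
  then show ?thesis by (rule LIM_zero_cancel)
qed

text \<open>A relation between kernel functions holds for the values of finite combinations, hence
  by continuity of evaluation for those of every function in the space. This is how relations for
  \<open>haar\<close> become operator identities.\<close>

lemma bounded_sum:
  assumes f: "rkhs_bounded f" and rel: "\<And>v. (\<Sum>i\<in>I. K v (u i)) = K v w"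
  shows "(\<Sum>i\<in>I. f (u i)) = f w"
proof (rule LIMSEQ_unique)
  show "(\<lambda>n. \<Sum>i\<in>I. synth (approx f n) (u i)) \<longlonglongrightarrow> (\<Sum>i\<in>I. f (u i))"
    by (intro tendsto_sum value_tendsto f)
  have ps: "pairing c (\<lambda>v. \<Sum>i\<in>I. g i v) = (\<Sum>i\<in>I. pairing c (g i))" for c and g :: "_ \<Rightarrow> 'i \<Rightarrow> complex"
    by (induction I rule: infinite_finite_induct) (simp_all add: pairing_add)
  have "(\<Sum>i\<in>I. synth c (u i)) = synth c w" for c
    unfolding synth_def cnj_sum[symmetric] ps[symmetric] rel by (rule refl)
  then show "(\<lambda>n. \<Sum>i\<in>I. synth (approx f n) (u i)) \<longlonglongrightarrow> f w"
    using value_tendsto[OF f] by simp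
qed

end

text \<open>A function is encoded by a set of numbers. Each member encodes a point of
  \<open>W\<close>, a tag 0 or 1 for the real or imaginary part, and an element of the set of
  naturals assigned to that real number by \<open>g\<close>.\<close>

lemma countable_support_lepoll_real:
  assumes "countable W"
  shows "{f :: 'w \<Rightarrow> complex. \<forall>w. w \<notin> W \<longrightarrow> f w = 0} \<lesssim> (UNIV :: real set)"
proof -
  obtain g :: "real \<Rightarrow> nat set" where g: "inj g"
    using eqpoll_imp_lepoll[OF eqpoll_sym[OF nat_sets_eqpoll_reals]] by (auto simp: lepoll_def)
  define e where "e = (\<lambda>f :: 'w \<Rightarrow> complex. {prod_encode (to_nat_on W w, prod_encode (i, n)) | w i n.
     w \<in> W \<and> (i = 0 \<and> n \<in> g (Re (f w)) \<or> i = 1 \<and> n \<in> g (Im (f w)))})"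
  have inW: "to_nat_on W v = to_nat_on W w \<longleftrightarrow> v = w" if "v \<in> W" "w \<in> W" for v w
    using inj_on_to_nat_on[OF assms] that by (auto simp: inj_on_def)
  have mem: "prod_encode (to_nat_on W w, prod_encode (i, n)) \<in> e f \<longleftrightarrow> i = 0 \<and> n \<in> g (Re (f w)) \<or> i = 1 \<and> n \<in> g (Im (f w))"
    if "w \<in> W" for w i n f
    using that inW by (auto simp: e_def)
  have "inj_on e {f. \<forall>w. w \<notin> W \<longrightarrow> f w = 0}"
  proof (rule inj_onI)
    fix f h assume f: "f \<in> {f. \<forall>w. w \<notin> W \<longrightarrow> f w = 0}" and h: "h \<in> {f. \<forall>w. w \<notin> W \<longrightarrow> f w = 0}" and eq: "e f = e h"
    show "f = h"
    proof
      fix w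
      show "f w = h w"
      proof (cases "w \<in> W")
        case True
        have "g (Re (f w)) = g (Re (h w))" using mem[OF True, of 0 _ f] mem[OF True, of 0 _ h] eq by auto
        moreover have "g (Im (f w)) = g (Im (h w))" using mem[OF True, of 1 _ f] mem[OF True, of 1 _ h] eq by auto
        ultimately show ?thesis using g by (simp add: inj_eq complex_eq_iff)
      qed (use f h in simp)
    qed
  qed
  then have "{f :: 'w \<Rightarrow> complex. \<forall>w. w \<notin> W \<longrightarrow> f w = 0} \<lesssim> (UNIV :: nat set set)"
    unfolding lepoll_def by blast
  then show ?thesis using nat_sets_eqpoll_reals lepoll_trans2 by blast
qed

section \<open>The kernel of the Haar functional\<close>

context isometry_game begin

text \<open>The GNS inner product of two words, with \<open>rev\<close> in the role of the
  star.\<close>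

definition kernel :: "('a \<times> 'b) list \<Rightarrow> ('a \<times> 'b) list \<Rightarrow> complex" where
  "kernel v w = haar (rev v @ w)"

lemma positive_kernel_haar: "positive_kernel kernel"
proof
  show "cnj (kernel v w) = kernel w v" for v w
    by (simp add: kernel_def haar_star[symmetric])
  show "0 \<le> Re (pairing c (\<lambda>v. cnj (pairing c (\<lambda>w. kernel w v))))" for c
  proof -
    have p: "pairing c f = (\<Sum>k\<in>{0..<length c}. cnj (fst (c ! k)) * f (snd (c ! k)))" for f
      unfolding pairing_def by (simp add: sum_list_sum_nth case_prod_unfold)
    have "pairing c (\<lambda>v. cnj (pairing c (\<lambda>w. kernel w v))) =
      (\<Sum>k\<in>{0..<length c}. \<Sum>l\<in>{0..<length c}. cnj (fst (c ! k)) * fst (c ! l) * haar (rev (snd (c ! k)) @ snd (c ! l)))"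
      unfolding p by (simp add: sum_distrib_left kernel_def haar_star[symmetric] mult.assoc)
    then show ?thesis using haar_positive[of "{0..<length c}" "\<lambda>k. fst (c ! k)" "\<lambda>k. snd (c ! k)"] by simp
  qed
qed

sublocale kernel: positive_kernel kernel by (rule positive_kernel_haar)

lemma kernel_Cons: "kernel (p # v) w = kernel v (p # w)"
  by (simp add: kernel_def)

lemma haar_square: "haar (u @ p # p # v) = haar (u @ p # v)"
proof (cases "p \<in> X \<times> Y")
  case True
  then show ?thesis using functional_idem[OF isom_fun_haar, of "fst p" "snd p" u v] by auto
next
  case False
  then show ?thesis by (auto simp: haar_def)
qed

lemma kernel_Cons_Cons: "kernel (p # v) (p # w) = kernel v (p # w)"
  using haar_square[of "rev v" p w] by (simp add: kernel_def)

lemma kernel_snoc: "kernel (v @ [p]) w = kernel v (w @ [p])"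
  using haar_rotate[of p "rev v @ w"] by (simp add: kernel_def)

lemma kernel_snoc_snoc: "kernel (v @ [p]) (w @ [p]) = kernel v (w @ [p])"
  unfolding kernel_snoc using haar_square[of "rev v @ w" p "[]"] by (simp add: kernel_def)

lemma kernel_rev: "kernel (rev v) w = kernel (rev w) v"
  using haar_cyclic[of v w] by (simp add: kernel_def)

text \<open>Evaluation at \<open>w\<close> is bounded by \<open>kernel w w\<close>, which is 0 as
  soon as a letter lies outside of \<open>X \<times> Y\<close>. So all functions of the space live
  on a countable set of words, which bounds its cardinality.\<close>

lemma bounded_support:
  assumes "kernel.rkhs_bounded f" "\<not> set w \<subseteq> X \<times> Y"
  shows "f w = 0"
proof -
  have "kernel w w = 0" using assms(2) by (auto simp: kernel_def haar_def)
  then show ?thesis using kernel.value_le[OF assms(1), of w] by simp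
qed

lemma bounded_sum_row:
  assumes f: "kernel.rkhs_bounded f" and x: "x \<in> X"
  shows "(\<Sum>y\<in>Y. f ((x, y) # w)) = f w"
  by (rule kernel.bounded_sum[OF f])
    (use isometry_functionalD(2)[OF isom_fun_haar x] in \<open>simp add: kernel_def\<close>)

lemma bounded_sum_col:
  assumes f: "kernel.rkhs_bounded f" and y: "y \<in> Y"
  shows "(\<Sum>x\<in>X. f ((x, y) # w)) = f w"
  by (rule kernel.bounded_sum[OF f])
    (use isometry_functionalD(3)[OF isom_fun_haar y] in \<open>simp add: kernel_def\<close>)

text \<open>The word is a null vector of the kernel, since \<open>rev ?u @ ?u\<close> contains the
  forbidden pair of letters; so evaluation at it is 0.\<close>

lemma bounded_distance:
  assumes f: "kernel.rkhs_bounded f" and ne: "dX x x' \<noteq> dY y y'"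
  shows "f ((x, y) # (x', y') # w) = 0"
proof -
  let ?u = "(x, y) # (x', y') # w"
  have "kernel ?u ?u = 0"
    using isometry_functionalD(4)[OF isom_fun_haar ne, of "rev ?u" w] by (simp add: kernel_def)
  then show ?thesis using kernel.value_le[OF f, of ?u] by simp
qed

lemma bounded_Cons_Cons:
  assumes f: "kernel.rkhs_bounded f"
  shows "f (p # p # w) = f (p # w)"
  using kernel.bounded_sum[OF f, where I = "{()}" and u = "\<lambda>_. p # p # w" and w = "p # w"] haar_square
  by (simp add: kernel_def)

end

context isometry_game begin

lemma countable_encoding:
  assumes "(UNIV :: real set) \<lesssim> (UNIV :: 'h set)"
  shows "\<exists>\<iota> :: (('a \<times> 'b) list \<Rightarrow> complex) \<Rightarrow> 'h. inj_on \<iota> {f. kernel.rkhs_bounded f}"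
proof -
  have "{f. kernel.rkhs_bounded f} \<subseteq> {f. \<forall>w. w \<notin> lists (X \<times> Y) \<longrightarrow> f w = 0}"
    using bounded_support by (auto simp: in_lists_conv_set)
  then have "{f. kernel.rkhs_bounded f} \<lesssim> {f :: ('a \<times> 'b) list \<Rightarrow> complex. \<forall>w. w \<notin> lists (X \<times> Y) \<longrightarrow> f w = 0}"
    by (rule subset_imp_lepoll)
  then have "{f. kernel.rkhs_bounded f} \<lesssim> (UNIV :: real set)"
    by (rule lepoll_trans) (rule countable_support_lepoll_real, intro countable_lists countable_finite finite_cartesian_product finite_X finite_Y)
  then have "{f. kernel.rkhs_bounded f} \<lesssim> (UNIV :: 'h set)"
    using assms by (rule lepoll_trans)
  then show ?thesis by (auto simp: lepoll_def)
qed

end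

section \<open>Left and right multiplication on the GNS space\<close>

locale haar_model = isometry_game X dX Y dY \<psi>0
  for X :: "'a set" and dX :: "'a \<Rightarrow> 'a \<Rightarrow> real" and Y :: "'b set" and dY :: "'b \<Rightarrow> 'b \<Rightarrow> real"
    and \<psi>0 :: "('a \<times> 'b) list \<Rightarrow> complex" +
  fixes \<iota> :: "(('a \<times> 'b) list \<Rightarrow> complex) \<Rightarrow> 'h"
  assumes inj_\<iota>: "inj_on \<iota> {f. kernel.rkhs_bounded f}"
begin

sublocale M: rkhs_model kernel \<iota>
  by unfold_locales (rule inj_\<iota>)

abbreviation "H \<equiv> M.rkhs"
text \<open>The value of \<open>h\<close> at \<open>w\<close> is its inner product with the vector
  of \<open>w\<close>; as letters are self-adjoint, prefixing a letter to the argument is left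
  multiplication by it. Appending is right multiplication, which is self-adjoint because
  \<open>haar\<close> is cyclic.\<close>

abbreviation "left_op p \<equiv> M.shift_op ((#) p)"
abbreviation "right_op p \<equiv> M.shift_op (\<lambda>w. w @ [p])"

lemmas left = kernel_Cons kernel_Cons_Cons
lemmas right = kernel_snoc kernel_snoc_snoc

lemmas left_op = M.dec_shift_op[where \<sigma> = "(#) _", OF left] M.shift_op_ops[where \<sigma> = "(#) _", OF left]
  M.cinner_shift_op[where \<sigma> = "(#) _", OF left] M.adjoint_shift_op[where \<sigma> = "(#) _", OF left]
lemmas right_op = M.dec_shift_op[where \<sigma> = "\<lambda>w. w @ [_]", OF right] M.shift_op_ops[where \<sigma> = "\<lambda>w. w @ [_]", OF right]
  M.cinner_shift_op[where \<sigma> = "\<lambda>w. w @ [_]", OF right]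

lemma left_op_in [simp]: "h \<in> carrier H \<Longrightarrow> left_op p h \<in> carrier H"
  by (rule M.H.op_closed[OF left_op(2)])

lemma right_op_in [simp]: "h \<in> carrier H \<Longrightarrow> right_op p h \<in> carrier H"
  by (rule M.H.op_closed[OF right_op(2)])

lemma cinner_left_op:
  assumes "h \<in> carrier H"
  shows "cinner H k (left_op p h) = kernel.inner (M.dec k) (\<lambda>w. M.dec h (p # w))"
proof -
  have "M.dec (left_op p h) = (\<lambda>w. M.dec h (p # w))" by (rule ext) (rule left_op(1)[OF assms])
  then show ?thesis by (simp add: M.rkhs_simps(4))
qed

text \<open>Stated for an arbitrary faithful representation, so that one proof covers the operators
  themselves and their encoded copies in \<open>haar_algebra\<close>.\<close>

lemma quantum_isometry_matrix_left_op:
  assumes rep: "operator_rep H A \<pi>"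
    and E: "\<And>x y. x \<in> X \<Longrightarrow> y \<in> Y \<Longrightarrow> E x y \<in> carrier A"
    and star: "\<And>x y. x \<in> X \<Longrightarrow> y \<in> Y \<Longrightarrow> star A (E x y) = E x y"
    and \<pi>: "\<And>x y. x \<in> X \<Longrightarrow> y \<in> Y \<Longrightarrow> \<pi> (E x y) = left_op (x, y)"
  shows "quantum_isometry_matrix A X dX Y dY E"
proof -
  interpret operator_rep H A \<pi> by (rule rep)
  have fs: "finite_spaces X dX Y dY" by (rule finite_spaces_axioms)
  show ?thesis
  proof (rule quantum_isometry_matrixI[OF fs E star])
    fix x y h assume "x \<in> X" "y \<in> Y" "h \<in> carrier H"
    then show "\<pi> (E x y) (\<pi> (E x y) h) = \<pi> (E x y) h"
      by (auto intro!: M.rkhs_eqI simp: \<pi> left_op(1) bounded_Cons_Cons)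
  next
    fix x h k assume x: "x \<in> X" and hk: "h \<in> carrier H" "k \<in> carrier H"
    have "(\<Sum>y\<in>Y. cinner H k (\<pi> (E x y) h)) = (\<Sum>y\<in>Y. kernel.inner (M.dec k) (\<lambda>w. M.dec h ((x, y) # w)))"
      by (intro sum.cong refl) (simp add: \<pi> x cinner_left_op hk)
    also have "\<dots> = kernel.inner (M.dec k) (\<lambda>w. \<Sum>y\<in>Y. M.dec h ((x, y) # w))"
      by (intro kernel.inner_sum_right(2)[symmetric] kernel.bounded_shift[OF left] M.bounded_dec)
    finally show "(\<Sum>y\<in>Y. cinner H k (\<pi> (E x y) h)) = cinner H k h"
      by (simp add: bounded_sum_row[OF M.bounded_dec x] M.rkhs_simps(4))
  next
    fix y h k assume y: "y \<in> Y" and hk: "h \<in> carrier H" "k \<in> carrier H"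
    have "(\<Sum>x\<in>X. cinner H k (\<pi> (E x y) h)) = (\<Sum>x\<in>X. kernel.inner (M.dec k) (\<lambda>w. M.dec h ((x, y) # w)))"
      by (intro sum.cong refl) (simp add: \<pi> y cinner_left_op hk)
    also have "\<dots> = kernel.inner (M.dec k) (\<lambda>w. \<Sum>x\<in>X. M.dec h ((x, y) # w))"
      by (intro kernel.inner_sum_right(2)[symmetric] kernel.bounded_shift[OF left] M.bounded_dec)
    finally show "(\<Sum>x\<in>X. cinner H k (\<pi> (E x y) h)) = cinner H k h"
      by (simp add: bounded_sum_col[OF M.bounded_dec y] M.rkhs_simps(4))
  next
    fix x y x' y' h
    assume *: "x \<in> X" "y \<in> Y" "x' \<in> X" "y' \<in> Y" "h \<in> carrier H" and ne: "dX x x' \<noteq> dY y y'"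
    \<comment> \<open>The letters reach the argument in the opposite order: \<open>h\<close> is
      evaluated at a word that starts with \<open>(x', y')\<close> followed by
      \<open>(x, y)\<close>.\<close>
    then have "dX x' x \<noteq> dY y' y" using symX symY by simp
    from bounded_distance[OF M.bounded_dec this] show "\<pi> (E x y) (\<pi> (E x' y') h) = \<zero>\<^bsub>H\<^esub>"
      using * by (auto intro!: M.rkhs_eqI simp: \<pi> left_op(1))
  qed
qed

lemma cstar_isometric_haar: "cstar_isometric TYPE('h) X dX Y dY"
proof -
  have "quantum_isometry_matrix (operator_algebra H) X dX Y dY (\<lambda>x y. left_op (x, y))"
    by (rule quantum_isometry_matrix_left_op[OF M.H.operator_rep_self]) (simp_all add: left_op(2,4))
  moreover have "carrier H \<noteq> {\<zero>\<^bsub>H\<^esub>}"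
  proof
    assume *: "carrier H = {\<zero>\<^bsub>H\<^esub>}"
    have "\<iota> (kernel.synth [(1, [])]) \<in> carrier H" by (intro M.\<iota>_carrier kernel.bounded_synth)
    then have "M.dec (\<iota> (kernel.synth [(1, [])])) = (\<lambda>w. 0)" using * by simp
    then have "kernel.synth [(1, [])] [] = 0" by (simp only: M.dec_\<iota>[OF kernel.bounded_synth])
    then have "kernel [] [] = 0" by (simp only: kernel.synth_single)
    then show False by (simp add: kernel_def haar_Nil)
  qed
  ultimately show ?thesis
    unfolding cstar_isometric_def using M.hilbert_space_rkhs by blast
qed

end

section \<open>The C*-algebra of the Haar functional\<close>

context haar_model begin

definition point :: "('a \<times> 'b) list \<Rightarrow> 'h" where
  "point w = \<iota> (kernel.synth [(1, w)])"

lemma point_in [simp]: "point w \<in> carrier H"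
  by (simp add: point_def kernel.bounded_synth)

lemma dec_point': "M.dec (point w) = kernel.synth [(1, w)]"
  unfolding point_def by (rule M.dec_\<iota>[OF kernel.bounded_synth])

lemma dec_point: "M.dec (point w) v = kernel v w"
  unfolding dec_point' kernel.synth_single ..

lemma cinner_point: "cinner H (point w) h = M.dec h w"
  unfolding M.rkhs_simps(4) dec_point' kernel.inner_synth[OF M.bounded_dec] by (rule kernel.pairing_single)

lemma right_op_point: "right_op p (point w) = point (w @ [p])"
  by (rule M.rkhs_eqI) (simp_all add: right_op(1) dec_point kernel_snoc)

text \<open>The commutant of right multiplication, an analogue of the left von Neumann algebra of a
  group. Possession of a bounded adjoint is part of the definition, so that
  \<open>adjoint_operator\<close> is meaningful on it.\<close>

definition commutant :: "('h \<Rightarrow> 'h) set" where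
  "commutant = {T \<in> bounded_linear_operators H.
     (\<exists>S\<in>bounded_linear_operators H. \<forall>h\<in>carrier H. \<forall>k\<in>carrier H. cinner H (T h) k = cinner H h (S k)) \<and>
     (\<forall>p. \<forall>h\<in>carrier H. T (right_op p h) = right_op p (T h))}"

abbreviation adj :: "('h \<Rightarrow> 'h) \<Rightarrow> 'h \<Rightarrow> 'h" where "adj \<equiv> adjoint_operator H"

lemma commutant_ops: "T \<in> commutant \<Longrightarrow> T \<in> bounded_linear_operators H"
  by (simp add: commutant_def)

lemma commutant_in [simp]: "T \<in> commutant \<Longrightarrow> h \<in> carrier H \<Longrightarrow> T h \<in> carrier H"
  by (rule M.H.op_closed[OF commutant_ops])

lemma commutant_right: "T \<in> commutant \<Longrightarrow> h \<in> carrier H \<Longrightarrow> T (right_op p h) = right_op p (T h)"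
  unfolding commutant_def by blast

lemma commutantI:
  assumes "T \<in> bounded_linear_operators H" "S \<in> bounded_linear_operators H"
    and "\<And>h k. h \<in> carrier H \<Longrightarrow> k \<in> carrier H \<Longrightarrow> cinner H (T h) k = cinner H h (S k)"
    and "\<And>p h. h \<in> carrier H \<Longrightarrow> T (right_op p h) = right_op p (T h)"
  shows "T \<in> commutant" "adj T = S"
  using assms(1,2,4) assms(3) M.H.adjoint_unique[OF assms(2,3)] unfolding commutant_def by blast+

lemma cinner_flip:
  assumes "h \<in> carrier H" "k \<in> carrier H" "h' \<in> carrier H" "k' \<in> carrier H" "cinner H h k = cinner H h' k'"
  shows "cinner H k h = cinner H k' h'"
  using M.H.cinner_cnj[OF assms(1,2)] M.H.cinner_cnj[OF assms(3,4)] assms(5) by simp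

lemma
  assumes T: "T \<in> commutant"
  shows adj_ops: "adj T \<in> bounded_linear_operators H"
    and adj: "\<And>h k. h \<in> carrier H \<Longrightarrow> k \<in> carrier H \<Longrightarrow> cinner H (T h) k = cinner H h (adj T k)"
    and adj_commutant: "adj T \<in> commutant"
    and adj_adj: "adj (adj T) = T"
proof -
  obtain S where S: "S \<in> bounded_linear_operators H" "\<And>h k. h \<in> carrier H \<Longrightarrow> k \<in> carrier H \<Longrightarrow> cinner H (T h) k = cinner H h (S k)"
    using T unfolding commutant_def by blast
  have a: "adj T = S" by (rule M.H.adjoint_unique[OF S])
  show ops: "adj T \<in> bounded_linear_operators H" using S a by simp
  show ad: "cinner H (T h) k = cinner H h (adj T k)" if "h \<in> carrier H" "k \<in> carrier H" for h k
    using S(2)[OF that] a by simp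
  have in': "adj T h \<in> carrier H" if "h \<in> carrier H" for h by (rule M.H.op_closed[OF ops that])
  have ad': "cinner H (adj T h) k = cinner H h (T k)" if "h \<in> carrier H" "k \<in> carrier H" for h k
    using cinner_flip[OF _ _ _ _ ad[OF that(2,1)]] that T in' by simp
  have com: "adj T (right_op p h) = right_op p (adj T h)" if h: "h \<in> carrier H" for p h
  proof (rule M.H.eqI_cinner)
    fix k assume k: "k \<in> carrier H"
    have "cinner H k (adj T (right_op p h)) = cinner H (T k) (right_op p h)" using ad[OF k right_op_in[OF h]] by simp
    also have "\<dots> = cinner H (right_op p (T k)) h" using right_op(3)[OF commutant_in[OF T k] h] by simp
    also have "\<dots> = cinner H (T (right_op p k)) h" using commutant_right[OF T k] by simp
    also have "\<dots> = cinner H (right_op p k) (adj T h)" by (rule ad[OF right_op_in[OF k] h])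
    also have "\<dots> = cinner H k (right_op p (adj T h))" by (rule right_op(3)[OF k in'[OF h]])
    finally show "cinner H k (adj T (right_op p h)) = cinner H k (right_op p (adj T h))" .
  qed (use h in' in simp_all)
  show "adj T \<in> commutant" "adj (adj T) = T"
    using commutantI[OF ops commutant_ops[OF T] ad' com] by auto
qed

text \<open>An operator that commutes with right multiplication sends the word \<open>w\<close> to
  its value at the empty word times \<open>w\<close>. Right letters are self-adjoint, so they move
  to \<open>h\<close> one by one.\<close>

lemma commutant_point:
  assumes T: "T \<in> commutant"
  shows "h \<in> carrier H \<Longrightarrow> cinner H (T (point w)) h = cinner H (T (point [])) (\<iota> (\<lambda>v. M.dec h (v @ w)))"
proof (induction w arbitrary: h rule: rev_induct)
  case Nil
  then show ?case by simp
next
  case (snoc p w)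
  have "cinner H (T (point (w @ [p]))) h = cinner H (right_op p (T (point w))) h"
    using commutant_right[OF T point_in, of p w] by (simp add: right_op_point)
  also have "\<dots> = cinner H (T (point w)) (right_op p h)"
    by (rule right_op(3)) (use T snoc.prems in simp_all)
  also have "\<dots> = cinner H (T (point [])) (\<iota> (\<lambda>v. M.dec (right_op p h) (v @ w)))"
    by (rule snoc.IH) (use snoc.prems in simp)
  finally show ?case using snoc.prems by (simp add: right_op(1))
qed

lemma dec_adj: "T \<in> commutant \<Longrightarrow> h \<in> carrier H \<Longrightarrow> M.dec (adj T h) w = cinner H (T (point w)) h"
  using adj[of T "point w" h] by (simp add: cinner_point)

text \<open>By \<open>commutant_point\<close> all values of the adjoint can be read off from the
  image of the empty word. Equal images thus give equal adjoints, and taking adjoints again ends the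
  proof. It makes the encoding \<open>vec\<close> injective.\<close>

lemma commutant_separating:
  assumes S: "S \<in> commutant" and T: "T \<in> commutant" and eq: "S (point []) = T (point [])"
  shows "S = T"
proof -
  have ops: "adj S \<in> bounded_linear_operators H" "adj T \<in> bounded_linear_operators H"
    by (rule adj_ops[OF S], rule adj_ops[OF T])
  have "adj S = adj T"
  proof (rule M.H.op_eqI[OF ops])
    fix h assume h: "h \<in> carrier H"
    show "adj S h = adj T h"
    proof (rule M.rkhs_eqI)
      show "M.dec (adj S h) w = M.dec (adj T h) w" for w
        using dec_adj[OF S h, of w] dec_adj[OF T h, of w] commutant_point[OF S h, of w] commutant_point[OF T h, of w]
        by (simp only: eq)
      show "adj S h \<in> carrier H" "adj T h \<in> carrier H"
        by (rule M.H.op_closed[OF ops(1) h], rule M.H.op_closed[OF ops(2) h])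
    qed
  qed
  then have "adj (adj S) = adj (adj T)" by (rule arg_cong)
  then show ?thesis unfolding adj_adj[OF S] adj_adj[OF T] .
qed

text \<open>The identity \<open>T* \<Omega> = J T \<Omega>\<close> of Tomita-Takesaki theory for a
  tracial vector, with \<Omega> the empty word and \<open>J\<close> the reflection of words.\<close>

lemma dec_adj_point:
  assumes T: "T \<in> commutant"
  shows "M.dec (adj T (point [])) w = cnj (M.dec (T (point [])) (rev w))"
proof -
  have "M.dec (point []) (v @ w) = M.dec (point (rev w)) v" for v
    using haar_cyclic[of "rev w" "rev v"] by (simp add: dec_point kernel_def)
  then have "\<iota> (\<lambda>v. M.dec (point []) (v @ w)) = point (rev w)" by simp
  then have "M.dec (adj T (point [])) w = cinner H (T (point [])) (point (rev w))"
    using commutant_point[OF T point_in, of w "[]"] by (simp add: dec_adj[OF T])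
  then show ?thesis using M.H.cinner_cnj[of "point (rev w)" "T (point [])"] T by (simp add: cinner_point)
qed

text \<open>\<open>S\<close> moves to the left as its adjoint, and \<open>dec_adj_point\<close>
  turns the expression into the inner product of the reflected vector of \<open>S\<close> with the
  vector of \<open>T\<close>. This is symmetric in \<open>S\<close> and \<open>T\<close> by
  \<open>inner_reflect\<close>.\<close>

lemma commutant_trace:
  assumes S: "S \<in> commutant" and T: "T \<in> commutant"
  shows "cinner H (point []) (S (T (point []))) = cinner H (point []) (T (S (point [])))"
proof -
  have aux: "cinner H (point []) (S (T (point []))) = kernel.inner (\<lambda>w. cnj (M.dec (S (point [])) (rev w))) (M.dec (T (point [])))"
    if S: "S \<in> commutant" and T: "T \<in> commutant" for S T
  proof -
    have "cinner H (point []) (S (T (point []))) = cinner H (adj S (point [])) (T (point []))"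
      using cinner_flip[OF _ _ _ _ adj[OF S, of "T (point [])" "point []"]] S T adj_commutant[OF S] by simp
    moreover have "M.dec (adj S (point [])) = (\<lambda>w. cnj (M.dec (S (point [])) (rev w)))"
      by (rule ext) (rule dec_adj_point[OF S])
    ultimately show ?thesis by (simp add: M.rkhs_simps(4))
  qed
  show ?thesis
    unfolding aux[OF S T] aux[OF T S]
    by (rule kernel.inner_reflect) (simp_all add: kernel_rev)
qed

lemma left_op_commutant: "left_op p \<in> commutant" "adj (left_op p) = left_op p"
proof -
  have "left_op p (right_op q h) = right_op q (left_op p h)" if "h \<in> carrier H" for q h
    using that by (intro M.rkhs_eqI) (simp_all add: left_op(1) right_op(1))
  from commutantI[OF left_op(2) left_op(2) left_op(3) this]
  show "left_op p \<in> commutant" "adj (left_op p) = left_op p" by auto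
qed

abbreviation "zero_op \<equiv> \<lambda>h\<in>carrier H. \<zero>\<^bsub>H\<^esub>"
abbreviation "one_op \<equiv> \<lambda>h\<in>carrier H. h"
abbreviation "add_op S T \<equiv> \<lambda>h\<in>carrier H. S h \<oplus>\<^bsub>H\<^esub> T h"
abbreviation "smult_op c T \<equiv> \<lambda>h\<in>carrier H. c \<odot>\<^bsub>H\<^esub> T h"

lemma commutant_zero: "zero_op \<in> commutant"
proof (rule commutantI(1)[OF M.H.ops_zero M.H.ops_zero])
  show "cinner H (zero_op h) k = cinner H h (zero_op k)" if "h \<in> carrier H" "k \<in> carrier H" for h k
    using that M.H.cinner_cnj[of k "\<zero>\<^bsub>H\<^esub>"] by simp
  show "zero_op (right_op p h) = right_op p (zero_op h)" if "h \<in> carrier H" for p h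
    using that by (intro M.rkhs_eqI) (simp_all add: right_op(1))
qed

lemma commutant_one: "one_op \<in> commutant"
  by (rule commutantI(1)[OF M.H.ops_one M.H.ops_one]) simp_all

lemma commutant_add:
  assumes "S \<in> commutant" "T \<in> commutant"
  shows "add_op S T \<in> commutant" "adj (add_op S T) = add_op (adj S) (adj T)"
proof -
  have *: "cinner H (add_op S T h) k = cinner H h (add_op (adj S) (adj T) k)" if "h \<in> carrier H" "k \<in> carrier H" for h k
    using that assms adj_commutant adj by (simp add: M.H.cinner_add M.H.cinner_add_left)
  have "add_op S T (right_op p h) = right_op p (add_op S T h)" if "h \<in> carrier H" for p h
    using that assms M.H.op_add[OF right_op(2)] by (simp add: commutant_right)
  note com = this
  show "add_op S T \<in> commutant" by (rule commutantI(1)[OF M.H.ops_add[OF commutant_ops[OF assms(1)] commutant_ops[OF assms(2)]] M.H.ops_add[OF adj_ops[OF assms(1)] adj_ops[OF assms(2)]] * com])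
  show "adj (add_op S T) = add_op (adj S) (adj T)" by (rule commutantI(2)[OF M.H.ops_add[OF commutant_ops[OF assms(1)] commutant_ops[OF assms(2)]] M.H.ops_add[OF adj_ops[OF assms(1)] adj_ops[OF assms(2)]] * com])
qed

lemma commutant_smult:
  assumes "T \<in> commutant"
  shows "smult_op c T \<in> commutant" "adj (smult_op c T) = smult_op (cnj c) (adj T)"
proof -
  have *: "cinner H (smult_op c T h) k = cinner H h (smult_op (cnj c) (adj T) k)" if "h \<in> carrier H" "k \<in> carrier H" for h k
    using that assms adj_commutant adj by (simp add: M.H.cinner_smult M.H.cinner_smult_left)
  have "smult_op c T (right_op p h) = right_op p (smult_op c T h)" if "h \<in> carrier H" for p h
    using that assms M.H.op_smult[OF right_op(2)] by (simp add: commutant_right)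
  note com = this
  show "smult_op c T \<in> commutant" by (rule commutantI(1)[OF M.H.ops_smult[OF commutant_ops[OF assms]] M.H.ops_smult[OF adj_ops[OF assms]] * com])
  show "adj (smult_op c T) = smult_op (cnj c) (adj T)" by (rule commutantI(2)[OF M.H.ops_smult[OF commutant_ops[OF assms]] M.H.ops_smult[OF adj_ops[OF assms]] * com])
qed

lemma commutant_compose:
  assumes "S \<in> commutant" "T \<in> commutant"
  shows "compose (carrier H) S T \<in> commutant" "adj (compose (carrier H) S T) = compose (carrier H) (adj T) (adj S)"
proof -
  have *: "cinner H (compose (carrier H) S T h) k = cinner H h (compose (carrier H) (adj T) (adj S) k)"
    if "h \<in> carrier H" "k \<in> carrier H" for h k
    using that assms adj_commutant adj by (simp add: compose_def)
  have "compose (carrier H) S T (right_op p h) = right_op p (compose (carrier H) S T h)" if "h \<in> carrier H" for p h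
    using that assms by (simp add: commutant_right compose_def)
  note com = this
  show "compose (carrier H) S T \<in> commutant" by (rule commutantI(1)[OF M.H.ops_compose[OF commutant_ops[OF assms(1)] commutant_ops[OF assms(2)]] M.H.ops_compose[OF adj_ops[OF assms(2)] adj_ops[OF assms(1)]] * com])
  show "adj (compose (carrier H) S T) = compose (carrier H) (adj T) (adj S)" by (rule commutantI(2)[OF M.H.ops_compose[OF commutant_ops[OF assms(1)] commutant_ops[OF assms(2)]] M.H.ops_compose[OF adj_ops[OF assms(2)] adj_ops[OF assms(1)]] * com])
qed

text \<open>The adjoints form a Cauchy sequence as well, and their limit is the adjoint that
  membership in the commutant demands. Convergence in norm is phrased by pointwise bounds, which can
  be checked by inner products.\<close>

lemma commutant_limit:
  fixes T :: "nat \<Rightarrow> 'h \<Rightarrow> 'h"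
  assumes T: "\<And>n. T n \<in> commutant"
    and C: "\<And>e. e > 0 \<Longrightarrow> \<exists>N. \<forall>m\<ge>N. \<forall>n\<ge>N. \<forall>h\<in>carrier H. hnorm H (T m h \<ominus>\<^bsub>H\<^esub> T n h) \<le> e * hnorm H h"
  shows "\<exists>S\<in>commutant. \<forall>e>0. \<exists>N. \<forall>n\<ge>N. \<forall>h\<in>carrier H. hnorm H (T n h \<ominus>\<^bsub>H\<^esub> S h) \<le> e * hnorm H h"
proof -
  have lim: "\<exists>S\<in>bounded_linear_operators H. \<forall>h\<in>carrier H. \<forall>k\<in>carrier H. (\<lambda>n. cinner H k (U n h)) \<longlonglongrightarrow> cinner H k (S h)"
    if U: "\<And>n. U n \<in> bounded_linear_operators H"
      and C: "\<And>e. e > 0 \<Longrightarrow> \<exists>N. \<forall>m\<ge>N. \<forall>n\<ge>N. \<forall>h\<in>carrier H. hnorm H (U m h \<ominus>\<^bsub>H\<^esub> U n h) \<le> e * hnorm H h" for U :: "nat \<Rightarrow> 'h \<Rightarrow> 'h"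
  proof -
    \<comment> \<open>From \<open>N\<close> on the operators differ from the fixed
      \<open>U N\<close> by at most 1 in norm, which gives the uniform bound
      \<open>1 + opnorm (U N)\<close>.\<close>
    obtain N where N: "\<And>n h. n \<ge> N \<Longrightarrow> h \<in> carrier H \<Longrightarrow> hnorm H (U n h \<ominus>\<^bsub>H\<^esub> U N h) \<le> 1 * hnorm H h"
      using C[of 1] by (meson order_refl zero_less_one)
    show ?thesis
    proof (rule M.H.weak_limit_operator[OF U, where N = N and C = "1 + M.H.opnorm (U N)"])
      fix n h assume n: "n \<ge> N" and h: "h \<in> carrier H"
      have "hnorm H (U n h \<ominus>\<^bsub>H\<^esub> \<zero>\<^bsub>H\<^esub>) \<le> hnorm H (U n h \<ominus>\<^bsub>H\<^esub> U N h) + hnorm H (U N h \<ominus>\<^bsub>H\<^esub> \<zero>\<^bsub>H\<^esub>)"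
        by (rule M.H.hnorm_triangle3) (use U h in simp_all)
      moreover have "y \<ominus>\<^bsub>H\<^esub> \<zero>\<^bsub>H\<^esub> = y" if "y \<in> carrier H" for y
        by (rule M.H.eqI_cinner) (use that in \<open>simp_all add: M.H.cinner_diff\<close>)
      ultimately show "hnorm H (U n h) \<le> (1 + M.H.opnorm (U N)) * hnorm H h"
        using N[OF n h] M.H.opnorm_bound[OF U h, of N] U h by (simp add: distrib_right)
    next
      fix h assume h: "h \<in> carrier H"
      have cau: "\<exists>N. \<forall>m\<ge>N. \<forall>n\<ge>N. hnorm H (U m h \<ominus>\<^bsub>H\<^esub> U n h) < e" if e: "e > 0" for e
      proof -
        have e': "e / (hnorm H h + 1) > 0" using e M.H.hnorm_nonneg[OF h] by simp
        obtain N where N: "\<And>m n. m \<ge> N \<Longrightarrow> n \<ge> N \<Longrightarrow> hnorm H (U m h \<ominus>\<^bsub>H\<^esub> U n h) \<le> e / (hnorm H h + 1) * hnorm H h"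
          using C[OF e'] h by meson
        have "e / (hnorm H h + 1) * hnorm H h < e"
          using e M.H.hnorm_nonneg[OF h] by (simp add: pos_divide_less_eq algebra_simps)
        then show ?thesis using N by (meson le_less_trans)
      qed
      obtain y where y: "y \<in> carrier H" "(\<lambda>n. hnorm H (U n h \<ominus>\<^bsub>H\<^esub> y)) \<longlonglongrightarrow> 0"
        using M.H.Cauchy_converges[OF M.Metric_space_rkhs M.H.op_closed[OF U h] cau] by blast
      then show "\<exists>y\<in>carrier H. \<forall>k\<in>carrier H. (\<lambda>n. cinner H k (U n h)) \<longlonglongrightarrow> cinner H k y"
        using M.H.cinner_tendsto[OF M.H.op_closed[OF U h] y(1) _ y(2)] by blast
    qed
  qed
  have Tops: "T n \<in> bounded_linear_operators H" and aops: "adj (T n) \<in> bounded_linear_operators H" for n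
    using T commutant_ops adj_ops by auto
  obtain S where S: "S \<in> bounded_linear_operators H"
    "\<And>h k. h \<in> carrier H \<Longrightarrow> k \<in> carrier H \<Longrightarrow> (\<lambda>n. cinner H k (T n h)) \<longlonglongrightarrow> cinner H k (S h)"
    using lim[OF Tops C] by blast
  have Cadj: "\<exists>N. \<forall>m\<ge>N. \<forall>n\<ge>N. \<forall>h\<in>carrier H. hnorm H (adj (T m) h \<ominus>\<^bsub>H\<^esub> adj (T n) h) \<le> e * hnorm H h" if e: "e > 0" for e
  proof -
    obtain N where N: "\<And>m n h. m \<ge> N \<Longrightarrow> n \<ge> N \<Longrightarrow> h \<in> carrier H \<Longrightarrow> hnorm H (T m h \<ominus>\<^bsub>H\<^esub> T n h) \<le> e * hnorm H h"
      using C[OF e] by meson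
    have "hnorm H (adj (T m) h \<ominus>\<^bsub>H\<^esub> adj (T n) h) \<le> e * hnorm H h" if mn: "m \<ge> N" "n \<ge> N" and h: "h \<in> carrier H" for m n h
    proof (rule M.H.hnorm_le_of_cinner)
      fix k assume k: "k \<in> carrier H"
      have "cinner H k (adj (T m) h \<ominus>\<^bsub>H\<^esub> adj (T n) h) = cinner H (T m k \<ominus>\<^bsub>H\<^esub> T n k) h"
        using h k T aops Tops adj by (simp add: M.H.cinner_diff M.H.cinner_diff_left)
      also have "cmod \<dots> \<le> hnorm H (T m k \<ominus>\<^bsub>H\<^esub> T n k) * hnorm H h"
        by (rule M.H.cauchy_schwarz) (use h k Tops in simp_all)
      also have "\<dots> \<le> (e * hnorm H k) * hnorm H h"
        by (rule mult_right_mono[OF N[OF mn k]]) (use h in simp)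
      finally show "cmod (cinner H k (adj (T m) h \<ominus>\<^bsub>H\<^esub> adj (T n) h)) \<le> e * hnorm H h * hnorm H k" by (simp add: mult_ac)
    qed (use e h aops in simp_all)
    then show ?thesis by blast
  qed
  obtain S' where S': "S' \<in> bounded_linear_operators H"
    "\<And>h k. h \<in> carrier H \<Longrightarrow> k \<in> carrier H \<Longrightarrow> (\<lambda>n. cinner H k (adj (T n) h)) \<longlonglongrightarrow> cinner H k (S' h)"
    using lim[OF aops Cadj] by blast
  have "cinner H (S h) k = cinner H h (S' k)" if h: "h \<in> carrier H" and k: "k \<in> carrier H" for h k
  proof (rule LIMSEQ_unique)
    have "cinner H h (adj (T n) k) = cnj (cinner H k (T n h))" for n
      using adj[OF T h k, of n] M.H.cinner_cnj[of k "T n h"] h k Tops by simp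
    then show "(\<lambda>n. cinner H h (adj (T n) k)) \<longlonglongrightarrow> cinner H (S h) k"
      using tendsto_cnj[OF S(2)[OF h k]] M.H.cinner_cnj[of k "S h"] h k S(1) by simp
    show "(\<lambda>n. cinner H h (adj (T n) k)) \<longlonglongrightarrow> cinner H h (S' k)" by (rule S'(2)[OF k h])
  qed
  moreover have "S (right_op p h) = right_op p (S h)" if h: "h \<in> carrier H" for p h
  proof (rule M.H.eqI_cinner)
    fix k assume k: "k \<in> carrier H"
    have "(\<lambda>n. cinner H k (T n (right_op p h))) \<longlonglongrightarrow> cinner H k (S (right_op p h))" by (rule S(2)) (use h k in simp_all)
    moreover have "cinner H k (T n (right_op p h)) = cinner H (right_op p k) (T n h)" for n
      using right_op(3)[OF k commutant_in[OF T h]] commutant_right[OF T h] by simp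
    moreover have "(\<lambda>n. cinner H (right_op p k) (T n h)) \<longlonglongrightarrow> cinner H (right_op p k) (S h)" by (rule S(2)) (use h k in simp_all)
    ultimately have "cinner H k (S (right_op p h)) = cinner H (right_op p k) (S h)"
      using LIMSEQ_unique by simp
    then show "cinner H k (S (right_op p h)) = cinner H k (right_op p (S h))"
      using right_op(3)[OF k, of "S h"] h S(1) by simp
  qed (use h S(1) in simp_all)
  ultimately have "S \<in> commutant" by (rule commutantI(1)[OF S(1) S'(1)])
  moreover have "\<exists>N. \<forall>n\<ge>N. \<forall>h\<in>carrier H. hnorm H (T n h \<ominus>\<^bsub>H\<^esub> S h) \<le> e * hnorm H h" if e: "e > 0" for e
  proof -
    obtain N where N: "\<And>m n h. m \<ge> N \<Longrightarrow> n \<ge> N \<Longrightarrow> h \<in> carrier H \<Longrightarrow> hnorm H (T m h \<ominus>\<^bsub>H\<^esub> T n h) \<le> e * hnorm H h"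
      using C[OF e] by meson
    \<comment> \<open>For fixed \<open>n\<close> the Cauchy estimate survives the weak limit in
      \<open>m\<close>; this upgrades weak convergence to convergence in norm.\<close>
    have "hnorm H (T n h \<ominus>\<^bsub>H\<^esub> S h) \<le> e * hnorm H h" if n: "n \<ge> N" and h: "h \<in> carrier H" for n h
    proof (rule M.H.hnorm_le_of_cinner)
      fix k assume k: "k \<in> carrier H"
      show "cmod (cinner H k (T n h \<ominus>\<^bsub>H\<^esub> S h)) \<le> e * hnorm H h * hnorm H k"
      proof (rule LIMSEQ_le_const2)
        show "(\<lambda>m. cmod (cinner H k (T n h) - cinner H k (T m h))) \<longlonglongrightarrow> cmod (cinner H k (T n h \<ominus>\<^bsub>H\<^esub> S h))"
          using h k S(1) Tops by (simp add: M.H.cinner_diff) (intro tendsto_norm tendsto_diff tendsto_const S(2))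
        have "cmod (cinner H k (T n h) - cinner H k (T m h)) \<le> e * hnorm H h * hnorm H k" if m: "m \<ge> N" for m
        proof -
          have "cmod (cinner H k (T n h) - cinner H k (T m h)) \<le> hnorm H k * hnorm H (T n h \<ominus>\<^bsub>H\<^esub> T m h)"
            using M.H.cauchy_schwarz[OF k, of "T n h \<ominus>\<^bsub>H\<^esub> T m h"] h k Tops by (simp add: M.H.cinner_diff)
          also have "\<dots> \<le> hnorm H k * (e * hnorm H h)"
            by (rule mult_left_mono[OF N[OF n m h]]) (use k in simp)
          finally show ?thesis by (simp add: mult_ac)
        qed
        then show "\<exists>N. \<forall>m\<ge>N. cmod (cinner H k (T n h) - cinner H k (T m h)) \<le> e * hnorm H h * hnorm H k" by blast
      qed
    qed (use e h S(1) Tops in simp_all)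
    then show ?thesis by blast
  qed
  ultimately show ?thesis by blast
qed

end

section \<open>The commutant as a C*-algebra with a trace\<close>

context haar_model begin

definition vec :: "('h \<Rightarrow> 'h) \<Rightarrow> 'h" where
  "vec T = T (point [])"

text \<open>The zero operator as default makes every element of the type act by an operator of the
  commutant. So the closure laws hold without carrier conditions, and distances make sense
  everywhere.\<close>

definition op_of :: "'h \<Rightarrow> 'h \<Rightarrow> 'h" where
  "op_of a = (if a \<in> vec ` commutant then inv_into commutant vec a else zero_op)"

lemma inj_vec: "inj_on vec commutant"
  by (rule inj_onI) (simp add: commutant_separating vec_def)

lemma op_of_vec [simp]: "T \<in> commutant \<Longrightarrow> op_of (vec T) = T"
  by (simp add: op_of_def inj_vec)

lemma op_of_commutant [simp]: "op_of a \<in> commutant"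
  unfolding op_of_def using inv_into_into[of a vec commutant] commutant_zero by simp

lemma op_of_in [simp]: "h \<in> carrier H \<Longrightarrow> op_of a h \<in> carrier H"
  by simp

text \<open>An operator in the commutant is represented by its value at the cyclic vector, so that the
  algebra lives on the type of the Hilbert space.\<close>

definition haar_algebra :: "'h cstar_algebra" where
  "haar_algebra = \<lparr>carrier = vec ` commutant, mult = \<lambda>a b. vec (compose (carrier H) (op_of a) (op_of b)),
    one = vec one_op, zero = vec zero_op, add = \<lambda>a b. vec (add_op (op_of a) (op_of b)),
    smult = \<lambda>c a. vec (smult_op c (op_of a)), star = \<lambda>a. vec (adj (op_of a)), anorm = \<lambda>a. M.H.opnorm (op_of a)\<rparr>"

lemma haar_algebra_simps:
  "carrier haar_algebra = vec ` commutant"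
  "mult haar_algebra a b = vec (compose (carrier H) (op_of a) (op_of b))"
  "one haar_algebra = vec one_op" "zero haar_algebra = vec zero_op"
  "add haar_algebra a b = vec (add_op (op_of a) (op_of b))"
  "smult haar_algebra c a = vec (smult_op c (op_of a))"
  "star haar_algebra a = vec (adj (op_of a))" "anorm haar_algebra a = M.H.opnorm (op_of a)"
  by (simp_all add: haar_algebra_def)

lemmas commutant_closed = commutant_zero commutant_one commutant_add(1) commutant_smult(1) commutant_compose(1) adj_commutant

lemma vec_carrier: "T \<in> commutant \<Longrightarrow> vec T \<in> carrier haar_algebra"
  by (simp add: haar_algebra_simps)

lemma vec_op_of: "a \<in> carrier haar_algebra \<Longrightarrow> vec (op_of a) = a"
  by (auto simp: haar_algebra_simps)

lemma op_of_simps: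
  "op_of (a \<otimes>\<^bsub>haar_algebra\<^esub> b) = compose (carrier H) (op_of a) (op_of b)"
  "op_of \<one>\<^bsub>haar_algebra\<^esub> = one_op" "op_of \<zero>\<^bsub>haar_algebra\<^esub> = zero_op"
  "op_of (a \<oplus>\<^bsub>haar_algebra\<^esub> b) = add_op (op_of a) (op_of b)"
  "op_of (c \<odot>\<^bsub>haar_algebra\<^esub> a) = smult_op c (op_of a)"
  "op_of (star haar_algebra a) = adj (op_of a)"
  unfolding haar_algebra_simps by (intro op_of_vec commutant_closed op_of_commutant)+

lemma haar_closed:
  "a \<otimes>\<^bsub>haar_algebra\<^esub> b \<in> carrier haar_algebra" "\<one>\<^bsub>haar_algebra\<^esub> \<in> carrier haar_algebra"
  "\<zero>\<^bsub>haar_algebra\<^esub> \<in> carrier haar_algebra" "a \<oplus>\<^bsub>haar_algebra\<^esub> b \<in> carrier haar_algebra"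
  "c \<odot>\<^bsub>haar_algebra\<^esub> a \<in> carrier haar_algebra" "star haar_algebra a \<in> carrier haar_algebra"
  unfolding haar_algebra_simps by (intro imageI commutant_closed op_of_commutant)+

lemma haar_eqI:
  assumes "a \<in> carrier haar_algebra" "b \<in> carrier haar_algebra" "op_of a = op_of b"
  shows "a = b"
  using vec_op_of[OF assms(1)] vec_op_of[OF assms(2)] assms(3) by metis

lemma operator_rep_haar: "operator_rep H haar_algebra op_of"
proof (intro operator_rep.intro operator_rep_axioms.intro)
  show "hilbert_space H" by (rule M.hilbert_space_rkhs)
  show "a = b" if "a \<in> carrier haar_algebra" "b \<in> carrier haar_algebra" "\<And>x. x \<in> carrier H \<Longrightarrow> op_of a x = op_of b x" for a b
    by (rule haar_eqI[OF that(1,2)], rule M.H.op_eqI[OF commutant_ops commutant_ops]) (use that in simp_all)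
qed (simp_all add: haar_closed op_of_simps compose_def commutant_ops)

sublocale R: operator_rep H haar_algebra op_of by (rule operator_rep_haar)

lemma op_of_adj: "h \<in> carrier H \<Longrightarrow> k \<in> carrier H \<Longrightarrow> cinner H (op_of a h) k = cinner H h (op_of (star haar_algebra a) k)"
  unfolding op_of_simps by (rule adj[OF op_of_commutant])

lemma star_algebra_haar: "star_algebra haar_algebra"
proof (intro star_algebra.intro star_algebra_axioms.intro)
  show "Module.module complex_ring haar_algebra" by (rule R.module)
  show "Ring.ring haar_algebra" by (rule R.ring)
  show "star haar_algebra (star haar_algebra a) = a" if "a \<in> carrier haar_algebra" for a
    by (rule haar_eqI[OF haar_closed(6) that]) (simp add: op_of_simps adj_adj)
  show "star haar_algebra (a \<oplus>\<^bsub>haar_algebra\<^esub> b) = star haar_algebra a \<oplus>\<^bsub>haar_algebra\<^esub> star haar_algebra b" for a b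
    by (rule haar_eqI[OF haar_closed(6) haar_closed(4)])
      (simp only: op_of_simps commutant_add(2)[OF op_of_commutant op_of_commutant])
  show "star haar_algebra (c \<odot>\<^bsub>haar_algebra\<^esub> a) = cnj c \<odot>\<^bsub>haar_algebra\<^esub> star haar_algebra a" for c a
    by (rule haar_eqI[OF haar_closed(6) haar_closed(5)])
      (simp only: op_of_simps commutant_smult(2)[OF op_of_commutant])
  show "star haar_algebra (a \<otimes>\<^bsub>haar_algebra\<^esub> b) = star haar_algebra b \<otimes>\<^bsub>haar_algebra\<^esub> star haar_algebra a" for a b
    by (rule haar_eqI[OF haar_closed(6) haar_closed(1)])
      (simp only: op_of_simps commutant_compose(2)[OF op_of_commutant op_of_commutant])
qed (simp_all add: haar_closed R.smult_mult_left R.smult_mult_right)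

lemma ops_op_of: "op_of a \<in> bounded_linear_operators H"
  by (rule commutant_ops[OF op_of_commutant])

lemma anorm_bound: "h \<in> carrier H \<Longrightarrow> hnorm H (op_of a h) \<le> anorm haar_algebra a * hnorm H h"
  unfolding haar_algebra_simps by (rule M.H.opnorm_bound[OF ops_op_of])

lemma anorm_least: "0 \<le> K \<Longrightarrow> (\<And>h. h \<in> carrier H \<Longrightarrow> hnorm H (op_of a h) \<le> K * hnorm H h) \<Longrightarrow> anorm haar_algebra a \<le> K"
  unfolding haar_algebra_simps by (rule M.H.opnorm_least)

lemma anorm_nonneg: "0 \<le> anorm haar_algebra a"
  unfolding haar_algebra_simps by (rule M.H.opnorm_nonneg[OF ops_op_of])

lemma anorm_zero_iff:
  assumes a: "a \<in> carrier haar_algebra"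
  shows "anorm haar_algebra a = 0 \<longleftrightarrow> a = \<zero>\<^bsub>haar_algebra\<^esub>"
proof
  assume *: "anorm haar_algebra a = 0"
  show "a = \<zero>\<^bsub>haar_algebra\<^esub>"
  proof (rule R.faithful[OF a haar_closed(3)])
    fix h assume h: "h \<in> carrier H"
    have "hnorm H (op_of a h) = 0"
      using anorm_bound[OF h, of a] * M.H.hnorm_nonneg[OF op_of_in[OF h], of a] by simp
    then show "op_of a h = op_of \<zero>\<^bsub>haar_algebra\<^esub> h" using h by (simp add: op_of_simps)
  qed
next
  assume "a = \<zero>\<^bsub>haar_algebra\<^esub>"
  then have "anorm haar_algebra a \<le> 0" by (intro anorm_least) (simp_all add: op_of_simps)
  then show "anorm haar_algebra a = 0" using anorm_nonneg[of a] by simp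
qed

lemma anorm_add: "anorm haar_algebra (a \<oplus>\<^bsub>haar_algebra\<^esub> b) \<le> anorm haar_algebra a + anorm haar_algebra b"
proof (rule anorm_least)
  fix h assume h: "h \<in> carrier H"
  have "hnorm H (op_of a h \<oplus>\<^bsub>H\<^esub> op_of b h) \<le> hnorm H (op_of a h) + hnorm H (op_of b h)"
    by (rule M.H.hnorm_triangle) (use h in simp_all)
  then show "hnorm H (op_of (a \<oplus>\<^bsub>haar_algebra\<^esub> b) h) \<le> (anorm haar_algebra a + anorm haar_algebra b) * hnorm H h"
    using anorm_bound[OF h, of a] anorm_bound[OF h, of b] h by (simp add: op_of_simps distrib_right)
qed (simp add: anorm_nonneg)

lemma anorm_scale: "anorm haar_algebra (c \<odot>\<^bsub>haar_algebra\<^esub> a) = cmod c * anorm haar_algebra a"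
proof -
  have sm: "hnorm H (op_of (c \<odot>\<^bsub>haar_algebra\<^esub> a) h) = cmod c * hnorm H (op_of a h)" if "h \<in> carrier H" for h
    using that by (simp add: op_of_simps M.H.hnorm_smult)
  have "anorm haar_algebra (c \<odot>\<^bsub>haar_algebra\<^esub> a) \<le> cmod c * anorm haar_algebra a"
    by (rule anorm_least) (use anorm_bound in \<open>simp_all add: sm anorm_nonneg mult.assoc mult_left_mono\<close>)
  moreover have "cmod c * anorm haar_algebra a \<le> anorm haar_algebra (c \<odot>\<^bsub>haar_algebra\<^esub> a)"
  proof (cases "c = 0")
    case False
    have "anorm haar_algebra a \<le> anorm haar_algebra (c \<odot>\<^bsub>haar_algebra\<^esub> a) / cmod c"
      by (rule anorm_least) (use anorm_bound[of _ "c \<odot>\<^bsub>haar_algebra\<^esub> a"] False in \<open>simp_all add: sm anorm_nonneg field_simps\<close>)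
    then show ?thesis using False by (simp add: field_simps)
  qed (simp add: anorm_nonneg)
  ultimately show ?thesis by simp
qed

lemma anorm_prod: "anorm haar_algebra (a \<otimes>\<^bsub>haar_algebra\<^esub> b) \<le> anorm haar_algebra a * anorm haar_algebra b"
proof (rule anorm_least)
  fix h assume h: "h \<in> carrier H"
  have "hnorm H (op_of a (op_of b h)) \<le> anorm haar_algebra a * hnorm H (op_of b h)"
    by (rule anorm_bound[OF op_of_in[OF h]])
  also have "\<dots> \<le> anorm haar_algebra a * (anorm haar_algebra b * hnorm H h)"
    by (rule mult_left_mono[OF anorm_bound[OF h] anorm_nonneg])
  finally show "hnorm H (op_of (a \<otimes>\<^bsub>haar_algebra\<^esub> b) h) \<le> anorm haar_algebra a * anorm haar_algebra b * hnorm H h"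
    using h by (simp add: op_of_simps compose_def mult.assoc)
qed (simp add: anorm_nonneg)

lemma anorm_star_le: "anorm haar_algebra (star haar_algebra a) \<le> anorm haar_algebra a"
proof (rule anorm_least)
  fix h assume h: "h \<in> carrier H"
  show "hnorm H (op_of (star haar_algebra a) h) \<le> anorm haar_algebra a * hnorm H h"
    unfolding haar_algebra_simps(8) by (rule M.H.adjoint_bound[OF ops_op_of ops_op_of op_of_adj h])
qed (rule anorm_nonneg)

text \<open>The lower bound rests on the squared norm of \<open>a h\<close> being the inner product
  of \<open>h\<close> with \<open>a* a h\<close>, the upper one on the star being
  contractive.\<close>

lemma anorm_star_mult: "anorm haar_algebra (star haar_algebra a \<otimes>\<^bsub>haar_algebra\<^esub> a) = (anorm haar_algebra a)\<^sup>2"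
proof (rule antisym)
  let ?s = "star haar_algebra a \<otimes>\<^bsub>haar_algebra\<^esub> a"
  have "anorm haar_algebra ?s \<le> anorm haar_algebra (star haar_algebra a) * anorm haar_algebra a" by (rule anorm_prod)
  also have "\<dots> \<le> anorm haar_algebra a * anorm haar_algebra a" by (rule mult_right_mono[OF anorm_star_le anorm_nonneg])
  finally show "anorm haar_algebra ?s \<le> (anorm haar_algebra a)\<^sup>2" by (simp add: power2_eq_square)
  have "anorm haar_algebra a \<le> sqrt (anorm haar_algebra ?s)"
  proof (rule anorm_least)
    fix h assume h: "h \<in> carrier H"
    have "complex_of_real ((hnorm H (op_of a h))\<^sup>2) = cinner H h (op_of ?s h)"
      using op_of_adj[OF h op_of_in[OF h], of a a] M.H.cinner_self[OF op_of_in[OF h], of a] h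
      by (simp add: op_of_simps compose_def)
    then have "(hnorm H (op_of a h))\<^sup>2 = cmod (cinner H h (op_of ?s h))"
      by (metis abs_of_nonneg norm_of_real zero_le_power2)
    also have "\<dots> \<le> hnorm H h * hnorm H (op_of ?s h)" by (rule M.H.cauchy_schwarz) (use h in simp_all)
    also have "\<dots> \<le> hnorm H h * (anorm haar_algebra ?s * hnorm H h)"
      by (rule mult_left_mono[OF anorm_bound[OF h]]) (use h in simp)
    also have "\<dots> = (sqrt (anorm haar_algebra ?s) * hnorm H h)\<^sup>2"
      by (simp add: power_mult_distrib anorm_nonneg) (simp add: power2_eq_square)
    finally show "hnorm H (op_of a h) \<le> sqrt (anorm haar_algebra ?s) * hnorm H h"
      by (rule power2_le_imp_le) (use h in \<open>simp add: anorm_nonneg\<close>)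
  qed (simp add: anorm_nonneg)
  then have "(anorm haar_algebra a)\<^sup>2 \<le> (sqrt (anorm haar_algebra ?s))\<^sup>2" by (rule power_mono[OF _ anorm_nonneg])
  then show "(anorm haar_algebra a)\<^sup>2 \<le> anorm haar_algebra ?s" by (simp add: anorm_nonneg)
qed

lemma uminus_haar: "a \<in> carrier haar_algebra \<Longrightarrow> \<ominus>\<^bsub>haar_algebra\<^esub> a = (-1) \<odot>\<^bsub>haar_algebra\<^esub> a"
proof -
  interpret A: Ring.ring haar_algebra by (rule R.ring)
  assume a: "a \<in> carrier haar_algebra"
  show ?thesis
  proof (rule A.minus_equality[OF _ a haar_closed(5)])
    show "(-1) \<odot>\<^bsub>haar_algebra\<^esub> a \<oplus>\<^bsub>haar_algebra\<^esub> a = \<zero>\<^bsub>haar_algebra\<^esub>"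
    proof (rule R.faithful)
      fix h assume h: "h \<in> carrier H"
      show "op_of ((-1) \<odot>\<^bsub>haar_algebra\<^esub> a \<oplus>\<^bsub>haar_algebra\<^esub> a) h = op_of \<zero>\<^bsub>haar_algebra\<^esub> h"
        by (rule M.rkhs_eqI) (use h in \<open>simp_all add: op_of_simps\<close>)
    qed (rule haar_closed)+
  qed
qed

lemma Metric_space_haar: "Metric_space (carrier haar_algebra) (\<lambda>a b. anorm haar_algebra (a \<ominus>\<^bsub>haar_algebra\<^esub> b))"
proof -
  interpret A: Ring.ring haar_algebra by (rule R.ring)
  show ?thesis
  proof (rule A.Metric_space_of_norm[where \<nu> = "\<lambda>a. vec (op_of a)"])
    show "anorm haar_algebra (\<ominus>\<^bsub>haar_algebra\<^esub> a) = anorm haar_algebra a" if "a \<in> carrier haar_algebra" for a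
      using anorm_scale[of "-1" a] by (simp add: uminus_haar[OF that])
    show "a \<oplus>\<^bsub>haar_algebra\<^esub> b = vec (op_of a) \<oplus>\<^bsub>haar_algebra\<^esub> vec (op_of b)" for a b
      by (simp add: haar_algebra_simps)
  qed (simp_all add: anorm_nonneg anorm_zero_iff anorm_add vec_carrier vec_op_of)
qed

lemma op_of_diff:
  assumes "a \<in> carrier haar_algebra" "b \<in> carrier haar_algebra" "h \<in> carrier H"
  shows "op_of (a \<ominus>\<^bsub>haar_algebra\<^esub> b) h = op_of a h \<ominus>\<^bsub>H\<^esub> op_of b h"
  by (rule M.rkhs_eqI)
    (use assms in \<open>simp_all add: a_minus_def[of haar_algebra] uminus_haar op_of_simps M.dec_minus\<close>)

lemma cstar_algebra_haar: "cstar_algebra haar_algebra"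
proof (intro cstar_algebra.intro cstar_algebra_axioms.intro)
  show "star_algebra haar_algebra" by (rule star_algebra_haar)
  show "Metric_space.mcomplete (carrier haar_algebra) (\<lambda>a b. anorm haar_algebra (a \<ominus>\<^bsub>haar_algebra\<^esub> b))"
  proof (rule mcomplete_of_sequences[OF Metric_space_haar])
    fix s :: "nat \<Rightarrow> 'h"
    assume "range s \<subseteq> carrier haar_algebra"
      and C: "\<And>e. e > 0 \<Longrightarrow> \<exists>N. \<forall>m\<ge>N. \<forall>n\<ge>N. anorm haar_algebra (s m \<ominus>\<^bsub>haar_algebra\<^esub> s n) < e"
    then have s: "s n \<in> carrier haar_algebra" for n by auto
    have "\<exists>N. \<forall>m\<ge>N. \<forall>n\<ge>N. \<forall>h\<in>carrier H. hnorm H (op_of (s m) h \<ominus>\<^bsub>H\<^esub> op_of (s n) h) \<le> e * hnorm H h" if e: "e > 0" for e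
    proof -
      obtain N where N: "\<And>m n. m \<ge> N \<Longrightarrow> n \<ge> N \<Longrightarrow> anorm haar_algebra (s m \<ominus>\<^bsub>haar_algebra\<^esub> s n) < e"
        using C[OF e] by meson
      have "hnorm H (op_of (s m) h \<ominus>\<^bsub>H\<^esub> op_of (s n) h) \<le> e * hnorm H h" if "m \<ge> N" "n \<ge> N" and h: "h \<in> carrier H" for m n h
      proof -
        have "hnorm H (op_of (s m \<ominus>\<^bsub>haar_algebra\<^esub> s n) h) \<le> anorm haar_algebra (s m \<ominus>\<^bsub>haar_algebra\<^esub> s n) * hnorm H h"
          by (rule anorm_bound[OF h])
        also have "\<dots> \<le> e * hnorm H h" by (rule mult_right_mono) (use N[OF that(1,2)] h in simp_all)
        finally show ?thesis by (simp add: op_of_diff[OF s s h])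
      qed
      then show ?thesis by blast
    qed
    from commutant_limit[OF op_of_commutant this]
    obtain S where S: "S \<in> commutant"
      "\<And>e. e > 0 \<Longrightarrow> \<exists>N. \<forall>n\<ge>N. \<forall>h\<in>carrier H. hnorm H (op_of (s n) h \<ominus>\<^bsub>H\<^esub> S h) \<le> e * hnorm H h" by blast
    have vS: "vec S \<in> carrier haar_algebra" by (rule vec_carrier[OF S(1)])
    have "(\<lambda>n. anorm haar_algebra (s n \<ominus>\<^bsub>haar_algebra\<^esub> vec S)) \<longlonglongrightarrow> 0"
    proof (rule LIMSEQ_I)
      fix e :: real assume e: "e > 0"
      then have e2: "e / 2 > 0" by simp
      obtain N where N: "\<And>n h. n \<ge> N \<Longrightarrow> h \<in> carrier H \<Longrightarrow> hnorm H (op_of (s n) h \<ominus>\<^bsub>H\<^esub> S h) \<le> e / 2 * hnorm H h"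
        using S(2)[OF e2] by meson
      have "norm (anorm haar_algebra (s n \<ominus>\<^bsub>haar_algebra\<^esub> vec S) - 0) < e" if n: "n \<ge> N" for n
      proof -
        have "anorm haar_algebra (s n \<ominus>\<^bsub>haar_algebra\<^esub> vec S) \<le> e / 2"
        proof (rule anorm_least)
          fix h assume h: "h \<in> carrier H"
          show "hnorm H (op_of (s n \<ominus>\<^bsub>haar_algebra\<^esub> vec S) h) \<le> e / 2 * hnorm H h"
            using N[OF n h] by (simp only: op_of_diff[OF s vS h] op_of_vec[OF S(1)])
        qed (use e in simp)
        then show ?thesis using anorm_nonneg[of "s n \<ominus>\<^bsub>haar_algebra\<^esub> vec S"] e by simp
      qed
      then show "\<exists>N. \<forall>n\<ge>N. norm (anorm haar_algebra (s n \<ominus>\<^bsub>haar_algebra\<^esub> vec S) - 0) < e" by blast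
    qed
    then show "\<exists>x\<in>carrier haar_algebra. (\<lambda>n. anorm haar_algebra (s n \<ominus>\<^bsub>haar_algebra\<^esub> x)) \<longlonglongrightarrow> 0"
      using vS by blast
  qed
qed (simp_all add: anorm_nonneg anorm_zero_iff anorm_add anorm_scale anorm_prod anorm_star_mult)

definition trace :: "'h \<Rightarrow> complex" where
  "trace a = cinner H (point []) (op_of a (point []))"

lemma tracial_state_trace: "tracial_state haar_algebra trace"
  unfolding tracial_state_def
proof (intro conjI ballI allI)
  show "trace (a \<oplus>\<^bsub>haar_algebra\<^esub> b) = trace a + trace b" for a b
    by (simp add: trace_def op_of_simps M.H.cinner_add)
  show "trace (c \<odot>\<^bsub>haar_algebra\<^esub> a) = c * trace a" for c a
    by (simp add: trace_def op_of_simps M.H.cinner_smult)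
  have "trace (star haar_algebra a \<otimes>\<^bsub>haar_algebra\<^esub> a) = of_real ((hnorm H (op_of a (point [])))\<^sup>2)" for a
    using op_of_adj[OF point_in[of "[]"] op_of_in[OF point_in[of "[]"], of a], of a] M.H.cinner_self[OF op_of_in[OF point_in[of "[]"], of a]]
    by (simp add: trace_def op_of_simps compose_def)
  then show "Im (trace (star haar_algebra a \<otimes>\<^bsub>haar_algebra\<^esub> a)) = 0" "0 \<le> Re (trace (star haar_algebra a \<otimes>\<^bsub>haar_algebra\<^esub> a))" for a
    by (simp_all del: of_real_power)
  show "trace \<one>\<^bsub>haar_algebra\<^esub> = 1"
    by (simp add: trace_def op_of_simps cinner_point dec_point kernel_def haar_Nil)
  show "trace (a \<otimes>\<^bsub>haar_algebra\<^esub> b) = trace (b \<otimes>\<^bsub>haar_algebra\<^esub> a)" for a b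
    using commutant_trace[OF op_of_commutant op_of_commutant, of a b] by (simp add: trace_def op_of_simps compose_def)
qed

lemma qc_isometric_haar: "qc_isometric TYPE('h) X dX Y dY"
proof -
  have "quantum_isometry_matrix haar_algebra X dX Y dY (\<lambda>x y. vec (left_op (x, y)))"
  proof (rule quantum_isometry_matrix_left_op[OF operator_rep_haar])
    show "star haar_algebra (vec (left_op (x, y))) = vec (left_op (x, y))" for x y
      unfolding haar_algebra_simps op_of_vec[OF left_op_commutant(1)] left_op_commutant(2) ..
  qed (simp_all add: vec_carrier left_op_commutant(1))
  then show ?thesis
    unfolding qc_isometric_def using cstar_algebra_haar tracial_state_trace by blast
qed

end

theorem corollary6p14:
  fixes X :: "'a set" and dX :: "'a \<Rightarrow> 'a \<Rightarrow> real"
    and Y :: "'b set" and dY :: "'b \<Rightarrow> 'b \<Rightarrow> real"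
  assumes "Metric_space X dX" and "finite X"
    and "Metric_space Y dY" and "finite Y"
    and universe_h: "(UNIV :: real set) \<lesssim> (UNIV :: 'h set)"
    and universe_c: "(UNIV :: real set) \<lesssim> (UNIV :: 'c set)"
  shows "(algebraically_isometric X dX Y dY \<longleftrightarrow> cstar_isometric TYPE('h) X dX Y dY) \<and>
         (cstar_isometric TYPE('h) X dX Y dY \<longleftrightarrow> qc_isometric TYPE('c) X dX Y dY)"
proof -
  interpret MX: Metric_space X dX by (rule assms(1))
  interpret MY: Metric_space Y dY by (rule assms(3))
  interpret finite_spaces X dX Y dY
    by unfold_locales (use assms(2,4) MX.commute MY.commute in auto)
  \<comment> \<open>All three properties are compared with this statement, which mentions no
    universe.\<close>
  let ?f = "\<exists>\<psi>. isom_fun \<psi> \<and> \<psi> [] = 1"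
  have "algebraically_isometric X dX Y dY \<longleftrightarrow> ?f"
    using functional_imp_algebraic algebraic_imp_functional by blast
  moreover have "cstar_isometric TYPE('h) X dX Y dY \<and> qc_isometric TYPE('c) X dX Y dY" if ?f
  proof -
    from that obtain \<psi> where "isom_fun \<psi>" "\<psi> [] = 1" by blast
    then interpret isometry_game X dX Y dY \<psi> by unfold_locales
    \<comment> \<open>The same functional is realised in two encodings, because the Hilbert space
      and the C*-algebra may live on different types.\<close>
    obtain \<iota> :: "(('a \<times> 'b) list \<Rightarrow> complex) \<Rightarrow> 'h" where "inj_on \<iota> {f. kernel.rkhs_bounded f}"
      using countable_encoding[OF universe_h] by blast
    then interpret h: haar_model X dX Y dY \<psi> \<iota> by unfold_locales
    obtain \<kappa> :: "(('a \<times> 'b) list \<Rightarrow> complex) \<Rightarrow> 'c" where "inj_on \<kappa> {f. kernel.rkhs_bounded f}"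
      using countable_encoding[OF universe_c] by blast
    then interpret c: haar_model X dX Y dY \<psi> \<kappa> by unfold_locales
    show ?thesis using h.cstar_isometric_haar c.qc_isometric_haar by blast
  qed
  moreover have ?f if "cstar_isometric TYPE('h) X dX Y dY"
    using cstar_isometric_imp_functional[OF that assms(2,4)] .
  moreover have ?f if "qc_isometric TYPE('c) X dX Y dY"
    using qc_isometric_imp_functional[OF that assms(2,4)] .
  ultimately show ?thesis by blast
qed

end
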